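(* Let $p$ be an odd prime, let $n\ge 1$, and let $i$ be an integer with $p^{n-1}+2\le i<p^n$. (a) For every Galois extension of fields $K/F$ with $\mathrm{Gal}(K/F)\simeq \mathbb{Z}/p^n$, $$\nu(A_i\bullet G_n\twoheadrightarrow G_n,\,K/F)=(p-1)\,\nu(A_i\rtimes G_n\twoheadrightarrow G_n,\,K/F).$$ (b) Moreover, for every field $F$, $$\nu(A_i\bullet G_n,F)=(p-1)\,\nu(A_i\rtimes G_n,F).$$
   Context: $G_n$ denotes the cyclic group $\mathbb{Z}/p^n$ written multiplicatively with generator $\sigma$. For $1\le i\le p^n$, $A_i=\mathbb{F}_p[G_n]/\langle(\sigma-1)^i\rangle$ as an $\mathbb{F}_p[G_n]$-module. $A_i\rtimes G_n$ is the semidirect product: the set $A_i\times G_n$ with $(f_1,\sigma^{j_1})(f_2,\sigma^{j_2})=(f_1+\sigma^{j_1}f_2,\sigma^{j_1+j_2})$. For $1\le i<p^n$, $A_i\bullet G_n$ is the set $A_i\times G_n$ with the operation, for $j_1,j_2\in\{0,\dots,p^n-1\}$: $(f_1,\sigma^{j_1})(f_2,\sigma^{j_2})=(f_1+\sigma^{j_1}f_2,\sigma^{j_1+j_2})$ if $j_1+j_2<p^n$, and $(f_1+\sigma^{j_1}f_2+(\sigma-1)^{i-1},\sigma^{j_1+j_2})$ if $j_1+j_2\ge p^n$. The surjections $A_i\rtimes G_n\twoheadrightarrow G_n$ and $A_i\bullet G_n\twoheadrightarrow G_n$ are the projections to the second coordinate. Given a surjection of finite groups $G\twoheadrightarrow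 Q$ and a Galois extension $K/F$ with an identification $\mathrm{Gal}(K/F)\simeq Q$, a solution of the embedding problem $G\twoheadrightarrow Q$ over $K/F$ is a Galois extension $L/F$ (in a fixed algebraic closure) with $K\subseteq L$ and an isomorphism $\mathrm{Gal}(L/F)\simeq G$ under which restriction $\mathrm{Gal}(L/F)\to\mathrm{Gal}(K/F)$ corresponds to $G\twoheadrightarrow Q$. $\nu(G\twoheadrightarrow Q,K/F)$ is the number of fields $L$ that are solutions. $\nu(G,F)$ is the number of Galois extensions $L/F$ in a fixed algebraic closure of $F$ with $\mathrm{Gal}(L/F)\simeq G$. *)

theory Defs
  imports
    "HOL-Algebra.Algebra"
    "HOL-Number_Theory.Residues"
    "HOL-Library.Equipollence"
begin

section \<open>Galois extensions inside a fixed algebraically closed field\<close>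

text \<open>
  All fields are subfields, given by their carrier sets, of one field \<open>\<Omega>\<close>, which in the
  statement is an algebraic closure of the base field \<open>F\<close>. An extension \<open>L\<close> of \<open>F\<close> is Galois if it is algebraic,
  normal and separable: the minimal polynomial over \<open>F\<close> of every element of \<open>L\<close> splits over \<open>L\<close> and
  has no multiple root. Since the minimal polynomial splits over \<open>L\<close>, it does not matter that its
  multiplicities are computed in \<open>\<Omega>\<close>.
\<close>

definition galois_extension :: "('a, 'b) ring_scheme \<Rightarrow> 'a set \<Rightarrow> 'a set \<Rightarrow> bool"
  where "galois_extension \<Omega> F L \<longleftrightarrow>
    subfield F \<Omega> \<and> subfield L \<Omega> \<and> F \<subseteq> L \<and>
    (\<forall>x\<in>L. \<not> ring.transcendental \<Omega> F x \<and>
           ring.splitted (\<Omega>\<lparr>carrier := L\<rparr>) (ring.Irr \<Omega> F x) \<and>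
           (\<forall>a. count (ring.roots \<Omega> (ring.Irr \<Omega> F x)) a \<le> 1))"

text \<open>
  The automorphisms are extensional functions (\<open>undefined\<close> outside \<open>L\<close>), as in \<^const>\<open>BijGroup\<close>, so
  that each field automorphism is represented exactly once.
\<close>

definition galois_group :: "('a, 'b) ring_scheme \<Rightarrow> 'a set \<Rightarrow> 'a set \<Rightarrow> ('a \<Rightarrow> 'a) monoid"
  where "galois_group \<Omega> F L =
    BijGroup L \<lparr>carrier :=
      {\<phi> \<in> Bij L. \<phi> \<in> ring_iso (\<Omega>\<lparr>carrier := L\<rparr>) (\<Omega>\<lparr>carrier := L\<rparr>) \<and> (\<forall>x\<in>F. \<phi> x = x)}\<rparr>"

text \<open>
  The set counted by \<open>\<nu>(G, F)\<close>.
\<close>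

definition galois_realizations ::
  "('a, 'b) ring_scheme \<Rightarrow> 'a set \<Rightarrow> ('g, 'm) monoid_scheme \<Rightarrow> 'a set set"
  where "galois_realizations \<Omega> F G =
    {L. galois_extension \<Omega> F L \<and> galois_group \<Omega> F L \<cong> G}"

text \<open>
  The set counted by \<open>\<nu>(G \<rightarrow> Q, K/F)\<close>, where \<open>\<pi>\<close> is the surjection from \<open>G\<close> to \<open>Q\<close> and \<open>\<iota>\<close> is the
  identification of \<open>Gal(K/F)\<close> with \<open>Q\<close>.
\<close>

definition embedding_solutions ::
  "('a, 'b) ring_scheme \<Rightarrow> 'a set \<Rightarrow> 'a set \<Rightarrow> (('a \<Rightarrow> 'a) \<Rightarrow> 'q) \<Rightarrow>
    ('g, 'm) monoid_scheme \<Rightarrow> ('g \<Rightarrow> 'q) \<Rightarrow> 'a set set"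
  where "embedding_solutions \<Omega> F K \<iota> G \<pi> =
    {L. galois_extension \<Omega> F L \<and> K \<subseteq> L \<and>
        (\<exists>\<psi>\<in>iso (galois_group \<Omega> F L) G.
           \<forall>\<phi>\<in>carrier (galois_group \<Omega> F L). \<pi> (\<psi> \<phi>) = \<iota> (restrict \<phi> K))}"


section \<open>Group rings of finite groups\<close>

text \<open>
  Elements are functions from the group to the coefficients, multiplied by convolution. There is no
  finite support condition, so this is the group ring only for finite \<open>G\<close>.
\<close>

definition group_ring ::
  "('r, 'b) ring_scheme \<Rightarrow> ('g, 'm) monoid_scheme \<Rightarrow> ('g \<Rightarrow> 'r) ring"
  where "group_ring R G =
    \<lparr>carrier = carrier G \<rightarrow>\<^sub>E carrier R,
     monoid.mult = (\<lambda>f g. \<lambda>x\<in>carrier G. \<Oplus>\<^bsub>R\<^esub>y\<in>carrier G. f y \<otimes>\<^bsub>R\<^esub> g (inv\<^bsub>G\<^esub> y \<otimes>\<^bsub>G\<^esub> x)),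
     monoid.one = (\<lambda>x\<in>carrier G. if x = \<one>\<^bsub>G\<^esub> then \<one>\<^bsub>R\<^esub> else \<zero>\<^bsub>R\<^esub>),
     ring.zero = (\<lambda>x\<in>carrier G. \<zero>\<^bsub>R\<^esub>),
     ring.add = (\<lambda>f g. \<lambda>x\<in>carrier G. f x \<oplus>\<^bsub>R\<^esub> g x)\<rparr>"

definition group_ring_of ::
  "('r, 'b) ring_scheme \<Rightarrow> ('g, 'm) monoid_scheme \<Rightarrow> 'g \<Rightarrow> 'g \<Rightarrow> 'r"
  where "group_ring_of R G g = (\<lambda>x\<in>carrier G. if x = g then \<one>\<^bsub>R\<^esub> else \<zero>\<^bsub>R\<^esub>)"


section \<open>The modules and the two group extensions\<close>

text \<open>
  The cyclic group of order \<open>p ^ n\<close> is the library's additive group on \<open>{0..<p ^ n}\<close>; its element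
  \<open>j\<close> stands for the power with exponent \<open>j\<close> of the generator \<open>\<sigma>\<close>, which itself is \<open>1\<close>.
\<close>

abbreviation cyc :: "nat \<Rightarrow> nat \<Rightarrow> int monoid"
  where "cyc p n \<equiv> integer_mod_group (p ^ n)"

definition FpG :: "nat \<Rightarrow> nat \<Rightarrow> (int \<Rightarrow> int) ring"
  where "FpG p n = group_ring (residue_ring (int p)) (cyc p n)"

definition sigma_pow :: "nat \<Rightarrow> nat \<Rightarrow> int \<Rightarrow> int \<Rightarrow> int"
  where "sigma_pow p n j = group_ring_of (residue_ring (int p)) (cyc p n) j"

definition sigma_minus_one_pow :: "nat \<Rightarrow> nat \<Rightarrow> nat \<Rightarrow> int \<Rightarrow> int"
  where "sigma_minus_one_pow p n i =
    (sigma_pow p n 1 \<ominus>\<^bsub>FpG p n\<^esub> \<one>\<^bsub>FpG p n\<^esub>) [^]\<^bsub>FpG p n\<^esub> i"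

definition A_ideal :: "nat \<Rightarrow> nat \<Rightarrow> nat \<Rightarrow> (int \<Rightarrow> int) set"
  where "A_ideal p n i = Idl\<^bsub>FpG p n\<^esub> {sigma_minus_one_pow p n i}"

definition A_mod :: "nat \<Rightarrow> nat \<Rightarrow> nat \<Rightarrow> (int \<Rightarrow> int) set ring"
  where "A_mod p n i = FpG p n Quot A_ideal p n i"

definition A_class :: "nat \<Rightarrow> nat \<Rightarrow> nat \<Rightarrow> (int \<Rightarrow> int) \<Rightarrow> (int \<Rightarrow> int) set"
  where "A_class p n i r = A_ideal p n i +>\<^bsub>FpG p n\<^esub> r"

text \<open>
  The action of the group on the module is multiplication by the class of the group element.
\<close>

definition A_act :: "nat \<Rightarrow> nat \<Rightarrow> nat \<Rightarrow> int \<Rightarrow> (int \<Rightarrow> int) set \<Rightarrow> (int \<Rightarrow> int) set"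
  where "A_act p n i j f = A_class p n i (sigma_pow p n j) \<otimes>\<^bsub>A_mod p n i\<^esub> f"

definition A_semidirect :: "nat \<Rightarrow> nat \<Rightarrow> nat \<Rightarrow> ((int \<Rightarrow> int) set \<times> int) monoid"
  where "A_semidirect p n i =
    \<lparr>carrier = carrier (A_mod p n i) \<times> carrier (cyc p n),
     monoid.mult = (\<lambda>(f1, j1) (f2, j2).
       (f1 \<oplus>\<^bsub>A_mod p n i\<^esub> A_act p n i j1 f2, j1 \<otimes>\<^bsub>cyc p n\<^esub> j2)),
     monoid.one = (\<zero>\<^bsub>A_mod p n i\<^esub>, \<one>\<^bsub>cyc p n\<^esub>)\<rparr>"

definition A_bullet :: "nat \<Rightarrow> nat \<Rightarrow> nat \<Rightarrow> ((int \<Rightarrow> int) set \<times> int) monoid"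
  where "A_bullet p n i =
    \<lparr>carrier = carrier (A_mod p n i) \<times> carrier (cyc p n),
     monoid.mult = (\<lambda>(f1, j1) (f2, j2).
       (if j1 + j2 < int (p ^ n)
        then f1 \<oplus>\<^bsub>A_mod p n i\<^esub> A_act p n i j1 f2
        else f1 \<oplus>\<^bsub>A_mod p n i\<^esub> A_act p n i j1 f2
               \<oplus>\<^bsub>A_mod p n i\<^esub> A_class p n i (sigma_minus_one_pow p n (i - 1)),
        j1 \<otimes>\<^bsub>cyc p n\<^esub> j2)),
     monoid.one = (\<zero>\<^bsub>A_mod p n i\<^esub>, \<one>\<^bsub>cyc p n\<^esub>)\<rparr>"

end

theory Submission
  imports Defs
begin

text \<open>
  Let \<open>\<G>\<close> be the absolute Galois group of \<open>F\<close> and write \<open>t = \<sigma> - 1\<close>. Both groups consist of pairs of an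
  element of \<open>A = \<F>\<^sub>p[t]/(t^i)\<close> and an exponent modulo \<open>q = p^n\<close>; in the bullet product a carry in the
  addition of exponents contributes \<open>t^(i-1)\<close>. A solution field of the embedding problem for one of these
  groups \<open>E\<close> is the fixed field of the kernel of a continuous epimorphism \<open>\<G> \<rightarrow> E\<close> that lifts the given
  \<open>\<G> \<rightarrow> \<int>/q\<close>, and the lifts with the same field form a free orbit of the group of automorphisms of \<open>E\<close>
  over \<open>\<int>/q\<close> (\<open>lifts_eqpoll_times\<close>). It remains to compare the numbers of lifts and of automorphisms.

  The numbers of lifts are equal. There is a continuous map \<open>C: \<G> \<rightarrow> tA\<close> whose coboundary is the carry
  cocycle with values in \<open>t^(i-1)\<close> (\<open>bullet_cochain_exists\<close>). Adding \<open>C\<close> to the first component of a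
  lift to the semidirect product gives a homomorphism to the bullet product. Surjectivity depends only on
  the first components modulo \<open>tA\<close>, by Nakayama's lemma, and is preserved (\<open>lifts_twist_eqpoll\<close>). If the
  characteristic is \<open>p\<close>, the map \<open>C\<close> comes from an Artin-Schreier extension of \<open>K\<close> and has values in the
  socle. Otherwise it comes from Kummer extensions of Lagrange resolvents: over the stabilizer of a
  primitive \<open>p\<close>-th root of unity the exponents of the roots of unity that occur are assembled to an element of
  \<open>A\<close>, and an average over the conjugates of the root of unity extends \<open>C\<close> to \<open>\<G>\<close>. The bound
  \<open>i \<ge> p^(n-1) + 2\<close> places the values of \<open>C\<close> in \<open>tA\<close>.

  An automorphism of \<open>E\<close> over \<open>\<int>/q\<close> consists of a unit of \<open>A\<close> that fixes the carry element and of an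
  arbitrary element of \<open>A\<close> (\<open>card_auts\<close>). All units are admitted for the semidirect product, only those
  fixing \<open>t^(i-1)\<close> for the bullet product, and the ratio is \<open>p - 1\<close> (\<open>card_units\<close>). Together with
  the equality of the numbers of lifts this gives the first part.

  For the second part, the module is characteristic in \<open>E\<close> (\<open>kernel_characteristic\<close>), again by the bound
  on \<open>i\<close>, so a field with group \<open>E\<close> determines its cyclic subfield \<open>K\<close>. Every automorphism of \<open>\<int>/q\<close>
  lifts to \<open>E\<close> (\<open>lift_automorphism\<close>), so the field solves the embedding problem over \<open>K\<close> for any
  identification of the Galois group of \<open>K\<close>. Summing the first part over all \<open>K\<close> gives the claim.
\<close>

section \<open>Extending embeddings into the algebraic closure\<close>

lemma hom_factors_through_image:
 assumes "ring P" and "ring R" and f: "f \<in> ring_hom P R" and g: "g \<in> ring_hom P S" and "ring S"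
  and ker: "\<And>r. r \<in> carrier P ==> f r = \<zero>\<^bsub>R\<^esub> ==> g r = \<zero>\<^bsub>S\<^esub>"
 obtains h where "h \<in> ring_hom (R\<lparr>carrier := f ` carrier P\<rparr>) S" "\<And>r. r \<in> carrier P ==> h (f r) = g r"
proof -
 interpret P: ring P by fact
 interpret R: ring R by fact
 interpret S: ring S by fact
 interpret f: ring_hom_ring P R f by (rule ring_hom_ringI2) fact+
 interpret g: ring_hom_ring P S g by (rule ring_hom_ringI2) fact+
 have wd: "g r = g r'" if "r \<in> carrier P" "r' \<in> carrier P" "f r = f r'" for r r'
 proof -
  have "f (r \<ominus>\<^bsub>P\<^esub> r') = \<zero>\<^bsub>R\<^esub>"
   using that by (simp add: P.minus_eq R.r_neg)
  hence "g (r \<ominus>\<^bsub>P\<^esub> r') = \<zero>\<^bsub>S\<^esub>" using ker that by simp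
  hence "g r \<ominus>\<^bsub>S\<^esub> g r' = \<zero>\<^bsub>S\<^esub>" using that by (simp add: P.minus_eq S.minus_eq)
  thus ?thesis using that by simp
 qed
 define h where "h = (\<lambda>x. g (SOME r. r \<in> carrier P \<and> f r = x))"
 have h: "h (f r) = g r" if r: "r \<in> carrier P" for r
 proof -
  have "(SOME r'. r' \<in> carrier P \<and> f r' = f r) \<in> carrier P \<and> f (SOME r'. r' \<in> carrier P \<and> f r' = f r) = f r"
   by (rule someI[of _ r]) (use r in simp)
  thus ?thesis unfolding h_def using wd r by blast
 qed
 have "h \<in> ring_hom (R\<lparr>carrier := f ` carrier P\<rparr>) S"
 proof (rule ring_hom_memI)
  fix x y assume "x \<in> carrier (R\<lparr>carrier := f ` carrier P\<rparr>)" "y \<in> carrier (R\<lparr>carrier := f ` carrier P\<rparr>)"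
  then obtain r r' where r: "x = f r" "y = f r'" "r \<in> carrier P" "r' \<in> carrier P" by auto
  have "h (f (r \<otimes>\<^bsub>P\<^esub> r')) = g (r \<otimes>\<^bsub>P\<^esub> r')" "h (f (r \<oplus>\<^bsub>P\<^esub> r')) = g (r \<oplus>\<^bsub>P\<^esub> r')"
   using r by (simp_all only: h P.m_closed P.a_closed)
  thus "h (x \<otimes>\<^bsub>R\<lparr>carrier := f ` carrier P\<rparr>\<^esub> y) = h x \<otimes>\<^bsub>S\<^esub> h y"
   "h (x \<oplus>\<^bsub>R\<lparr>carrier := f ` carrier P\<rparr>\<^esub> y) = h x \<oplus>\<^bsub>S\<^esub> h y"
   using r by (simp_all add: h)
 next
  show "h \<one>\<^bsub>R\<lparr>carrier := f ` carrier P\<rparr>\<^esub> = \<one>\<^bsub>S\<^esub>"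
   using h[of "\<one>\<^bsub>P\<^esub>"] by simp
 qed (auto simp: h)
 thus ?thesis using h that by blast
qed

lemma (in ring_hom_ring) eval_map_hom:
 assumes "cring S" and y: "y \<in> carrier S" and K: "subring K R"
 shows "(\<lambda>p. S.eval (map h p) y) \<in> ring_hom (K[X]\<^bsub>R\<^esub>) S"
proof -
 interpret S: cring S by fact
 have in_K: "set p \<subseteq> carrier R" if "p \<in> carrier (K[X]\<^bsub>R\<^esub>)" for p
  using that subringE(1)[OF K] R.polynomial_incl unfolding sym[OF univ_poly_carrier[of R]] by blast
 have in_S: "set (map h p) \<subseteq> carrier S" if "p \<in> carrier (K[X]\<^bsub>R\<^esub>)" for p
  using in_K[OF that] by auto
 show ?thesis
 proof (rule ring_hom_memI)
  fix p q assume p: "p \<in> carrier (K[X]\<^bsub>R\<^esub>)" and q: "q \<in> carrier (K[X]\<^bsub>R\<^esub>)"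
  have "S.eval (map h (R.poly_mult p q)) y = S.eval (normalize (map h (R.poly_mult p q))) y"
   by (rule S.eval_normalize[symmetric])
    (use R.poly_mult_in_carrier[OF in_K[OF p] in_K[OF q]] y in auto)
  also have "\<dots> = S.eval (map h p) y \<otimes>\<^bsub>S\<^esub> S.eval (map h q) y"
   by (simp only: poly_mult_hom'[OF in_K[OF p] in_K[OF q]] S.eval_poly_mult[OF in_S[OF p] in_S[OF q] y])
  finally show "S.eval (map h (p \<otimes>\<^bsub>K[X]\<^bsub>R\<^esub>\<^esub> q)) y = S.eval (map h p) y \<otimes>\<^bsub>S\<^esub> S.eval (map h q) y"
   by (simp add: univ_poly_mult)
  have "S.eval (map h (R.poly_add p q)) y = S.eval (normalize (map h (R.poly_add p q))) y"
   by (rule S.eval_normalize[symmetric])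
    (use R.poly_add_in_carrier[OF in_K[OF p] in_K[OF q]] y in auto)
  also have "\<dots> = S.eval (map h p) y \<oplus>\<^bsub>S\<^esub> S.eval (map h q) y"
   by (simp only: poly_add_hom'[OF in_K[OF p] in_K[OF q]] S.eval_poly_add[OF in_S[OF p] in_S[OF q] y])
  finally show "S.eval (map h (p \<oplus>\<^bsub>K[X]\<^bsub>R\<^esub>\<^esub> q)) y = S.eval (map h p) y \<oplus>\<^bsub>S\<^esub> S.eval (map h q) y"
   by (simp add: univ_poly_add)
 next
  fix p assume "p \<in> carrier (K[X]\<^bsub>R\<^esub>)"
  thus "S.eval (map h p) y \<in> carrier S" using in_S y by (intro S.eval_in_carrier)
 next
  show "S.eval (map h \<one>\<^bsub>K[X]\<^bsub>R\<^esub>\<^esub>) y = \<one>\<^bsub>S\<^esub>" by (simp add: univ_poly_one)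
 qed
qed

text \<open>
 A homomorphism on \<open>E(x)\<close> is evaluation at a root of the transported minimal polynomial; it is
 well defined because the kernel of evaluation at \<open>x\<close> is generated by that polynomial.
\<close>

lemma (in field) extend_hom_to_simple_extension:
 assumes E: "subfield E R" and \<phi>: "\<phi> \<in> ring_hom (R\<lparr>carrier := E\<rparr>) R"
  and x: "x \<in> carrier R" "(algebraic over E) x"
  and y: "y \<in> carrier R" "eval (map \<phi> (Irr E x)) y = \<zero>"
 obtains \<psi> where "\<psi> \<in> ring_hom (R\<lparr>carrier := simple_extension E x\<rparr>) R"
  "\<And>a. a \<in> E ==> \<psi> a = \<phi> a" "\<psi> x = y"
proof -
 note subring = subfieldE(1)[OF E]
 interpret RE: field "R\<lparr>carrier := E\<rparr>" using E by (rule subfield_iff(2))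
 interpret h: ring_hom_ring "R\<lparr>carrier := E\<rparr>" R \<phi>
  by (rule ring_hom_ringI2) (use \<phi> in \<open>auto intro: RE.ring_axioms ring_axioms\<close>)
 interpret UP: domain "E[X]" using subring by (rule univ_poly_is_domain)
 define g where "g = (\<lambda>p. eval (map \<phi> p) y)"
 have same: "E[X]\<^bsub>R\<lparr>carrier := E\<rparr>\<^esub> = E[X]" by (simp add: univ_poly_consistent[OF subring])
 have g: "g \<in> ring_hom (E[X]) R"
  using h.eval_map_hom[OF is_cring y(1) RE.carrier_is_subring] same by (simp add: g_def)
 have f: "(\<lambda>p. eval p x) \<in> ring_hom (E[X]) R"
  using subring x(1) by (rule eval_is_hom)
 have ker: "g r = \<zero>" if r: "r \<in> carrier (E[X])" "eval r x = \<zero>" for r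
 proof -
  have "Irr E x pdivides r" using Irr_minimal[OF E x r] .
  hence "Irr E x divides\<^bsub>E[X]\<^esub> r"
   using pdivides_iff_shell[OF E IrrE(1)[OF E x] r(1)] by simp
  then obtain s where s: "s \<in> carrier (E[X])" "r = Irr E x \<otimes>\<^bsub>E[X]\<^esub> s" unfolding factor_def by blast
  have "g r = g (Irr E x) \<otimes> g s"
   unfolding s(2) by (rule ring_hom_mult[OF g IrrE(1)[OF E x] s(1)])
  thus ?thesis using y(2) ring_hom_closed[OF g s(1)] by (simp add: g_def)
 qed
 obtain \<psi> where \<psi>: "\<psi> \<in> ring_hom (R\<lparr>carrier := (\<lambda>p. eval p x) ` carrier (E[X])\<rparr>) R"
  and \<psi>': "\<And>p. p \<in> carrier (E[X]) ==> \<psi> (eval p x) = g p"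
  by (rule hom_factors_through_image[OF UP.ring_axioms ring_axioms f g ring_axioms ker]) auto
 have "\<psi> a = \<phi> a" if a: "a \<in> E" for a
 proof (cases "a = \<zero>")
  case True
  have "\<psi> (eval [] x) = g []" by (rule \<psi>') (simp add: univ_poly_def polynomial_def)
  thus ?thesis using True h.hom_zero by (simp add: g_def)
 next
  case False
  have aR: "a \<in> carrier R" using a subfieldE(3)[OF E] by blast
  have "\<psi> (eval [a] x) = g [a]"
   by (rule \<psi>') (use False a in \<open>simp add: univ_poly_def polynomial_def\<close>)
  thus ?thesis using aR x h.hom_closed[of a] a by (simp add: g_def)
 qed
 moreover have "\<psi> x = y"
 proof -
  have "\<phi> \<one> = \<one>" "\<phi> \<zero> = \<zero>" using h.hom_one h.hom_zero by simp_all
  moreover have "\<psi> (eval [\<one>, \<zero>] x) = g [\<one>, \<zero>]"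
   by (rule \<psi>') (use subringE(2,3)[OF subring] in \<open>simp add: univ_poly_def polynomial_def\<close>)
  ultimately show ?thesis using x y by (simp add: g_def)
 qed
 moreover have "simple_extension E x = (\<lambda>p. eval p x) ` carrier (E[X])"
  by (rule simple_extension_as_eval_img) (use x subfieldE(3)[OF E] in auto)
 ultimately show ?thesis using that \<psi> by simp
qed

locale galois_setting = algebraic_closure \<Omega> F for \<Omega> (structure) and F
begin

abbreviation "\<G> \<equiv> galois_group \<Omega> F (carrier \<Omega>)"

lemma F_subfield: "subfield F \<Omega>" by (rule subfield_axioms)

lemma F_sub: "F \<subseteq> carrier \<Omega>" using subfieldE(3)[OF F_subfield] .

lemma subfield_one_zero: "subfield E \<Omega> ==> \<one> \<in> E \<and> \<zero> \<in> E"
 using subringE(2,3)[OF subfieldE(1)] by blast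

lemma algebraic_over: "subfield E \<Omega> ==> F \<subseteq> E ==> x \<in> carrier \<Omega> ==> (algebraic over E) x"
 using algebraic_mono[of F E x] algebraic_extension[of x] by blast

definition embeds :: "'a set => ('a => 'a) => bool" where
 "embeds E \<phi> \<longleftrightarrow> subfield E \<Omega> \<and> F \<subseteq> E \<and> \<phi> \<in> ring_hom (\<Omega>\<lparr>carrier := E\<rparr>) \<Omega>"

lemma embeds_simps:
 assumes "embeds E \<phi>"
 shows "\<And>a. a \<in> E ==> \<phi> a \<in> carrier \<Omega>"
  "\<And>a b. a \<in> E ==> b \<in> E ==> \<phi> (a \<oplus> b) = \<phi> a \<oplus> \<phi> b"
  "\<And>a b. a \<in> E ==> b \<in> E ==> \<phi> (a \<otimes> b) = \<phi> a \<otimes> \<phi> b" "\<phi> \<one> = \<one>"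
 using assms ring_hom_memE[of \<phi> "\<Omega>\<lparr>carrier := E\<rparr>" \<Omega>] by (auto simp: embeds_def)

lemma embeds_domain:
 assumes "embeds E \<phi>"
 shows "E \<subseteq> carrier \<Omega>" "\<And>a. a \<in> E ==> \<ominus> a \<in> E" "\<And>a b. a \<in> E ==> b \<in> E ==> a \<oplus> b \<in> E"
  "\<And>a b. a \<in> E ==> b \<in> E ==> a \<otimes> b \<in> E" "\<And>a. a \<in> E ==> a \<noteq> \<zero> ==> inv a \<in> E"
proof -
 have E: "subfield E \<Omega>" using assms by (simp add: embeds_def)
 show "E \<subseteq> carrier \<Omega>" using subfieldE(3)[OF E] .
 show "\<And>a. a \<in> E ==> \<ominus> a \<in> E" using subringE(5)[OF subfieldE(1)[OF E]] .
 show "\<And>a b. a \<in> E ==> b \<in> E ==> a \<oplus> b \<in> E" using subringE(7)[OF subfieldE(1)[OF E]] .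
 show "\<And>a b. a \<in> E ==> b \<in> E ==> a \<otimes> b \<in> E" using subringE(6)[OF subfieldE(1)[OF E]] .
 show "\<And>a. a \<in> E ==> a \<noteq> \<zero> ==> inv a \<in> E" using subfield_m_inv(1)[OF E] by blast
qed

lemma embeds_chain_union:
 assumes C: "C \<noteq> {}" "\<And>Z. Z \<in> C ==> \<exists>E \<phi>. embeds E \<phi> \<and> Z = (\<lambda>a. (a, \<phi> a)) ` E"
  and chain: "\<And>Y Z. Y \<in> C ==> Z \<in> C ==> Y \<subseteq> Z \<or> Z \<subseteq> Y"
 shows "\<exists>E \<phi>. embeds E \<phi> \<and> \<Union>C = (\<lambda>a. (a, \<phi> a)) ` E"
proof -
 define E where "E = fst ` \<Union>C"
 define \<phi> where "\<phi> = (\<lambda>a. THE b. (a, b) \<in> \<Union>C)"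
 have fn: "b = b'" if ab: "(a, b) \<in> \<Union>C" "(a, b') \<in> \<Union>C" for a b b'
 proof -
  obtain Y Z where YZ: "Y \<in> C" "Z \<in> C" "(a, b) \<in> Y" "(a, b') \<in> Z" using ab by blast
  then obtain W where "W \<in> C" "(a, b) \<in> W" "(a, b') \<in> W" using chain[of Y Z] by blast
  thus ?thesis using C(2)[of W] by auto
 qed
 have \<phi>: "\<phi> a = b" if "(a, b) \<in> \<Union>C" for a b
  unfolding \<phi>_def by (rule the_equality) (use fn that in blast)+
 have pair: "\<exists>E' \<phi>'. embeds E' \<phi>' \<and> a \<in> E' \<and> b \<in> E' \<and> E' \<subseteq> E \<and> (\<forall>c\<in>E'. \<phi> c = \<phi>' c)" if ab: "a \<in> E" "b \<in> E" for a b
 proof -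
  obtain Y Z where YZ: "Y \<in> C" "Z \<in> C" "a \<in> fst ` Y" "b \<in> fst ` Z" using ab unfolding E_def by blast
  then obtain W where W: "W \<in> C" "a \<in> fst ` W" "b \<in> fst ` W" using chain[of Y Z] by blast
  obtain E' \<phi>' where E': "embeds E' \<phi>'" "W = (\<lambda>a. (a, \<phi>' a)) ` E'" using C(2)[OF W(1)] by blast
  have "fst ` W = E'" unfolding E'(2) by (simp add: image_image)
  hence "E' \<subseteq> E" "a \<in> E'" "b \<in> E'" unfolding E_def using W by blast+
  moreover have "\<forall>c\<in>E'. \<phi> c = \<phi>' c"
  proof
   fix c assume "c \<in> E'"
   hence "(c, \<phi>' c) \<in> \<Union>C" using W(1) unfolding E'(2) by blast
   thus "\<phi> c = \<phi>' c" by (rule \<phi>)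
  qed
  ultimately show ?thesis using E'(1) by blast
 qed
 have FE: "F \<subseteq> E"
 proof -
  obtain W where "W \<in> C" using C(1) by blast
  then obtain E' \<phi>' where E': "embeds E' \<phi>'" "W = (\<lambda>a. (a, \<phi>' a)) ` E'" using C(2) by blast
  have "fst ` W = E'" unfolding E'(2) by (simp add: image_image)
  moreover have "F \<subseteq> E'" using E'(1) unfolding embeds_def by blast
  ultimately show ?thesis unfolding E_def using \<open>W \<in> C\<close> by blast
 qed
 have oneF: "\<one> \<in> F" using subfield_one_zero[OF F_subfield] by blast
 have sub: "subfield E \<Omega>"
 proof (rule subfieldI'[OF subringI])
  show "E \<subseteq> carrier \<Omega>"
  proof
   fix a assume "a \<in> E"
   then obtain E' \<phi>' where "embeds E' \<phi>'" "a \<in> E'" using pair[of a a] by blast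
   thus "a \<in> carrier \<Omega>" using embeds_domain(1)[of E' \<phi>'] by blast
  qed
  show "\<one> \<in> E" using oneF FE by blast
 next
  fix a assume "a \<in> E"
  then obtain E' \<phi>' where "embeds E' \<phi>'" "a \<in> E'" "E' \<subseteq> E" using pair[of a a] by blast
  thus "\<ominus> a \<in> E" using embeds_domain(2)[of E' \<phi>' a] by blast
 next
  fix a b assume "a \<in> E" "b \<in> E"
  then obtain E' \<phi>' where "embeds E' \<phi>'" "a \<in> E'" "b \<in> E'" "E' \<subseteq> E" using pair[of a b] by blast
  thus "a \<otimes> b \<in> E" "a \<oplus> b \<in> E" using embeds_domain(3,4)[of E' \<phi>' a b] by blast+
 next
  fix a assume a: "a \<in> E - {\<zero>}"
  then obtain E' \<phi>' where "embeds E' \<phi>'" "a \<in> E'" "E' \<subseteq> E" using pair[of a a] by blast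
  thus "inv a \<in> E" using embeds_domain(5)[of E' \<phi>' a] a by blast
 qed
 have "\<phi> \<in> ring_hom (\<Omega>\<lparr>carrier := E\<rparr>) \<Omega>"
 proof (rule ring_hom_memI)
  fix a assume "a \<in> carrier (\<Omega>\<lparr>carrier := E\<rparr>)"
  then obtain E' \<phi>' where "embeds E' \<phi>'" "a \<in> E'" "\<phi> a = \<phi>' a" using pair[of a a] by auto
  thus "\<phi> a \<in> carrier \<Omega>" using embeds_simps(1)[of E' \<phi>'] by auto
 next
  fix a b assume "a \<in> carrier (\<Omega>\<lparr>carrier := E\<rparr>)" "b \<in> carrier (\<Omega>\<lparr>carrier := E\<rparr>)"
  then obtain E' \<phi>' where *: "embeds E' \<phi>'" "a \<in> E'" "b \<in> E'" and eq: "\<And>c. c \<in> E' ==> \<phi> c = \<phi>' c"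
   using pair[of a b] by auto
  have "a \<otimes> b \<in> E'" "a \<oplus> b \<in> E'"
   using embeds_domain(3,4)[of E' \<phi>' a b] * by blast+
  thus "\<phi> (a \<otimes>\<^bsub>\<Omega>\<lparr>carrier := E\<rparr>\<^esub> b) = \<phi> a \<otimes> \<phi> b" "\<phi> (a \<oplus>\<^bsub>\<Omega>\<lparr>carrier := E\<rparr>\<^esub> b) = \<phi> a \<oplus> \<phi> b"
   using embeds_simps(2,3)[OF *(1)] * eq by simp_all
 next
  obtain E' \<phi>' where *: "embeds E' \<phi>'" "\<one> \<in> E'" "\<phi> \<one> = \<phi>' \<one>" using pair[of \<one> \<one>] subsetD[OF FE oneF] by blast
  thus "\<phi> \<one>\<^bsub>\<Omega>\<lparr>carrier := E\<rparr>\<^esub> = \<one>" using embeds_simps(4)[OF *(1)] by simp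
 qed
 moreover have "\<Union>C = (\<lambda>a. (a, \<phi> a)) ` E"
 proof (intro equalityI subsetI)
  fix z assume z: "z \<in> \<Union>C"
  hence "z = (fst z, \<phi> (fst z))" using \<phi>[of "fst z" "snd z"] by simp
  moreover have "fst z \<in> E" unfolding E_def using z by (rule imageI)
  ultimately show "z \<in> (\<lambda>a. (a, \<phi> a)) ` E" by (rule image_eqI)
 next
  fix z assume "z \<in> (\<lambda>a. (a, \<phi> a)) ` E"
  then obtain w where "w \<in> \<Union>C" "z = (fst w, \<phi> (fst w))" unfolding E_def by blast
  thus "z \<in> \<Union>C" using \<phi>[of "fst w" "snd w"] by simp
 qed
 ultimately show ?thesis using sub FE unfolding embeds_def by blast
qed

lemma gal_memD:
 assumes "\<g> \<in> carrier (galois_group \<Omega> F L)"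
 shows "\<g> \<in> extensional L" "bij_betw \<g> L L" "\<And>a. a \<in> L ==> \<g> a \<in> L"
  "\<And>a b. a \<in> L ==> b \<in> L ==> \<g> (a \<oplus> b) = \<g> a \<oplus> \<g> b"
  "\<And>a b. a \<in> L ==> b \<in> L ==> \<g> (a \<otimes> b) = \<g> a \<otimes> \<g> b"
  "\<g> \<one> = \<one>" "\<And>a. a \<in> F ==> \<g> a = a"
 using assms ring_hom_memE[of \<g> "\<Omega>\<lparr>carrier := L\<rparr>" "\<Omega>\<lparr>carrier := L\<rparr>"]
 by (auto simp: galois_group_def Bij_def ring_iso_def)

lemma gal_memI:
 assumes "\<g> \<in> extensional L" "bij_betw \<g> L L"
  "\<And>a b. a \<in> L ==> b \<in> L ==> \<g> (a \<oplus> b) = \<g> a \<oplus> \<g> b"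
  "\<And>a b. a \<in> L ==> b \<in> L ==> \<g> (a \<otimes> b) = \<g> a \<otimes> \<g> b"
  "\<g> \<one> = \<one>" "\<And>a. a \<in> F ==> \<g> a = a"
 shows "\<g> \<in> carrier (galois_group \<Omega> F L)"
 using assms bij_betwE[OF assms(2)]
 by (auto simp: galois_group_def Bij_def ring_iso_def intro!: ring_hom_memI)

lemma hom_injective:
 assumes "embeds E \<phi>" shows "inj_on \<phi> E"
proof -
 interpret RE: field "\<Omega>\<lparr>carrier := E\<rparr>" using assms subfield_iff(2) unfolding embeds_def by blast
 interpret h: ring_hom_ring "\<Omega>\<lparr>carrier := E\<rparr>" \<Omega> \<phi>
  by (rule ring_hom_ringI2) (use assms in \<open>auto simp: embeds_def intro: RE.ring_axioms ring_axioms\<close>)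
 show ?thesis using h.img_is_subfield(1)[OF RE.carrier_is_subfield] by simp
qed

lemma eval_fixed:
 assumes h: "embeds (carrier \<Omega>) \<phi>" and p: "p \<in> carrier (E[X])" and E: "E \<subseteq> carrier \<Omega>"
  and fx: "\<And>a. a \<in> E ==> \<phi> a = a" and x: "x \<in> carrier \<Omega>"
 shows "\<phi> (eval p x) = eval p (\<phi> x)"
proof -
 interpret h: ring_hom_ring \<Omega> \<Omega> \<phi>
  by (rule ring_hom_ringI2) (use h in \<open>auto simp: embeds_def intro: ring_axioms\<close>)
 have pE: "set p \<subseteq> E" using p polynomial_incl unfolding univ_poly_def by auto
 have "map \<phi> p = p" using pE fx by (intro map_idI) auto
 thus ?thesis using h.eval_hom'[OF x, of p] pE E by auto
qed

lemma embedding_is_automorphism: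
 assumes h: "embeds (carrier \<Omega>) \<phi>" and fx: "\<And>a. a \<in> F ==> \<phi> a = a"
 shows "restrict \<phi> (carrier \<Omega>) \<in> carrier \<G>"
proof -
 have surj: "\<exists>a\<in>carrier \<Omega>. \<phi> a = b" if b: "b \<in> carrier \<Omega>" for b
 proof -
  define S where "S = {z. is_root (Irr F b) z}"
  note irr = IrrE[OF F_subfield b algebraic_extension[OF b]]
  have p: "Irr F b \<noteq> []"
   using pirreducible_degree[OF F_subfield irr(1,2)] by force
  have fin: "finite S" unfolding S_def
   using finite_number_of_roots[OF carrier_polynomial_shell[OF subfieldE(1)[OF F_subfield] irr(1)]] .
  have "\<phi> \<in> ring_hom \<Omega> \<Omega>" using h by (simp add: embeds_def)
  hence zero: "\<phi> \<zero> = \<zero>" using ring_hom_zero[OF _ ring_axioms ring_axioms] by blast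
  have "\<phi> z \<in> S" if "z \<in> S" for z
  proof -
   have z: "z \<in> carrier \<Omega>" "eval (Irr F b) z = \<zero>" using that by (simp_all add: S_def is_root_def)
   have "eval (Irr F b) (\<phi> z) = \<phi> (eval (Irr F b) z)"
    by (rule eval_fixed[OF h irr(1) F_sub fx z(1), symmetric])
   thus ?thesis using zero z(2) embeds_simps(1)[OF h z(1)] p by (simp add: S_def is_root_def)
  qed
  hence "\<phi> ` S \<subseteq> S" by blast
  moreover have sub: "S \<subseteq> carrier \<Omega>" unfolding S_def is_root_def by blast
  ultimately have "\<phi> ` S = S"
   using endo_inj_surj[OF fin _ inj_on_subset[OF hom_injective[OF h] sub]] by blast
  moreover have "b \<in> S" using b p irr(4) by (simp add: S_def is_root_def)
  ultimately have "b \<in> \<phi> ` S" by (rule subst[OF sym, of _ _ "\<lambda>S. b \<in> S"])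
  then obtain a where "a \<in> S" "b = \<phi> a" by (rule imageE)
  thus ?thesis using sub by blast
 qed
 have bij: "bij_betw \<phi> (carrier \<Omega>) (carrier \<Omega>)"
  unfolding bij_betw_def
 proof (intro conjI equalityI subsetI)
  show "inj_on \<phi> (carrier \<Omega>)" using h by (rule hom_injective)
  show "b \<in> carrier \<Omega>" if "b \<in> \<phi> ` carrier \<Omega>" for b using that embeds_simps(1)[OF h] by auto
  show "b \<in> \<phi> ` carrier \<Omega>" if "b \<in> carrier \<Omega>" for b using surj[OF that] by blast
 qed
 have "bij_betw (restrict \<phi> (carrier \<Omega>)) (carrier \<Omega>) (carrier \<Omega>)"
  using bij_betw_cong[of "carrier \<Omega>" "restrict \<phi> (carrier \<Omega>)" \<phi>] bij by simp
 thus ?thesis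
  using embeds_simps(2-4)[OF h] fx F_sub by (intro gal_memI) auto
qed

text \<open>
 Zorn's lemma on the graphs of the extensions of \<open>\<phi>\<close>. A maximal one is defined on all of
 \<open>\<Omega>\<close>, since an element outside its domain is algebraic and the transported minimal
 polynomial has a root. The result is surjective because it permutes the finitely many roots of each
 polynomial over \<open>F\<close>.
\<close>

theorem embedding_extends:
 assumes E: "embeds E \<phi>" and fx: "\<And>a. a \<in> F ==> \<phi> a = a"
 obtains \<g> where "\<g> \<in> carrier \<G>" "\<And>a. a \<in> E ==> \<g> a = \<phi> a"
proof -
 define gr where "gr = (\<lambda>(E::'a set) (\<phi>::'a => 'a). (\<lambda>a. (a, \<phi> a)) ` E)"
 define Z where "Z = {W. gr E \<phi> \<subseteq> W \<and> (\<exists>E' \<phi>'. embeds E' \<phi>' \<and> W = gr E' \<phi>')}"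
 have "\<exists>M\<in>Z. \<forall>W\<in>Z. M \<subseteq> W \<longrightarrow> W = M"
 proof (rule subset_Zorn_nonempty)
  show "Z \<noteq> {}" using E unfolding Z_def by blast
  fix C assume C: "C \<noteq> {}" "subset.chain Z C"
  have "\<exists>E \<phi>. embeds E \<phi> \<and> \<Union>C = gr E \<phi>" unfolding gr_def
  proof (rule embeds_chain_union[OF C(1)])
   show "\<exists>E \<phi>. embeds E \<phi> \<and> W = (\<lambda>a. (a, \<phi> a)) ` E" if "W \<in> C" for W
   proof -
    have "W \<in> Z" using C(2) that unfolding subset.chain_def by blast
    thus ?thesis unfolding Z_def gr_def by blast
   qed
   show "W \<subseteq> Y \<or> Y \<subseteq> W" if "W \<in> C" "Y \<in> C" for W Y
    using C(2) that by (auto simp: subset_chain_def)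
  qed
  moreover have "gr E \<phi> \<subseteq> \<Union>C"
  proof -
   obtain W where "W \<in> C" using C(1) by blast
   moreover have "W \<in> Z" using C(2) \<open>W \<in> C\<close> unfolding subset.chain_def by blast
   ultimately show ?thesis unfolding Z_def by blast
  qed
  ultimately show "\<Union>C \<in> Z" unfolding Z_def by blast
 qed
 then obtain M where M: "M \<in> Z" and max: "\<And>W. W \<in> Z ==> M \<subseteq> W ==> W = M" by blast
 obtain E' \<phi>' where E': "embeds E' \<phi>'" "M = gr E' \<phi>'" using M unfolding Z_def by blast
 have agree: "a \<in> E' \<and> \<phi>' a = \<phi> a" if "a \<in> E" for a
 proof -
  have "(a, \<phi> a) \<in> gr E' \<phi>'" using that M E'(2) unfolding Z_def gr_def by blast
  thus ?thesis by (auto simp: gr_def)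
 qed
 have E'_sub: "subfield E' \<Omega>" "F \<subseteq> E'" and \<phi>': "\<phi>' \<in> ring_hom (\<Omega>\<lparr>carrier := E'\<rparr>) \<Omega>"
  using E' by (auto simp: embeds_def)
 have "E' = carrier \<Omega>"
 proof (rule ccontr)
  assume "E' \<noteq> carrier \<Omega>"
  then obtain x where x: "x \<in> carrier \<Omega>" "x \<notin> E'" using subfieldE(3)[OF E'_sub(1)] by blast
  have alg: "(algebraic over E') x" using algebraic_over E'_sub x by blast
  let ?p = "map \<phi>' (Irr E' x)"
  interpret RE: field "\<Omega>\<lparr>carrier := E'\<rparr>" using subfield_iff(2)[OF E'_sub(1)] .
  interpret h: ring_hom_ring "\<Omega>\<lparr>carrier := E'\<rparr>" \<Omega> \<phi>'
   by (rule ring_hom_ringI2) (use \<phi>' in \<open>auto intro: RE.ring_axioms ring_axioms\<close>)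
  note irr = IrrE(1)[OF E'_sub(1) x(1) alg] pirreducible_degree[OF E'_sub(1) IrrE(1,2)[OF E'_sub(1) x(1) alg]]
  have "polynomial E' (Irr E' x)" using irr(1) by (simp add: univ_poly_carrier)
  hence pE: "set (Irr E' x) \<subseteq> E'" "lead_coeff (Irr E' x) \<noteq> \<zero>"
   using irr(2) by (auto simp: polynomial_def)
  have nz: "\<phi>' a \<noteq> \<zero>" if "a \<in> E'" "a \<noteq> \<zero>" for a
   using inj_onD[OF hom_injective[OF E'(1)], of a \<zero>] h.hom_zero that subfield_one_zero[OF E'_sub(1)] by auto
  have "lead_coeff (Irr E' x) \<in> E'" using irr(2) pE(1) hd_in_set[of "Irr E' x"] by fastforce
  hence p: "?p \<in> carrier (poly_ring \<Omega>)"
   unfolding univ_poly_carrier[symmetric] polynomial_def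
   using pE nz[of "lead_coeff (Irr E' x)"] h.hom_closed irr(2)
   by (auto simp: hd_map)
  have "roots ?p \<noteq> {#}"
   using roots_over_carrier[OF p] irr(2) by (auto simp: splitted_def)
  then obtain y where y: "y \<in># roots ?p" by blast
  hence y: "y \<in> carrier \<Omega>" "eval ?p y = \<zero>" using roots_mem_iff_is_root[OF p] by (auto simp: is_root_def)
  obtain \<psi> where \<psi>: "\<psi> \<in> ring_hom (\<Omega>\<lparr>carrier := simple_extension E' x\<rparr>) \<Omega>"
   "\<And>a. a \<in> E' ==> \<psi> a = \<phi>' a"
   using extend_hom_to_simple_extension[OF E'_sub(1) \<phi>' x(1) alg y] by blast
  have sub: "E' \<subseteq> simple_extension E' x" "x \<in> simple_extension E' x"
   using simple_extension_incl[OF subfieldE(3)[OF E'_sub(1)] x(1)]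
    simple_extension_mem[OF subfieldE(1)[OF E'_sub(1)] x(1)] by auto
  have "embeds (simple_extension E' x) \<psi>"
   unfolding embeds_def using simple_extension_is_subfield[OF E'_sub(1) x(1)] alg \<psi>(1) sub(1) E'_sub(2) by auto
  moreover have "M \<subseteq> gr (simple_extension E' x) \<psi>"
   unfolding E'(2) gr_def using sub(1) \<psi>(2) by force
  ultimately have "gr (simple_extension E' x) \<psi> = M"
   using max M unfolding Z_def by blast
  thus False using sub(2) x(2) E'(2) by (auto simp: gr_def)
 qed
 hence emb: "embeds (carrier \<Omega>) \<phi>'" using E' by simp
 have FE: "F \<subseteq> E" using E by (simp add: embeds_def)
 have "restrict \<phi>' (carrier \<Omega>) \<in> carrier \<G>"
  by (rule embedding_is_automorphism[OF emb]) (use agree FE fx in auto)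
 thus ?thesis
 proof (rule that)
  fix a assume a: "a \<in> E"
  hence "a \<in> carrier \<Omega>" using subsetD[OF embeds_domain(1)[OF E]] by blast
  thus "restrict \<phi>' (carrier \<Omega>) a = \<phi> a" using agree[OF a] by simp
 qed
qed

end

section \<open>Independence of characters and polynomials with prescribed roots\<close>

text \<open>
 Dedekind's argument: in a shortest nontrivial relation, replace the argument \<open>x\<close> by \<open>x
 \<otimes> y\<close>, where \<open>y\<close> separates two of the characters, and subtract a multiple of
 the original relation; this produces a shorter one.
\<close>

lemma (in field) independence_of_characters:
 assumes "finite I" and M: "\<And>x y. x \<in> M ==> y \<in> M ==> x \<otimes> y \<in> M" "\<one> \<in> M"
  and cl: "\<And>i x. i \<in> I ==> x \<in> M ==> f i x \<in> carrier R"
  and mult: "\<And>i x y. i \<in> I ==> x \<in> M ==> y \<in> M ==> f i (x \<otimes> y) = f i x \<otimes> f i y"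
  and one: "\<And>i. i \<in> I ==> f i \<one> = \<one>"
  and distinct: "\<And>i j. i \<in> I ==> j \<in> I ==> i \<noteq> j ==> \<exists>x\<in>M. f i x \<noteq> f j x"
  and c: "\<And>i. i \<in> I ==> c i \<in> carrier R"
  and rel: "\<And>x. x \<in> M ==> (\<Oplus>i\<in>I. c i \<otimes> f i x) = \<zero>"
  and k: "k \<in> I"
 shows "c k = \<zero>"
 using assms
proof (induction I arbitrary: c k rule: finite_induct)
 case empty thus ?case by simp
next
 case (insert j J)
 note cl = insert.prems(3) and c = insert.prems(7)
 have J0: "c l = \<zero>" if l: "l \<in> J" for l
 proof -
  have "l \<noteq> j" using l insert.hyps by blast
  then obtain m where m: "m \<in> M" "f l m \<noteq> f j m" using insert.prems(6)[of l j] l by blast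
  define d where "d = (\<lambda>i. c i \<otimes> (f i m \<ominus> f j m))"
  have "d l = \<zero>"
  proof (rule insert.IH)
   show "d i \<in> carrier R" if "i \<in> J" for i
    using that c cl m by (simp add: d_def)
   fix x assume x: "x \<in> M"
   have fx: "f i x \<in> carrier R" "f i m \<in> carrier R" "c i \<in> carrier R" if "i \<in> insert j J" for i
    using that x m cl c by auto
   have S: "(\<Oplus>i\<in>J. c i \<otimes> f i x) \<in> carrier R" "(\<Oplus>i\<in>J. c i \<otimes> f i (m \<otimes> x)) \<in> carrier R"
    using fx x m M insert.prems(3) by (auto intro!: finsum_closed)
   have r1: "c j \<otimes> f j x \<oplus> (\<Oplus>i\<in>J. c i \<otimes> f i x) = \<zero>"
    using insert.prems(8)[OF x] insert.hyps fx by (simp add: finsum_insert Pi_def)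
   have mx: "m \<otimes> x \<in> M" using M(1) m x by blast
   have "c j \<otimes> f j (m \<otimes> x) \<oplus> (\<Oplus>i\<in>J. c i \<otimes> f i (m \<otimes> x)) = \<zero>"
    using insert.prems(8)[OF mx] insert.hyps c cl mx by (simp add: finsum_insert Pi_def)
   hence r2: "f j m \<otimes> (c j \<otimes> f j x) \<oplus> (\<Oplus>i\<in>J. c i \<otimes> f i (m \<otimes> x)) = \<zero>"
    using insert.prems(4) m x fx by (simp add: m_lcomm)
   have "(\<Oplus>i\<in>J. d i \<otimes> f i x) = (\<Oplus>i\<in>J. c i \<otimes> f i (m \<otimes> x) \<oplus> (\<ominus> f j m) \<otimes> (c i \<otimes> f i x))"
   proof (rule finsum_cong')
    show "d i \<otimes> f i x = c i \<otimes> f i (m \<otimes> x) \<oplus> (\<ominus> f j m) \<otimes> (c i \<otimes> f i x)" if "i \<in> J" for i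
    proof -
     have i: "i \<in> insert j J" "j \<in> insert j J" using that by auto
     have "c i \<otimes> (a \<ominus> b) \<otimes> y = c i \<otimes> (a \<otimes> y) \<oplus> (\<ominus> b) \<otimes> (c i \<otimes> y)"
      if "a \<in> carrier R" "b \<in> carrier R" "y \<in> carrier R" for a b y
      using that fx(3)[OF i(1)] by algebra
     thus ?thesis
      unfolding d_def using insert.prems(4)[OF i(1) m(1) x] fx[OF i(1)] fx[OF i(2)] by simp
    qed
   qed (use fx mx cl c in auto)
   also have "\<dots> = (\<Oplus>i\<in>J. c i \<otimes> f i (m \<otimes> x)) \<oplus> (\<ominus> f j m) \<otimes> (\<Oplus>i\<in>J. c i \<otimes> f i x)"
    using fx mx cl c insert.hyps(1) by (subst finsum_addf) (auto simp: finsum_rdistr intro!: arg_cong2[where f="(\<oplus>)"])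
   also have "\<dots> = \<zero>"
   proof -
    have "b \<oplus> (\<ominus> g) \<otimes> a = \<zero>"
     if "v \<oplus> a = \<zero>" "g \<otimes> v \<oplus> b = \<zero>" "a \<in> carrier R" "b \<in> carrier R" "v \<in> carrier R" "g \<in> carrier R" for a b v g
    proof -
     have "a = \<ominus> v" using that(1,3,5) by (metis a_comm minus_equality minus_minus)
     moreover have "b = \<ominus> (g \<otimes> v)" using that by (metis a_comm minus_equality minus_minus m_closed)
     ultimately show ?thesis using that(5,6) by algebra
    qed
    from this[OF r1 r2] show ?thesis using S fx by simp
   qed
   finally show "(\<Oplus>i\<in>J. d i \<otimes> f i x) = \<zero>" .
  qed (use insert.prems l in auto)
  moreover have "f l m \<ominus> f j m \<noteq> \<zero>" using m l cl by simp
  ultimately show ?thesis unfolding d_def using integral[of "c l" "f l m \<ominus> f j m"] c cl l m by simp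
 qed
 have "(\<Oplus>i\<in>J. c i \<otimes> f i \<one>) = \<zero>"
  by (rule add.finprod_one_eqI) (use J0 cl M in auto)
 moreover have "(\<Oplus>i\<in>insert j J. c i \<otimes> f i \<one>) = \<zero>" using insert.prems(8) M(2) by blast
 ultimately have "c j = \<zero>"
  using insert.hyps c insert.prems(5) J0 by (simp add: finsum_insert Pi_def)
 thus ?case using J0 insert.prems(9) by blast
qed

context ring begin

definition root_poly :: "'a set => 'a list" where
 "root_poly S = finprod (poly_ring R) (\<lambda>a. [\<one>, \<ominus> a]) S"

end

context field begin

lemma linear_poly_closed: "a \<in> carrier R ==> [\<one>, \<ominus> a] \<in> carrier (poly_ring R)"
 unfolding univ_poly_carrier[symmetric] polynomial_def by simp

lemma root_poly_insert:
 assumes "finite S" "a \<notin> S" "insert a S \<subseteq> carrier R"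
 shows "root_poly (insert a S) = poly_mult [\<one>, \<ominus> a] (root_poly S)"
  "root_poly S \<in> carrier (poly_ring R)"
proof -
 interpret UP: cring "poly_ring R" by (rule univ_poly_is_cring[OF carrier_is_subring])
 show "root_poly S \<in> carrier (poly_ring R)"
  unfolding root_poly_def using assms linear_poly_closed by (intro UP.finprod_closed) auto
 have "finprod (poly_ring R) (\<lambda>a. [\<one>, \<ominus> a]) (insert a S) = [\<one>, \<ominus> a] \<otimes>\<^bsub>poly_ring R\<^esub> finprod (poly_ring R) (\<lambda>a. [\<one>, \<ominus> a]) S"
  by (rule UP.finprod_insert) (use assms linear_poly_closed in auto)
 thus "root_poly (insert a S) = poly_mult [\<one>, \<ominus> a] (root_poly S)"
  by (simp add: root_poly_def univ_poly_mult)
qed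

lemma root_poly_empty: "root_poly {} = [\<one>]"
proof -
 interpret UP: cring "poly_ring R" by (rule univ_poly_is_cring[OF carrier_is_subring])
 show ?thesis by (simp add: root_poly_def univ_poly_one)
qed

lemma root_poly_props_aux:
 assumes "finite S" "S \<subseteq> carrier R"
 shows "root_poly S \<in> carrier (poly_ring R) \<and> root_poly S \<noteq> [] \<and> roots (root_poly S) = mset_set S
  \<and> degree (root_poly S) = card S"
 using assms
proof (induction S rule: finite_induct)
 case empty
 interpret UP: domain "poly_ring R" by (rule univ_poly_is_domain[OF carrier_is_subring])
 have const: "[\<one>] \<in> carrier (poly_ring R)" using UP.one_closed unfolding univ_poly_one .
 show ?case using const degree_zero_imp_empty_roots[OF const] by (simp add: root_poly_empty)
next
 case (insert a S)
 interpret UP: domain "poly_ring R" by (rule univ_poly_is_domain[OF carrier_is_subring])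
 have S: "S \<subseteq> carrier R" and a: "a \<in> carrier R" using insert.prems(1) by auto
 have IH: "root_poly S \<in> carrier (poly_ring R)" "root_poly S \<noteq> []" "roots (root_poly S) = mset_set S"
  "degree (root_poly S) = card S" using insert.IH[OF S] by auto
 have eq: "root_poly (insert a S) = [\<one>, \<ominus> a] \<otimes>\<^bsub>poly_ring R\<^esub> root_poly S"
  using root_poly_insert(1)[OF insert.hyps(1,2)] insert.prems(1) by (simp add: univ_poly_mult)
 have "root_poly (insert a S) \<in> carrier (poly_ring R)"
  unfolding eq using linear_poly_closed[OF a] IH(1) by (rule UP.m_closed)
 moreover have "root_poly (insert a S) \<noteq> []"
  using UP.integral[of "[\<one>, \<ominus> a]" "root_poly S"] linear_poly_closed[OF a] IH(1,2)
  unfolding eq by (auto simp: univ_poly_zero)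
 moreover have "roots (root_poly (insert a S)) = mset_set (insert a S)"
  unfolding eq using poly_mult_degree_one_monic_imp_same_roots[OF a IH(1,2)] IH(3) insert.hyps by simp
 moreover have "degree (poly_mult [\<one>, \<ominus> a] (root_poly S)) = degree [\<one>, \<ominus> a] + degree (root_poly S)"
  using poly_mult_degree_eq[OF carrier_is_subring, of "[\<one>, \<ominus> a]" "root_poly S"] IH(1,2) linear_poly_closed[OF a]
  by (simp add: univ_poly_carrier)
 hence "degree (root_poly (insert a S)) = card (insert a S)"
  using IH(4) insert.hyps unfolding eq univ_poly_mult by (simp del: poly_mult.simps)
 ultimately show ?case by simp
qed

lemma root_poly_props:
 assumes "finite S" "S \<subseteq> carrier R"
 shows "root_poly S \<in> carrier (poly_ring R)" "root_poly S \<noteq> []" "roots (root_poly S) = mset_set S"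
  "degree (root_poly S) = card S"
 using root_poly_props_aux[OF assms] by simp_all

lemma root_poly_consistent:
 assumes E: "subfield E R" and "finite S" "S \<subseteq> E"
 shows "ring.root_poly (R\<lparr>carrier := E\<rparr>) S = root_poly S"
proof -
 interpret RE: field "R\<lparr>carrier := E\<rparr>" using E by (rule subfield_iff(2))
 note sub = subfieldE(1)[OF E]
 have inv: "\<ominus>\<^bsub>R\<lparr>carrier := E\<rparr>\<^esub> a = \<ominus> a" if "a \<in> E" for a
  using RE.minus_equality[of "\<ominus> a" a] that subringE(5)[OF sub that] subsetD[OF subringE(1)[OF sub] that] l_neg by auto
 show ?thesis using assms(2,3)
 proof (induction S rule: finite_induct)
  case empty thus ?case by (simp add: root_poly_empty RE.root_poly_empty)
 next
  case (insert a S)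
  have "RE.root_poly (insert a S) = poly_mult [\<one>, \<ominus> a] (RE.root_poly S)"
   using RE.root_poly_insert(1)[OF insert.hyps(1,2)] insert.prems inv[of a]
   by (simp add: poly_mult_consistent[OF sub] del: poly_mult.simps)
  also have "\<dots> = root_poly (insert a S)"
   using root_poly_insert(1)[OF insert.hyps(1,2)] insert.prems insert.IH subringE(1)[OF sub]
   by (simp del: poly_mult.simps add: subset_iff)
  finally show ?case .
 qed
qed

lemma root_poly_map_automorphism:
 assumes h: "ring_hom_ring R R h" and inj: "inj_on h (carrier R)" and "finite S" "S \<subseteq> carrier R"
 shows "map h (root_poly S) = root_poly (h ` S)"
 using assms(3,4)
proof (induction S rule: finite_induct)
 interpret h: ring_hom_ring R R h by fact
 { case empty show ?case by (simp add: root_poly_empty) }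
 case (insert a S)
 have S: "S \<subseteq> carrier R" "a \<in> carrier R" using insert.prems by auto
 have hS: "h ` S \<subseteq> carrier R" "h a \<in> carrier R" using S by auto
 have "h a \<notin> h ` S" using inj insert.hyps(2) S by (auto dest: inj_onD)
 hence "root_poly (h ` insert a S) = poly_mult [\<one>, \<ominus> h a] (root_poly (h ` S))"
  using root_poly_insert(1)[of "h ` S" "h a"] hS insert.hyps(1) by (simp del: poly_mult.simps)
 also have "\<dots> = poly_mult (map h [\<one>, \<ominus> a]) (map h (root_poly S))"
  using insert.IH S by (simp del: poly_mult.simps)
 also have "\<dots> = normalize (map h (poly_mult [\<one>, \<ominus> a] (root_poly S)))"
  using root_poly_props(1)[OF insert.hyps(1) S(1)] S(2) polynomial_incl
  by (intro h.poly_mult_hom'[symmetric]) (auto simp: univ_poly_carrier[symmetric])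
 also have "\<dots> = normalize (map h (root_poly (insert a S)))"
  using root_poly_insert(1)[OF insert.hyps(1,2) insert.prems] by (simp del: poly_mult.simps)
 also have "\<dots> = map h (root_poly (insert a S))"
 proof (rule normalize_polynomial[of "carrier R"])
  have p: "polynomial (carrier R) (root_poly (insert a S))" "root_poly (insert a S) \<noteq> []"
   using root_poly_props(1,2)[of "insert a S"] insert by (simp_all add: univ_poly_carrier)
  hence "lead_coeff (root_poly (insert a S)) \<noteq> \<zero>" "lead_coeff (root_poly (insert a S)) \<in> carrier R"
   "set (root_poly (insert a S)) \<subseteq> carrier R"
   by (auto simp: polynomial_def)
  moreover from this have "h (lead_coeff (root_poly (insert a S))) \<noteq> \<zero>"
   using inj_onD[OF inj, of "lead_coeff (root_poly (insert a S))" \<zero>] by auto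
  ultimately show "polynomial (carrier R) (map h (root_poly (insert a S)))"
   using p(2) by (auto simp: polynomial_def hd_map)
 qed
 finally show ?case by simp
qed

end

section \<open>The absolute Galois group\<close>

context galois_setting
begin

lemma gal_mult:
 assumes "\<g> \<in> carrier (galois_group \<Omega> F L)" "\<d> \<in> carrier (galois_group \<Omega> F L)"
 shows "\<g> \<otimes>\<^bsub>galois_group \<Omega> F L\<^esub> \<d> = compose L \<g> \<d>"
 using assms by (simp add: galois_group_def BijGroup_def)

lemma gal_mult_app:
 assumes "\<g> \<in> carrier (galois_group \<Omega> F L)" "\<d> \<in> carrier (galois_group \<Omega> F L)" "x \<in> L"
 shows "(\<g> \<otimes>\<^bsub>galois_group \<Omega> F L\<^esub> \<d>) x = \<g> (\<d> x)"
 using assms by (simp add: gal_mult compose_eq)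

lemma gal_one: "\<one>\<^bsub>galois_group \<Omega> F L\<^esub> = (\<lambda>x\<in>L. x)"
 by (simp add: galois_group_def BijGroup_def)

lemma gal_group:
 assumes L: "subfield L \<Omega>" "F \<subseteq> L"
 shows "group (galois_group \<Omega> F L)"
proof -
 have sub: "subgroup (carrier (galois_group \<Omega> F L)) (BijGroup L)"
 proof (rule group.subgroupI[OF group_BijGroup])
  show "carrier (galois_group \<Omega> F L) \<subseteq> carrier (BijGroup L)"
   by (auto simp: galois_group_def BijGroup_def)
  have one: "\<one> \<in> L" using subfield_one_zero[OF L(1)] by blast
  have "(\<lambda>x\<in>L. x) \<in> carrier (galois_group \<Omega> F L)"
  proof (rule gal_memI)
   have "bij_betw (\<lambda>x\<in>L. x) L L" using id_Bij[of L] by (simp add: Bij_def)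
   thus "bij_betw (\<lambda>x\<in>L. x) L L" .
  qed (use L one subringE(6,7)[OF subfieldE(1)[OF L(1)]] in auto)
  thus "carrier (galois_group \<Omega> F L) \<noteq> {}" by blast
 next
  fix \<g> assume g: "\<g> \<in> carrier (galois_group \<Omega> F L)"
  note gD = gal_memD[OF g]
  have B: "\<g> \<in> Bij L" using gD by (simp add: Bij_def)
  have inv: "inv\<^bsub>BijGroup L\<^esub> \<g> = (\<lambda>x\<in>L. inv_into L \<g> x)" using inv_BijGroup[OF B] by simp
  have left: "inv_into L \<g> (\<g> x) = x" if "x \<in> L" for x
   using gD(2) that by (simp add: bij_betw_def)
  have right: "\<g> (inv_into L \<g> x) = x" "inv_into L \<g> x \<in> L" if "x \<in> L" for x
   using gD(2) that by (simp_all add: bij_betw_def f_inv_into_f inv_into_into)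
  have cl: "a \<oplus> b \<in> L" "a \<otimes> b \<in> L" if "a \<in> L" "b \<in> L" for a b
   using subringE(6,7)[OF subfieldE(1)[OF L(1)]] that by blast+
  have "(\<lambda>x\<in>L. inv_into L \<g> x) \<in> carrier (galois_group \<Omega> F L)"
  proof (rule gal_memI)
   show "bij_betw (\<lambda>x\<in>L. inv_into L \<g> x) L L" using restrict_inv_into_Bij[OF B] by (simp add: Bij_def)
   fix a b assume ab: "a \<in> L" "b \<in> L"
   have "inv_into L \<g> (\<g> (inv_into L \<g> a \<oplus> inv_into L \<g> b)) = inv_into L \<g> a \<oplus> inv_into L \<g> b"
    "inv_into L \<g> (\<g> (inv_into L \<g> a \<otimes> inv_into L \<g> b)) = inv_into L \<g> a \<otimes> inv_into L \<g> b"
    using ab right cl by (auto intro!: left)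
   thus "(\<lambda>x\<in>L. inv_into L \<g> x) (a \<oplus> b) = (\<lambda>x\<in>L. inv_into L \<g> x) a \<oplus> (\<lambda>x\<in>L. inv_into L \<g> x) b"
    "(\<lambda>x\<in>L. inv_into L \<g> x) (a \<otimes> b) = (\<lambda>x\<in>L. inv_into L \<g> x) a \<otimes> (\<lambda>x\<in>L. inv_into L \<g> x) b"
    using ab right cl gD by simp_all
  next
   show "(\<lambda>x\<in>L. inv_into L \<g> x) \<one> = \<one>"
    using left[of \<one>] gD(6) subfield_one_zero[OF L(1)] by simp
   show "(\<lambda>x\<in>L. inv_into L \<g> x) a = a" if "a \<in> F" for a
    using left[of a] gD(7)[OF that] that L by auto
  qed simp
  thus "inv\<^bsub>BijGroup L\<^esub> \<g> \<in> carrier (galois_group \<Omega> F L)" using inv by simp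
 next
  fix \<g> \<d> assume g: "\<g> \<in> carrier (galois_group \<Omega> F L)" "\<d> \<in> carrier (galois_group \<Omega> F L)"
  note gD = gal_memD[OF g(1)] and dD = gal_memD[OF g(2)]
  have B: "\<g> \<in> Bij L" "\<d> \<in> Bij L" using gD dD by (simp_all add: Bij_def)
  have cl: "a \<oplus> b \<in> L" "a \<otimes> b \<in> L" if "a \<in> L" "b \<in> L" for a b
   using subringE(6,7)[OF subfieldE(1)[OF L(1)]] that by blast+
  have "compose L \<g> \<d> \<in> carrier (galois_group \<Omega> F L)"
  proof (rule gal_memI)
   show "bij_betw (compose L \<g> \<d>) L L" using compose_Bij[OF B] by (simp add: Bij_def)
  qed (use gD dD cl L subfield_one_zero[OF L(1)] in \<open>auto simp: compose_def\<close>)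
  thus "\<g> \<otimes>\<^bsub>BijGroup L\<^esub> \<d> \<in> carrier (galois_group \<Omega> F L)" using B by (simp add: BijGroup_def)
 qed
 have "galois_group \<Omega> F L = BijGroup L\<lparr>carrier := carrier (galois_group \<Omega> F L)\<rparr>"
  by (simp add: galois_group_def)
 thus ?thesis using group.subgroup_imp_group[OF group_BijGroup sub] by simp
qed

lemma \<G>_group: "group \<G>"
 by (rule gal_group[OF carrier_is_subfield F_sub])

interpretation \<G>: group \<G> by (rule \<G>_group)

lemma \<G>_embeds: "\<g> \<in> carrier \<G> ==> embeds (carrier \<Omega>) \<g>"
 using gal_memD[of \<g> "carrier \<Omega>"] carrier_is_subfield F_sub
 by (auto simp: embeds_def intro!: ring_hom_memI)

lemma \<G>_closed[simp]: "\<g> \<in> carrier \<G> ==> x \<in> carrier \<Omega> ==> \<g> x \<in> carrier \<Omega>"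
 by (rule gal_memD)

lemma \<G>_inj: "\<g> \<in> carrier \<G> ==> inj_on \<g> (carrier \<Omega>)"
 using gal_memD(2) by (auto simp: bij_betw_def)

lemma \<G>_hom: "\<g> \<in> carrier \<G> ==> ring_hom_ring \<Omega> \<Omega> \<g>"
 using \<G>_embeds by (intro ring_hom_ringI2) (auto simp: embeds_def intro: ring_axioms)

lemma \<G>_simps[simp]:
 assumes "\<g> \<in> carrier \<G>"
 shows "\<And>a b. a \<in> carrier \<Omega> ==> b \<in> carrier \<Omega> ==> \<g> (a \<oplus> b) = \<g> a \<oplus> \<g> b"
  "\<And>a b. a \<in> carrier \<Omega> ==> b \<in> carrier \<Omega> ==> \<g> (a \<otimes> b) = \<g> a \<otimes> \<g> b"
  "\<And>a b. a \<in> carrier \<Omega> ==> b \<in> carrier \<Omega> ==> \<g> (a \<ominus> b) = \<g> a \<ominus> \<g> b"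
  "\<And>a. a \<in> carrier \<Omega> ==> \<g> (\<ominus> a) = \<ominus> \<g> a"
  "\<And>a. a \<in> carrier \<Omega> ==> \<g> (a [^] (n::nat)) = \<g> a [^] n"
  "\<g> \<one> = \<one>" "\<g> \<zero> = \<zero>" "\<And>a. a \<in> F ==> \<g> a = a"
proof -
 interpret h: ring_hom_ring \<Omega> \<Omega> \<g> using assms by (rule \<G>_hom)
 show "\<And>a. a \<in> F ==> \<g> a = a" using assms by (rule gal_memD)
 show "\<And>a b. a \<in> carrier \<Omega> ==> b \<in> carrier \<Omega> ==> \<g> (a \<ominus> b) = \<g> a \<ominus> \<g> b" by (simp add: minus_eq)
 show "\<And>a. a \<in> carrier \<Omega> ==> \<g> (a [^] n) = \<g> a [^] n" by (rule h.hom_nat_pow)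
 show "\<And>a. a \<in> carrier \<Omega> ==> \<g> (\<ominus> a) = \<ominus> \<g> a" by simp
 show "\<g> \<zero> = \<zero>" by simp
qed (fact gal_memD(4-6)[OF assms])+

lemma \<G>_inv:
 assumes "\<g> \<in> carrier \<G>" "x \<in> carrier \<Omega>"
 shows "(inv\<^bsub>\<G>\<^esub> \<g>) (\<g> x) = x" "\<g> ((inv\<^bsub>\<G>\<^esub> \<g>) x) = x"
proof -
 have g: "inv\<^bsub>\<G>\<^esub> \<g> \<in> carrier \<G>" using assms by simp
 show "(inv\<^bsub>\<G>\<^esub> \<g>) (\<g> x) = x" "\<g> ((inv\<^bsub>\<G>\<^esub> \<g>) x) = x"
  using gal_mult_app[OF g assms] gal_mult_app[OF assms(1) g assms(2)] assms by (simp_all add: gal_one)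
qed

lemma \<G>_mult: "\<g> \<in> carrier \<G> ==> \<d> \<in> carrier \<G> ==> x \<in> carrier \<Omega> ==> (\<g> \<otimes>\<^bsub>\<G>\<^esub> \<d>) x = \<g> (\<d> x)"
 by (rule gal_mult_app)

definition fixgrp :: "'a set => ('a => 'a) set" where
 "fixgrp E = {\<g> \<in> carrier \<G>. \<forall>x\<in>E. \<g> x = x}"

definition invariants :: "('a => 'a) set => 'a set" where
 "invariants N = {x \<in> carrier \<Omega>. \<forall>\<g>\<in>N. \<g> x = x}"

definition stable :: "'a set => bool" where
 "stable M \<longleftrightarrow> M \<subseteq> carrier \<Omega> \<and> (\<forall>\<g>\<in>carrier \<G>. \<forall>x\<in>M. \<g> x \<in> M)"

lemma eval_automorphism:
 assumes "\<g> \<in> fixgrp E" "p \<in> carrier (E[X])" "E \<subseteq> carrier \<Omega>" "x \<in> carrier \<Omega>"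
 shows "\<g> (eval p x) = eval p (\<g> x)"
 using eval_fixed[OF \<G>_embeds, of \<g> p E x] assms by (auto simp: fixgrp_def)

lemma Irr_nonzero:
 assumes "subfield E \<Omega>" "F \<subseteq> E" "x \<in> carrier \<Omega>"
 shows "Irr E x \<noteq> []" "degree (Irr E x) \<ge> 1"
 using pirreducible_degree[OF assms(1) IrrE(1,2)[OF assms(1,3) algebraic_over[OF assms]]] by force+

lemma conjugate_exists:
 assumes E: "subfield E \<Omega>" "F \<subseteq> E" and t: "t \<in> carrier \<Omega>" "is_root (Irr E t) r"
 obtains \<g> where "\<g> \<in> fixgrp E" "\<g> t = r"
proof -
 note alg = algebraic_over[OF E t(1)]
 note irr = IrrE[OF E(1) t(1) alg]
 have idh: "(\<lambda>x. x) \<in> ring_hom (\<Omega>\<lparr>carrier := E\<rparr>) \<Omega>"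
  using subfieldE(3)[OF E(1)] by (auto intro!: ring_hom_memI)
 have r: "r \<in> carrier \<Omega>" "eval (map (\<lambda>x. x) (Irr E t)) r = \<zero>" using t(2) by (simp_all add: is_root_def)
 obtain \<psi> where \<psi>: "\<psi> \<in> ring_hom (\<Omega>\<lparr>carrier := simple_extension E t\<rparr>) \<Omega>"
  "\<And>a. a \<in> E ==> \<psi> a = a" "\<psi> t = r"
  using extend_hom_to_simple_extension[OF E(1) idh t(1) alg r] by blast
 have sub: "E \<subseteq> simple_extension E t" "t \<in> simple_extension E t"
  using simple_extension_incl[OF subfieldE(3)[OF E(1)] t(1)]
   simple_extension_mem[OF subfieldE(1)[OF E(1)] t(1)] by auto
 have "embeds (simple_extension E t) \<psi>"
  unfolding embeds_def using simple_extension_is_subfield[OF E(1) t(1)] alg \<psi>(1) sub(1) E(2) by auto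
 then obtain \<g> where g: "\<g> \<in> carrier \<G>" "\<And>a. a \<in> simple_extension E t ==> \<g> a = \<psi> a"
  by (rule embedding_extends) (use \<psi>(2) E(2) in auto)
 have "\<g> \<in> fixgrp E" using g sub(1) \<psi>(2) by (auto simp: fixgrp_def)
 moreover have "\<g> t = r" using g(2)[OF sub(2)] \<psi>(3) by simp
 ultimately show ?thesis by (rule that)
qed

lemma finite_orbit:
 assumes "x \<in> carrier \<Omega>" shows "finite ((\<lambda>\<g>. \<g> x) ` carrier \<G>)"
proof -
 note irr = IrrE[OF F_subfield assms algebraic_extension[OF assms]]
 have "(\<lambda>\<g>. \<g> x) ` carrier \<G> \<subseteq> {z. is_root (Irr F x) z}"
 proof (rule image_subsetI)
  fix \<g> assume g: "\<g> \<in> carrier \<G>"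
  hence "\<g> \<in> fixgrp F" by (simp add: fixgrp_def)
  hence "eval (Irr F x) (\<g> x) = \<g> \<zero>"
   using eval_automorphism[OF _ irr(1) F_sub assms] irr(4) by simp
  thus "\<g> x \<in> {z. is_root (Irr F x) z}"
   using g assms Irr_nonzero(1)[OF F_subfield subset_refl assms] by (simp add: is_root_def)
 qed
 thus ?thesis
  using finite_number_of_roots[OF carrier_polynomial_shell[OF subfieldE(1)[OF F_subfield] irr(1)]]
  by (rule finite_subset)
qed

lemma count_le_1_of_size_le:
 assumes "size M \<le> card (set_mset M)" shows "count M a \<le> 1"
proof (rule ccontr)
 assume a: "\<not> count M a \<le> 1"
 hence "a \<in># M" by (metis count_inI le0)
 have "card (set_mset M) = (\<Sum>x\<in>set_mset M. 1)" by simp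
 also have "\<dots> < (\<Sum>x\<in>set_mset M. count M x)"
  by (rule sum_strict_mono_ex1) (use a \<open>a \<in># M\<close> in \<open>auto intro!: bexI[of _ a] simp: Suc_le_eq\<close>)
 also have "\<dots> = size M" by (simp add: size_multiset_overloaded_eq)
 finally show False using assms by simp
qed

text \<open>
 Separability of \<open>t\<close> over \<open>E\<close>, witnessed by any polynomial over \<open>E\<close>
 with as many distinct roots as its degree. No minimal polynomial has to be computed to establish it.
\<close>

definition separable_root :: "'a set => 'a => bool" where
 "separable_root E t \<longleftrightarrow> t \<in> carrier \<Omega> \<and>
  (\<exists>f \<in> carrier (E[X]). f \<noteq> [] \<and> eval f t = \<zero> \<and> degree f \<le> card {z. is_root f z})"

text \<open>
 Write \<open>z\<close> as a polynomial in \<open>t\<close> of degree less than that of the minimal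
 polynomial \<open>q\<close> of \<open>t\<close>. Every root of \<open>q\<close> is a conjugate of
 \<open>t\<close> over \<open>E\<close>, so this polynomial takes the value \<open>z\<close> at all
 \<open>degree q\<close> distinct roots of \<open>q\<close>, and therefore is constant.
\<close>

lemma fixed_in_simple_extension:
 assumes E: "subfield E \<Omega>" "F \<subseteq> E" and t: "separable_root E t"
  and z: "z \<in> simple_extension E t" and fixed: "\<And>\<g>. \<g> \<in> fixgrp E ==> \<g> z = z"
 shows "z \<in> E"
proof -
 obtain f where f: "f \<in> carrier (E[X])" "f \<noteq> []" "eval f t = \<zero>" "degree f \<le> card {z. is_root f z}"
  and tc: "t \<in> carrier \<Omega>"
  using t by (auto simp: separable_root_def)
 note alg = algebraic_over[OF E tc]
 define q where "q = Irr E t"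
 have irr: "q \<in> carrier (E[X])" "eval q t = \<zero>" "q \<noteq> []" "degree q \<ge> 1"
  using IrrE[OF E(1) tc alg] Irr_nonzero[OF E tc] by (simp_all add: q_def)
 have Ec: "E \<subseteq> carrier \<Omega>" using subfieldE(3)[OF E(1)] .
 note sub = subfieldE(1)[OF E(1)]
 have fc: "f \<in> carrier (poly_ring \<Omega>)" "q \<in> carrier (poly_ring \<Omega>)"
  using carrier_polynomial_shell[OF sub] f(1) irr(1) by blast+
 have "q pdivides f" unfolding q_def by (rule Irr_minimal[OF E(1) tc alg f(1,3)])
 hence incl: "roots q \<subseteq># roots f" by (rule pdivides_imp_roots_incl[OF fc(2,1) f(2)])
 have "set_mset (roots f) = {z. is_root f z}" using roots_mem_iff_is_root[OF fc(1)] by auto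
 hence "size (roots f) \<le> card (set_mset (roots f))" using size_roots_le_degree[OF fc(1)] f(4) by simp
 hence "count (roots q) a \<le> 1" for a
  using count_le_1_of_size_le[of "roots f" a] incl mset_subset_eq_count[of "roots q" "roots f" a] by linarith
 hence "roots q = mset_set (set_mset (roots q))"
  by (intro multiset_eqI) (metis count_eq_zero_iff count_mset_set(1,3) finite_set_mset le_antisym less_one linorder_not_le)
 hence "size (roots q) = card (set_mset (roots q))" by (metis size_mset_set)
 moreover have "size (roots q) = degree q" using roots_over_carrier[OF fc(2)] by (simp add: splitted_def)
 ultimately have cardq: "card (set_mset (roots q)) = degree q" by simp
 obtain g where g: "g \<in> carrier (E[X])" "z = eval g t"
  using z simple_extension_as_eval_img[OF Ec tc] by auto
 define h where "h = pmod g q"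
 have h: "h \<in> carrier (E[X])" unfolding h_def by (rule long_division_closed(2)[OF E(1) g(1) irr(1)])
 have hdeg: "h = [] \<or> degree h < degree q" unfolding h_def by (rule pmod_degree[OF E(1) g(1) irr(1,3)])
 interpret UP: domain "E[X]" by (rule univ_poly_is_domain[OF sub])
 interpret UPc: domain "poly_ring \<Omega>" by (rule univ_poly_is_domain[OF carrier_is_subring])
 have ev: "(\<lambda>p. eval p t) \<in> ring_hom (E[X]) \<Omega>" by (rule eval_is_hom[OF sub tc])
 have zh: "z = eval h t"
 proof -
  have pd: "pdiv g q \<in> carrier (E[X])" by (rule long_division_closed(1)[OF E(1) g(1) irr(1)])
  have "z = eval (q \<otimes>\<^bsub>E[X]\<^esub> (pdiv g q) \<oplus>\<^bsub>E[X]\<^esub> h) t"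
   using pdiv_pmod[OF E(1) g(1) irr(1)] g(2) by (simp add: h_def)
  also have "\<dots> = eval q t \<otimes> eval (pdiv g q) t \<oplus> eval h t"
   using ring_hom_add[OF ev UP.m_closed[OF irr(1) pd] h] ring_hom_mult[OF ev irr(1) pd] by simp
  finally show ?thesis
   using irr(2) ring_hom_closed[OF ev pd] ring_hom_closed[OF ev h] by simp
 qed
 have zc: "z \<in> carrier \<Omega>" unfolding zh by (rule ring_hom_closed[OF ev h])
 have hE: "set h \<subseteq> E" using h polynomial_incl unfolding univ_poly_def by auto
 show "z \<in> E"
 proof (cases "length h \<le> 1")
  case True
  show ?thesis
  proof (cases h)
   case Nil thus ?thesis using zh subfield_one_zero[OF E(1)] by simp
  next
   case (Cons a h') thus ?thesis using True zh hE Ec by auto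
  qed
 next
  case False
  show ?thesis
  proof (rule ccontr)
   assume nE: "z \<notin> E"
   hence z0: "z \<noteq> \<zero>" using subfield_one_zero[OF E(1)] by auto
   have hc: "h \<in> carrier (poly_ring \<Omega>)" by (rule carrier_polynomial_shell[OF sub h])
   have zp: "[\<ominus> z] \<in> carrier (poly_ring \<Omega>)"
    unfolding univ_poly_carrier[symmetric] polynomial_def using zc z0 by simp
   define w where "w = h \<oplus>\<^bsub>poly_ring \<Omega>\<^esub> [\<ominus> z]"
   have w: "w \<in> carrier (poly_ring \<Omega>)" unfolding w_def using hc zp by (rule UPc.a_closed)
   have "length w = length h"
    unfolding w_def univ_poly_add using poly_add_length_eq[OF carrier_is_subring, of h "[\<ominus> z]"] hc zp False
    by (simp add: univ_poly_carrier del: poly_add.simps)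
   hence wdeg: "w \<noteq> []" "degree w < degree q" using hdeg False by auto
   have "is_root w r" if r: "r \<in># roots q" for r
   proof -
    have rr: "is_root q r" using r roots_mem_iff_is_root[OF fc(2)] by simp
    obtain \<g> where \<g>: "\<g> \<in> fixgrp E" "\<g> t = r"
     using conjugate_exists[OF E tc] rr unfolding q_def by blast
    have rc: "r \<in> carrier \<Omega>" using rr by (simp add: is_root_def)
    have "eval h r = z" using eval_automorphism[OF \<g>(1) h Ec tc] \<g>(2) fixed[OF \<g>(1)] zh by simp
    moreover have "eval w r = eval h r \<oplus> eval [\<ominus> z] r"
     unfolding w_def by (rule ring_hom_add[OF eval_is_hom[OF carrier_is_subring rc] hc zp])
    ultimately show ?thesis using zc rc wdeg(1) by (simp add: is_root_def r_neg)
   qed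
   hence "set_mset (roots q) \<subseteq> set_mset (roots w)" using roots_mem_iff_is_root[OF w] by auto
   hence "degree q \<le> card (set_mset (roots w))" using cardq card_mono[OF finite_set_mset] by metis
   also have "\<dots> \<le> size (roots w)" by (metis card_eq_sum order_refl size_multiset_overloaded_eq count_greater_eq_one_iff sum_mono)
   also have "\<dots> \<le> degree w" by (rule size_roots_le_degree[OF w])
   finally show False using wdeg(2) by simp
  qed
 qed
qed

end

section \<open>Galois subextensions and normal subgroups\<close>

context galois_setting
begin

interpretation \<G>: group \<G> by (rule \<G>_group)

lemma galois_extension_subfield:
 assumes "galois_extension \<Omega> F L" shows "subfield L \<Omega>" "F \<subseteq> L" "L \<subseteq> carrier \<Omega>"
 using assms subfieldE(3)[of L \<Omega>] by (auto simp: galois_extension_def)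

text \<open>
 Split off one root after the other: a polynomial that splits over \<open>E\<close> has no roots outside
 \<open>E\<close>.
\<close>

lemma root_in_splitting_subfield:
 assumes E: "subfield E \<Omega>" and q: "q \<in> carrier (E[X])" "q \<noteq> []" and spl: "ring.splitted (\<Omega>\<lparr>carrier := E\<rparr>) q"
  and y: "y \<in> carrier \<Omega>" "eval q y = \<zero>"
 shows "y \<in> E"
 using q spl y
proof (induction "degree q" arbitrary: q)
 case 0
 hence "\<not> is_root q y"
  using degree_zero_imp_not_is_root[OF carrier_polynomial_shell[OF subfieldE(1)[OF E]]] by metis
 thus ?case using 0 by (simp add: is_root_def)
next
 case (Suc n)
 note sub = subfieldE(1)[OF E]
 have Ec: "E \<subseteq> carrier \<Omega>" using subfieldE(3)[OF E] .
 interpret RE: field "\<Omega>\<lparr>carrier := E\<rparr>" using E by (rule subfield_iff(2))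
 interpret UP: domain "E[X]" by (rule univ_poly_is_domain[OF sub])
 have up: "E[X]\<^bsub>\<Omega>\<lparr>carrier := E\<rparr>\<^esub> = E[X]" by (simp add: univ_poly_consistent[OF sub])
 have qE: "q \<in> carrier (poly_ring (\<Omega>\<lparr>carrier := E\<rparr>))" using Suc.prems(1) up by simp
 have "RE.roots q \<noteq> {#}" using Suc.prems(3) Suc.hyps(2) unfolding RE.splitted_def by (metis nat.distinct(1) size_empty)
 then obtain a where a: "a \<in> E" and lin: "[\<one>, \<ominus>\<^bsub>\<Omega>\<lparr>carrier := E\<rparr>\<^esub> a] \<in> carrier (poly_ring (\<Omega>\<lparr>carrier := E\<rparr>))"
  and "[\<one>, \<ominus>\<^bsub>\<Omega>\<lparr>carrier := E\<rparr>\<^esub> a] pdivides\<^bsub>\<Omega>\<lparr>carrier := E\<rparr>\<^esub> q"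
  using RE.not_empty_rootsE[OF qE] by auto
 then obtain s where s: "s \<in> carrier (E[X])" "q = [\<one>, \<ominus>\<^bsub>\<Omega>\<lparr>carrier := E\<rparr>\<^esub> a] \<otimes>\<^bsub>E[X]\<^esub> s"
  unfolding pdivides_def factor_def using up by auto
 have inv: "\<ominus>\<^bsub>\<Omega>\<lparr>carrier := E\<rparr>\<^esub> a = \<ominus> a"
  using RE.minus_equality[of "\<ominus> a" a] a subringE(5)[OF sub a] subsetD[OF Ec a] l_neg by auto
 have lin': "[\<one>, \<ominus> a] \<in> carrier (E[X])" using lin up inv by simp
 have ac: "a \<in> carrier \<Omega>" using a Ec by auto
 have sne: "s \<noteq> []" using Suc.prems(2) s lin' UP.r_null unfolding inv by (auto simp: univ_poly_zero)
 have "RE.roots q = add_mset a (RE.roots s)"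
  using RE.poly_mult_degree_one_monic_imp_same_roots[of a s] a s sne up by simp
 moreover have "degree q = Suc (degree s)"
 proof -
  have "degree (poly_mult [\<one>, \<ominus> a] s) = degree [\<one>, \<ominus> a] + degree s"
   using poly_mult_degree_eq[OF sub, of "[\<one>, \<ominus> a]" s] s(1) sne lin' by (simp add: univ_poly_carrier)
  thus ?thesis using s(2) unfolding inv univ_poly_mult by simp
 qed
 ultimately have spl: "RE.splitted s" "n = degree s"
  using Suc.prems(3) Suc.hyps(2) by (simp_all add: RE.splitted_def)
 have ev: "(\<lambda>p. eval p y) \<in> ring_hom (E[X]) \<Omega>" by (rule eval_is_hom[OF sub Suc.prems(4)])
 have "eval [\<one>, \<ominus> a] y \<otimes> eval s y = \<zero>"
  using ring_hom_mult[OF ev lin' s(1)] Suc.prems(5) s(2) unfolding inv by simp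
 hence "eval [\<one>, \<ominus> a] y = \<zero> \<or> eval s y = \<zero>"
  using integral ring_hom_closed[OF ev lin'] ring_hom_closed[OF ev s(1)] by blast
 thus ?case
 proof
  assume "eval [\<one>, \<ominus> a] y = \<zero>"
  hence "y \<oplus> \<ominus> a = \<zero>" using Suc.prems(4) ac by simp
  hence "y = a" using Suc.prems(4) ac by (metis minus_equality minus_minus add.inv_closed)
  thus ?thesis using a by simp
 next
  assume "eval s y = \<zero>"
  thus ?thesis using Suc.hyps(1)[OF spl(2) s(1) sne spl(1) Suc.prems(4)] by simp
 qed
qed

lemma galois_extension_stable:
 assumes L: "galois_extension \<Omega> F L" shows "stable L"
 unfolding stable_def
proof (intro conjI ballI)
 note Ls = galois_extension_subfield[OF L]
 show "L \<subseteq> carrier \<Omega>" by (rule Ls)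
 fix \<g> x assume g: "\<g> \<in> carrier \<G>" and x: "x \<in> L"
 have xc: "x \<in> carrier \<Omega>" using subsetD[OF Ls(3) x] .
 note irr = IrrE[OF F_subfield xc algebraic_extension[OF xc]]
 have "carrier (F[X]) \<subseteq> carrier (L[X])" using Ls(2) unfolding univ_poly_def polynomial_def by auto
 hence "Irr F x \<in> carrier (L[X])" using irr(1) by auto
 moreover have "eval (Irr F x) (\<g> x) = \<zero>"
  using eval_automorphism[of \<g> F, OF _ irr(1) F_sub xc] irr(4) g by (simp add: fixgrp_def)
 moreover have "ring.splitted (\<Omega>\<lparr>carrier := L\<rparr>) (Irr F x)" using L x by (auto simp: galois_extension_def)
 ultimately show "\<g> x \<in> L"
  using root_in_splitting_subfield[OF Ls(1)] Irr_nonzero(1)[OF F_subfield subset_refl xc] g xc by simp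
qed

lemma galois_extension_separable:
 assumes L: "galois_extension \<Omega> F L" and E: "F \<subseteq> E" and x: "x \<in> L"
 shows "separable_root E x"
proof -
 have xc: "x \<in> carrier \<Omega>" using x galois_extension_subfield(3)[OF L] by auto
 note irr = IrrE[OF F_subfield xc algebraic_extension[OF xc]]
 have pc: "Irr F x \<in> carrier (poly_ring \<Omega>)"
  using carrier_polynomial_shell[OF subfieldE(1)[OF F_subfield] irr(1)] .
 have cnt: "count (roots (Irr F x)) a \<le> 1" for a using L x by (auto simp: galois_extension_def)
 have "size (roots (Irr F x)) = (\<Sum>a\<in>set_mset (roots (Irr F x)). count (roots (Irr F x)) a)"
  by (simp add: size_multiset_overloaded_eq)
 also have "\<dots> \<le> (\<Sum>a\<in>set_mset (roots (Irr F x)). 1)" by (rule sum_mono) (rule cnt)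
 finally have "size (roots (Irr F x)) \<le> card (set_mset (roots (Irr F x)))" by simp
 moreover have "size (roots (Irr F x)) = degree (Irr F x)" using roots_over_carrier[OF pc] by (simp add: splitted_def)
 moreover have "set_mset (roots (Irr F x)) = {z. is_root (Irr F x) z}" using roots_mem_iff_is_root[OF pc] by auto
 moreover have "Irr F x \<in> carrier (E[X])" using irr(1) E unfolding univ_poly_def polynomial_def by auto
 ultimately show ?thesis
  unfolding separable_root_def using xc irr(4) Irr_nonzero(1)[OF F_subfield subset_refl xc]
  by (intro conjI bexI[of _ "Irr F x"]) auto
qed

lemma fixed_in_galois_extension:
 assumes L: "galois_extension \<Omega> F L" and E: "subfield E \<Omega>" "F \<subseteq> E" and x: "x \<in> L"
  and fixed: "\<And>\<g>. \<g> \<in> fixgrp E ==> \<g> x = x"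
 shows "x \<in> E"
proof (rule fixed_in_simple_extension[OF E galois_extension_separable[OF L E(2) x]])
 show "x \<in> simple_extension E x"
  using simple_extension_mem[OF subfieldE(1)[OF E(1)]] subsetD[OF galois_extension_subfield(3)[OF L] x] by blast
qed (rule fixed)

lemma galois_extension_le:
 assumes L: "galois_extension \<Omega> F L" and E: "galois_extension \<Omega> F E" and sub: "fixgrp E \<subseteq> fixgrp L"
 shows "L \<subseteq> E"
 using fixed_in_galois_extension[OF L galois_extension_subfield(1,2)[OF E]] sub by (auto simp: fixgrp_def)

text \<open>
 A Galois extension is recovered from the automorphisms that fix it. This is how fields are identified when
 they are counted through kernels of homomorphisms.
\<close>

lemma galois_extension_unique:
 assumes "galois_extension \<Omega> F L" "galois_extension \<Omega> F L'" "fixgrp L = fixgrp L'"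
 shows "L = L'"
 using galois_extension_le[OF assms(1,2)] galois_extension_le[OF assms(2,1)] assms(3) by auto

text \<open>
 The conjugates of an element of \<open>M\<close> form a finite set inside \<open>M\<close>. The polynomial
 with exactly these simple roots is invariant under \<open>\<G>\<close>, hence has coefficients in
 \<open>F\<close>, and the minimal polynomial divides it.
\<close>

lemma galois_extensionI:
 assumes M: "subfield M \<Omega>" "F \<subseteq> M" "stable M"
  and fixed: "\<And>x. x \<in> M ==> (\<And>\<g>. \<g> \<in> carrier \<G> ==> \<g> x = x) ==> x \<in> F"
 shows "galois_extension \<Omega> F M"
 unfolding galois_extension_def
proof (intro conjI ballI allI)
 show "subfield F \<Omega>" "subfield M \<Omega>" "F \<subseteq> M" by (fact F_subfield M)+
 fix x assume x: "x \<in> M"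
 have Mc: "M \<subseteq> carrier \<Omega>" using M(3) by (simp add: stable_def)
 have xc: "x \<in> carrier \<Omega>" using x Mc by auto
 show "(algebraic F) x" using algebraic_extension[OF xc] by (simp add: over_def)
 note irr = IrrE[OF F_subfield xc algebraic_extension[OF xc]]
 note subF = subfieldE(1)[OF F_subfield] and subM = subfieldE(1)[OF M(1)]
 define S where "S = (\<lambda>\<g>. \<g> x) ` carrier \<G>"
 have S: "finite S" "S \<subseteq> M" "S \<subseteq> carrier \<Omega>"
  using finite_orbit[OF xc] M(3) x Mc by (auto simp: S_def stable_def)
 have "\<one>\<^bsub>\<G>\<^esub> x \<in> S" unfolding S_def by (rule imageI) simp
 hence xS: "x \<in> S" using xc by (simp add: gal_one)
 interpret RM: field "\<Omega>\<lparr>carrier := M\<rparr>" using M(1) by (rule subfield_iff(2))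
 interpret UPF: domain "F[X]" by (rule univ_poly_is_domain[OF subF])
 define P where "P = root_poly S"
 have PM: "RM.root_poly S = P" unfolding P_def by (rule root_poly_consistent[OF M(1) S(1,2)])
 note Pp = root_poly_props[OF S(1,3), folded P_def]
 note PpM = RM.root_poly_props[OF S(1), unfolded PM]
 have upM: "M[X]\<^bsub>\<Omega>\<lparr>carrier := M\<rparr>\<^esub> = M[X]" by (simp add: univ_poly_consistent[OF subM])
 have PMc: "P \<in> carrier (M[X])" using PpM(1) S(2) upM by simp
 have setP: "set P \<subseteq> M" using PMc polynomial_incl unfolding univ_poly_def by auto
 have "set P \<subseteq> F"
 proof
  fix c assume c: "c \<in> set P"
  show "c \<in> F"
  proof (rule fixed)
   show "c \<in> M" using c setP by auto
   fix \<g> assume g: "\<g> \<in> carrier \<G>"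
   have "\<g> ` S = S"
   proof (rule endo_inj_surj[OF S(1)])
    show "\<g> ` S \<subseteq> S"
    proof (rule image_subsetI)
     fix s assume "s \<in> S"
     then obtain \<d> where d: "\<d> \<in> carrier \<G>" "s = \<d> x" by (auto simp: S_def)
     hence "\<g> s = (\<g> \<otimes>\<^bsub>\<G>\<^esub> \<d>) x" using g xc by (simp add: \<G>_mult)
     thus "\<g> s \<in> S" unfolding S_def using g d by auto
    qed
    show "inj_on \<g> S" using inj_on_subset[OF \<G>_inj[OF g] S(3)] .
   qed
   hence "map \<g> P = P"
    using root_poly_map_automorphism[OF \<G>_hom[OF g] \<G>_inj[OF g] S(1,3)] by (simp add: P_def)
   thus "\<g> c = c" using c by (metis map_eq_conv map_idI list.map_ident)
  qed
 qed
 hence PF: "P \<in> carrier (F[X])"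
  using Pp(1) unfolding univ_poly_carrier[symmetric] polynomial_def by auto
 have "x \<in># roots P" using Pp(3) S(1) xS by simp
 hence Px: "eval P x = \<zero>" using roots_mem_iff_is_root[OF Pp(1)] by (simp add: is_root_def)
 have div: "Irr F x pdivides P" by (rule Irr_minimal[OF F_subfield xc algebraic_extension[OF xc] PF Px])
 have irrc: "Irr F x \<in> carrier (poly_ring \<Omega>)" by (rule carrier_polynomial_shell[OF subF irr(1)])
 show "count (roots (Irr F x)) a \<le> 1" for a
 proof -
  have "count (roots (Irr F x)) a \<le> count (roots P) a"
   by (rule mset_subset_eq_count[OF pdivides_imp_roots_incl[OF irrc Pp(1,2) div]])
  also have "\<dots> \<le> 1" unfolding Pp(3) by (simp add: count_mset_set')
  finally show ?thesis .
 qed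
 have FM: "carrier (F[X]) \<subseteq> carrier (M[X])" using M(2) unfolding univ_poly_def polynomial_def by auto
 obtain s where "s \<in> carrier (F[X])" "P = Irr F x \<otimes>\<^bsub>F[X]\<^esub> s"
  using div pdivides_iff_shell[OF F_subfield irr(1) PF] unfolding factor_def by auto
 hence "Irr F x pdivides\<^bsub>\<Omega>\<lparr>carrier := M\<rparr>\<^esub> P"
  unfolding pdivides_def factor_def using FM upM by (auto simp: univ_poly_mult)
 moreover have "RM.splitted P" using PpM S(2) by (simp add: RM.splitted_def)
 moreover have "Irr F x \<in> carrier (M[X])" using irr(1) FM by auto
 ultimately show "RM.splitted (Irr F x)"
  using RM.pdivides_imp_splitted[of "Irr F x" P] PMc Pp(2) upM by simp
qed

lemma restrict_gal:
 assumes "stable L" "subfield L \<Omega>" "F \<subseteq> L" "\<g> \<in> carrier \<G>"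
 shows "restrict \<g> L \<in> carrier (galois_group \<Omega> F L)"
proof (rule gal_memI)
 have cl: "\<d> x \<in> L" if "\<d> \<in> carrier \<G>" "x \<in> L" for \<d> x using that assms(1) by (simp add: stable_def)
 have Lc: "L \<subseteq> carrier \<Omega>" using assms(1) by (simp add: stable_def)
 have xc: "x \<in> carrier \<Omega>" if "x \<in> L" for x using subsetD[OF Lc that] .
 have "bij_betw \<g> L L"
  by (rule bij_betwI[where g="inv\<^bsub>\<G>\<^esub> \<g>"]) (use cl assms(4) \<G>_inv[OF assms(4)] xc in auto)
 thus "bij_betw (restrict \<g> L) L L" using bij_betw_cong[of L "restrict \<g> L" \<g>] by simp
 have cl2: "a \<oplus> b \<in> L" "a \<otimes> b \<in> L" if "a \<in> L" "b \<in> L" for a b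
  using subringE(6,7)[OF subfieldE(1)[OF assms(2)]] that by blast+
 show "restrict \<g> L (a \<oplus> b) = restrict \<g> L a \<oplus> restrict \<g> L b"
  "restrict \<g> L (a \<otimes> b) = restrict \<g> L a \<otimes> restrict \<g> L b" if "a \<in> L" "b \<in> L" for a b
  using that cl2 Lc assms(4) by (auto simp: subset_iff)
 show "restrict \<g> L \<one> = \<one>" using subfield_one_zero[OF assms(2)] assms(4) by simp
 show "restrict \<g> L a = a" if "a \<in> F" for a using that assms(3,4) by auto
qed simp

lemma restrict_gal_surj:
 assumes "subfield L \<Omega>" "F \<subseteq> L" "\<phi> \<in> carrier (galois_group \<Omega> F L)"
 obtains \<g> where "\<g> \<in> carrier \<G>" "restrict \<g> L = \<phi>"
proof -
 note D = gal_memD[OF assms(3)]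
 have Lc: "L \<subseteq> carrier \<Omega>" using subfieldE(3)[OF assms(1)] .
 have "\<phi> a \<in> carrier \<Omega>" if "a \<in> L" for a using subsetD[OF Lc D(3)[OF that]] .
 hence "embeds L \<phi>" unfolding embeds_def using assms(1,2) D by (auto intro!: ring_hom_memI)
 then obtain \<g> where "\<g> \<in> carrier \<G>" "\<And>a. a \<in> L ==> \<g> a = \<phi> a"
  by (rule embedding_extends) (use D(7) in auto)
 moreover from this D(1) have "restrict \<g> L = \<phi>" by (auto simp: extensional_def restrict_def)
 ultimately show ?thesis by (intro that)
qed

lemma restrict_gal_mult:
 assumes "stable L" "subfield L \<Omega>" "F \<subseteq> L" "\<g> \<in> carrier \<G>" "\<d> \<in> carrier \<G>"
 shows "restrict (\<g> \<otimes>\<^bsub>\<G>\<^esub> \<d>) L = restrict \<g> L \<otimes>\<^bsub>galois_group \<Omega> F L\<^esub> restrict \<d> L"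
 using assms restrict_gal[OF assms(1-3)]
 by (auto simp: gal_mult compose_def stable_def fun_eq_iff restrict_def subset_iff \<G>_mult)

lemma finsum_automorphism:
 assumes "\<g> \<in> carrier \<G>" "finite A" "\<And>i. i \<in> A ==> f i \<in> carrier \<Omega>"
 shows "\<g> (\<Oplus>i\<in>A. f i) = (\<Oplus>i\<in>A. \<g> (f i))"
 using assms(2,3)
proof (induction A rule: finite_induct)
 case empty thus ?case using assms(1) by simp
next
 case (insert a A)
 have "\<g> (f a \<oplus> (\<Oplus>i\<in>A. f i)) = \<g> (f a) \<oplus> \<g> (\<Oplus>i\<in>A. f i)"
  using insert.prems assms(1) by (intro \<G>_simps(1)) auto
 thus ?case using insert assms(1) by (simp add: finsum_insert Pi_def)
qed

text \<open>
 Artin's argument. If \<open>\<g>\<close> agreed on \<open>M\<close> with no element of \<open>N\<close>,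
 the restrictions of \<open>N\<close> and those of \<open>\<g>N\<close> would be distinct characters of
 \<open>M\<close>. For every \<open>x\<close> the sum over \<open>N\<close> of the conjugates of
 \<open>x\<close> is \<open>N\<close>-invariant, hence fixed by \<open>\<g>\<close>; this is a linear
 relation between those characters.
\<close>

lemma artin_closure:
 assumes N: "subgroup N \<G>" and M: "subfield M \<Omega>" "stable M"
  and fin: "finite ((\<lambda>\<g>. restrict \<g> M) ` N)"
  and g: "\<g> \<in> carrier \<G>" and fix_inv: "\<And>x. x \<in> M ==> x \<in> invariants N ==> \<g> x = x"
 shows "\<exists>\<d>\<in>N. \<forall>x\<in>M. \<d> x = \<g> x"
proof (rule ccontr)
 assume no: "\<not> (\<exists>\<d>\<in>N. \<forall>x\<in>M. \<d> x = \<g> x)"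
 have Nc: "N \<subseteq> carrier \<G>" using N by (rule subgroup.subset)
 have Mc: "M \<subseteq> carrier \<Omega>" using M(2) by (simp add: stable_def)
 have cl: "\<d> x \<in> M" if "\<d> \<in> carrier \<G>" "x \<in> M" for \<d> x using that M(2) by (simp add: stable_def)
 define H where "H = (\<lambda>\<g>. restrict \<g> M) ` N"
 define tw where "tw = (\<lambda>\<d>::'a => 'a. \<lambda>h::'a => 'a. restrict (\<lambda>x. \<d> (h x)) M)"
 have H: "finite H" using fin by (simp add: H_def)
 have Hel: "\<exists>\<d>\<in>N. h = restrict \<d> M" if "h \<in> H" for h using that by (auto simp: H_def)
 have tw_inj: "inj_on (tw \<d>) H" if d: "\<d> \<in> carrier \<G>" for \<d>
 proof (rule inj_onI)
  fix h h' assume h: "h \<in> H" "h' \<in> H" and eq: "tw \<d> h = tw \<d> h'"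
  obtain \<d>1 \<d>2 where dd: "\<d>1 \<in> N" "h = restrict \<d>1 M" "\<d>2 \<in> N" "h' = restrict \<d>2 M"
   using Hel[OF h(1)] Hel[OF h(2)] by blast
  have "\<d>1 x = \<d>2 x" if x: "x \<in> M" for x
  proof (rule inj_onD[OF \<G>_inj[OF d]])
   show "\<d> (\<d>1 x) = \<d> (\<d>2 x)" using fun_cong[OF eq, of x] dd x by (simp add: tw_def)
   show "\<d>1 x \<in> carrier \<Omega>" "\<d>2 x \<in> carrier \<Omega>"
    using subsetD[OF Nc dd(1)] subsetD[OF Nc dd(3)] subsetD[OF Mc x] by simp_all
  qed
  thus "h = h'" using dd by (auto simp: restrict_def)
 qed
 have tw_N: "tw \<d> ` H = H" if d: "\<d> \<in> N" for \<d>
 proof (rule endo_inj_surj[OF H _ tw_inj])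
  show "tw \<d> ` H \<subseteq> H"
  proof (rule image_subsetI)
   fix h assume "h \<in> H"
   then obtain \<d>1 where d1: "\<d>1 \<in> N" "h = restrict \<d>1 M" using Hel by blast
   have "tw \<d> h = restrict (\<d> \<otimes>\<^bsub>\<G>\<^esub> \<d>1) M"
    using d d1 Nc Mc by (auto simp: tw_def restrict_def fun_eq_iff \<G>_mult subset_iff)
   thus "tw \<d> h \<in> H" unfolding H_def using subgroup.m_closed[OF N d d1(1)] by simp
  qed
  show "\<d> \<in> carrier \<G>" using d Nc by auto
 qed
 have disj: "H \<inter> tw \<g> ` H = {}"
 proof (rule ccontr)
  assume "H \<inter> tw \<g> ` H \<noteq> {}"
  then obtain \<d>1 \<d>2 where dd: "\<d>1 \<in> N" "\<d>2 \<in> N" and eq: "restrict \<d>1 M = tw \<g> (restrict \<d>2 M)"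
   unfolding H_def by blast
  have ddc: "\<d>1 \<in> carrier \<G>" "\<d>2 \<in> carrier \<G>" using dd Nc by auto
  have "(\<d>1 \<otimes>\<^bsub>\<G>\<^esub> inv\<^bsub>\<G>\<^esub> \<d>2) y = \<g> y" if y: "y \<in> M" for y
  proof -
   have x: "(inv\<^bsub>\<G>\<^esub> \<d>2) y \<in> M" using cl[OF _ y] ddc by simp
   have yc: "y \<in> carrier \<Omega>" using y Mc by auto
   have "\<d>1 ((inv\<^bsub>\<G>\<^esub> \<d>2) y) = \<g> (\<d>2 ((inv\<^bsub>\<G>\<^esub> \<d>2) y))"
    using fun_cong[OF eq, of "(inv\<^bsub>\<G>\<^esub> \<d>2) y"] x by (simp add: tw_def)
   thus ?thesis using \<G>_inv(2)[OF ddc(2) yc] ddc yc by (simp add: \<G>_mult)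
  qed
  moreover have "\<d>1 \<otimes>\<^bsub>\<G>\<^esub> inv\<^bsub>\<G>\<^esub> \<d>2 \<in> N"
   using subgroup.m_closed[OF N dd(1)] subgroup.m_inv_closed[OF N dd(2)] by blast
  ultimately show False using no by blast
 qed
 define c where "c = (\<lambda>h. if h \<in> H then \<one> else \<ominus> \<one>)"
 have val: "h x \<in> M" "h x \<in> carrier \<Omega>" if "h \<in> H \<union> tw \<g> ` H" "x \<in> M" for h x
 proof -
  have "h x \<in> M" using that cl g Nc by (auto simp: H_def tw_def)
  thus "h x \<in> M" "h x \<in> carrier \<Omega>" using Mc by auto
 qed
 have "\<one>\<^bsub>\<G>\<^esub> \<in> N" using subgroup.one_closed[OF N] .
 hence k: "restrict \<one>\<^bsub>\<G>\<^esub> M \<in> H" by (auto simp: H_def)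
 have "c (restrict \<one>\<^bsub>\<G>\<^esub> M) = \<zero>"
 proof (rule independence_of_characters[where I="H \<union> tw \<g> ` H" and M=M and f="\<lambda>h. h" and c=c])
  show "finite (H \<union> tw \<g> ` H)" using H by simp
  show "x \<otimes> y \<in> M" if "x \<in> M" "y \<in> M" for x y using subringE(6)[OF subfieldE(1)[OF M(1)]] that by blast
  thus "h (x \<otimes> y) = h x \<otimes> h y" if "h \<in> H \<union> tw \<g> ` H" "x \<in> M" "y \<in> M" for h x y
   using that g Nc Mc cl by (auto simp: H_def tw_def subset_iff)
  show "\<one> \<in> M" using subfield_one_zero[OF M(1)] by blast
  thus "h \<one> = \<one>" if "h \<in> H \<union> tw \<g> ` H" for h
   using that g Nc by (auto simp: H_def tw_def subset_iff)
  show "\<exists>x\<in>M. h x \<noteq> h' x" if "h \<in> H \<union> tw \<g> ` H" "h' \<in> H \<union> tw \<g> ` H" "h \<noteq> h'" for h h'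
  proof (rule ccontr)
   assume "\<not> (\<exists>x\<in>M. h x \<noteq> h' x)"
   moreover have "h \<in> extensional M" "h' \<in> extensional M" using that by (auto simp: H_def tw_def)
   ultimately have "h = h'" by (intro extensionalityI) auto
   thus False using that(3) by simp
  qed
  show "h x \<in> carrier \<Omega>" if "h \<in> H \<union> tw \<g> ` H" "x \<in> M" for h x using val that by blast
  show "c h \<in> carrier \<Omega>" if "h \<in> H \<union> tw \<g> ` H" for h by (simp add: c_def)
  show "restrict \<one>\<^bsub>\<G>\<^esub> M \<in> H \<union> tw \<g> ` H" using k by simp
  fix x assume x: "x \<in> M"
  define u where "u = (\<Oplus>h\<in>H. h x)"
  have hx: "h x \<in> carrier \<Omega>" if "h \<in> H" for h using val that x by blast
  have uc: "u \<in> carrier \<Omega>" unfolding u_def using hx by (intro finsum_closed) auto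
  have shift: "\<d> u = (\<Oplus>h\<in>tw \<d> ` H. h x)" if d: "\<d> \<in> carrier \<G>" for \<d>
  proof -
   have "\<d> u = (\<Oplus>h\<in>H. \<d> (h x))" unfolding u_def by (rule finsum_automorphism[OF d H hx])
   also have "\<dots> = (\<Oplus>h\<in>H. tw \<d> h x)" using x by (simp add: tw_def)
   also have "\<dots> = (\<Oplus>h\<in>tw \<d> ` H. h x)"
    by (rule add.finprod_reindex[symmetric, OF _ tw_inj[OF d]]) (use x hx d in \<open>auto simp: tw_def\<close>)
   finally show ?thesis .
  qed
  have "u \<in> M"
  proof -
   have "(\<Oplus>h\<in>A. h x) \<in> M" if "finite A" "A \<subseteq> H" for A using that
   proof (induction A rule: finite_induct)
    case empty thus ?case using subfield_one_zero[OF M(1)] by simp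
   next
    case (insert h A)
    thus ?case using hx val(1)[OF _ x] subringE(7)[OF subfieldE(1)[OF M(1)]]
     by (subst finsum_insert) (auto simp: subset_iff)
   qed
   thus ?thesis unfolding u_def using H by blast
  qed
  moreover have "\<d> u = u" if "\<d> \<in> N" for \<d>
   using shift[of \<d>] tw_N[OF that] that Nc by (auto simp: u_def)
  hence "u \<in> invariants N" using uc by (simp add: invariants_def)
  ultimately have gu: "\<g> u = u" using fix_inv by blast
  have "(\<Oplus>h\<in>H \<union> tw \<g> ` H. c h \<otimes> h x) = (\<Oplus>h\<in>H. c h \<otimes> h x) \<oplus> (\<Oplus>h\<in>tw \<g> ` H. c h \<otimes> h x)"
   by (rule finsum_Un_disjoint) (use H disj val x in \<open>auto simp: c_def\<close>)
  also have "(\<Oplus>h\<in>H. c h \<otimes> h x) = u"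
   unfolding u_def by (rule finsum_cong') (use hx in \<open>auto simp: c_def\<close>)
  also have "(\<Oplus>h\<in>tw \<g> ` H. c h \<otimes> h x) = (\<Oplus>h\<in>tw \<g> ` H. (\<ominus> \<one>) \<otimes> h x)"
   by (rule finsum_cong') (use val x disj in \<open>auto simp: c_def\<close>)
  also have "\<dots> = (\<ominus> \<one>) \<otimes> (\<Oplus>h\<in>tw \<g> ` H. h x)"
   by (rule finsum_rdistr[symmetric]) (use H val x in auto)
  also have "\<dots> = \<ominus> u" using shift[OF g] gu uc by (simp add: l_minus)
  finally show "(\<Oplus>h\<in>H \<union> tw \<g> ` H. c h \<otimes> h x) = \<zero>" using uc by (simp add: r_neg)
 qed
 thus False using k by (simp add: c_def)
qed

text \<open>
 The field is \<open>M \<inter> invariants N\<close>. It is Galois since \<open>N\<close> is normal, and an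
 automorphism fixing it lies in \<open>N\<close> by Artin's argument. Continuity of a homomorphism takes
 the form that its kernel contains \<open>fixgrp M\<close> for some Galois \<open>M\<close>.
\<close>

theorem galois_correspondence:
 assumes N: "N \<lhd> \<G>" and M: "galois_extension \<Omega> F M" "fixgrp M \<subseteq> N"
  and fin: "finite ((\<lambda>\<g>. restrict \<g> M) ` N)"
 obtains L where "galois_extension \<Omega> F L" "fixgrp L = N"
proof -
 note Ms = galois_extension_subfield[OF M(1)] and st = galois_extension_stable[OF M(1)]
 have Nsub: "subgroup N \<G>" using N by (rule normal_imp_subgroup)
 have Nc: "N \<subseteq> carrier \<G>" using Nsub by (rule subgroup.subset)
 define L where "L = M \<inter> invariants N"
 have fx: "\<g> x = x" if "\<g> \<in> N" "x \<in> L" for \<g> x using that by (auto simp: L_def invariants_def)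
 have LM: "L \<subseteq> M" by (auto simp: L_def)
 have LI: "x \<in> L" if "x \<in> M" "\<And>\<g>. \<g> \<in> N ==> \<g> x = x" for x
  using that subsetD[OF Ms(3) that(1)] by (auto simp: L_def invariants_def)
 have FL: "F \<subseteq> L" using Ms(2) Nc by (auto intro!: LI)
 have subM: "subring M \<Omega>" using subfieldE(1)[OF Ms(1)] .
 have Lc: "L \<subseteq> carrier \<Omega>" using LM Ms(3) by (rule subset_trans)
 have L: "subfield L \<Omega>"
 proof (rule subfieldI'[OF subringI])
  show "L \<subseteq> carrier \<Omega>" by (rule Lc)
  show "\<one> \<in> L" using subfield_one_zero[OF Ms(1)] Nc by (auto intro!: LI)
  fix a assume a: "a \<in> L"
  have aM: "a \<in> M" "a \<in> carrier \<Omega>" using subsetD[OF LM a] subsetD[OF Lc a] .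
  show "\<ominus> a \<in> L"
  proof (rule LI)
   show "\<ominus> a \<in> M" using aM subringE(5)[OF subM] by blast
   show "\<g> (\<ominus> a) = \<ominus> a" if g: "\<g> \<in> N" for \<g>
    using fx[OF g a] subsetD[OF Nc g] aM by simp
  qed
  fix b assume b: "b \<in> L"
  have bM: "b \<in> M" "b \<in> carrier \<Omega>" using subsetD[OF LM b] subsetD[OF Lc b] .
  show "a \<otimes> b \<in> L"
  proof (rule LI)
   show "a \<otimes> b \<in> M" using aM bM subringE(6)[OF subM] by blast
   show "\<g> (a \<otimes> b) = a \<otimes> b" if g: "\<g> \<in> N" for \<g>
    using fx[OF g a] fx[OF g b] subsetD[OF Nc g] aM bM by simp
  qed
  show "a \<oplus> b \<in> L"
  proof (rule LI)
   show "a \<oplus> b \<in> M" using aM bM subringE(7)[OF subM] by blast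
   show "\<g> (a \<oplus> b) = a \<oplus> b" if g: "\<g> \<in> N" for \<g>
    using fx[OF g a] fx[OF g b] subsetD[OF Nc g] aM bM by simp
  qed
 next
  fix a assume a: "a \<in> L - {\<zero>}"
  hence ac: "a \<in> carrier \<Omega>" "a \<noteq> \<zero>" "a \<in> M" using Lc LM by auto
  hence iv: "inv a \<in> carrier \<Omega>" "a \<otimes> inv a = \<one>" "inv a \<otimes> a = \<one>" using field_Units by auto
  show "inv a \<in> L"
  proof (rule LI)
   show "inv a \<in> M" using subfield_m_inv(1)[OF Ms(1)] ac by auto
   fix \<g> assume g: "\<g> \<in> N"
   hence gc: "\<g> \<in> carrier \<G>" using Nc by auto
   have "\<g> (inv a) \<otimes> \<g> a = \<one>" using \<G>_simps(2)[OF gc iv(1) ac(1)] iv(3) gc by simp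
   hence "\<g> (inv a) \<otimes> a = \<one>" using fx[OF g] a by simp
   thus "\<g> (inv a) = inv a" using inv_unique[of "\<g> (inv a)" a "inv a"] iv ac gc by simp
  qed
 qed
 have stL: "stable L"
  unfolding stable_def
 proof (intro conjI ballI)
  show "L \<subseteq> carrier \<Omega>" by (rule Lc)
  fix \<g> x assume g: "\<g> \<in> carrier \<G>" and x: "x \<in> L"
  have xc: "x \<in> carrier \<Omega>" using x Lc by auto
  show "\<g> x \<in> L"
  proof (rule LI)
   show "\<g> x \<in> M" using st g x LM by (auto simp: stable_def)
   fix \<d> assume d: "\<d> \<in> N"
   have dc: "\<d> \<in> carrier \<G>" using d Nc by auto
   have "inv\<^bsub>\<G>\<^esub> \<g> \<otimes>\<^bsub>\<G>\<^esub> \<d> \<otimes>\<^bsub>\<G>\<^esub> \<g> \<in> N" using normal.inv_op_closed1[OF N g d] .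
   hence "(inv\<^bsub>\<G>\<^esub> \<g> \<otimes>\<^bsub>\<G>\<^esub> \<d> \<otimes>\<^bsub>\<G>\<^esub> \<g>) x = x" using fx x by blast
   hence "(inv\<^bsub>\<G>\<^esub> \<g>) (\<d> (\<g> x)) = x" using g dc xc by (simp add: \<G>_mult)
   hence "\<g> ((inv\<^bsub>\<G>\<^esub> \<g>) (\<d> (\<g> x))) = \<g> x" by simp
   thus "\<d> (\<g> x) = \<g> x" using \<G>_inv(2)[OF g] g dc xc by simp
  qed
 qed
 have Fid: "x \<in> F" if "x \<in> M" "\<And>\<g>. \<g> \<in> carrier \<G> ==> \<g> x = x" for x
  using fixed_in_galois_extension[OF M(1) F_subfield subset_refl that(1)] that(2) by (auto simp: fixgrp_def)
 have "galois_extension \<Omega> F L"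
  by (rule galois_extensionI[OF L FL stL]) (use Fid LM in auto)
 moreover have "fixgrp L = N"
 proof
  show "N \<subseteq> fixgrp L" using fx Nc by (auto simp: fixgrp_def)
  show "fixgrp L \<subseteq> N"
  proof
   fix \<g> assume g: "\<g> \<in> fixgrp L"
   hence gc: "\<g> \<in> carrier \<G>" by (simp add: fixgrp_def)
   have "\<exists>\<d>\<in>N. \<forall>x\<in>M. \<d> x = \<g> x"
    by (rule artin_closure[OF Nsub Ms(1) st fin gc]) (use g in \<open>auto simp: fixgrp_def L_def\<close>)
   then obtain \<d> where d: "\<d> \<in> N" "\<And>x. x \<in> M ==> \<d> x = \<g> x" by blast
   have dc: "\<d> \<in> carrier \<G>" using d(1) Nc by auto
   have "inv\<^bsub>\<G>\<^esub> \<d> \<otimes>\<^bsub>\<G>\<^esub> \<g> \<in> fixgrp M"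
   proof -
    have "(inv\<^bsub>\<G>\<^esub> \<d> \<otimes>\<^bsub>\<G>\<^esub> \<g>) x = x" if x: "x \<in> M" for x
    proof -
     have xc: "x \<in> carrier \<Omega>" using subsetD[OF Ms(3) x] .
     show ?thesis using \<G>_mult[of "inv\<^bsub>\<G>\<^esub> \<d>" \<g> x] d(2)[OF x, symmetric] \<G>_inv(1)[OF dc xc] dc gc xc by simp
    qed
    thus ?thesis using dc gc by (simp add: fixgrp_def)
   qed
   hence "inv\<^bsub>\<G>\<^esub> \<d> \<otimes>\<^bsub>\<G>\<^esub> \<g> \<in> N" using M(2) by blast
   hence "\<d> \<otimes>\<^bsub>\<G>\<^esub> (inv\<^bsub>\<G>\<^esub> \<d> \<otimes>\<^bsub>\<G>\<^esub> \<g>) \<in> N" by (rule subgroup.m_closed[OF Nsub d(1)])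
   thus "\<g> \<in> N" using dc gc by (simp add: \<G>.m_assoc[symmetric])
  qed
 qed
 ultimately show ?thesis by (rule that)
qed

end

section \<open>Quotients of a truncated polynomial ring\<close>

lemma prime_dvd_choose_prime_power:
 fixes p :: nat
 assumes "Factorial_Ring.prime p" "0 < k" "k < p ^ n"
 shows "p dvd (p ^ n choose k)"
proof (rule ccontr)
 assume "\<not> p dvd (p ^ n choose k)"
 hence "coprime (p ^ n) (p ^ n choose k)" using assms(1) by (simp add: prime_imp_coprime)
 moreover have "p ^ n dvd k * (p ^ n choose k)"
  using binomial_absorption[of "k - 1" "p ^ n"] assms(2,3) by simp
 ultimately have "p ^ n dvd k" by (simp add: coprime_dvd_mult_left_iff)
 thus False using assms(2,3) by (auto dest: dvd_imp_le)
qed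

context cring
begin

text \<open>
 Natural multiples \<open>x \<oplus> \<dots> \<oplus> x\<close>. They let exponents of roots of unity act
 on the ring without a scalar field.
\<close>

definition nat_mult :: "nat => 'a => 'a" where
 "nat_mult k x = add_pow R k x"

lemma nat_mult_closed [simp]: "x \<in> carrier R ==> nat_mult k x \<in> carrier R"
 by (simp add: nat_mult_def)

lemma nat_mult_0 [simp]: "nat_mult 0 x = \<zero>" by (simp add: nat_mult_def)

lemma nat_mult_Suc: "nat_mult (Suc k) x = nat_mult k x \<oplus> x"
 by (simp add: nat_mult_def)

lemma nat_mult_1 [simp]: "x \<in> carrier R ==> nat_mult (Suc 0) x = x"
 by (simp add: nat_mult_Suc)

lemma nat_mult_add: "x \<in> carrier R ==> nat_mult (k + l) x = nat_mult k x \<oplus> nat_mult l x"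
 by (simp add: nat_mult_def add.nat_pow_mult)

lemma nat_mult_mult: "x \<in> carrier R ==> nat_mult (k * l) x = nat_mult l (nat_mult k x)"
 by (simp add: nat_mult_def add.nat_pow_pow)

lemma nat_mult_distrib: "x \<in> carrier R ==> y \<in> carrier R ==> nat_mult k (x \<oplus> y) = nat_mult k x \<oplus> nat_mult k y"
 by (simp add: nat_mult_def add.nat_pow_distrib)

lemma nat_mult_left: "x \<in> carrier R ==> y \<in> carrier R ==> nat_mult k x \<otimes> y = nat_mult k (x \<otimes> y)"
 by (simp add: nat_mult_def add_pow_ldistr)

lemma nat_mult_right: "x \<in> carrier R ==> y \<in> carrier R ==> x \<otimes> nat_mult k y = nat_mult k (x \<otimes> y)"
 by (simp add: nat_mult_def add_pow_rdistr)

lemma nat_mult_zero [simp]: "nat_mult k \<zero> = \<zero>"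
 by (induction k) (simp_all add: nat_mult_Suc)

lemma nat_mult_eq: "x \<in> carrier R ==> nat_mult k x = nat_mult k \<one> \<otimes> x"
 by (simp add: nat_mult_left)

lemma nat_mult_dvd:
 assumes "nat_mult p \<one> = \<zero>" "p dvd k" "x \<in> carrier R" shows "nat_mult k x = \<zero>"
proof -
 obtain l where "k = p * l" using assms(2) by blast
 hence "nat_mult k \<one> = \<zero>" using assms(1) by (simp add: nat_mult_mult)
 thus ?thesis using nat_mult_eq[OF assms(3)] assms(3) by simp
qed

lemma nat_mult_mod:
 assumes "nat_mult p \<one> = \<zero>" "x \<in> carrier R" shows "nat_mult (k mod p) x = nat_mult k x"
proof -
 have "nat_mult k x = nat_mult (p * (k div p) + k mod p) x" by simp
 also have "\<dots> = nat_mult (p * (k div p)) x \<oplus> nat_mult (k mod p) x" by (rule nat_mult_add[OF assms(2)])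
 also have "nat_mult (p * (k div p)) x = \<zero>" by (rule nat_mult_dvd[OF assms(1) _ assms(2)]) simp
 finally show ?thesis using assms(2) by simp
qed

lemma binomial_expansion:
 assumes x: "x \<in> carrier R" and y: "y \<in> carrier R"
 shows "(x \<oplus> y) [^] m = (\<Oplus>k\<in>{..m}. nat_mult (m choose k) (x [^] k \<otimes> y [^] (m - k)))"
proof (induction m)
 case 0 thus ?case using x y by simp
next
 case (Suc m)
 define G where "G = (\<lambda>k. x [^] k \<otimes> y [^] (Suc m - k))"
 have G: "G k \<in> carrier R" for k using x y by (simp add: G_def)
 have "(x \<oplus> y) [^] Suc m = (x \<oplus> y) [^] m \<otimes> x \<oplus> (x \<oplus> y) [^] m \<otimes> y"
  using x y by (simp add: r_distr)
 also have "(x \<oplus> y) [^] m \<otimes> y = (\<Oplus>k\<in>{..m}. nat_mult (m choose k) (G k))"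
  unfolding Suc.IH using x y
  by (subst finsum_ldistr) (auto simp: G_def nat_mult_left m_assoc Suc_diff_le intro!: finsum_cong')
 also have "\<dots> = (\<Oplus>k\<in>{..Suc m}. nat_mult (m choose k) (G k))"
  using G by (subst finsum_Suc) (auto simp: binomial_eq_0)
 also have "\<dots> = (\<Oplus>k\<in>{..m}. nat_mult (m choose Suc k) (G (Suc k))) \<oplus> G 0"
  using G by (subst finsum_Suc2) (auto simp: a_comm)
 also have "(x \<oplus> y) [^] m \<otimes> x = (\<Oplus>k\<in>{..m}. nat_mult (m choose k) (G (Suc k)))"
  unfolding Suc.IH using x y
  by (subst finsum_ldistr) (auto simp: G_def nat_mult_left nat_mult_right m_ac intro!: finsum_cong')
 finally have "(x \<oplus> y) [^] Suc m = (\<Oplus>k\<in>{..m}. nat_mult (m choose k) (G (Suc k)))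
   \<oplus> ((\<Oplus>k\<in>{..m}. nat_mult (m choose Suc k) (G (Suc k))) \<oplus> G 0)" .
 also have "\<dots> = (\<Oplus>k\<in>{..m}. nat_mult (Suc m choose Suc k) (G (Suc k))) \<oplus> G 0"
  using G by (simp add: nat_mult_add finsum_addf a_assoc Pi_def)
 also have "\<dots> = (\<Oplus>k\<in>{..Suc m}. nat_mult (Suc m choose k) (G k))"
  using G by (subst finsum_Suc2) (auto simp: a_comm)
 finally show ?case by (simp add: G_def)
qed

lemma frobenius_add:
 assumes p: "Factorial_Ring.prime p" and char: "nat_mult p \<one> = \<zero>"
  and x: "x \<in> carrier R" and y: "y \<in> carrier R"
 shows "(x \<oplus> y) [^] (p ^ n) = x [^] (p ^ n) \<oplus> y [^] (p ^ n)"
proof -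
 define f where "f = (\<lambda>k. nat_mult (p ^ n choose k) (x [^] k \<otimes> y [^] (p ^ n - k)))"
 have fc: "f k \<in> carrier R" for k using x y by (simp add: f_def)
 have f0: "f k = \<zero>" if "0 < k" "k < p ^ n" for k
  unfolding f_def using nat_mult_dvd[OF char prime_dvd_choose_prime_power[OF p that]] x y by simp
 have pn: "p ^ n > 0" using p by (simp add: prime_gt_0_nat)
 have "(x \<oplus> y) [^] (p ^ n) = (\<Oplus>k\<in>{..p ^ n}. f k)" unfolding f_def by (rule binomial_expansion[OF x y])
 also have "\<dots> = (\<Oplus>k\<in>{0, p ^ n}. f k)"
 proof (rule add.finprod_mono_neutral_cong_right)
  show "f k = \<zero>" if "k \<in> {..p ^ n} - {0, p ^ n}" for k using that by (intro f0) auto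
 qed (use fc in auto)
 also have "\<dots> = x [^] (p ^ n) \<oplus> y [^] (p ^ n)"
  using pn x y fc by (simp add: f_def a_comm)
 finally show ?thesis .
qed

definition geometric :: "'a => nat => 'a" where
 "geometric u m = (\<Oplus>k\<in>{..<m}. u [^] k)"

lemma geometric_closed [simp]: "u \<in> carrier R ==> geometric u m \<in> carrier R"
 unfolding geometric_def by (intro finsum_closed) auto

lemma geometric_0 [simp]: "geometric u 0 = \<zero>" by (simp add: geometric_def)

lemma geometric_Suc: "u \<in> carrier R ==> geometric u (Suc m) = geometric u m \<oplus> u [^] m"
 unfolding geometric_def by (simp add: lessThan_Suc finsum_insert Pi_def a_comm)

lemma geometric_add:
 "u \<in> carrier R ==> geometric u (k + m) = geometric u k \<oplus> u [^] k \<otimes> geometric u m"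
 by (induction m) (simp_all add: geometric_Suc r_distr nat_pow_mult a_assoc)

lemma geometric_telescope:
 assumes "t \<in> carrier R"
 shows "(\<one> \<oplus> t) [^] m = \<one> \<oplus> t \<otimes> geometric (\<one> \<oplus> t) m"
proof (induction m)
 case 0 thus ?case using assms by simp
next
 case (Suc m)
 have "(\<one> \<oplus> t) [^] Suc m = (\<one> \<oplus> t) [^] m \<oplus> t \<otimes> (\<one> \<oplus> t) [^] m"
  using assms by (simp add: r_distr m_comm[of t])
 thus ?case using assms Suc by (simp add: geometric_Suc r_distr a_assoc)
qed

lemma geometric_binomial:
 assumes "t \<in> carrier R"
 shows "geometric (\<one> \<oplus> t) m = (\<Oplus>k\<in>{..<m}. nat_mult (m choose Suc k) (t [^] k))"
proof (induction m)
 case 0 thus ?case by simp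
next
 case (Suc m)
 have "geometric (\<one> \<oplus> t) m = (\<Oplus>k\<in>{..m}. nat_mult (m choose Suc k) (t [^] k))"
 proof -
  have "(\<Oplus>k\<in>{..m}. nat_mult (m choose Suc k) (t [^] k)) = (\<Oplus>k\<in>insert m {..<m}. nat_mult (m choose Suc k) (t [^] k))"
   by (simp add: lessThan_Suc_atMost[symmetric] lessThan_Suc)
  also have "\<dots> = (\<Oplus>k\<in>{..<m}. nat_mult (m choose Suc k) (t [^] k))"
   using assms by (subst finsum_insert) (auto simp: binomial_eq_0)
  finally show ?thesis using Suc by simp
 qed
 moreover have "(\<one> \<oplus> t) [^] m = (\<Oplus>k\<in>{..m}. nat_mult (m choose k) (t [^] k))"
 proof -
  have "(t \<oplus> \<one>) [^] m = (\<Oplus>k\<in>{..m}. nat_mult (m choose k) (t [^] k \<otimes> \<one> [^] (m - k)))"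
   by (rule binomial_expansion) (use assms in auto)
  also have "\<dots> = (\<Oplus>k\<in>{..m}. nat_mult (m choose k) (t [^] k))"
   by (rule finsum_cong') (use assms in auto)
  finally show ?thesis using assms by (simp add: a_comm)
 qed
 ultimately have "geometric (\<one> \<oplus> t) (Suc m)
  = (\<Oplus>k\<in>{..m}. nat_mult (m choose Suc k) (t [^] k) \<oplus> nat_mult (m choose k) (t [^] k))"
  using assms by (simp add: geometric_Suc finsum_addf Pi_def)
 also have "\<dots> = (\<Oplus>k\<in>{..<Suc m}. nat_mult (Suc m choose Suc k) (t [^] k))"
  unfolding lessThan_Suc_atMost by (rule finsum_cong') (use assms in \<open>auto simp: nat_mult_add a_comm\<close>)
 finally show ?case .
qed

end

text \<open>
 The properties of \<open>A = \<F>\<^sub>p[G]/\<langle>(\<sigma> - 1)^i\<rangle>\<close> that matter, with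
 \<open>t = \<sigma> - 1\<close> and \<open>s = \<sigma>\<close>. All ideals are powers of
 \<open>(t)\<close>, and \<open>t^(i-1)\<close> spans the socle. The assumption \<open>twist\<close> says
 that every automorphism \<open>\<sigma> \<mapsto> \<sigma>^u\<close> of the group acts semilinearly on
 \<open>A\<close>.
\<close>

locale uniserial_ring = cring A for A (structure) +
 fixes p n i :: nat and t
 assumes p: "Factorial_Ring.prime p" and n: "n \<ge> 1" and i_lower: "p ^ (n - 1) + 2 \<le> i" and i_upper: "i < p ^ n"
  and t[simp]: "t \<in> carrier A" and char: "nat_mult p \<one> = \<zero>"
  and t_i: "t [^] i = \<zero>" and t_i1: "t [^] (i - 1) \<noteq> \<zero>"
  and decompose: "a \<in> carrier A ==> \<exists>k. \<exists>b\<in>carrier A. a = nat_mult k \<one> \<oplus> t \<otimes> b"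
  and finite_carrier: "finite (carrier A)"
  and twist: "coprime u p ==> \<exists>\<alpha>. \<alpha> \<in> carrier A \<rightarrow> carrier A \<and> \<alpha> \<one> = \<one> \<and>
   (\<forall>x\<in>carrier A. \<forall>y\<in>carrier A. \<alpha> (x \<oplus> y) = \<alpha> x \<oplus> \<alpha> y) \<and>
   (\<forall>x\<in>carrier A. \<alpha> ((\<one> \<oplus> t) \<otimes> x) = (\<one> \<oplus> t) [^] (u::nat) \<otimes> \<alpha> x)"
begin

abbreviation "s \<equiv> \<one> \<oplus> t"
definition q :: nat where "q = p ^ n"
abbreviation "P \<equiv> p ^ (n - 1)"

lemma p_ge_2: "p \<ge> 2" using p by (rule prime_ge_2_nat)

lemma q_eq: "q = p * P" using n unfolding q_def by (cases n) simp_all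

lemma i_less_q: "i < q" using i_upper by (simp add: q_def)

lemma i_ge_3: "i \<ge> 3"
proof -
 have "P \<ge> 1" using p_ge_2 by simp
 thus ?thesis using i_lower by linarith
qed

lemma q_gt_1: "1 < q" using i_ge_3 i_less_q by linarith

lemma t_pow_ge: "m \<ge> i ==> t [^] m = \<zero>"
 using nat_pow_mult[OF t, of i "m - i"] t_i by simp

lemma t_pow_less: "m < i ==> t [^] m \<noteq> \<zero>"
 using nat_pow_mult[OF t, of m "i - 1 - m"] t_i1 by auto

lemma s_closed [simp]: "s \<in> carrier A" by simp

lemma s_pow_prime_power: "s [^] (p ^ m) = \<one> \<oplus> t [^] (p ^ m)"
 using frobenius_add[OF p char one_closed t, of m] by simp

lemma s_pow_q: "s [^] q = \<one>"
 using s_pow_prime_power[of n] t_pow_ge[of q] i_less_q by (simp add: q_def)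

lemma s_pow_mod: "s [^] (m mod q) = s [^] m"
proof -
 have "s [^] m = s [^] (q * (m div q) + m mod q)" by simp
 also have "\<dots> = (s [^] q) [^] (m div q) \<otimes> s [^] (m mod q)"
  by (simp only: nat_pow_mult[symmetric] nat_pow_pow s_closed)
 finally show ?thesis by (simp add: s_pow_q)
qed

text \<open>
 The norm element of the group algebra vanishes in \<open>A\<close>: in \<open>\<Sum> (q choose k+1)
 t^k\<close> all binomial coefficients are divisible by \<open>p\<close> except the last, and
 \<open>t^(q-1) = 0\<close> as \<open>i < q\<close>.
\<close>

lemma geometric_q: "geometric s q = \<zero>"
proof -
 have "geometric s q = (\<Oplus>k\<in>{..<q}. nat_mult (q choose Suc k) (t [^] k))" by (rule geometric_binomial[OF t])
 also have "\<dots> = \<zero>"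
 proof (rule add.finprod_one_eqI)
  fix k assume k: "k \<in> {..<q}"
  show "nat_mult (q choose Suc k) (t [^] k) = \<zero>"
  proof (cases "Suc k = q")
   case True
   hence "k \<ge> i" using i_less_q by simp
   thus ?thesis using t_pow_ge by simp
  next
   case False
   thus ?thesis using nat_mult_dvd[OF char prime_dvd_choose_prime_power[OF p, of "Suc k" n]] k by (simp add: q_def)
  qed
 qed
 finally show ?thesis .
qed

lemma geometric_mod: "geometric s (m mod q) = geometric s m"
proof -
 have "geometric s (q * k) = \<zero>" for k
  by (induction k) (simp_all add: geometric_add geometric_q s_pow_q)
 moreover have "s [^] (q * k) = \<one>" for k
  using nat_pow_pow[OF s_closed, of q k] s_pow_q by simp
 ultimately have "geometric s (q * (m div q) + m mod q) = geometric s (m mod q)"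
  by (subst geometric_add) simp_all
 thus ?thesis by simp
qed

lemma nat_mult_unit:
 assumes "\<not> p dvd k" shows "\<exists>l. nat_mult k \<one> \<otimes> nat_mult l \<one> = \<one> \<and> \<not> p dvd l"
proof -
 have "coprime k p" using assms p by (metis coprime_commute prime_imp_coprime)
 then obtain l where l: "[k * l = 1] (mod p)" using cong_solve_coprime_nat[of k p] by auto
 have "nat_mult k \<one> \<otimes> nat_mult l \<one> = nat_mult (k * l) \<one>"
  by (simp add: nat_mult_left nat_mult_mult mult.commute[of k])
 also have "\<dots> = nat_mult ((k * l) mod p) \<one>" using nat_mult_mod[OF char] by simp
 also have "\<dots> = \<one>" using l p_ge_2 by (simp add: cong_def)
 finally have "nat_mult k \<one> \<otimes> nat_mult l \<one> = \<one>" .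
 moreover have "\<not> p dvd l"
 proof
  assume "p dvd l"
  hence "p dvd 1" using l cong_dvd_iff[of "k * l" 1 p] by simp
  thus False using p_ge_2 by simp
 qed
 ultimately show ?thesis by blast
qed

lemma one_plus_t_unit:
 assumes "b \<in> carrier A" shows "\<one> \<oplus> t \<otimes> b \<in> Units A"
proof -
 let ?x = "\<ominus> (t \<otimes> b)"
 have x: "?x \<in> carrier A" using assms by simp
 have "?x = t \<otimes> (\<ominus> b)" using assms by (simp add: r_minus)
 hence xi: "?x [^] i = \<zero>" using assms by (simp add: nat_pow_distrib t_i)
 have tel: "(\<one> \<ominus> x) \<otimes> geometric x m = \<one> \<ominus> x [^] m" if "x \<in> carrier A" for x m
 proof (induction m)
  case 0 thus ?case using that by (simp add: minus_eq r_neg)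
 next
  case (Suc m)
  have "(\<one> \<ominus> x) \<otimes> geometric x (Suc m) = (\<one> \<ominus> x [^] m) \<oplus> (\<one> \<ominus> x) \<otimes> x [^] m"
   using that Suc by (simp add: geometric_Suc r_distr)
  moreover have "x [^] Suc m = x \<otimes> x [^] m" using that by (simp add: m_comm)
  moreover have "(\<one> \<ominus> y) \<oplus> (\<one> \<ominus> x) \<otimes> y = \<one> \<ominus> x \<otimes> y" if "y \<in> carrier A" for y
   using that \<open>x \<in> carrier A\<close> by algebra
  ultimately show ?case using that by (simp del: nat_pow_Suc)
 qed
 have "(\<one> \<oplus> t \<otimes> b) \<otimes> geometric ?x i = \<one>"
  using tel[OF x, of i] xi assms by (simp add: minus_eq)
 moreover have "geometric ?x i \<in> carrier A" using x by simp
 moreover have "\<one> \<oplus> t \<otimes> b \<in> carrier A" using assms by simp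
 ultimately show ?thesis unfolding Units_def by (auto simp: m_comm intro!: bexI[of _ "geometric ?x i"])
qed

lemma unit_decomposition:
 assumes "b \<in> carrier A" "\<not> p dvd k" shows "nat_mult k \<one> \<oplus> t \<otimes> b \<in> Units A"
proof -
 obtain l where l: "nat_mult k \<one> \<otimes> nat_mult l \<one> = \<one>" using nat_mult_unit[OF assms(2)] by blast
 have "nat_mult k \<one> \<in> Units A" unfolding Units_def using l by (auto simp: m_comm intro!: bexI[of _ "nat_mult l \<one>"])
 moreover have "\<one> \<oplus> t \<otimes> (nat_mult l \<one> \<otimes> b) \<in> Units A" using one_plus_t_unit assms(1) by simp
 ultimately have "nat_mult k \<one> \<otimes> (\<one> \<oplus> t \<otimes> (nat_mult l \<one> \<otimes> b)) \<in> Units A" by (rule Units_m_closed)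
 moreover have "a \<otimes> (\<one> \<oplus> t \<otimes> (c \<otimes> b)) = a \<oplus> t \<otimes> ((a \<otimes> c) \<otimes> b)" if "a \<in> carrier A" "c \<in> carrier A" for a c
  using that assms(1) t by algebra
 ultimately show ?thesis using l assms(1) by simp
qed

lemma unit_or_multiple:
 assumes "a \<in> carrier A" shows "a \<in> Units A \<or> (\<exists>b\<in>carrier A. a = t \<otimes> b)"
proof -
 obtain k b where kb: "b \<in> carrier A" "a = nat_mult k \<one> \<oplus> t \<otimes> b" using decompose[OF assms] by blast
 show ?thesis
 proof (cases "p dvd k")
  case True
  hence "a = t \<otimes> b" using kb nat_mult_dvd[OF char True one_closed] by simp
  thus ?thesis using kb by blast
 qed (use kb unit_decomposition in blast)
qed

lemma t_not_unit_multiple: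
 assumes "b \<in> carrier A" shows "t \<otimes> b \<notin> Units A"
proof
 assume u: "t \<otimes> b \<in> Units A"
 have "t [^] (i - 1) \<otimes> t = \<zero>" using t_i i_ge_3 nat_pow_Suc[of t "i - 1"] by simp
 hence "t [^] (i - 1) \<otimes> (t \<otimes> b) = \<zero>" using assms by (simp add: m_assoc[symmetric])
 hence "t [^] (i - 1) \<otimes> (t \<otimes> b) \<otimes> inv (t \<otimes> b) = \<zero>" using u by simp
 hence "t [^] (i - 1) = \<zero>" using u assms by (simp add: m_assoc Units_r_inv)
 thus False using t_i1 by simp
qed

text \<open>
 An additive subset that is stable under \<open>s\<close> is stable under \<open>t = s - 1\<close>, and
 \<open>t\<close> generates \<open>A\<close> over the prime ring.
\<close>

lemma stable_mult_closed:
 assumes I: "I \<subseteq> carrier A" "\<zero> \<in> I" "\<And>x y. x \<in> I ==> y \<in> I ==> x \<oplus> y \<in> I"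
  and sI: "\<And>x. x \<in> I ==> s \<otimes> x \<in> I" and a: "a \<in> carrier A" and w: "w \<in> I"
 shows "a \<otimes> w \<in> I"
proof -
 have mult: "nat_mult k x \<in> I" if "x \<in> I" for k x
  using that I by (induction k) (auto simp: nat_mult_Suc)
 have tI: "t \<otimes> x \<in> I" if x: "x \<in> I" for x
 proof -
  have xc: "x \<in> carrier A" using x I by auto
  have "nat_mult (p - 1) x \<oplus> x = \<zero>"
   using nat_mult_dvd[OF char dvd_refl xc] nat_mult_Suc[of "p - 1" x] p_ge_2 by simp
  moreover have "(x \<oplus> y) \<oplus> b = y \<oplus> (b \<oplus> x)" if "y \<in> carrier A" "b \<in> carrier A" for y b
   using that xc by algebra
  ultimately have "s \<otimes> x \<oplus> nat_mult (p - 1) x = t \<otimes> x" using xc by (simp add: l_distr)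
  thus ?thesis using I(3)[OF sI[OF x] mult[OF x, of "p - 1"]] by simp
 qed
 have tmI: "t [^] m \<otimes> x \<in> I" if "x \<in> I" for m :: nat and x
  using that
 proof (induction m arbitrary: x)
  case 0 thus ?case using I by (auto simp: subset_iff)
 next
  case (Suc m)
  have xc: "x \<in> carrier A" using Suc.prems I by auto
  have "t [^] Suc m \<otimes> x = t [^] m \<otimes> (t \<otimes> x)" using xc by (simp add: m_assoc)
  thus ?case using Suc.IH[OF tI[OF Suc.prems]] by simp
 qed
 have "t [^] (i - m) \<otimes> a \<otimes> w \<in> I" if "a \<in> carrier A" for a m
  using that
 proof (induction m arbitrary: a)
  case 0 thus ?case using t_i I w by (auto simp: subset_iff)
 next
  case (Suc m)
  have wc: "w \<in> carrier A" using w I by auto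
  show ?case
  proof (cases "i \<le> m")
   case True thus ?thesis using Suc by simp
  next
   case False
   obtain k b where kb: "b \<in> carrier A" "a = nat_mult k \<one> \<oplus> t \<otimes> b" using decompose[OF Suc.prems] by blast
   have e: "i - m = Suc (i - Suc m)" using False by simp
   have "t [^] (i - Suc m) \<otimes> a \<otimes> w = nat_mult k (t [^] (i - Suc m) \<otimes> w) \<oplus> t [^] (i - m) \<otimes> b \<otimes> w"
    unfolding e kb(2) using kb(1) wc by (simp add: r_distr l_distr nat_mult_left nat_mult_right m_assoc)
   thus ?thesis using I(3)[OF mult[OF tmI[OF w]] Suc.IH[OF kb(1)]] by simp
  qed
 qed
 from this[OF a, of i] show ?thesis using a by simp
qed

text \<open>
 Nakayama's lemma for \<open>A\<close>: a submodule not contained in \<open>tA\<close> contains a unit.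
 This makes surjectivity of a homomorphism into an extension of \<open>G\<close> by \<open>A\<close>
 insensitive to changes by elements of \<open>tA\<close>.
\<close>

lemma stable_eq_carrier:
 assumes I: "I \<subseteq> carrier A" "\<zero> \<in> I" "\<And>x y. x \<in> I ==> y \<in> I ==> x \<oplus> y \<in> I"
  and sI: "\<And>x. x \<in> I ==> s \<otimes> x \<in> I" and w: "w \<in> I" "w \<in> Units A"
 shows "I = carrier A"
proof
 show "carrier A \<subseteq> I"
 proof
  fix a assume a: "a \<in> carrier A"
  have "(a \<otimes> inv w) \<otimes> w \<in> I" by (rule stable_mult_closed[OF I sI _ w(1)]) (use a w in auto)
  moreover have "a \<otimes> inv w \<otimes> w = a" using a w(2) by (simp add: m_assoc Units_closed)
  ultimately show "a \<in> I" by simp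
 qed
qed (rule I)

lemma multiple_of_socle:
 assumes x: "x \<in> carrier A" "x \<noteq> \<zero>" obtains y where "y \<in> carrier A" "y \<otimes> x = t [^] (i - 1)"
proof -
 have "(\<exists>b\<in>carrier A. x = t [^] m \<otimes> b) \<or> (\<exists>r<m. \<exists>w\<in>Units A. x = t [^] r \<otimes> w)" for m :: nat
 proof (induction m)
  case 0 thus ?case using x by auto
 next
  case (Suc m)
  thus ?case
  proof
   assume "\<exists>b\<in>carrier A. x = t [^] m \<otimes> b"
   then obtain b where b: "b \<in> carrier A" "x = t [^] m \<otimes> b" by blast
   from unit_or_multiple[OF b(1)] show ?thesis
   proof
    assume "b \<in> Units A" thus ?thesis using b by blast
   next
    assume "\<exists>c\<in>carrier A. b = t \<otimes> c"
    then obtain c where "c \<in> carrier A" "b = t \<otimes> c" by blast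
    hence "x = t [^] Suc m \<otimes> c" using b by (simp add: m_assoc)
    thus ?thesis using \<open>c \<in> carrier A\<close> by blast
   qed
  qed (use less_Suc_eq in blast)
 qed
 from this[of i] obtain r w where rw: "r < i" "w \<in> Units A" "x = t [^] r \<otimes> w" using t_i x by auto
 have wc: "w \<in> carrier A" using rw(2) by (rule Units_closed)
 have "(t [^] (i - 1 - r) \<otimes> inv w) \<otimes> x = t [^] (i - 1 - r) \<otimes> (inv w \<otimes> w) \<otimes> t [^] r"
 proof -
  have "(a \<otimes> b) \<otimes> (d \<otimes> w) = a \<otimes> (b \<otimes> w) \<otimes> d" if "a \<in> carrier A" "b \<in> carrier A" "d \<in> carrier A" for a b d
   using that wc by algebra
  thus ?thesis unfolding rw(3) using rw(2) by simp
 qed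
 also have "\<dots> = t [^] (i - 1 - r + r)" using rw(2) by (simp add: nat_pow_mult)
 finally show ?thesis using that[of "t [^] (i - 1 - r) \<otimes> inv w"] rw by simp
qed

lemma additive_linear:
 assumes \<alpha>: "\<alpha> \<in> carrier A \<rightarrow> carrier A" "\<And>x y. x \<in> carrier A ==> y \<in> carrier A ==> \<alpha> (x \<oplus> y) = \<alpha> x \<oplus> \<alpha> y"
  and s\<alpha>: "\<And>x. x \<in> carrier A ==> \<alpha> (s \<otimes> x) = s \<otimes> \<alpha> x" and x: "x \<in> carrier A"
 shows "\<alpha> x = \<alpha> \<one> \<otimes> x"
proof -
 have c: "\<alpha> x \<in> carrier A" if "x \<in> carrier A" for x using \<alpha>(1) that by auto
 have a0: "\<alpha> \<zero> = \<zero>"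
 proof -
  have "\<alpha> \<zero> \<oplus> \<alpha> \<zero> = \<alpha> \<zero>" using \<alpha>(2)[OF zero_closed zero_closed] by simp
  thus ?thesis using c[OF zero_closed] by (metis add.r_cancel_one')
 qed
 have mult: "\<alpha> (nat_mult k x) = nat_mult k (\<alpha> x)" if "x \<in> carrier A" for k x
  using that c a0 by (induction k) (auto simp: nat_mult_Suc \<alpha>(2))
 have ta: "\<alpha> (t \<otimes> x) = t \<otimes> \<alpha> x" if x: "x \<in> carrier A" for x
 proof -
  have "\<alpha> (s \<otimes> x) = \<alpha> x \<oplus> \<alpha> (t \<otimes> x)" using x by (simp add: l_distr \<alpha>(2))
  moreover have "s \<otimes> \<alpha> x = \<alpha> x \<oplus> t \<otimes> \<alpha> x" using c[OF x] by (simp add: l_distr)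
  ultimately show ?thesis using s\<alpha>[OF x] c x by simp
 qed
 have tm: "\<alpha> (t [^] m \<otimes> x) = t [^] m \<otimes> \<alpha> x" if "x \<in> carrier A" for m :: nat and x
  using that
 proof (induction m arbitrary: x)
  case (Suc m)
  have "\<alpha> (t [^] Suc m \<otimes> x) = \<alpha> (t [^] m \<otimes> (t \<otimes> x))" using Suc.prems by (simp add: m_assoc)
  thus ?case using Suc.IH[of "t \<otimes> x"] ta[OF Suc.prems] Suc.prems c by (simp add: m_assoc)
 qed (use c in simp)
 have "\<alpha> (t [^] (i - m) \<otimes> a) = \<alpha> \<one> \<otimes> (t [^] (i - m) \<otimes> a)" if "a \<in> carrier A" for a m
  using that
 proof (induction m arbitrary: a)
  case 0 thus ?case using t_i a0 c by simp
 next
  case (Suc m)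
  show ?case
  proof (cases "i \<le> m")
   case True thus ?thesis using Suc.IH[OF Suc.prems] by simp
  next
   case False
   obtain k b where kb: "b \<in> carrier A" "a = nat_mult k \<one> \<oplus> t \<otimes> b" using decompose[OF Suc.prems] by blast
   have e: "i - m = Suc (i - Suc m)" using False by simp
   let ?T = "t [^] (i - Suc m)"
   have eq: "?T \<otimes> a = nat_mult k ?T \<oplus> t [^] (i - m) \<otimes> b"
    unfolding e kb(2) using kb(1) by (simp add: r_distr nat_mult_right m_assoc)
   have T: "\<alpha> ?T = ?T \<otimes> \<alpha> \<one>" using tm[OF one_closed, of "i - Suc m"] by simp
   have "\<alpha> (?T \<otimes> a) = nat_mult k (\<alpha> ?T) \<oplus> \<alpha> (t [^] (i - m) \<otimes> b)"
    unfolding eq using kb(1) by (simp only: \<alpha>(2) mult nat_mult_closed nat_pow_closed t m_closed)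
   also have "\<dots> = \<alpha> \<one> \<otimes> nat_mult k ?T \<oplus> \<alpha> \<one> \<otimes> (t [^] (i - m) \<otimes> b)"
    unfolding T Suc.IH[OF kb(1)] using c[OF one_closed] by (simp add: nat_mult_right m_comm)
   also have "\<dots> = \<alpha> \<one> \<otimes> (?T \<otimes> a)"
    unfolding eq by (rule r_distr[symmetric]) (use c kb(1) in auto)
   finally show ?thesis .
  qed
 qed
 from this[OF x, of i] show ?thesis using x by simp
qed

end

section \<open>Extensions of a cyclic group by the ring\<close>

declare pow_nat [simp del]

text \<open>
 The semidirect product is the case \<open>c = 0\<close> and the bullet product the case \<open>c =
 t^(i-1)\<close>: the two groups differ only in the multiple of \<open>c\<close> that records a carry in
 the addition of exponents.
\<close>

locale ext_group = uniserial_ring A p n i t for A (structure) and p n i :: nat and t +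
 fixes E :: "('a \<times> int) monoid" and c
 assumes c: "c = \<zero> \<or> c = t [^] (i - 1)"
  and carrier_E: "carrier E = carrier A \<times> {0..<int q}"
  and one_E: "\<one>\<^bsub>E\<^esub> = (\<zero>, 0)"
  and mult_E: "\<And>f g j k. f \<in> carrier A ==> g \<in> carrier A ==> j \<in> {0..<int q} ==> k \<in> {0..<int q} ==>
   (f, j) \<otimes>\<^bsub>E\<^esub> (g, k) = (f \<oplus> s [^] nat j \<otimes> g \<oplus> (if j + k < int q then \<zero> else c), (j + k) mod int q)"
begin

definition carry :: "int => int => 'a" where
 "carry j k = (if j + k < int q then \<zero> else c)"

lemma c_closed [simp]: "c \<in> carrier A" using c by auto

lemma t_c: "t \<otimes> c = \<zero>"
proof -
 have "t \<otimes> t [^] (i - 1) = t [^] Suc (i - 1)" by (simp add: m_comm)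
 hence "t \<otimes> t [^] (i - 1) = \<zero>" using t_i i_ge_3 by simp
 thus ?thesis using c by auto
qed

lemma s_pow_c [simp]: "s [^] (m::nat) \<otimes> c = c"
proof (induction m)
 case (Suc m)
 have "s [^] Suc m \<otimes> c = s [^] m \<otimes> (c \<oplus> t \<otimes> c)" by (simp add: m_assoc l_distr)
 thus ?case using Suc t_c by simp
qed simp

lemma carry_closed [simp]: "carry j k \<in> carrier A" by (simp add: carry_def)

lemma s_pow_carry [simp]: "s [^] (m::nat) \<otimes> carry j k = carry j k" by (simp add: carry_def)

lemma mod_range: "j \<in> {0..<int q} ==> k \<in> {0..<int q} ==>
  (j + k) mod int q = (if j + k < int q then j + k else j + k - int q)"
 using minus_mod_self2[of "j + k" "int q"] mod_pos_pos_trivial[of "j + k - int q" "int q"]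
 by (cases "j + k < int q") auto

lemma s_pow_add: "j \<in> {0..<int q} ==> k \<in> {0..<int q} ==>
  s [^] nat ((j + k) mod int q) = s [^] nat j \<otimes> s [^] nat k"
proof -
 assume jk: "j \<in> {0..<int q}" "k \<in> {0..<int q}"
 have "nat ((j + k) mod int q) = (nat j + nat k) mod q"
  using jk by (simp add: nat_mod_distrib nat_add_distrib)
 thus ?thesis using s_pow_mod[of "nat j + nat k"] by (simp add: nat_pow_mult)
qed

lemma carry_cocycle:
 assumes "j \<in> {0..<int q}" "k \<in> {0..<int q}" "l \<in> {0..<int q}"
 shows "carry j k \<oplus> carry ((j + k) mod int q) l = carry k l \<oplus> carry j ((k + l) mod int q)"
 unfolding mod_range[OF assms(1,2)] mod_range[OF assms(2,3)] carry_def using assms by auto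

lemma E_mult: "f \<in> carrier A ==> g \<in> carrier A ==> j \<in> {0..<int q} ==> k \<in> {0..<int q} ==>
   (f, j) \<otimes>\<^bsub>E\<^esub> (g, k) = (f \<oplus> s [^] nat j \<otimes> g \<oplus> carry j k, (j + k) mod int q)"
 by (simp only: mult_E carry_def)

lemma q_pos: "0 < int q" using q_gt_1 by linarith

lemma mod_in_range [simp]: "j mod int q \<in> {0..<int q}" using q_pos by simp

lemma group_E: "group E"
proof (rule groupI)
 show "x \<otimes>\<^bsub>E\<^esub> y \<in> carrier E" if "x \<in> carrier E" "y \<in> carrier E" for x y
  using that q_pos by (auto simp: carrier_E E_mult)
 show "\<one>\<^bsub>E\<^esub> \<in> carrier E" using q_pos by (simp add: one_E carrier_E)
 show "\<one>\<^bsub>E\<^esub> \<otimes>\<^bsub>E\<^esub> x = x" if "x \<in> carrier E" for x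
  using that q_pos by (auto simp: carrier_E E_mult one_E carry_def)
 show "x \<otimes>\<^bsub>E\<^esub> y \<otimes>\<^bsub>E\<^esub> z = x \<otimes>\<^bsub>E\<^esub> (y \<otimes>\<^bsub>E\<^esub> z)" if xyz: "x \<in> carrier E" "y \<in> carrier E" "z \<in> carrier E" for x y z
 proof -
  obtain f1 j1 f2 j2 f3 j3 where e: "x = (f1, j1)" "y = (f2, j2)" "z = (f3, j3)"
   by (cases x, cases y, cases z)
  have f: "f1 \<in> carrier A" "f2 \<in> carrier A" "f3 \<in> carrier A"
   and j: "j1 \<in> {0..<int q}" "j2 \<in> {0..<int q}" "j3 \<in> {0..<int q}" using xyz e by (auto simp: carrier_E)
  have "f1 \<oplus> a \<otimes> f2 \<oplus> d12 \<oplus> (a \<otimes> b) \<otimes> f3 \<oplus> d123 = f1 \<oplus> a \<otimes> (f2 \<oplus> b \<otimes> f3 \<oplus> d23) \<oplus> d1_23"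
   if "a \<in> carrier A" "b \<in> carrier A" "d12 \<in> carrier A" "d123 \<in> carrier A" "d23 \<in> carrier A" "d1_23 \<in> carrier A"
    "d12 \<oplus> d123 = d23 \<oplus> d1_23" "a \<otimes> d23 = d23" for a b d12 d123 d23 d1_23
  proof -
   have "f1 \<oplus> a \<otimes> f2 \<oplus> d12 \<oplus> (a \<otimes> b) \<otimes> f3 \<oplus> d123 = f1 \<oplus> a \<otimes> f2 \<oplus> (a \<otimes> b) \<otimes> f3 \<oplus> (d12 \<oplus> d123)"
    using that(1-6) f by algebra
   also have "\<dots> = f1 \<oplus> a \<otimes> f2 \<oplus> (a \<otimes> b) \<otimes> f3 \<oplus> (a \<otimes> d23 \<oplus> d1_23)" unfolding that(7,8) ..
   also have "\<dots> = f1 \<oplus> a \<otimes> (f2 \<oplus> b \<otimes> f3 \<oplus> d23) \<oplus> d1_23" using that(1-6) f by algebra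
   finally show ?thesis .
  qed
  from this[OF _ _ _ _ _ _ carry_cocycle[OF j]] show ?thesis
   unfolding e using f j by (simp only: E_mult mod_in_range m_closed a_closed nat_pow_closed s_closed carry_closed
     s_pow_add s_pow_carry mod_add_left_eq mod_add_right_eq add.assoc refl)
 qed
 show "\<exists>y\<in>carrier E. y \<otimes>\<^bsub>E\<^esub> x = \<one>\<^bsub>E\<^esub>" if x: "x \<in> carrier E" for x
 proof -
  obtain f j where e: "x = (f, j)" and f: "f \<in> carrier A" and j: "j \<in> {0..<int q}"
   using x by (cases x) (auto simp: carrier_E)
  define k where "k = (- j) mod int q"
  define g where "g = \<ominus> (s [^] nat k \<otimes> f \<oplus> carry k j)"
  have g: "g \<in> carrier A" using f by (simp add: g_def)
  have kr: "k \<in> {0..<int q}" using q_pos by (simp add: k_def)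
  have "(k + j) mod int q = 0" by (simp add: k_def mod_add_left_eq)
  moreover have "g \<oplus> s [^] nat k \<otimes> f \<oplus> carry k j = \<zero>"
   using f by (simp add: g_def a_assoc l_neg)
  ultimately have "(g, k) \<otimes>\<^bsub>E\<^esub> (f, j) = \<one>\<^bsub>E\<^esub>" using E_mult[OF g f kr j] by (simp add: one_E)
  moreover have "(g, k) \<in> carrier E" using g kr by (simp add: carrier_E)
  ultimately show ?thesis using e by blast
 qed
qed

text \<open>
 Some power of \<open>s^j\<close> is \<open>s\<close> raised to the divisor \<open>gcd j q\<close> of
 \<open>P = p^(n-1)\<close>, so \<open>s^P = 1 + t^P\<close> would fix \<open>t\<close> as well and
 \<open>t^(P+1)\<close> would vanish. The lower bound on \<open>i\<close> excludes this.
\<close>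

lemma power_t_eq_zero_imp:
 assumes j: "j \<in> {0..<int q}" and z: "s [^] nat j \<otimes> t = t" shows "j = 0"
proof (rule ccontr)
 assume j0: "j \<noteq> 0"
 define j' where "j' = nat j"
 have j': "0 < j'" "j' < q" using j j0 by (auto simp: j'_def nat_less_iff)
 obtain r where r: "gcd j' q = p ^ r" "r \<le> n"
  using divides_primepow_nat[OF p, of "gcd j' q" n] by (auto simp: q_def)
 have "r \<noteq> n" using r(1) j' by (metis gcd_dvd1 dvd_imp_le linorder_not_less q_def)
 hence "p ^ r dvd P" using r(2) by (intro le_imp_power_dvd) simp
 then obtain d where d: "P = gcd j' q * d" using r(1) by (metis dvd_def)
 obtain a where a: "[j' * a = gcd j' q] (mod q)" using cong_solve_nat[of j' q] j' by auto
 have "[j' * (a * d) = P] (mod q)" using cong_mult[OF a cong_refl[of d]] d by (simp add: mult.assoc)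
 hence "s [^] (j' * (a * d)) = s [^] P" using s_pow_mod by (metis cong_def)
 moreover have "s [^] (j' * m) \<otimes> t = t" for m
 proof (induction m)
  case (Suc m)
  have "s [^] (j' * Suc m) \<otimes> t = s [^] (j' * m) \<otimes> (s [^] j' \<otimes> t)"
   by (simp add: nat_pow_mult[symmetric] m_ac add.commute)
  thus ?case using Suc z by (simp add: j'_def)
 qed simp
 ultimately have "s [^] P \<otimes> t = t" by metis
 hence "t \<oplus> t [^] P \<otimes> t = t" using s_pow_prime_power[of "n - 1"] by (simp add: l_distr)
 hence "t [^] Suc P = \<zero>" by (simp add: add.l_cancel_one')
 thus False using t_pow_less[of "Suc P"] i_lower by simp
qed

text \<open>
 The module is the centralizer of the commutators: all commutators lie in the commutative module, and
 \<open>(t, 0)\<close> is a commutator that \<open>(f, j)\<close> centralizes only if \<open>s^j t =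
 t\<close>. The condition is phrased through products alone, so that it can be pulled back along any
 epimorphism onto the group. It shows that a field with this Galois group determines its cyclic subfield.
\<close>

lemma kernel_characteristic:
 assumes x: "x \<in> carrier E"
 shows "snd x = 0 \<longleftrightarrow> (\<forall>a\<in>carrier E. \<forall>b\<in>carrier E. \<forall>y\<in>carrier E.
  a \<otimes>\<^bsub>E\<^esub> b = y \<otimes>\<^bsub>E\<^esub> (b \<otimes>\<^bsub>E\<^esub> a) \<longrightarrow> x \<otimes>\<^bsub>E\<^esub> y = y \<otimes>\<^bsub>E\<^esub> x)"
proof
 obtain f j where e: "x = (f, j)" and f: "f \<in> carrier A" and j: "j \<in> {0..<int q}"
  using x by (cases x) (auto simp: carrier_E)
 have z0: "0 \<in> {0..<int q}" and z1: "1 \<in> {0..<int q}" using q_gt_1 by auto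
 {
  assume x0: "snd x = 0"
  show "\<forall>a\<in>carrier E. \<forall>b\<in>carrier E. \<forall>y\<in>carrier E.
   a \<otimes>\<^bsub>E\<^esub> b = y \<otimes>\<^bsub>E\<^esub> (b \<otimes>\<^bsub>E\<^esub> a) \<longrightarrow> x \<otimes>\<^bsub>E\<^esub> y = y \<otimes>\<^bsub>E\<^esub> x"
  proof (intro ballI impI)
   fix a b y assume aby: "a \<in> carrier E" "b \<in> carrier E" "y \<in> carrier E" and eq: "a \<otimes>\<^bsub>E\<^esub> b = y \<otimes>\<^bsub>E\<^esub> (b \<otimes>\<^bsub>E\<^esub> a)"
   obtain fa ja fb jb fy jy where ee: "a = (fa, ja)" "b = (fb, jb)" "y = (fy, jy)"
    by (cases a, cases b, cases y)
   have ff: "fa \<in> carrier A" "fb \<in> carrier A" "fy \<in> carrier A"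
    and jj: "ja \<in> {0..<int q}" "jb \<in> {0..<int q}" "jy \<in> {0..<int q}" using aby ee by (auto simp: carrier_E)
   have "(ja + jb) mod int q = (jy + (jb + ja) mod int q) mod int q"
    using arg_cong[OF eq, of snd] ff jj q_pos unfolding ee by (simp add: E_mult)
   hence "[jy + (ja + jb) = 0 + (ja + jb)] (mod int q)" by (simp add: cong_def mod_add_right_eq add.commute)
   hence "[jy = 0] (mod int q)" by (simp only: cong_add_rcancel)
   hence "jy = 0" using jj(3) by (simp add: cong_def)
   thus "x \<otimes>\<^bsub>E\<^esub> y = y \<otimes>\<^bsub>E\<^esub> x" unfolding ee e
    using x0 f ff z0 q_pos by (simp add: e E_mult a_comm carry_def)
  qed
 }
 assume comm: "\<forall>a\<in>carrier E. \<forall>b\<in>carrier E. \<forall>y\<in>carrier E.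
   a \<otimes>\<^bsub>E\<^esub> b = y \<otimes>\<^bsub>E\<^esub> (b \<otimes>\<^bsub>E\<^esub> a) \<longrightarrow> x \<otimes>\<^bsub>E\<^esub> y = y \<otimes>\<^bsub>E\<^esub> x"
 have mem: "(\<zero>, 1) \<in> carrier E" "(\<one>, 0) \<in> carrier E" "(t, 0) \<in> carrier E" using z0 z1 by (simp_all add: carrier_E)
 have "(\<zero>, 1) \<otimes>\<^bsub>E\<^esub> (\<one>, 0) = (t, 0) \<otimes>\<^bsub>E\<^esub> ((\<one>, 0) \<otimes>\<^bsub>E\<^esub> (\<zero>, 1))"
  using z0 z1 q_gt_1 by (simp add: E_mult carry_def a_comm)
 hence "x \<otimes>\<^bsub>E\<^esub> (t, 0) = (t, 0) \<otimes>\<^bsub>E\<^esub> x" using comm mem by blast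
 hence "f \<oplus> s [^] nat j \<otimes> t = t \<oplus> f"
  using f j z0 unfolding e by (simp add: E_mult carry_def)
 hence "s [^] nat j \<otimes> t = t" using f by (simp add: a_comm[of t f])
 thus "snd x = 0" using power_t_eq_zero_imp[OF j] e by simp
qed

definition auts :: "('a \<times> int => 'a \<times> int) set" where
 "auts = {a \<in> iso E E. a \<in> extensional (carrier E) \<and> (\<forall>x\<in>carrier E. snd (a x) = snd x)}"

text \<open>
 An automorphism over the cyclic quotient multiplies the module by a unit \<open>v\<close> with \<open>v c
 = c\<close> and sends the lift \<open>(0, 1)\<close> of the generator to \<open>(g, 1)\<close>; \<open>(0,
 j)\<close> then goes to its \<open>j\<close>-th power.
\<close>

definition aut_of :: "'a \<times> 'a => 'a \<times> int => 'a \<times> int" where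
 "aut_of = (\<lambda>(v, g). \<lambda>(f, j)\<in>carrier E. (v \<otimes> f \<oplus> geometric s (nat j) \<otimes> g, j))"

definition aut_params :: "('a \<times> 'a) set" where
 "aut_params = {v \<in> Units A. v \<otimes> c = c} \<times> carrier A"

lemma aut_of_in_auts:
 assumes "vg \<in> aut_params" shows "aut_of vg \<in> auts"
proof -
 obtain v g where e: "vg = (v, g)" and v: "v \<in> Units A" "v \<otimes> c = c" and g: "g \<in> carrier A"
  using assms by (auto simp: aut_params_def)
 have vc: "v \<in> carrier A" using v(1) by (rule Units_closed)
 interpret E: group E by (rule group_E)
 define h where "h = aut_of (v, g)"
 have h: "h (f, j) = (v \<otimes> f \<oplus> geometric s (nat j) \<otimes> g, j)" if "f \<in> carrier A" "j \<in> {0..<int q}" for f j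
  using that by (simp add: h_def aut_of_def carrier_E)
 have hom: "h \<in> hom E E"
 proof (rule homI)
  show "h x \<in> carrier E" if "x \<in> carrier E" for x
   using that vc g by (auto simp: carrier_E h)
  show "h (x \<otimes>\<^bsub>E\<^esub> y) = h x \<otimes>\<^bsub>E\<^esub> h y" if xy: "x \<in> carrier E" "y \<in> carrier E" for x y
  proof -
   obtain f1 j1 f2 j2 where ee: "x = (f1, j1)" "y = (f2, j2)" by (cases x, cases y)
   have f: "f1 \<in> carrier A" "f2 \<in> carrier A" and j: "j1 \<in> {0..<int q}" "j2 \<in> {0..<int q}"
    using xy ee by (auto simp: carrier_E)
   have "nat ((j1 + j2) mod int q) = (nat j1 + nat j2) mod q"
    using j by (simp add: nat_mod_distrib nat_add_distrib)
   hence geo: "geometric s (nat ((j1 + j2) mod int q)) = geometric s (nat j1) \<oplus> s [^] nat j1 \<otimes> geometric s (nat j2)"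
    using geometric_mod[of "nat j1 + nat j2"] by (simp add: geometric_add)
   have vcarry: "v \<otimes> carry j1 j2 = carry j1 j2" using v vc by (simp add: carry_def)
   have "v \<otimes> (f1 \<oplus> a \<otimes> f2 \<oplus> d) \<oplus> (g1 \<oplus> a \<otimes> g2) \<otimes> g = (v \<otimes> f1 \<oplus> g1 \<otimes> g) \<oplus> a \<otimes> (v \<otimes> f2 \<oplus> g2 \<otimes> g) \<oplus> d"
    if "a \<in> carrier A" "g1 \<in> carrier A" "g2 \<in> carrier A" "d \<in> carrier A" "v \<otimes> d = d" for a g1 g2 d
   proof -
    have "v \<otimes> (f1 \<oplus> a \<otimes> f2 \<oplus> d) \<oplus> (g1 \<oplus> a \<otimes> g2) \<otimes> g = (v \<otimes> f1 \<oplus> g1 \<otimes> g) \<oplus> a \<otimes> (v \<otimes> f2 \<oplus> g2 \<otimes> g) \<oplus> v \<otimes> d"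
     using that(1-4) f g vc by algebra
    thus ?thesis using that(5) by simp
   qed
   from this[OF _ _ _ _ vcarry] show ?thesis
    unfolding ee using f j g vc
    by (simp only: E_mult h geo mod_in_range m_closed a_closed nat_pow_closed s_closed carry_closed geometric_closed)
  qed
 qed
 have inj: "inj_on h (carrier E)"
 proof (rule inj_onI)
  fix x y assume xy: "x \<in> carrier E" "y \<in> carrier E" and eq: "h x = h y"
  obtain f1 j1 f2 j2 where ee: "x = (f1, j1)" "y = (f2, j2)" by (cases x, cases y)
  have f: "f1 \<in> carrier A" "f2 \<in> carrier A" and j: "j1 \<in> {0..<int q}" "j2 \<in> {0..<int q}"
   using xy ee by (auto simp: carrier_E)
  have "j1 = j2" "v \<otimes> f1 = v \<otimes> f2" using eq f j vc g unfolding ee by (auto simp: h)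
  hence "f1 = f2" using v(1) f by (metis Units_l_cancel)
  thus "x = y" using \<open>j1 = j2\<close> ee by simp
 qed
 have "h ` carrier E = carrier E"
 proof (rule endo_inj_surj[OF _ _ inj])
  show "finite (carrier E)" using finite_carrier by (simp add: carrier_E)
  show "h ` carrier E \<subseteq> carrier E" using hom by (auto simp: hom_def)
 qed
 hence "h \<in> iso E E" using hom inj by (simp add: iso_def bij_betw_def)
 moreover have "h \<in> extensional (carrier E)" by (simp add: h_def aut_of_def)
 moreover have "snd (h x) = snd x" if "x \<in> carrier E" for x using that by (cases x) (auto simp: carrier_E h)
 ultimately show ?thesis by (simp add: auts_def e h_def)
qed

lemma power_of_lift:
 assumes a: "a \<in> hom E E" and g: "a (\<zero>, 1) = (g, 1)" "g \<in> carrier A"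
 shows "m < q ==> a (\<zero>, int m) = (geometric s m \<otimes> g, int m)"
proof (induction m)
 case 0
 interpret E: group E by (rule group_E)
 have "a \<one>\<^bsub>E\<^esub> = \<one>\<^bsub>E\<^esub>" using a by (simp add: hom_one group_E)
 thus ?case using g by (simp add: one_E)
next
 case (Suc m)
 have m: "int m \<in> {0..<int q}" "1 \<in> {0..<int q}" using Suc.prems q_gt_1 by auto
 have "(\<zero>, int m) \<otimes>\<^bsub>E\<^esub> (\<zero>, 1) = (\<zero>, int (Suc m))"
  using Suc.prems m by (simp add: E_mult carry_def add.commute)
 hence "a (\<zero>, int (Suc m)) = a (\<zero>, int m) \<otimes>\<^bsub>E\<^esub> a (\<zero>, 1)"
  using hom_mult[OF a, of "(\<zero>, int m)" "(\<zero>, 1)"] m by (simp add: carrier_E)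
 also have "\<dots> = (geometric s m \<otimes> g \<oplus> s [^] m \<otimes> g, int (Suc m))"
  using Suc m g by (simp add: E_mult carry_def add.commute)
 also have "geometric s m \<otimes> g \<oplus> s [^] m \<otimes> g = geometric s (Suc m) \<otimes> g"
  using g(2) by (simp add: geometric_Suc l_distr)
 finally show ?case .
qed

lemma auts_eq: "auts = aut_of ` aut_params"
proof
 show "aut_of ` aut_params \<subseteq> auts" using aut_of_in_auts by blast
 show "auts \<subseteq> aut_of ` aut_params"
 proof
  fix a assume a: "a \<in> auts"
  interpret E: group E by (rule group_E)
  have hom: "a \<in> hom E E" and bij: "bij_betw a (carrier E) (carrier E)" and ext: "a \<in> extensional (carrier E)"
   and snd_a: "\<And>x. x \<in> carrier E ==> snd (a x) = snd x"
   using a by (auto simp: auts_def iso_def)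
  have z: "0 \<in> {0..<int q}" "1 \<in> {0..<int q}" using q_gt_1 by auto
  define \<alpha> where "\<alpha> = (\<lambda>f. fst (a (f, 0)))"
  have \<alpha>: "a (f, 0) = (\<alpha> f, 0)" "\<alpha> f \<in> carrier A" if f: "f \<in> carrier A" for f
  proof -
   have m: "(f, 0) \<in> carrier E" using f z by (simp add: carrier_E)
   show "a (f, 0) = (\<alpha> f, 0)" using snd_a[OF m] by (simp add: \<alpha>_def prod_eq_iff)
   show "\<alpha> f \<in> carrier A" using hom_in_carrier[OF hom m] by (auto simp: \<alpha>_def carrier_E)
  qed
  define g where "g = fst (a (\<zero>, 1))"
  have m1: "(\<zero>, 1) \<in> carrier E" using z by (simp add: carrier_E)
  have g: "a (\<zero>, 1) = (g, 1)" "g \<in> carrier A"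
   using snd_a[OF m1] hom_in_carrier[OF hom m1] by (auto simp: g_def carrier_E prod_eq_iff)
  have add: "\<alpha> (x \<oplus> y) = \<alpha> x \<oplus> \<alpha> y" if xy: "x \<in> carrier A" "y \<in> carrier A" for x y
  proof -
   have "(x, 0) \<otimes>\<^bsub>E\<^esub> (y, 0) = (x \<oplus> y, 0)" using xy z by (simp add: E_mult carry_def)
   hence "a (x \<oplus> y, 0) = a (x, 0) \<otimes>\<^bsub>E\<^esub> a (y, 0)"
    using hom_mult[OF hom, of "(x, 0)" "(y, 0)"] xy z by (simp add: carrier_E)
   thus ?thesis using \<alpha> xy z by (simp add: E_mult carry_def)
  qed
  have s\<alpha>: "\<alpha> (s \<otimes> x) = s \<otimes> \<alpha> x" if x: "x \<in> carrier A" for x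
  proof -
   have mem: "(x, 0) \<in> carrier E" "(s \<otimes> x, 0) \<in> carrier E" using x z by (simp_all add: carrier_E)
   have "(\<zero>, 1) \<otimes>\<^bsub>E\<^esub> (x, 0) = (s \<otimes> x, 0) \<otimes>\<^bsub>E\<^esub> (\<zero>, 1)"
    using x z q_gt_1 by (simp add: E_mult carry_def)
   hence "a (\<zero>, 1) \<otimes>\<^bsub>E\<^esub> a (x, 0) = a (s \<otimes> x, 0) \<otimes>\<^bsub>E\<^esub> a (\<zero>, 1)"
    using hom_mult[OF hom m1 mem(1)] hom_mult[OF hom mem(2) m1] by simp
   hence "g \<oplus> s \<otimes> \<alpha> x = \<alpha> (s \<otimes> x) \<oplus> g"
    using x \<alpha>[OF x] \<alpha>[of "s \<otimes> x"] g z q_gt_1 by (simp add: E_mult carry_def)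
   thus ?thesis using g(2) \<alpha>(2)[OF x] \<alpha>(2)[of "s \<otimes> x"] x by (simp add: a_comm[of _ g])
  qed
  define v where "v = \<alpha> \<one>"
  have v: "v \<in> carrier A" using \<alpha>(2) by (simp add: v_def)
  have lin: "\<alpha> x = v \<otimes> x" if "x \<in> carrier A" for x
   unfolding v_def by (rule additive_linear) (use \<alpha>(2) add s\<alpha> that in auto)
  have "(\<one>, 0) \<in> a ` carrier E" using bij z by (simp add: bij_betw_def carrier_E)
  then obtain y where y: "y \<in> carrier E" "a y = (\<one>, 0)" by auto
  have "snd y = 0" using snd_a[OF y(1)] y(2) by simp
  hence "\<alpha> (fst y) = \<one>" "fst y \<in> carrier A" using y \<alpha>[of "fst y"] by (auto simp: carrier_E prod_eq_iff)
  hence "v \<otimes> fst y = \<one>" using lin by simp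
  hence vU: "v \<in> Units A" using \<open>fst y \<in> carrier A\<close> v m_comm[of v "fst y"] unfolding Units_def by auto
  have a0: "a (\<zero>, j) = (geometric s (nat j) \<otimes> g, j)" if "j \<in> {0..<int q}" for j
   using power_of_lift[OF hom g, of "nat j"] that by (simp add: nat_less_iff)
  have "(c, 0) = (\<zero>, int q - 1) \<otimes>\<^bsub>E\<^esub> (\<zero>, 1)"
   using z by (subst E_mult) (auto simp: carry_def)
  hence "a (c, 0) = a (\<zero>, int q - 1) \<otimes>\<^bsub>E\<^esub> a (\<zero>, 1)"
   using hom_mult[OF hom, of "(\<zero>, int q - 1)" "(\<zero>, 1)"] z by (simp add: carrier_E)
  also have "\<dots> = (geometric s (q - 1) \<otimes> g \<oplus> s [^] (q - 1) \<otimes> g \<oplus> c, 0)"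
   using z g by (subst a0, simp, subst g, subst E_mult) (auto simp: carry_def nat_diff_distrib)
  also have "geometric s (q - 1) \<otimes> g \<oplus> s [^] (q - 1) \<otimes> g = geometric s (Suc (q - 1)) \<otimes> g"
   using g(2) by (simp add: geometric_Suc l_distr)
  also have "\<dots> = \<zero>" using q_gt_1 geometric_q g(2) by simp
  finally have vc: "v \<otimes> c = c" using \<alpha>(1)[OF c_closed] lin[OF c_closed] by simp
  have "a = aut_of (v, g)"
  proof (rule extensionalityI[OF ext])
   show "aut_of (v, g) \<in> extensional (carrier E)" by (simp add: aut_of_def)
   fix x assume x: "x \<in> carrier E"
   obtain f j where e: "x = (f, j)" and f: "f \<in> carrier A" and j: "j \<in> {0..<int q}"
    using x by (cases x) (auto simp: carrier_E)
   have "(f, j) = (f, 0) \<otimes>\<^bsub>E\<^esub> (\<zero>, j)" using f j z by (simp add: E_mult carry_def)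
   hence "a x = a (f, 0) \<otimes>\<^bsub>E\<^esub> a (\<zero>, j)"
    using hom_mult[OF hom, of "(f, 0)" "(\<zero>, j)"] f j z e by (simp add: carrier_E)
   also have "\<dots> = (v \<otimes> f \<oplus> geometric s (nat j) \<otimes> g, j)"
    using \<alpha>[OF f] a0[OF j] lin[OF f] f j z g v by (simp add: E_mult carry_def)
   finally show "a x = aut_of (v, g) x" using e f j by (simp add: aut_of_def carrier_E)
  qed
  thus "a \<in> aut_of ` aut_params" using vU vc g by (auto simp: aut_params_def)
 qed
qed

lemma aut_of_inj: "inj_on aut_of aut_params"
proof (rule inj_onI)
 fix x y assume xy: "x \<in> aut_params" "y \<in> aut_params" and eq: "aut_of x = aut_of y"
 obtain v g v' g' where e: "x = (v, g)" "y = (v', g')" by (cases x, cases y)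
 have cl: "v \<in> carrier A" "g \<in> carrier A" "v' \<in> carrier A" "g' \<in> carrier A"
  using xy e by (auto simp: aut_params_def Units_closed)
 have z: "0 \<in> {0..<int q}" "1 \<in> {0..<int q}" using q_gt_1 by auto
 have "v = v'" using fun_cong[OF eq, of "(\<one>, 0)"] cl z unfolding e by (simp add: aut_of_def carrier_E)
 moreover have "g = g'" using fun_cong[OF eq, of "(\<zero>, 1)"] cl z unfolding e
  by (simp add: aut_of_def carrier_E geometric_Suc)
 ultimately show "x = y" using e by simp
qed

lemma card_auts: "finite auts" "card auts = card {v \<in> Units A. v \<otimes> c = c} * card (carrier A)" "auts \<noteq> {}"
proof -
 have fin: "finite aut_params" unfolding aut_params_def
  using finite_subset[of "{v \<in> Units A. v \<otimes> c = c}" "carrier A"] finite_carrier Units_closed by auto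
 show "finite auts" unfolding auts_eq using fin by simp
 show "card auts = card {v \<in> Units A. v \<otimes> c = c} * card (carrier A)"
  unfolding auts_eq using card_image[OF aut_of_inj] by (simp add: aut_params_def card_cartesian_product)
 have "(\<one>, \<zero>) \<in> aut_params" by (simp add: aut_params_def)
 thus "auts \<noteq> {}" unfolding auts_eq by blast
qed

end

section \<open>Units, and automorphisms over the cyclic quotient\<close>

context uniserial_ring
begin

lemma nat_mult_less_p_inject:
 assumes "k < p" "l < p" "x \<in> carrier A" "x \<noteq> \<zero>" "nat_mult k x = nat_mult l x" shows "k = l"
proof -
 have *: False if kl: "k < l" "l < p" "nat_mult k x = nat_mult l x" for k l
 proof -
  have "nat_mult l x = nat_mult k x \<oplus> nat_mult (l - k) x"
   using nat_mult_add[OF assms(3), of k "l - k"] kl(1) by simp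
  hence z: "nat_mult (l - k) x = \<zero>" using kl(3) assms(3) by (metis add.l_cancel_one' nat_mult_closed)
  have "\<not> p dvd (l - k)" using kl by (auto dest: dvd_imp_le)
  then obtain d where d: "nat_mult (l - k) \<one> \<otimes> nat_mult d \<one> = \<one>" using nat_mult_unit by blast
  have "x = nat_mult d \<one> \<otimes> (nat_mult (l - k) \<one> \<otimes> x)"
   using d assms(3) by (simp add: m_assoc[symmetric] m_comm[of "nat_mult d \<one>"])
  also have "nat_mult (l - k) \<one> \<otimes> x = \<zero>" using z nat_mult_eq[OF assms(3)] by simp
  finally show False using assms(4) by simp
 qed
 show ?thesis using *[of k l] *[of l k] assms by (cases k l rule: linorder_cases) auto
qed

text \<open>
 Every unit is uniquely a nonzero constant times a unit that fixes \<open>t^(i-1)\<close>, because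
 \<open>t\<close> annihilates \<open>t^(i-1)\<close> and the constant can be read off from the action on
 the socle. This is the source of the factor \<open>p - 1\<close>.
\<close>

lemma card_units:
 "card {v \<in> Units A. v \<otimes> \<zero> = \<zero>} = (p - 1) * card {v \<in> Units A. v \<otimes> t [^] (i - 1) = t [^] (i - 1)}"
proof -
 define T where "T = t [^] (i - 1)"
 define U where "U = {v \<in> Units A. v \<otimes> T = T}"
 have T: "T \<in> carrier A" "T \<noteq> \<zero>" using t_i1 by (simp_all add: T_def)
 have bij: "bij_betw (\<lambda>(k, u). nat_mult k \<one> \<otimes> u) ({1..<p} \<times> U) {v \<in> Units A. v \<otimes> \<zero> = \<zero>}"
  unfolding bij_betw_def
 proof (intro conjI inj_onI equalityI subsetI)
  fix x y assume xy: "x \<in> {1..<p} \<times> U" "y \<in> {1..<p} \<times> U"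
   and eq: "(case x of (k, u) => nat_mult k \<one> \<otimes> u) = (case y of (k, u) => nat_mult k \<one> \<otimes> u)"
  obtain k u l v where e: "x = (k, u)" "y = (l, v)" by (cases x, cases y)
  have k: "k < p" "l < p" "1 \<le> k" and u: "u \<in> carrier A" "v \<in> carrier A" "u \<otimes> T = T" "v \<otimes> T = T"
   using xy e by (auto simp: U_def Units_closed)
  have "nat_mult k \<one> \<otimes> u \<otimes> T = nat_mult l \<one> \<otimes> v \<otimes> T" using eq e by simp
  hence "nat_mult k T = nat_mult l T" using u T by (simp add: m_assoc nat_mult_left)
  hence kl: "k = l" using nat_mult_less_p_inject[OF k(1,2) T] by simp
  have "\<not> p dvd k" using k by (auto dest: dvd_imp_le)
  then obtain d where d: "nat_mult k \<one> \<otimes> nat_mult d \<one> = \<one>" using nat_mult_unit by blast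
  have "w = nat_mult d \<one> \<otimes> (nat_mult k \<one> \<otimes> w)" if "w \<in> carrier A" for w
   using d that by (simp add: m_assoc[symmetric] m_comm[of "nat_mult d \<one>"])
  hence "u = v" using eq e kl u by (metis case_prod_conv)
  thus "x = y" using e kl by simp
 next
  fix w assume "w \<in> (\<lambda>(k, u). nat_mult k \<one> \<otimes> u) ` ({1..<p} \<times> U)"
  then obtain k u where k: "1 \<le> k" "k < p" and u: "u \<in> Units A" and w: "w = nat_mult k \<one> \<otimes> u"
   by (auto simp: U_def)
  have "\<not> p dvd k" using k by (auto dest: dvd_imp_le)
  hence "nat_mult k \<one> \<in> Units A" using unit_decomposition[OF zero_closed, of k] by simp
  hence "w \<in> Units A" unfolding w using u by simp
  thus "w \<in> {v \<in> Units A. v \<otimes> \<zero> = \<zero>}" by (simp add: Units_closed)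
 next
  fix v assume "v \<in> {v \<in> Units A. v \<otimes> \<zero> = \<zero>}"
  hence v: "v \<in> Units A" "v \<in> carrier A" by (simp_all add: Units_closed)
  obtain k b where kb: "b \<in> carrier A" "v = nat_mult k \<one> \<oplus> t \<otimes> b" using decompose[OF v(2)] by blast
  define k' where "k' = k mod p"
  have kk: "nat_mult k' \<one> = nat_mult k \<one>" using nat_mult_mod[OF char] by (simp add: k'_def)
  have "\<not> p dvd k"
  proof
   assume "p dvd k"
   hence "v = t \<otimes> b" using kb nat_mult_dvd[OF char _ one_closed] by simp
   thus False using t_not_unit_multiple[OF kb(1)] v by simp
  qed
  hence nk: "\<not> p dvd k'" by (simp add: k'_def dvd_mod_iff)
  have k': "1 \<le> k'" "k' < p" using nk p_ge_2 by (auto simp: k'_def) (metis Suc_leI dvd_0_right gr0I)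
  obtain d where d: "nat_mult k' \<one> \<otimes> nat_mult d \<one> = \<one>" "\<not> p dvd d" using nat_mult_unit[OF nk] by blast
  define u where "u = nat_mult d \<one> \<otimes> v"
  have tT: "t \<otimes> T = \<zero>"
  proof -
   have "t \<otimes> T = t [^] Suc (i - 1)" by (simp add: T_def m_comm)
   thus ?thesis using t_i i_ge_3 by simp
  qed
  have "v \<otimes> T = nat_mult k' \<one> \<otimes> T \<oplus> b \<otimes> (t \<otimes> T)"
   unfolding kb(2) kk using kb(1) T by (simp add: l_distr m_comm[of t] m_assoc)
  hence vT: "v \<otimes> T = nat_mult k' \<one> \<otimes> T" using tT kb(1) T by simp
  have "u \<otimes> T = (nat_mult k' \<one> \<otimes> nat_mult d \<one>) \<otimes> T"
   unfolding u_def using v T vT by (simp add: m_assoc m_comm[of "nat_mult k' \<one>"])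
  hence "u \<otimes> T = T" using d T by simp
  moreover have "nat_mult d \<one> \<in> Units A" using unit_decomposition[OF zero_closed d(2)] by simp
  hence "u \<in> Units A" unfolding u_def using v by simp
  ultimately have "u \<in> U" by (simp add: U_def)
  moreover have "nat_mult k' \<one> \<otimes> u = v" unfolding u_def using d v by (simp add: m_assoc[symmetric])
  ultimately show "v \<in> (\<lambda>(k, u). nat_mult k \<one> \<otimes> u) ` ({1..<p} \<times> U)"
   using k' by (intro image_eqI[of _ _ "(k', u)"]) auto
 qed
 have "card {v \<in> Units A. v \<otimes> \<zero> = \<zero>} = card ({1..<p} \<times> U)" using bij_betw_same_card[OF bij] by simp
 thus ?thesis by (simp add: card_cartesian_product U_def T_def)
qed

lemma geometric_decompose: "\<exists>b\<in>carrier A. geometric s m = nat_mult m \<one> \<oplus> t \<otimes> b"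
proof (induction m)
 case 0 show ?case by (intro bexI[of _ \<zero>]) simp_all
next
 case (Suc m)
 then obtain b where b: "b \<in> carrier A" "geometric s m = nat_mult m \<one> \<oplus> t \<otimes> b" by blast
 have "geometric s (Suc m) = nat_mult m \<one> \<oplus> t \<otimes> b \<oplus> (\<one> \<oplus> t \<otimes> geometric s m)"
  using b geometric_telescope[OF t, of m] by (simp add: geometric_Suc)
 moreover have "a \<oplus> t \<otimes> b \<oplus> (\<one> \<oplus> t \<otimes> g) = (a \<oplus> \<one>) \<oplus> t \<otimes> (b \<oplus> g)" if "a \<in> carrier A" "g \<in> carrier A" for a g
  using that b(1) t by algebra
 ultimately have "geometric s (Suc m) = nat_mult (Suc m) \<one> \<oplus> t \<otimes> (b \<oplus> geometric s m)"
  by (simp add: nat_mult_Suc)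
 thus ?case using b(1) by (intro bexI[of _ "b \<oplus> geometric s m"]) simp_all
qed

text \<open>
 The semilinear map \<open>\<beta>\<close> belonging to \<open>\<sigma> \<mapsto> \<sigma>^u\<close>
 multiplies \<open>t^(i-1)\<close> by \<open>u^(i-1)\<close>, while the carry requires the factor
 \<open>u\<close>. Multiplication by a constant unit corrects this.
\<close>

lemma twisted_automorphism:
 assumes u: "coprime u p"
 obtains \<alpha> where "\<alpha> \<in> carrier A \<rightarrow> carrier A"
  "\<And>x y. x \<in> carrier A ==> y \<in> carrier A ==> \<alpha> (x \<oplus> y) = \<alpha> x \<oplus> \<alpha> y"
  "\<And>x (m::nat). x \<in> carrier A ==> \<alpha> (s [^] m \<otimes> x) = s [^] (u * m) \<otimes> \<alpha> x"
  "\<alpha> (t [^] (i - 1)) = nat_mult u (t [^] (i - 1))" "inj_on \<alpha> (carrier A)"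
proof -
 obtain \<beta> where \<beta>0: "\<beta> \<in> carrier A \<rightarrow> carrier A" "\<beta> \<one> = \<one>"
  "\<forall>x\<in>carrier A. \<forall>y\<in>carrier A. \<beta> (x \<oplus> y) = \<beta> x \<oplus> \<beta> y"
  "\<forall>x\<in>carrier A. \<beta> (s \<otimes> x) = s [^] u \<otimes> \<beta> x"
  using twist[OF u] by blast
 have c: "\<beta> x \<in> carrier A" if "x \<in> carrier A" for x using \<beta>0(1) that by auto
 note add = \<beta>0(3)[rule_format] and sb = \<beta>0(4)[rule_format]
 have b0: "\<beta> \<zero> = \<zero>"
 proof -
  have "\<beta> \<zero> \<oplus> \<beta> \<zero> = \<beta> \<zero>" using add[OF zero_closed zero_closed] by simp
  thus ?thesis using c[OF zero_closed] by (metis add.r_cancel_one')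
 qed
 define T where "T = t [^] (i - 1)"
 have T: "T \<in> carrier A" "T \<noteq> \<zero>" using t_i1 by (simp_all add: T_def)
 define G where "G = geometric s u"
 have G: "G \<in> carrier A" by (simp add: G_def)
 have tb: "\<beta> (t \<otimes> x) = t \<otimes> G \<otimes> \<beta> x" if x: "x \<in> carrier A" for x
 proof -
  have "\<beta> x \<oplus> \<beta> (t \<otimes> x) = \<beta> (s \<otimes> x)" using x by (simp add: l_distr add)
  also have "\<dots> = \<beta> x \<oplus> t \<otimes> G \<otimes> \<beta> x"
   using sb[OF x] geometric_telescope[OF t, of u] c[OF x] by (simp add: G_def l_distr)
  finally show ?thesis using c x G by simp
 qed
 have tmb: "\<beta> (t [^] m) = t [^] m \<otimes> G [^] m" for m :: nat
 proof (induction m)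
  case 0 thus ?case using \<beta>0(2) by simp
 next
  case (Suc m)
  have "\<beta> (t \<otimes> t [^] m) = t \<otimes> G \<otimes> (t [^] m \<otimes> G [^] m)" using tb[of "t [^] m"] Suc by simp
  thus ?case using G by (simp add: m_ac)
 qed
 define k where "k = nat_mult u \<one>"
 have k: "k \<in> carrier A" by (simp add: k_def)
 have TG: "T \<otimes> G = T \<otimes> k"
 proof -
  obtain b where b: "b \<in> carrier A" "G = k \<oplus> t \<otimes> b" using geometric_decompose by (auto simp: G_def k_def)
  have "T \<otimes> t = t [^] Suc (i - 1)" by (simp add: T_def)
  hence Tt: "T \<otimes> t = \<zero>" using t_i i_ge_3 by simp
  have "T \<otimes> G = T \<otimes> k \<oplus> (T \<otimes> t) \<otimes> b" unfolding b(2) using b(1) T k by (simp add: r_distr m_assoc)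
  thus ?thesis using Tt b(1) T k by simp
 qed
 have TGm: "T \<otimes> G [^] m = T \<otimes> k [^] m" for m :: nat
 proof (induction m)
  case (Suc m)
  have "T \<otimes> G [^] Suc m = (T \<otimes> G [^] m) \<otimes> G" using T G by (simp add: m_assoc)
  also have "\<dots> = (T \<otimes> G) \<otimes> k [^] m" using Suc T G k by (simp add: m_ac)
  finally show ?case using TG T k by (simp add: m_ac)
 qed simp
 have "\<not> p dvd u" using u p by (metis coprime_absorb_right not_prime_unit)
 then obtain d where d: "k \<otimes> nat_mult d \<one> = \<one>" "\<not> p dvd d" using nat_mult_unit by (auto simp: k_def)
 define l where "l = nat_mult d \<one>"
 have l: "l \<in> carrier A" "k \<otimes> l = \<one>" using d by (simp_all add: l_def)
 have lU: "l \<in> Units A" using unit_decomposition[OF zero_closed d(2)] by (simp add: l_def)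
 have kU: "k \<in> Units A" using l k m_comm[of k l] unfolding Units_def by auto
 define e where "e = k \<otimes> l [^] (i - 1)"
 have e: "e \<in> Units A" "e \<in> carrier A" using kU lU k l by (simp_all add: e_def Units_pow_closed)
 define \<alpha> where "\<alpha> = (\<lambda>x. e \<otimes> \<beta> x)"
 have binj: "x = \<zero>" if x: "x \<in> carrier A" "\<beta> x = \<zero>" for x
 proof (rule ccontr)
  assume "x \<noteq> \<zero>"
  then obtain y where y: "y \<in> carrier A" "y \<otimes> x = T" using multiple_of_socle[OF x(1)] by (auto simp: T_def)
  have "y \<otimes> x \<in> {x \<in> carrier A. \<beta> x = \<zero>}"
   by (rule stable_mult_closed) (use b0 add sb x y in auto)
  hence "T \<otimes> G [^] (i - 1) = \<zero>" using y tmb[of "i - 1"] by (simp add: T_def)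
  hence "T \<otimes> k [^] (i - 1) = \<zero>" using TGm by simp
  hence "T \<otimes> k [^] (i - 1) \<otimes> l [^] (i - 1) = \<zero>" using l by simp
  moreover have "k [^] (i - 1) \<otimes> l [^] (i - 1) = \<one>" using nat_pow_distrib[OF k l(1), of "i - 1"] l(2) by simp
  ultimately show False using T k l by (simp add: m_assoc)
 qed
 show ?thesis
 proof (rule that)
  show "\<alpha> \<in> carrier A \<rightarrow> carrier A" using c e by (auto simp: \<alpha>_def)
  show "\<alpha> (x \<oplus> y) = \<alpha> x \<oplus> \<alpha> y" if "x \<in> carrier A" "y \<in> carrier A" for x y
   using that c e by (simp add: \<alpha>_def add r_distr)
  show "\<alpha> (s [^] m \<otimes> x) = s [^] (u * m) \<otimes> \<alpha> x" if x: "x \<in> carrier A" for x and m :: nat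
   using x
  proof (induction m arbitrary: x)
   case 0 thus ?case using c e by (simp add: \<alpha>_def)
  next
   case (Suc m)
   have "\<alpha> (s [^] Suc m \<otimes> x) = \<alpha> (s [^] m \<otimes> (s \<otimes> x))" using Suc.prems by (simp add: m_assoc)
   also have "\<dots> = s [^] (u * m) \<otimes> (e \<otimes> (s [^] u \<otimes> \<beta> x))"
    using Suc.IH[of "s \<otimes> x"] Suc.prems sb by (simp add: \<alpha>_def)
   also have "\<dots> = (s [^] (u * m) \<otimes> s [^] u) \<otimes> \<alpha> x" using c[OF Suc.prems] e by (simp add: \<alpha>_def m_ac)
   finally show ?case by (simp add: nat_pow_mult add.commute)
  qed
  have "\<alpha> T = (k \<otimes> l [^] (i - 1)) \<otimes> (T \<otimes> k [^] (i - 1))"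
   using tmb[of "i - 1"] TGm[of "i - 1"] by (simp add: \<alpha>_def e_def T_def)
  also have "\<dots> = (k \<otimes> T) \<otimes> (k [^] (i - 1) \<otimes> l [^] (i - 1))" using k l T by (simp add: m_ac)
  also have "k [^] (i - 1) \<otimes> l [^] (i - 1) = \<one>" using nat_pow_distrib[OF k l(1), of "i - 1"] l(2) by simp
  finally show "\<alpha> (t [^] (i - 1)) = nat_mult u (t [^] (i - 1))"
   using T k by (simp add: T_def k_def nat_mult_left)
  show "inj_on \<alpha> (carrier A)"
  proof (rule inj_onI)
   fix x y assume xy: "x \<in> carrier A" "y \<in> carrier A" and eq: "\<alpha> x = \<alpha> y"
   have "\<beta> x = \<beta> y" using eq e c xy unfolding \<alpha>_def by (metis Units_l_cancel)
   moreover have "\<beta> x = \<beta> (x \<ominus> y) \<oplus> \<beta> y"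
    using add[of "x \<ominus> y" y] xy by (simp add: minus_eq a_assoc l_neg)
   ultimately have "\<beta> (x \<ominus> y) = \<zero>" using c xy by (metis add.r_cancel_one' minus_closed)
   hence "x \<ominus> y = \<zero>" using binj[of "x \<ominus> y"] xy by simp
   thus "x = y" using xy by simp
  qed
 qed
qed

end

text \<open>
 Carries of \<open>u m\<^sub>1\<close> and \<open>u m\<^sub>2\<close> compared with \<open>u\<close> times
 the carry of \<open>m\<^sub>1\<close> and \<open>m\<^sub>2\<close>: the two differ by a coboundary.
\<close>

lemma div_carry:
 fixes u m1 m2 q :: nat
 assumes "q > 0"
 shows "u * ((m1 + m2) mod q) div q + u * ((m1 + m2) div q)
  = u * m1 div q + u * m2 div q + (u * m1 mod q + u * m2 mod q) div q"
proof -
 have "u * (m1 + m2) = u * ((m1 + m2) mod q) + u * ((m1 + m2) div q) * q"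
  using mod_div_mult_eq[of "m1 + m2" q] by (metis distrib_left mult.assoc)
 hence "u * (m1 + m2) div q = u * ((m1 + m2) mod q) div q + u * ((m1 + m2) div q)"
  using assms by simp
 moreover have "u * (m1 + m2) div q = u * m1 div q + u * m2 div q + (u * m1 mod q + u * m2 mod q) div q"
  unfolding distrib_left by (rule div_add1_eq)
 ultimately show ?thesis by simp
qed

context ext_group
begin

lemma carry_nat: "j \<in> {0..<int q} ==> k \<in> {0..<int q} ==> carry j k = nat_mult ((nat j + nat k) div q) c"
proof -
 assume jk: "j \<in> {0..<int q}" "k \<in> {0..<int q}"
 show ?thesis
 proof (cases "j + k < int q")
  case True
  hence "nat j + nat k < q" using jk by (simp add: nat_add_distrib[symmetric] nat_less_iff)
  thus ?thesis using True by (simp add: carry_def)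
 next
  case False
  hence "q \<le> nat j + nat k" "nat j + nat k < 2 * q" using jk by auto
  hence "(nat j + nat k) div q = 1" by (simp add: div_nat_eqI)
  thus ?thesis using False by (simp add: carry_def)
 qed
qed

lemma s_pow_nat_mult_c [simp]: "s [^] (m::nat) \<otimes> nat_mult k c = nat_mult k c"
 by (simp add: nat_mult_right)

text \<open>
 If \<open>w\<close> is multiplication by \<open>u\<close>, then \<open>(f, j) \<mapsto> (\<alpha> f +
 \<lfloor>u j / q\<rfloor> c, u j)\<close> is the automorphism, with \<open>\<alpha>\<close> semilinear for
 \<open>s \<mapsto> s^u\<close>; the floor term turns \<open>u\<close> times the carry into the carry of
 the multiplied exponents. Hence the choice of an identification of the Galois group of \<open>K\<close> is
 irrelevant for the existence of solutions.
\<close>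

lemma lift_automorphism:
 assumes w: "w \<in> iso (integer_mod_group q) (integer_mod_group q)"
 obtains a where "a \<in> iso E E" "\<And>x. x \<in> carrier E ==> snd (a x) = w (snd x)"
proof -
 have car: "carrier (integer_mod_group q) = {0..<int q}" using q_pos by (simp add: carrier_integer_mod_group)
 have hom: "w \<in> hom (integer_mod_group q) (integer_mod_group q)"
  and bij: "bij_betw w {0..<int q} {0..<int q}" using w car by (auto simp: iso_def)
 have z: "0 \<in> {0..<int q}" "1 \<in> {0..<int q}" using q_gt_1 by auto
 define u where "u = nat (w 1)"
 have w1: "w 1 \<in> {0..<int q}" using bij z(2) by (auto simp: bij_betw_def)
 have w0: "w 0 = 0" using hom_one[OF hom] by simp
 have wm: "w (int m) = int ((u * m) mod q)" if "m < q" for m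
  using that
 proof (induction m)
  case (Suc m)
  have "w ((int m + 1) mod int q) = (w (int m) + w 1) mod int q"
   using hom_mult[OF hom, of "int m" 1] Suc.prems z car by simp
  moreover have "(int m + 1) mod int q = int (Suc m)" using Suc.prems by simp
  moreover have "(int ((u * m) mod q) + w 1) mod int q = int ((u * Suc m) mod q)"
   using w1 by (simp add: u_def zmod_int mod_add_left_eq mod_add_right_eq distrib_left add.commute[of _ "w 1"])
  ultimately show ?case using Suc by simp
 qed (use w0 in simp)
 have wj: "w j = int ((u * nat j) mod q)" if "j \<in> {0..<int q}" for j
  using wm[of "nat j"] that by (simp add: nat_less_iff)
 have "1 \<in> w ` {0..<int q}" using bij z by (simp add: bij_betw_def)
 then obtain j where j: "j \<in> {0..<int q}" "w j = 1" by auto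
 have "int ((u * nat j) mod q) = 1" using wj[OF j(1)] j(2) by simp
 hence "[u * nat j = 1] (mod q)" using q_gt_1 by (simp add: cong_def)
 hence "coprime u q" using coprime_iff_invertible_nat[of u q] by auto
 moreover have "p dvd q" unfolding q_eq by simp
 ultimately have cop: "coprime u p" using coprime_divisors[of u u p q] by simp
 obtain \<alpha> where \<alpha>: "\<alpha> \<in> carrier A \<rightarrow> carrier A"
  and add: "\<And>x y. x \<in> carrier A ==> y \<in> carrier A ==> \<alpha> (x \<oplus> y) = \<alpha> x \<oplus> \<alpha> y"
  and s\<alpha>: "\<And>x (m::nat). x \<in> carrier A ==> \<alpha> (s [^] m \<otimes> x) = s [^] (u * m) \<otimes> \<alpha> x"
  and T: "\<alpha> (t [^] (i - 1)) = nat_mult u (t [^] (i - 1))" and inj: "inj_on \<alpha> (carrier A)"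
  using twisted_automorphism[OF cop] by blast
 have cl: "\<alpha> x \<in> carrier A" if "x \<in> carrier A" for x using \<alpha> that by auto
 have a0: "\<alpha> \<zero> = \<zero>"
 proof -
  have "\<alpha> \<zero> \<oplus> \<alpha> \<zero> = \<alpha> \<zero>" using add[OF zero_closed zero_closed] by simp
  thus ?thesis using cl[OF zero_closed] by (metis add.r_cancel_one')
 qed
 have \<alpha>c: "\<alpha> (nat_mult m c) = nat_mult (u * m) c" for m
 proof -
  have "\<alpha> c = nat_mult u c" using c T a0 by auto
  hence "\<alpha> (nat_mult m c) = nat_mult m (nat_mult u c)"
   by (induction m) (simp_all add: a0 nat_mult_Suc add)
  thus ?thesis by (simp add: nat_mult_mult)
 qed
 define h where "h = (\<lambda>(f, j). (\<alpha> f \<oplus> nat_mult ((u * nat j) div q) c, w j))"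
 have wr: "w j \<in> {0..<int q}" if "j \<in> {0..<int q}" for j using bij that by (auto simp: bij_betw_def)
 have hhom: "h \<in> hom E E"
 proof (rule homI)
  show "h x \<in> carrier E" if "x \<in> carrier E" for x
   using that cl wr by (auto simp: h_def carrier_E)
  show "h (x \<otimes>\<^bsub>E\<^esub> y) = h x \<otimes>\<^bsub>E\<^esub> h y" if xy: "x \<in> carrier E" "y \<in> carrier E" for x y
  proof -
   obtain f1 j1 f2 j2 where ee: "x = (f1, j1)" "y = (f2, j2)" by (cases x, cases y)
   have f: "f1 \<in> carrier A" "f2 \<in> carrier A" and j: "j1 \<in> {0..<int q}" "j2 \<in> {0..<int q}"
    using xy ee by (auto simp: carrier_E)
   define m1 m2 where "m1 = nat j1" and "m2 = nat j2"
   have nm: "nat ((j1 + j2) mod int q) = (m1 + m2) mod q"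
    using j by (simp add: nat_mod_distrib nat_add_distrib m1_def m2_def)
   have snd: "w ((j1 + j2) mod int q) = (w j1 + w j2) mod int q"
    using hom_mult[OF hom, of j1 j2] j car by simp
   have sw: "s [^] nat (w j1) = s [^] (u * m1)"
    using wj[OF j(1)] s_pow_mod[of "u * m1"] by (simp add: m1_def)
   have cw: "carry (w j1) (w j2) = nat_mult (((u * m1) mod q + (u * m2) mod q) div q) c"
    using carry_nat[OF wr[OF j(1)] wr[OF j(2)]] wj[OF j(1)] wj[OF j(2)] by (simp add: m1_def m2_def)
   have cj: "carry j1 j2 = nat_mult ((m1 + m2) div q) c" using carry_nat[OF j] by (simp add: m1_def m2_def)
   have "\<alpha> (f1 \<oplus> s [^] m1 \<otimes> f2 \<oplus> carry j1 j2) \<oplus> nat_mult ((u * ((m1 + m2) mod q)) div q) c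
    = \<alpha> f1 \<oplus> s [^] (u * m1) \<otimes> \<alpha> f2 \<oplus> (nat_mult (u * ((m1 + m2) div q)) c \<oplus> nat_mult ((u * ((m1 + m2) mod q)) div q) c)"
    unfolding cj using f cl by (simp add: add s\<alpha> \<alpha>c a_assoc)
   also have "nat_mult (u * ((m1 + m2) div q)) c \<oplus> nat_mult ((u * ((m1 + m2) mod q)) div q) c
     = nat_mult (u * m1 div q + u * m2 div q + (u * m1 mod q + u * m2 mod q) div q) c"
    using div_carry[of q u m1 m2] q_gt_1 nat_mult_add[OF c_closed] by (metis add.commute less_trans zero_less_one)
   also have "\<dots> = nat_mult (u * m1 div q) c \<oplus> nat_mult (u * m2 div q) c \<oplus> carry (w j1) (w j2)"
    unfolding cw by (simp add: nat_mult_add)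
   also have "\<alpha> f1 \<oplus> s [^] (u * m1) \<otimes> \<alpha> f2 \<oplus> (nat_mult (u * m1 div q) c \<oplus> nat_mult (u * m2 div q) c \<oplus> carry (w j1) (w j2))
    = \<alpha> f1 \<oplus> nat_mult (u * m1 div q) c \<oplus> s [^] (u * m1) \<otimes> (\<alpha> f2 \<oplus> nat_mult (u * m2 div q) c) \<oplus> carry (w j1) (w j2)"
   proof -
    have "a \<oplus> b \<otimes> d \<oplus> (k1 \<oplus> k2 \<oplus> k3) = a \<oplus> k1 \<oplus> b \<otimes> (d \<oplus> k2) \<oplus> k3"
     if "a \<in> carrier A" "b \<in> carrier A" "d \<in> carrier A" "k1 \<in> carrier A" "k2 \<in> carrier A" "k3 \<in> carrier A" "b \<otimes> k2 = k2"
     for a b d k1 k2 k3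
    proof -
     have "a \<oplus> k1 \<oplus> b \<otimes> (d \<oplus> k2) \<oplus> k3 = a \<oplus> k1 \<oplus> (b \<otimes> d \<oplus> b \<otimes> k2) \<oplus> k3" using that(1-6) by (simp add: r_distr)
     thus ?thesis unfolding that(7) using that(1-6) by (simp add: a_ac)
    qed
    thus ?thesis using f cl by simp
   qed
   finally show ?thesis
    unfolding ee using f j wr cl sw by (simp add: h_def E_mult snd nm m1_def[symmetric] m2_def[symmetric] del: atLeastLessThan_iff)
  qed
 qed
 have hinj: "inj_on h (carrier E)"
 proof (rule inj_onI)
  fix x y assume xy: "x \<in> carrier E" "y \<in> carrier E" and eq: "h x = h y"
  obtain f1 j1 f2 j2 where ee: "x = (f1, j1)" "y = (f2, j2)" by (cases x, cases y)
  have f: "f1 \<in> carrier A" "f2 \<in> carrier A" and j: "j1 \<in> {0..<int q}" "j2 \<in> {0..<int q}"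
   using xy ee by (auto simp: carrier_E)
  have "w j1 = w j2" using eq ee by (simp add: h_def)
  hence jj: "j1 = j2" using bij j by (auto simp: bij_betw_def dest: inj_onD)
  hence "\<alpha> f1 = \<alpha> f2" using eq ee f cl by (simp add: h_def)
  thus "x = y" using inj f ee jj by (auto dest: inj_onD)
 qed
 have "h ` carrier E = carrier E"
 proof (rule endo_inj_surj[OF _ _ hinj])
  show "finite (carrier E)" using finite_carrier by (simp add: carrier_E)
  show "h ` carrier E \<subseteq> carrier E" using hhom by (auto simp: hom_def)
 qed
 hence "h \<in> iso E E" using hhom hinj by (simp add: iso_def bij_betw_def)
 moreover have "snd (h x) = w (snd x)" for x by (cases x) (simp add: h_def)
 ultimately show ?thesis by (rule that)
qed

end

section \<open>The group algebra of a cyclic group of prime power order\<close>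

lemma sum_mod_mult:
 fixes a b :: "'i => int"
 shows "(\<Sum>y\<in>Y. (a y mod m) * b y) mod m = (\<Sum>y\<in>Y. a y * b y) mod m"
  "(\<Sum>y\<in>Y. a y * (b y mod m)) mod m = (\<Sum>y\<in>Y. a y * b y) mod m"
proof -
 have "[(\<Sum>y\<in>Y. (a y mod m) * b y) = (\<Sum>y\<in>Y. a y * b y)] (mod m)"
  "[(\<Sum>y\<in>Y. a y * (b y mod m)) = (\<Sum>y\<in>Y. a y * b y)] (mod m)"
  by (intro cong_sum cong_mult cong_refl; simp)+
 thus "(\<Sum>y\<in>Y. (a y mod m) * b y) mod m = (\<Sum>y\<in>Y. a y * b y) mod m"
  "(\<Sum>y\<in>Y. a y * (b y mod m)) mod m = (\<Sum>y\<in>Y. a y * b y) mod m"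
  by (simp_all only: cong_def)
qed

locale group_algebra =
 fixes p n :: nat
 assumes p: "Factorial_Ring.prime p" and n: "n \<ge> 1"
begin

definition q :: nat where "q = p ^ n"

lemma p_ge_2: "p \<ge> 2" using p by (rule prime_ge_2_nat)

lemma q_gt_1: "1 < q" unfolding q_def using one_less_power[of p n] p_ge_2 n by simp

abbreviation Z :: "int set" where "Z \<equiv> {0..<int q}"

abbreviation "R \<equiv> FpG p n"

lemma cyc_simps: "carrier (cyc p n) = Z" "x \<otimes>\<^bsub>cyc p n\<^esub> y = (x + y) mod int q"
 "\<one>\<^bsub>cyc p n\<^esub> = 0" "x \<in> Z ==> inv\<^bsub>cyc p n\<^esub> x = (- x) mod int q"
 using q_gt_1 p_ge_2 by (simp_all add: carrier_integer_mod_group q_def)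

sublocale base: residues "int p" "residue_ring (int p)"
 by unfold_locales (use p_ge_2 in auto)

lemma base_finsum: "finite Y ==> (\<And>y. y \<in> Y ==> f y \<in> carrier (residue_ring (int p))) ==>
  finsum (residue_ring (int p)) f Y = (\<Sum>y\<in>Y. f y) mod int p"
 by (induction Y rule: finite_induct)
   (auto simp: base.res_zero_eq base.res_add_eq base.finsum_insert Pi_def mod_add_right_eq)

lemma R_carrier: "carrier R = Z \<rightarrow>\<^sub>E {0..<int p}"
 by (auto simp: FpG_def group_ring_def cyc_simps base.res_carrier_eq)

lemma R_value: "f \<in> carrier R ==> x \<in> Z ==> f x \<in> {0..<int p}"
 by (auto simp: R_carrier PiE_def Pi_def)

lemma R_value_mod: "f \<in> carrier R ==> x \<in> Z ==> f x mod int p = f x"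
 using R_value by fastforce

lemma R_add: "f \<oplus>\<^bsub>R\<^esub> g = (\<lambda>x\<in>Z. (f x + g x) mod int p)"
 by (simp add: FpG_def group_ring_def cyc_simps base.res_add_eq)

lemma R_zero: "\<zero>\<^bsub>R\<^esub> = (\<lambda>x\<in>Z. 0)"
 by (simp add: FpG_def group_ring_def cyc_simps base.res_zero_eq)

lemma R_one: "\<one>\<^bsub>R\<^esub> = (\<lambda>x\<in>Z. if x = 0 then 1 else 0)"
 by (simp add: FpG_def group_ring_def cyc_simps base.res_zero_eq base.res_one_eq cong: if_cong)

lemma mod_Z [simp]: "x mod int q \<in> Z" using q_gt_1 by simp

lemma Z_mod [simp]: "x \<in> Z ==> x mod int q = x" by simp

lemma R_mult:
 assumes "f \<in> carrier R" "g \<in> carrier R"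
 shows "f \<otimes>\<^bsub>R\<^esub> g = (\<lambda>x\<in>Z. (\<Sum>y\<in>Z. f y * g ((x - y) mod int q)) mod int p)"
proof -
 have shift: "inv\<^bsub>cyc p n\<^esub> y \<otimes>\<^bsub>cyc p n\<^esub> x = (x - y) mod int q" if "y \<in> Z" for x y
  using that by (simp only: cyc_simps mod_add_left_eq) simp
 have "(\<Oplus>\<^bsub>residue_ring (int p)\<^esub>y\<in>carrier (cyc p n). f y \<otimes>\<^bsub>residue_ring (int p)\<^esub> g (inv\<^bsub>cyc p n\<^esub> y \<otimes>\<^bsub>cyc p n\<^esub> x))
   = (\<Sum>y\<in>Z. f y * g ((x - y) mod int q)) mod int p" for x
 proof -
  have "(\<Oplus>\<^bsub>residue_ring (int p)\<^esub>y\<in>Z. f y \<otimes>\<^bsub>residue_ring (int p)\<^esub> g (inv\<^bsub>cyc p n\<^esub> y \<otimes>\<^bsub>cyc p n\<^esub> x))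
    = (\<Sum>y\<in>Z. f y \<otimes>\<^bsub>residue_ring (int p)\<^esub> g (inv\<^bsub>cyc p n\<^esub> y \<otimes>\<^bsub>cyc p n\<^esub> x)) mod int p"
   by (rule base_finsum) (use p_ge_2 in \<open>auto simp: base.res_mult_eq base.res_carrier_eq\<close>)
  also have "\<dots> = (\<Sum>y\<in>Z. (f y * g ((x - y) mod int q)) mod int p) mod int p"
   by (intro arg_cong2[where f="(mod)"] sum.cong refl) (simp only: shift base.res_mult_eq)
  finally show ?thesis by (simp only: cyc_simps(1) mod_sum_eq)
 qed
 thus ?thesis unfolding FpG_def group_ring_def by (simp add: cyc_simps(1))
qed

lemma R_eqI: "f \<in> carrier R ==> g \<in> carrier R ==> (\<And>x. x \<in> Z ==> f x mod int p = g x mod int p) ==> f = g"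
 by (rule extensionalityI[of _ Z]) (auto simp: R_carrier PiE_def Pi_def)

lemma restrict_in_R: "(\<lambda>x\<in>Z. h x mod int p) \<in> carrier R"
 using p_ge_2 by (auto simp: R_carrier)

lemma sum_shift: "(\<Sum>y\<in>Z. h ((y + a) mod int q)) = (\<Sum>y\<in>Z. h y)" for h :: "int => int"
proof (rule sum.reindex_bij_witness[of _ "\<lambda>y. (y - a) mod int q" "\<lambda>y. (y + a) mod int q"])
qed (auto simp: mod_diff_left_eq mod_add_left_eq simp del: atLeastLessThan_iff)

lemma sum_reflect: "(\<Sum>y\<in>Z. h ((a - y) mod int q)) = (\<Sum>y\<in>Z. h y)" for h :: "int => int"
proof (rule sum.reindex_bij_witness[of _ "\<lambda>y. (a - y) mod int q" "\<lambda>y. (a - y) mod int q"])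
qed (auto simp: mod_diff_right_eq simp del: atLeastLessThan_iff)

lemma cring_R: "cring R"
proof (rule cringI)
 show "abelian_group R"
 proof (rule abelian_groupI)
  show "f \<oplus>\<^bsub>R\<^esub> g \<in> carrier R" for f g unfolding R_add by (rule restrict_in_R)
  show "\<zero>\<^bsub>R\<^esub> \<in> carrier R" using p_ge_2 by (auto simp: R_zero R_carrier)
  show "f \<oplus>\<^bsub>R\<^esub> g \<oplus>\<^bsub>R\<^esub> h = f \<oplus>\<^bsub>R\<^esub> (g \<oplus>\<^bsub>R\<^esub> h)" for f g h
   by (auto simp: R_add fun_eq_iff restrict_def mod_add_left_eq mod_add_right_eq add.assoc)
  show "f \<oplus>\<^bsub>R\<^esub> g = g \<oplus>\<^bsub>R\<^esub> f" for f g by (simp add: R_add add.commute)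
  show "\<zero>\<^bsub>R\<^esub> \<oplus>\<^bsub>R\<^esub> f = f" if f: "f \<in> carrier R" for f
   by (rule R_eqI) (use f in \<open>auto simp: R_add R_zero intro: restrict_in_R\<close>)
  show "\<exists>g\<in>carrier R. g \<oplus>\<^bsub>R\<^esub> f = \<zero>\<^bsub>R\<^esub>" if f: "f \<in> carrier R" for f
  proof (rule bexI[of _ "\<lambda>x\<in>Z. (- f x) mod int p"])
   show "(\<lambda>x\<in>Z. (- f x) mod int p) \<oplus>\<^bsub>R\<^esub> f = \<zero>\<^bsub>R\<^esub>"
    by (auto simp: R_add R_zero fun_eq_iff restrict_def mod_add_left_eq)
  qed (rule restrict_in_R)
 qed
 have closed: "f \<otimes>\<^bsub>R\<^esub> g \<in> carrier R" if "f \<in> carrier R" "g \<in> carrier R" for f g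
  unfolding R_mult[OF that] by (rule restrict_in_R)
 have one: "\<one>\<^bsub>R\<^esub> \<in> carrier R" using p_ge_2 by (auto simp: R_one R_carrier)
 have comm: "f \<otimes>\<^bsub>R\<^esub> g = g \<otimes>\<^bsub>R\<^esub> f" if fg: "f \<in> carrier R" "g \<in> carrier R" for f g
 proof -
  have "(\<Sum>y\<in>Z. f y * g ((x - y) mod int q)) = (\<Sum>y\<in>Z. g y * f ((x - y) mod int q))" for x
  proof -
   have "(\<Sum>y\<in>Z. g y * f ((x - y) mod int q))
     = (\<Sum>y\<in>Z. g ((x - y) mod int q) * f ((x - (x - y) mod int q) mod int q))"
    by (rule sum_reflect[of "\<lambda>y. g y * f ((x - y) mod int q)", symmetric])
   also have "\<dots> = (\<Sum>y\<in>Z. g ((x - y) mod int q) * f y)"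
    by (rule sum.cong) (auto simp: mod_diff_right_eq simp del: atLeastLessThan_iff)
   finally show ?thesis by (simp add: mult.commute)
  qed
  thus ?thesis using fg by (simp add: R_mult)
 qed
 show "Group.comm_monoid R"
 proof (rule comm_monoidI)
  show "\<one>\<^bsub>R\<^esub> \<otimes>\<^bsub>R\<^esub> f = f" if f: "f \<in> carrier R" for f
  proof (rule R_eqI[OF closed[OF one f] f])
   fix x assume x: "x \<in> Z"
   have "(\<Sum>y\<in>Z. \<one>\<^bsub>R\<^esub> y * f ((x - y) mod int q)) = (\<Sum>y\<in>Z. if y = 0 then f (x mod int q) else 0)"
    by (rule sum.cong) (auto simp: R_one)
   also have "\<dots> = f x" using x q_gt_1 by (simp add: sum.delta)
   finally show "(\<one>\<^bsub>R\<^esub> \<otimes>\<^bsub>R\<^esub> f) x mod int p = f x mod int p" using x by (simp add: R_mult[OF one f])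
  qed
  show "f \<otimes>\<^bsub>R\<^esub> g \<otimes>\<^bsub>R\<^esub> h = f \<otimes>\<^bsub>R\<^esub> (g \<otimes>\<^bsub>R\<^esub> h)"
   if fgh: "f \<in> carrier R" "g \<in> carrier R" "h \<in> carrier R" for f g h
  proof (rule R_eqI)
   fix x assume x: "x \<in> Z"
   have "(f \<otimes>\<^bsub>R\<^esub> g \<otimes>\<^bsub>R\<^esub> h) x mod int p
    = (\<Sum>y\<in>Z. ((\<Sum>z\<in>Z. f z * g ((y - z) mod int q)) mod int p) * h ((x - y) mod int q)) mod int p"
   proof -
    have "(f \<otimes>\<^bsub>R\<^esub> g) y = (\<Sum>z\<in>Z. f z * g ((y - z) mod int q)) mod int p" if "y \<in> Z" for y
     using that by (simp add: R_mult[OF fgh(1,2)])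
    thus ?thesis using x by (simp add: R_mult[OF closed[OF fgh(1,2)] fgh(3)])
   qed
   also have "\<dots> = (\<Sum>y\<in>Z. (\<Sum>z\<in>Z. f z * g ((y - z) mod int q)) * h ((x - y) mod int q)) mod int p"
    by (rule sum_mod_mult)
   also have "(\<Sum>y\<in>Z. (\<Sum>z\<in>Z. f z * g ((y - z) mod int q)) * h ((x - y) mod int q))
    = (\<Sum>z\<in>Z. f z * (\<Sum>y\<in>Z. g ((y - z) mod int q) * h ((x - y) mod int q)))"
    by (simp add: sum_distrib_left sum_distrib_right mult.assoc) (rule sum.swap)
   also have "\<dots> = (\<Sum>z\<in>Z. f z * (\<Sum>y\<in>Z. g y * h (((x - z) mod int q - y) mod int q)))"
   proof (rule sum.cong[OF refl])
    fix z
    have "(\<Sum>y\<in>Z. g ((y - z) mod int q) * h ((x - y) mod int q))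
      = (\<Sum>y\<in>Z. g (((y + z) mod int q - z) mod int q) * h ((x - (y + z) mod int q) mod int q))"
     by (rule sum_shift[of "\<lambda>y. g ((y - z) mod int q) * h ((x - y) mod int q)", symmetric])
    also have "\<dots> = (\<Sum>y\<in>Z. g y * h (((x - z) mod int q - y) mod int q))"
     by (rule sum.cong) (auto simp: mod_diff_left_eq mod_diff_right_eq algebra_simps simp del: atLeastLessThan_iff)
    finally show "f z * (\<Sum>y\<in>Z. g ((y - z) mod int q) * h ((x - y) mod int q))
      = f z * (\<Sum>y\<in>Z. g y * h (((x - z) mod int q - y) mod int q))" by (rule arg_cong)
   qed
   also have "\<dots> mod int p = (\<Sum>z\<in>Z. f z * ((\<Sum>y\<in>Z. g y * h (((x - z) mod int q - y) mod int q)) mod int p)) mod int p"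
    by (rule sum_mod_mult(2)[symmetric])
   also have "\<dots> = (f \<otimes>\<^bsub>R\<^esub> (g \<otimes>\<^bsub>R\<^esub> h)) x mod int p"
   proof -
    have "(g \<otimes>\<^bsub>R\<^esub> h) y = (\<Sum>z\<in>Z. g z * h ((y - z) mod int q)) mod int p" if "y \<in> Z" for y
     using that by (simp add: R_mult[OF fgh(2,3)])
    thus ?thesis using x by (simp add: R_mult[OF fgh(1) closed[OF fgh(2,3)]] del: atLeastLessThan_iff)
   qed
   finally show "(f \<otimes>\<^bsub>R\<^esub> g \<otimes>\<^bsub>R\<^esub> h) x mod int p = (f \<otimes>\<^bsub>R\<^esub> (g \<otimes>\<^bsub>R\<^esub> h)) x mod int p" .
  qed (use closed fgh in auto)
 qed (use closed one comm in auto)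
 show "(f \<oplus>\<^bsub>R\<^esub> g) \<otimes>\<^bsub>R\<^esub> h = f \<otimes>\<^bsub>R\<^esub> h \<oplus>\<^bsub>R\<^esub> g \<otimes>\<^bsub>R\<^esub> h"
  if fgh: "f \<in> carrier R" "g \<in> carrier R" "h \<in> carrier R" for f g h
 proof (rule R_eqI)
  have fg: "f \<oplus>\<^bsub>R\<^esub> g \<in> carrier R" unfolding R_add by (rule restrict_in_R)
  show "(f \<oplus>\<^bsub>R\<^esub> g) \<otimes>\<^bsub>R\<^esub> h \<in> carrier R" using closed fg fgh by blast
  show "f \<otimes>\<^bsub>R\<^esub> h \<oplus>\<^bsub>R\<^esub> g \<otimes>\<^bsub>R\<^esub> h \<in> carrier R" unfolding R_add by (rule restrict_in_R)
  fix x assume x: "x \<in> Z"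
  have "((f \<oplus>\<^bsub>R\<^esub> g) \<otimes>\<^bsub>R\<^esub> h) x mod int p = (\<Sum>y\<in>Z. ((f y + g y) mod int p) * h ((x - y) mod int q)) mod int p"
  proof -
   have "(f \<oplus>\<^bsub>R\<^esub> g) y = (f y + g y) mod int p" if "y \<in> Z" for y using that by (simp add: R_add)
   thus ?thesis using x by (simp add: R_mult[OF fg fgh(3)])
  qed
  also have "\<dots> = (\<Sum>y\<in>Z. (f y + g y) * h ((x - y) mod int q)) mod int p"
   by (rule sum_mod_mult)
  also have "\<dots> = (f \<otimes>\<^bsub>R\<^esub> h \<oplus>\<^bsub>R\<^esub> g \<otimes>\<^bsub>R\<^esub> h) x mod int p"
   using x fgh by (simp add: R_add R_mult distrib_right sum.distrib mod_add_eq)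
  finally show "((f \<oplus>\<^bsub>R\<^esub> g) \<otimes>\<^bsub>R\<^esub> h) x mod int p = (f \<otimes>\<^bsub>R\<^esub> h \<oplus>\<^bsub>R\<^esub> g \<otimes>\<^bsub>R\<^esub> h) x mod int p" .
 qed
qed

end

section \<open>The two group extensions as instances\<close>

lemma (in cring) Idl_singleton:
 assumes "a \<in> carrier R" "x \<in> Idl {a}" shows "\<exists>y\<in>carrier R. x = y \<otimes> a"
 using assms cgenideal_eq_genideal[OF assms(1)] by (auto simp: cgenideal_def)

context group_algebra
begin

sublocale R: cring R by (rule cring_R)

definition \<sigma> :: "int => int" where "\<sigma> = sigma_pow p n 1"

definition \<tau> :: "int => int" where "\<tau> = \<sigma> \<ominus>\<^bsub>R\<^esub> \<one>\<^bsub>R\<^esub>"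

lemma sigma_pow_eq: "sigma_pow p n j = (\<lambda>x\<in>Z. if x = j then 1 else 0)"
 by (simp add: sigma_pow_def group_ring_of_def cyc_simps base.res_zero_eq base.res_one_eq cong: if_cong)

lemma sigma_pow_closed [simp]: "sigma_pow p n j \<in> carrier R"
 using p_ge_2 by (auto simp: sigma_pow_eq R_carrier)

lemma \<sigma>_closed [simp]: "\<sigma> \<in> carrier R" by (simp add: \<sigma>_def)

lemma \<tau>_closed [simp]: "\<tau> \<in> carrier R" by (simp add: \<tau>_def)

lemma \<sigma>_eq: "\<sigma> = \<one>\<^bsub>R\<^esub> \<oplus>\<^bsub>R\<^esub> \<tau>"
proof -
 have "a = b \<oplus>\<^bsub>R\<^esub> (a \<ominus>\<^bsub>R\<^esub> b)" if "a \<in> carrier R" "b \<in> carrier R" for a b using that by algebra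
 thus ?thesis unfolding \<tau>_def by simp
qed

lemma sigma_minus_one_pow_eq: "sigma_minus_one_pow p n k = \<tau> [^]\<^bsub>R\<^esub> k"
 by (simp add: sigma_minus_one_pow_def \<tau>_def \<sigma>_def)

lemma mult_\<sigma>:
 assumes f: "f \<in> carrier R" and x: "x \<in> Z" and j: "j \<in> Z"
 shows "(sigma_pow p n j \<otimes>\<^bsub>R\<^esub> f) x = f ((x - j) mod int q)"
proof -
 have "(\<Sum>y\<in>Z. sigma_pow p n j y * f ((x - y) mod int q)) = (\<Sum>y\<in>Z. if y = j then f ((x - j) mod int q) else 0)"
  by (rule sum.cong) (auto simp: sigma_pow_eq)
 also have "\<dots> = f ((x - j) mod int q)" using j by (simp add: sum.delta)
 finally show ?thesis
  using x R_value_mod[OF f mod_Z] by (simp add: R_mult[OF sigma_pow_closed f])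
qed

lemma \<sigma>_power: "m < q ==> \<sigma> [^]\<^bsub>R\<^esub> m = sigma_pow p n (int m)"
proof (induction m)
 case 0 show ?case by (simp add: sigma_pow_eq R_one)
next
 case (Suc m)
 have z1: "1 \<in> Z" using q_gt_1 by simp
 have eq: "\<sigma> [^]\<^bsub>R\<^esub> Suc m = sigma_pow p n 1 \<otimes>\<^bsub>R\<^esub> sigma_pow p n (int m)"
  using Suc by (simp add: \<sigma>_def R.m_comm)
 show ?case unfolding eq
 proof (rule R_eqI)
  fix x assume x: "x \<in> Z"
  have "(x - 1) mod int q = int m \<longleftrightarrow> x = int (Suc m)"
  proof
   assume "(x - 1) mod int q = int m"
   hence "((x - 1) mod int q + 1) mod int q = (int m + 1) mod int q" by simp
   thus "x = int (Suc m)" using x Suc.prems by (simp add: mod_add_left_eq)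
  qed (use Suc.prems in simp)
  thus "(sigma_pow p n 1 \<otimes>\<^bsub>R\<^esub> sigma_pow p n (int m)) x mod int p = sigma_pow p n (int (Suc m)) x mod int p"
   using x mult_\<sigma>[OF sigma_pow_closed x z1] mod_Z[of "x - 1"] by (simp add: sigma_pow_eq)
 qed simp_all
qed

lemma \<sigma>_q: "\<sigma> [^]\<^bsub>R\<^esub> q = \<one>\<^bsub>R\<^esub>"
proof -
 have z1: "1 \<in> Z" using q_gt_1 by simp
 have "\<sigma> [^]\<^bsub>R\<^esub> Suc (q - 1) = sigma_pow p n 1 \<otimes>\<^bsub>R\<^esub> sigma_pow p n (int (q - 1))"
 proof -
  have "\<sigma> [^]\<^bsub>R\<^esub> Suc (q - 1) = \<sigma> [^]\<^bsub>R\<^esub> (q - 1) \<otimes>\<^bsub>R\<^esub> \<sigma>" by (rule R.nat_pow_Suc)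
  also have "\<dots> = \<sigma> \<otimes>\<^bsub>R\<^esub> sigma_pow p n (int (q - 1))"
   using \<sigma>_power[of "q - 1"] q_gt_1 R.m_comm[OF sigma_pow_closed \<sigma>_closed] by simp
  finally show ?thesis by (simp only: \<sigma>_def)
 qed
 also have "\<dots> = \<one>\<^bsub>R\<^esub>"
 proof (rule R_eqI)
  fix x assume x: "x \<in> Z"
  have "(x - 1) mod int q = int (q - 1) \<longleftrightarrow> x = 0"
  proof
   assume "(x - 1) mod int q = int (q - 1)"
   hence "((x - 1) mod int q + 1) mod int q = (int (q - 1) + 1) mod int q" by simp
   thus "x = 0" using x q_gt_1 by (simp add: mod_add_left_eq)
  next
   assume "x = 0"
   have "(x - 1) mod int q = (int q - 1) mod int q" using \<open>x = 0\<close> by (simp add: mod_diff_left_eq[symmetric])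
   thus "(x - 1) mod int q = int (q - 1)" using q_gt_1 zmod_minus1[of "int q"] by simp
  qed
  thus "(sigma_pow p n 1 \<otimes>\<^bsub>R\<^esub> sigma_pow p n (int (q - 1))) x mod int p = \<one>\<^bsub>R\<^esub> x mod int p"
   using x mult_\<sigma>[OF sigma_pow_closed x z1] mod_Z[of "x - 1"] by (simp add: sigma_pow_eq R_one)
 qed simp_all
 finally show ?thesis using q_gt_1 by simp
qed

lemma R_nat_mult: "f \<in> carrier R ==> R.nat_mult k f = (\<lambda>x\<in>Z. (int k * f x) mod int p)"
proof (induction k)
 case 0 show ?case by (simp add: R_zero)
next
 case (Suc k)
 thus ?case by (auto simp: R.nat_mult_Suc R_add fun_eq_iff restrict_def mod_add_left_eq mod_add_right_eq distrib_right add.commute)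
qed

lemma R_char: "R.nat_mult p \<one>\<^bsub>R\<^esub> = \<zero>\<^bsub>R\<^esub>"
 by (simp add: R_nat_mult R_zero)

lemma \<tau>_q: "\<tau> [^]\<^bsub>R\<^esub> q = \<zero>\<^bsub>R\<^esub>"
proof -
 have "\<one>\<^bsub>R\<^esub> \<oplus>\<^bsub>R\<^esub> \<tau> [^]\<^bsub>R\<^esub> q = \<one>\<^bsub>R\<^esub>"
  using R.frobenius_add[OF p R_char R.one_closed \<tau>_closed, of n] \<sigma>_q by (simp add: \<sigma>_eq[symmetric] q_def)
 thus ?thesis by (metis R.add.l_cancel_one R.nat_pow_closed R.one_closed \<tau>_closed)
qed

text \<open>
 The monomial with the largest exponent in \<open>(\<sigma> - 1)^k\<close> is \<open>\<sigma>^k\<close>,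
 which does not wrap around while \<open>k < q\<close>.
\<close>

lemma \<tau>_power_value:
 "k < q ==> (\<tau> [^]\<^bsub>R\<^esub> k) (int k) = 1 \<and> (\<forall>x\<in>Z. int k < x \<longrightarrow> (\<tau> [^]\<^bsub>R\<^esub> k) x = 0)"
proof (induction k)
 case 0 thus ?case using q_gt_1 by (simp add: R_one)
next
 case (Suc k)
 let ?g = "\<tau> [^]\<^bsub>R\<^esub> k"
 have z1: "1 \<in> Z" using q_gt_1 by simp
 have g: "?g \<in> carrier R" by simp
 have eq: "\<tau> [^]\<^bsub>R\<^esub> Suc k \<oplus>\<^bsub>R\<^esub> ?g = \<sigma> \<otimes>\<^bsub>R\<^esub> ?g"
  unfolding \<sigma>_eq by (simp add: R.l_distr R.m_comm[of ?g \<tau>] R.a_comm[of ?g])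
 have val: "((\<tau> [^]\<^bsub>R\<^esub> Suc k) x + ?g x) mod int p = ?g (x - 1)" if x: "x \<in> Z" "0 < x" for x
 proof -
  have "((\<tau> [^]\<^bsub>R\<^esub> Suc k) x + ?g x) mod int p = (\<tau> [^]\<^bsub>R\<^esub> Suc k \<oplus>\<^bsub>R\<^esub> ?g) x"
   using x by (simp add: R_add)
  also have "\<dots> = ?g ((x - 1) mod int q)" unfolding eq \<sigma>_def using mult_\<sigma>[OF g x(1) z1] .
  finally show ?thesis using x by simp
 qed
 have cl: "\<tau> [^]\<^bsub>R\<^esub> Suc k \<in> carrier R" by (rule R.nat_pow_closed) simp
 have IH: "?g (int k) = 1" "\<And>x. x \<in> Z ==> int k < x ==> ?g x = 0" using Suc by auto
 have red: "(\<tau> [^]\<^bsub>R\<^esub> Suc k) x mod int p = (\<tau> [^]\<^bsub>R\<^esub> Suc k) x" if "x \<in> Z" for x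
  using R_value_mod[OF cl that] .
 show ?case
 proof (intro conjI ballI impI)
  have m: "int (Suc k) \<in> Z" using Suc.prems by simp
  show "(\<tau> [^]\<^bsub>R\<^esub> Suc k) (int (Suc k)) = 1"
   using val[OF m] red[OF m] IH(1) IH(2)[OF m] by (simp del: R.nat_pow_Suc)
  show "(\<tau> [^]\<^bsub>R\<^esub> Suc k) x = 0" if x: "x \<in> Z" "int (Suc k) < x" for x
   using val[OF x(1)] red[OF x(1)] IH(2)[OF x(1)] IH(2)[of "x - 1"] x by (simp del: R.nat_pow_Suc)
 qed
qed

lemma \<tau>_power_nonzero: "\<tau> [^]\<^bsub>R\<^esub> (q - 1) \<noteq> \<zero>\<^bsub>R\<^esub>"
proof
 assume z: "\<tau> [^]\<^bsub>R\<^esub> (q - 1) = \<zero>\<^bsub>R\<^esub>"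
 have "(\<tau> [^]\<^bsub>R\<^esub> (q - 1)) (int (q - 1)) = 1" using \<tau>_power_value[of "q - 1"] q_gt_1 by simp
 thus False unfolding z using q_gt_1 by (simp add: R_zero)
qed

text \<open>
 The augmentation ideal is generated by \<open>\<sigma> - 1\<close>. The elements of the asserted form are
 closed under addition and multiplication by \<open>\<sigma>\<close>.
\<close>

lemma R_decompose:
 assumes "f \<in> carrier R" shows "\<exists>k. \<exists>b\<in>carrier R. f = R.nat_mult k \<one>\<^bsub>R\<^esub> \<oplus>\<^bsub>R\<^esub> \<tau> \<otimes>\<^bsub>R\<^esub> b"
proof -
 define D where "D = {f. \<exists>k. \<exists>b\<in>carrier R. f = R.nat_mult k \<one>\<^bsub>R\<^esub> \<oplus>\<^bsub>R\<^esub> \<tau> \<otimes>\<^bsub>R\<^esub> b}"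
 have Dadd: "f \<oplus>\<^bsub>R\<^esub> g \<in> D" if fg: "f \<in> D" "g \<in> D" for f g
 proof -
  obtain k b l d where e: "b \<in> carrier R" "f = R.nat_mult k \<one>\<^bsub>R\<^esub> \<oplus>\<^bsub>R\<^esub> \<tau> \<otimes>\<^bsub>R\<^esub> b"
   "d \<in> carrier R" "g = R.nat_mult l \<one>\<^bsub>R\<^esub> \<oplus>\<^bsub>R\<^esub> \<tau> \<otimes>\<^bsub>R\<^esub> d" using fg unfolding D_def by blast
  have "(x \<oplus>\<^bsub>R\<^esub> \<tau> \<otimes>\<^bsub>R\<^esub> b) \<oplus>\<^bsub>R\<^esub> (y \<oplus>\<^bsub>R\<^esub> \<tau> \<otimes>\<^bsub>R\<^esub> d) = (x \<oplus>\<^bsub>R\<^esub> y) \<oplus>\<^bsub>R\<^esub> \<tau> \<otimes>\<^bsub>R\<^esub> (b \<oplus>\<^bsub>R\<^esub> d)"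
   if "x \<in> carrier R" "y \<in> carrier R" for x y using that e(1,3) \<tau>_closed by algebra
  hence "f \<oplus>\<^bsub>R\<^esub> g = R.nat_mult (k + l) \<one>\<^bsub>R\<^esub> \<oplus>\<^bsub>R\<^esub> \<tau> \<otimes>\<^bsub>R\<^esub> (b \<oplus>\<^bsub>R\<^esub> d)"
   unfolding e by (simp add: R.nat_mult_add)
  thus ?thesis unfolding D_def using e(1,3) by blast
 qed
 have D0: "\<zero>\<^bsub>R\<^esub> \<in> D" unfolding D_def by (intro CollectI exI[of _ 0] bexI[of _ "\<zero>\<^bsub>R\<^esub>"]) simp_all
 have Dmult: "R.nat_mult k f \<in> D" if "f \<in> D" for k f
  using that D0 Dadd by (induction k) (auto simp: R.nat_mult_Suc)
 have D\<sigma>: "\<sigma> [^]\<^bsub>R\<^esub> m \<in> D" for m :: nat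
  unfolding D_def \<sigma>_eq R.geometric_telescope[OF \<tau>_closed]
  by (intro CollectI exI[of _ 1] bexI[of _ "R.geometric (\<one>\<^bsub>R\<^esub> \<oplus>\<^bsub>R\<^esub> \<tau>) m"]) simp_all
 have "f \<in> D" if "f \<in> carrier R" "\<forall>x\<in>Z. int m \<le> x \<longrightarrow> f x = 0" "m \<le> q" for m f
  using that
 proof (induction m arbitrary: f)
  case 0
  have "f = \<zero>\<^bsub>R\<^esub>" by (rule R_eqI[OF _ R.zero_closed]) (use 0 in \<open>auto simp: R_zero\<close>)
  thus ?case using D0 by simp
 next
  case (Suc m)
  define f' where "f' = (\<lambda>x\<in>Z. if x = int m then 0 else f x)"
  have f': "f' \<in> carrier R" using R_value[OF Suc.prems(1)] p_ge_2 by (auto simp: f'_def R_carrier)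
  have mZ: "int m \<in> Z" using Suc.prems(3) by simp
  have "f' \<in> D" by (rule Suc.IH[OF f']) (use Suc.prems in \<open>auto simp: f'_def\<close>)
  moreover have "R.nat_mult (nat (f (int m))) (\<sigma> [^]\<^bsub>R\<^esub> m) \<in> D" by (rule Dmult[OF D\<sigma>])
  moreover have "f = f' \<oplus>\<^bsub>R\<^esub> R.nat_mult (nat (f (int m))) (\<sigma> [^]\<^bsub>R\<^esub> m)"
  proof (rule R_eqI[OF Suc.prems(1)])
   fix x assume x: "x \<in> Z"
   have pos: "0 \<le> f (int m)" using R_value[OF Suc.prems(1) mZ] by simp
   have "R.nat_mult k (\<sigma> [^]\<^bsub>R\<^esub> m) x = (int k * (\<sigma> [^]\<^bsub>R\<^esub> m) x) mod int p" for k
    using R_nat_mult[of "\<sigma> [^]\<^bsub>R\<^esub> m" k] x by simp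
   moreover have "(\<sigma> [^]\<^bsub>R\<^esub> m) x = (if x = int m then 1 else 0)"
    using x Suc.prems(3) \<sigma>_power[of m] by (simp add: sigma_pow_eq)
   ultimately have "R.nat_mult k (\<sigma> [^]\<^bsub>R\<^esub> m) x = (if x = int m then int k mod int p else 0)" for k
    by simp
   with pos show "f x mod int p = (f' \<oplus>\<^bsub>R\<^esub> R.nat_mult (nat (f (int m))) (\<sigma> [^]\<^bsub>R\<^esub> m)) x mod int p"
    using x by (simp add: R_add f'_def)
  qed (use f' in simp)
  ultimately show ?case using Dadd by metis
 qed
 from this[OF assms, of q] have "f \<in> D" by simp
 thus ?thesis unfolding D_def by blast
qed

text \<open>
 The automorphism \<open>\<sigma> \<mapsto> \<sigma>^u\<close> of the group, extended linearly to the group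
 algebra; in terms of coefficient functions it is precomposition with multiplication by the inverse
 \<open>v\<close> of \<open>u\<close>.
\<close>

lemma substitution:
 assumes "coprime u p"
 obtains \<beta> where "\<beta> \<in> carrier R \<rightarrow> carrier R" "\<beta> \<one>\<^bsub>R\<^esub> = \<one>\<^bsub>R\<^esub>"
  "\<And>f g. f \<in> carrier R ==> g \<in> carrier R ==> \<beta> (f \<oplus>\<^bsub>R\<^esub> g) = \<beta> f \<oplus>\<^bsub>R\<^esub> \<beta> g"
  "\<And>f. f \<in> carrier R ==> \<beta> (\<sigma> \<otimes>\<^bsub>R\<^esub> f) = \<sigma> [^]\<^bsub>R\<^esub> (u mod q) \<otimes>\<^bsub>R\<^esub> \<beta> f"
proof -
 have "coprime u q" using assms by (simp add: q_def)
 then obtain v where v: "[u * v = 1] (mod q)" using cong_solve_coprime_nat[of u q] by auto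
 hence vi: "[int v * int u = 1] (mod int q)" by (metis cong_int_iff mult.commute of_nat_1 of_nat_mult)
 have uZ: "int (u mod q) \<in> Z" using q_gt_1 by simp
 define \<beta> where "\<beta> = (\<lambda>f. \<lambda>x\<in>Z. f ((int v * x) mod int q) :: int)"
 have cl: "\<beta> f \<in> carrier R" if "f \<in> carrier R" for f
  using R_value[OF that mod_Z] by (auto simp: \<beta>_def R_carrier)
 show ?thesis
 proof (rule that)
  show "\<beta> \<in> carrier R \<rightarrow> carrier R" using cl by simp
  show "\<beta> \<one>\<^bsub>R\<^esub> = \<one>\<^bsub>R\<^esub>"
  proof (rule R_eqI[OF cl])
   fix x assume x: "x \<in> Z"
   have "(int v * x) mod int q = 0 \<longleftrightarrow> x = 0"
   proof
    assume "(int v * x) mod int q = 0"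
    hence "[int u * (int v * x) = int u * 0] (mod int q)" by (intro cong_mult cong_refl) (simp add: cong_def)
    moreover have "[(int v * int u) * x = 1 * x] (mod int q)" using vi by (intro cong_mult cong_refl)
    ultimately have "[x = 0] (mod int q)" by (simp add: ac_simps) (metis cong_sym cong_trans)
    thus "x = 0" using x by (simp add: cong_def)
   qed simp
   thus "\<beta> \<one>\<^bsub>R\<^esub> x mod int p = \<one>\<^bsub>R\<^esub> x mod int p"
    using x mod_Z[of "int v * x"] by (simp add: \<beta>_def R_one del: atLeastLessThan_iff)
  qed simp_all
  show "\<beta> (f \<oplus>\<^bsub>R\<^esub> g) = \<beta> f \<oplus>\<^bsub>R\<^esub> \<beta> g" for f g
   using mod_Z by (auto simp: \<beta>_def R_add fun_eq_iff restrict_def simp del: atLeastLessThan_iff)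
  show "\<beta> (\<sigma> \<otimes>\<^bsub>R\<^esub> f) = \<sigma> [^]\<^bsub>R\<^esub> (u mod q) \<otimes>\<^bsub>R\<^esub> \<beta> f" if f: "f \<in> carrier R" for f
  proof (rule R_eqI)
   show "\<beta> (\<sigma> \<otimes>\<^bsub>R\<^esub> f) \<in> carrier R" using cl f by simp
   show "\<sigma> [^]\<^bsub>R\<^esub> (u mod q) \<otimes>\<^bsub>R\<^esub> \<beta> f \<in> carrier R" using cl f by simp
   fix x assume x: "x \<in> Z"
   have z1: "1 \<in> Z" using q_gt_1 by simp
   have "\<beta> (\<sigma> \<otimes>\<^bsub>R\<^esub> f) x = f (((int v * x) mod int q - 1) mod int q)"
    using x mult_\<sigma>[OF f mod_Z z1] by (simp add: \<beta>_def \<sigma>_def del: atLeastLessThan_iff)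
   also have "((int v * x) mod int q - 1) mod int q = (int v * ((x - int (u mod q)) mod int q)) mod int q"
   proof -
    have "[int v * x - 1 = int v * x - int v * int u] (mod int q)" using vi by (intro cong_diff cong_refl) (rule cong_sym)
    moreover have "int v * x - int v * int u = int v * (x - int u)" by (simp add: right_diff_distrib)
    ultimately have "(int v * x - 1) mod int q = (int v * (x - int u)) mod int q" by (simp add: cong_def)
    thus ?thesis by (simp add: mod_diff_left_eq mod_mult_right_eq zmod_int mod_diff_right_eq)
   qed
   also have "f \<dots> = (\<sigma> [^]\<^bsub>R\<^esub> (u mod q) \<otimes>\<^bsub>R\<^esub> \<beta> f) x"
    using x mult_\<sigma>[OF cl[OF f] x uZ] \<sigma>_power[of "u mod q"] q_gt_1 mod_Z[of "x - int (u mod q)"]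
    by (simp add: \<beta>_def del: atLeastLessThan_iff)
   finally show "\<beta> (\<sigma> \<otimes>\<^bsub>R\<^esub> f) x mod int p = (\<sigma> [^]\<^bsub>R\<^esub> (u mod q) \<otimes>\<^bsub>R\<^esub> \<beta> f) x mod int p" by simp
  qed
 qed
qed

end

locale truncated_group_algebra = group_algebra p n for p n :: nat +
 fixes i :: nat
 assumes i_lower: "p ^ (n - 1) + 2 \<le> i" and i_upper: "i < p ^ n"
begin

abbreviation "A \<equiv> A_mod p n i"
abbreviation "I \<equiv> A_ideal p n i"
abbreviation "cls \<equiv> A_class p n i"

lemma I_eq: "I = Idl\<^bsub>R\<^esub> {\<tau> [^]\<^bsub>R\<^esub> i}" by (simp add: A_ideal_def sigma_minus_one_pow_eq)

sublocale I: ideal I R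
 unfolding I_eq by (rule R.genideal_ideal) simp

sublocale A: cring A
 unfolding A_mod_def by (rule I.quotient_is_cring[OF cring_R])

lemma cls_hom: "ring_hom_ring R A cls"
 using I.rcos_ring_hom_ring unfolding A_mod_def A_class_def .

sublocale cls: ring_hom_ring R A cls by (rule cls_hom)

lemma cls_surj: "a \<in> carrier A ==> \<exists>f\<in>carrier R. a = cls f"
 by (auto simp: A_mod_def FactRing_def A_RCOSETS_def' A_class_def)

lemma cls_eq_zero: "f \<in> carrier R ==> cls f = \<zero>\<^bsub>A\<^esub> \<longleftrightarrow> f \<in> I"
 by (simp add: A_mod_def FactRing_def A_class_def) (metis I.Icarr I.a_rcos_const I.a_rcos_self)

lemma cls_nat_mult: "f \<in> carrier R ==> cls (R.nat_mult k f) = A.nat_mult k (cls f)"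
 by (induction k) (simp_all add: R.nat_mult_Suc A.nat_mult_Suc)

abbreviation "T \<equiv> cls \<tau>"

lemma one_plus_T: "\<one>\<^bsub>A\<^esub> \<oplus>\<^bsub>A\<^esub> T = cls \<sigma>" by (simp add: \<sigma>_eq)

text \<open>
 The substitution maps \<open>\<tau>\<close> to a multiple of \<open>\<tau>\<close>, so it preserves the
 ideal generated by \<open>\<tau>^i\<close> and descends to \<open>A\<close>.
\<close>

lemma cls_twist:
 assumes "coprime u p"
 shows "\<exists>\<alpha>. \<alpha> \<in> carrier A \<rightarrow> carrier A \<and> \<alpha> \<one>\<^bsub>A\<^esub> = \<one>\<^bsub>A\<^esub> \<and>
   (\<forall>x\<in>carrier A. \<forall>y\<in>carrier A. \<alpha> (x \<oplus>\<^bsub>A\<^esub> y) = \<alpha> x \<oplus>\<^bsub>A\<^esub> \<alpha> y) \<and>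
   (\<forall>x\<in>carrier A. \<alpha> ((\<one>\<^bsub>A\<^esub> \<oplus>\<^bsub>A\<^esub> T) \<otimes>\<^bsub>A\<^esub> x) = (\<one>\<^bsub>A\<^esub> \<oplus>\<^bsub>A\<^esub> T) [^]\<^bsub>A\<^esub> u \<otimes>\<^bsub>A\<^esub> \<alpha> x)"
proof -
 obtain \<beta> where \<beta>: "\<beta> \<in> carrier R \<rightarrow> carrier R" "\<beta> \<one>\<^bsub>R\<^esub> = \<one>\<^bsub>R\<^esub>"
  and add: "\<And>f g. f \<in> carrier R ==> g \<in> carrier R ==> \<beta> (f \<oplus>\<^bsub>R\<^esub> g) = \<beta> f \<oplus>\<^bsub>R\<^esub> \<beta> g"
  and sig: "\<And>f. f \<in> carrier R ==> \<beta> (\<sigma> \<otimes>\<^bsub>R\<^esub> f) = \<sigma> [^]\<^bsub>R\<^esub> (u mod q) \<otimes>\<^bsub>R\<^esub> \<beta> f"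
  using substitution[OF assms] by blast
 have cl: "\<beta> f \<in> carrier R" if "f \<in> carrier R" for f using \<beta> that by auto
 have pow: "\<sigma> [^]\<^bsub>R\<^esub> (u mod q) = \<sigma> [^]\<^bsub>R\<^esub> u"
 proof -
  have "\<sigma> [^]\<^bsub>R\<^esub> u = \<sigma> [^]\<^bsub>R\<^esub> (q * (u div q) + u mod q)" by simp
  also have "\<dots> = (\<sigma> [^]\<^bsub>R\<^esub> q) [^]\<^bsub>R\<^esub> (u div q) \<otimes>\<^bsub>R\<^esub> \<sigma> [^]\<^bsub>R\<^esub> (u mod q)"
   by (simp only: R.nat_pow_mult[symmetric] R.nat_pow_pow \<sigma>_closed)
  finally show ?thesis by (simp add: \<sigma>_q)
 qed
 define G where "G = R.geometric \<sigma> u"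
 have G: "G \<in> carrier R" by (simp add: G_def)
 have \<tau>\<beta>: "\<beta> (\<tau> \<otimes>\<^bsub>R\<^esub> f) = \<tau> \<otimes>\<^bsub>R\<^esub> G \<otimes>\<^bsub>R\<^esub> \<beta> f" if f: "f \<in> carrier R" for f
 proof -
  have "\<beta> f \<oplus>\<^bsub>R\<^esub> \<beta> (\<tau> \<otimes>\<^bsub>R\<^esub> f) = \<beta> (\<sigma> \<otimes>\<^bsub>R\<^esub> f)"
   unfolding \<sigma>_eq using f by (simp add: R.l_distr add)
  also have "\<dots> = \<beta> f \<oplus>\<^bsub>R\<^esub> \<tau> \<otimes>\<^bsub>R\<^esub> G \<otimes>\<^bsub>R\<^esub> \<beta> f"
   using sig[OF f] R.geometric_telescope[OF \<tau>_closed, of u] cl[OF f]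
   by (simp add: pow G_def \<sigma>_eq[symmetric] R.l_distr)
  finally show ?thesis using cl[OF f] cl[of "\<tau> \<otimes>\<^bsub>R\<^esub> f"] f G R.add.l_cancel[of "\<beta> f"] by simp
 qed
 have \<tau>m\<beta>: "\<beta> (f \<otimes>\<^bsub>R\<^esub> \<tau> [^]\<^bsub>R\<^esub> m) = G [^]\<^bsub>R\<^esub> m \<otimes>\<^bsub>R\<^esub> \<beta> f \<otimes>\<^bsub>R\<^esub> \<tau> [^]\<^bsub>R\<^esub> m" if f: "f \<in> carrier R" for f and m :: nat
  using f
 proof (induction m arbitrary: f)
  case 0 thus ?case using cl by simp
 next
  case (Suc m)
  have "\<beta> (f \<otimes>\<^bsub>R\<^esub> \<tau> [^]\<^bsub>R\<^esub> Suc m) = \<beta> ((\<tau> \<otimes>\<^bsub>R\<^esub> f) \<otimes>\<^bsub>R\<^esub> \<tau> [^]\<^bsub>R\<^esub> m)"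
   using Suc.prems by (simp add: R.m_ac)
  also have "\<dots> = G [^]\<^bsub>R\<^esub> m \<otimes>\<^bsub>R\<^esub> (\<tau> \<otimes>\<^bsub>R\<^esub> G \<otimes>\<^bsub>R\<^esub> \<beta> f) \<otimes>\<^bsub>R\<^esub> \<tau> [^]\<^bsub>R\<^esub> m"
   using Suc.IH[of "\<tau> \<otimes>\<^bsub>R\<^esub> f"] Suc.prems by (simp add: \<tau>\<beta>)
  finally show ?case using Suc.prems cl G by (simp add: R.m_ac)
 qed
 have I\<beta>: "\<beta> f \<in> I" if fI: "f \<in> I" for f
 proof -
  obtain h where h: "h \<in> carrier R" "f = h \<otimes>\<^bsub>R\<^esub> \<tau> [^]\<^bsub>R\<^esub> i"
   using R.Idl_singleton[of "\<tau> [^]\<^bsub>R\<^esub> i" f] fI unfolding I_eq by auto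
  have "\<tau> [^]\<^bsub>R\<^esub> i \<in> I" unfolding I_eq by (rule R.genideal_self') simp
  thus ?thesis unfolding h(2) \<tau>m\<beta>[OF h(1)] using G cl[OF h(1)] by (intro I.I_l_closed) auto
 qed
 have \<beta>0: "\<beta> \<zero>\<^bsub>R\<^esub> = \<zero>\<^bsub>R\<^esub>"
 proof -
  have "\<beta> \<zero>\<^bsub>R\<^esub> \<oplus>\<^bsub>R\<^esub> \<beta> \<zero>\<^bsub>R\<^esub> = \<beta> \<zero>\<^bsub>R\<^esub>" using add[OF R.zero_closed R.zero_closed] by simp
  thus ?thesis using cl[OF R.zero_closed] by (metis R.add.r_cancel_one')
 qed
 define \<alpha> where "\<alpha> = (\<lambda>a. cls (\<beta> (SOME f. f \<in> carrier R \<and> cls f = a)))"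
 have \<alpha>: "\<alpha> (cls f) = cls (\<beta> f)" if f: "f \<in> carrier R" for f
 proof -
  define g where "g = (SOME g. g \<in> carrier R \<and> cls g = cls f)"
  have g: "g \<in> carrier R \<and> cls g = cls f" unfolding g_def by (rule someI[of _ f]) (use f in simp)
  have d: "g \<ominus>\<^bsub>R\<^esub> f \<in> carrier R" using g f by simp
  have "cls (g \<ominus>\<^bsub>R\<^esub> f) = \<zero>\<^bsub>A\<^esub>" using g f by (simp add: R.minus_eq A.r_neg)
  hence "cls (\<beta> (g \<ominus>\<^bsub>R\<^esub> f)) = \<zero>\<^bsub>A\<^esub>" using I\<beta> cls_eq_zero cl d by blast
  moreover have "\<beta> g = \<beta> (g \<ominus>\<^bsub>R\<^esub> f) \<oplus>\<^bsub>R\<^esub> \<beta> f"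
   using add[OF d f] g f by (simp add: R.minus_eq R.a_assoc R.l_neg)
  ultimately have "cls (\<beta> g) = cls (\<beta> f)" using cl d f by simp
  thus ?thesis by (simp add: \<alpha>_def g_def)
 qed
 show ?thesis
 proof (intro exI[of _ \<alpha>] conjI ballI)
  show "\<alpha> \<in> carrier A \<rightarrow> carrier A" using cls_surj cl by (fastforce simp: \<alpha>)
  show "\<alpha> \<one>\<^bsub>A\<^esub> = \<one>\<^bsub>A\<^esub>" using \<alpha>[OF R.one_closed] \<beta>(2) by simp
  fix x assume "x \<in> carrier A"
  then obtain f where f: "f \<in> carrier R" "x = cls f" using cls_surj by blast
  have "\<alpha> (cls (\<sigma> \<otimes>\<^bsub>R\<^esub> f)) = cls (\<sigma> [^]\<^bsub>R\<^esub> u \<otimes>\<^bsub>R\<^esub> \<beta> f)" using \<alpha>[of "\<sigma> \<otimes>\<^bsub>R\<^esub> f"] f sig pow by simp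
  thus "\<alpha> ((\<one>\<^bsub>A\<^esub> \<oplus>\<^bsub>A\<^esub> T) \<otimes>\<^bsub>A\<^esub> x) = (\<one>\<^bsub>A\<^esub> \<oplus>\<^bsub>A\<^esub> T) [^]\<^bsub>A\<^esub> u \<otimes>\<^bsub>A\<^esub> \<alpha> x"
   unfolding one_plus_T f(2) using f(1) cl \<alpha> by (simp add: cls.hom_nat_pow)
  fix y assume "y \<in> carrier A"
  then obtain g where g: "g \<in> carrier R" "y = cls g" using cls_surj by blast
  have "\<alpha> (cls (f \<oplus>\<^bsub>R\<^esub> g)) = cls (\<beta> f \<oplus>\<^bsub>R\<^esub> \<beta> g)" using \<alpha>[of "f \<oplus>\<^bsub>R\<^esub> g"] f g add by simp
  thus "\<alpha> (x \<oplus>\<^bsub>A\<^esub> y) = \<alpha> x \<oplus>\<^bsub>A\<^esub> \<alpha> y" using f g cl \<alpha> by simp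
 qed
qed

sublocale U: uniserial_ring A p n i T
proof unfold_locales
 show "Factorial_Ring.prime p" "n \<ge> 1" "p ^ (n - 1) + 2 \<le> i" "i < p ^ n" by (fact p n i_lower i_upper)+
 show "T \<in> carrier A" by simp
 show "A.nat_mult p \<one>\<^bsub>A\<^esub> = \<zero>\<^bsub>A\<^esub>" using cls_nat_mult[of "\<one>\<^bsub>R\<^esub>" p] R_char by simp
 have "\<tau> [^]\<^bsub>R\<^esub> i \<in> I" unfolding I_eq by (rule R.genideal_self') simp
 thus "T [^]\<^bsub>A\<^esub> i = \<zero>\<^bsub>A\<^esub>" using cls_eq_zero[of "\<tau> [^]\<^bsub>R\<^esub> i"] by (simp add: cls.hom_nat_pow)
 show "T [^]\<^bsub>A\<^esub> (i - 1) \<noteq> \<zero>\<^bsub>A\<^esub>"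
 proof
  assume "T [^]\<^bsub>A\<^esub> (i - 1) = \<zero>\<^bsub>A\<^esub>"
  hence "\<tau> [^]\<^bsub>R\<^esub> (i - 1) \<in> I" using cls_eq_zero[of "\<tau> [^]\<^bsub>R\<^esub> (i - 1)"] by (simp add: cls.hom_nat_pow)
  then obtain h where h: "h \<in> carrier R" "\<tau> [^]\<^bsub>R\<^esub> (i - 1) = h \<otimes>\<^bsub>R\<^esub> \<tau> [^]\<^bsub>R\<^esub> i"
   using R.Idl_singleton[of "\<tau> [^]\<^bsub>R\<^esub> i"] unfolding I_eq by auto
  have iq: "i - 1 + (q - i) = q - 1" "i + (q - i) = q" using i_lower i_upper by (auto simp: q_def)
  have "\<tau> [^]\<^bsub>R\<^esub> (q - 1) = \<tau> [^]\<^bsub>R\<^esub> (i - 1) \<otimes>\<^bsub>R\<^esub> \<tau> [^]\<^bsub>R\<^esub> (q - i)" using iq by (simp add: R.nat_pow_mult)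
  also have "\<dots> = h \<otimes>\<^bsub>R\<^esub> \<tau> [^]\<^bsub>R\<^esub> q" unfolding h(2) using h(1) iq by (simp add: R.m_assoc R.nat_pow_mult)
  also have "\<dots> = \<zero>\<^bsub>R\<^esub>" using \<tau>_q h(1) by simp
  finally show False using \<tau>_power_nonzero by simp
 qed
 show "\<exists>k. \<exists>b\<in>carrier A. a = A.nat_mult k \<one>\<^bsub>A\<^esub> \<oplus>\<^bsub>A\<^esub> T \<otimes>\<^bsub>A\<^esub> b" if a: "a \<in> carrier A" for a
 proof -
  obtain f where f: "f \<in> carrier R" "a = cls f" using cls_surj[OF a] by blast
  obtain k b where b: "b \<in> carrier R" "f = R.nat_mult k \<one>\<^bsub>R\<^esub> \<oplus>\<^bsub>R\<^esub> \<tau> \<otimes>\<^bsub>R\<^esub> b" using R_decompose[OF f(1)] by blast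
  have "a = A.nat_mult k \<one>\<^bsub>A\<^esub> \<oplus>\<^bsub>A\<^esub> T \<otimes>\<^bsub>A\<^esub> cls b"
   unfolding f(2) b(2) using b(1) by (simp add: cls_nat_mult)
  thus ?thesis using b(1) by (intro exI bexI[of _ "cls b"]) auto
 qed
 have "finite (carrier R)" unfolding R_carrier by (intro finite_PiE) auto
 moreover have "carrier A \<subseteq> cls ` carrier R" using cls_surj by blast
 ultimately show "finite (carrier A)" by (meson finite_imageI finite_subset)
 show "\<exists>\<alpha>. \<alpha> \<in> carrier A \<rightarrow> carrier A \<and> \<alpha> \<one>\<^bsub>A\<^esub> = \<one>\<^bsub>A\<^esub> \<and>
   (\<forall>x\<in>carrier A. \<forall>y\<in>carrier A. \<alpha> (x \<oplus>\<^bsub>A\<^esub> y) = \<alpha> x \<oplus>\<^bsub>A\<^esub> \<alpha> y) \<and>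
   (\<forall>x\<in>carrier A. \<alpha> ((\<one>\<^bsub>A\<^esub> \<oplus>\<^bsub>A\<^esub> T) \<otimes>\<^bsub>A\<^esub> x) = (\<one>\<^bsub>A\<^esub> \<oplus>\<^bsub>A\<^esub> T) [^]\<^bsub>A\<^esub> u \<otimes>\<^bsub>A\<^esub> \<alpha> x)"
  if "coprime u p" for u by (rule cls_twist[OF that])
qed

lemma A_act_eq:
 assumes "j \<in> {0..<int U.q}" "f \<in> carrier A"
 shows "A_act p n i j f = (\<one>\<^bsub>A\<^esub> \<oplus>\<^bsub>A\<^esub> T) [^]\<^bsub>A\<^esub> nat j \<otimes>\<^bsub>A\<^esub> f"
proof -
 have "nat j < q" using assms(1) by (auto simp: U.q_def q_def nat_less_iff)
 hence "\<sigma> [^]\<^bsub>R\<^esub> nat j = sigma_pow p n j" using \<sigma>_power[of "nat j"] assms(1) by simp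
 thus ?thesis unfolding A_act_def one_plus_T by (metis cls.hom_nat_pow \<sigma>_closed)
qed

lemma A_semidirect_ext: "ext_group A p n i T (A_semidirect p n i) \<zero>\<^bsub>A\<^esub>"
proof (intro ext_group.intro ext_group_axioms.intro)
 show "uniserial_ring A p n i T" by (rule U.uniserial_ring_axioms)
 show "carrier (A_semidirect p n i) = carrier A \<times> {0..<int U.q}"
  by (simp add: A_semidirect_def cyc_simps q_def U.q_def)
 show "\<one>\<^bsub>A_semidirect p n i\<^esub> = (\<zero>\<^bsub>A\<^esub>, 0)" by (simp add: A_semidirect_def)
 show "(f, j) \<otimes>\<^bsub>A_semidirect p n i\<^esub> (g, k) =
   (f \<oplus>\<^bsub>A\<^esub> (\<one>\<^bsub>A\<^esub> \<oplus>\<^bsub>A\<^esub> T) [^]\<^bsub>A\<^esub> nat j \<otimes>\<^bsub>A\<^esub> g \<oplus>\<^bsub>A\<^esub> (if j + k < int U.q then \<zero>\<^bsub>A\<^esub> else \<zero>\<^bsub>A\<^esub>), (j + k) mod int U.q)"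
  if "f \<in> carrier A" "g \<in> carrier A" "j \<in> {0..<int U.q}" "k \<in> {0..<int U.q}" for f g j k
  using A_act_eq[OF that(3,2)] that(1,2) by (simp add: A_semidirect_def U.q_def)
qed simp

lemma A_bullet_ext: "ext_group A p n i T (A_bullet p n i) (T [^]\<^bsub>A\<^esub> (i - 1))"
proof (intro ext_group.intro ext_group_axioms.intro)
 show "uniserial_ring A p n i T" by (rule U.uniserial_ring_axioms)
 show "carrier (A_bullet p n i) = carrier A \<times> {0..<int U.q}"
  by (simp add: A_bullet_def cyc_simps q_def U.q_def)
 show "\<one>\<^bsub>A_bullet p n i\<^esub> = (\<zero>\<^bsub>A\<^esub>, 0)" by (simp add: A_bullet_def)
 have c: "cls (sigma_minus_one_pow p n (i - 1)) = T [^]\<^bsub>A\<^esub> (i - 1)"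
  by (simp add: sigma_minus_one_pow_eq cls.hom_nat_pow)
 show "(f, j) \<otimes>\<^bsub>A_bullet p n i\<^esub> (g, k) =
   (f \<oplus>\<^bsub>A\<^esub> (\<one>\<^bsub>A\<^esub> \<oplus>\<^bsub>A\<^esub> T) [^]\<^bsub>A\<^esub> nat j \<otimes>\<^bsub>A\<^esub> g \<oplus>\<^bsub>A\<^esub> (if j + k < int U.q then \<zero>\<^bsub>A\<^esub> else T [^]\<^bsub>A\<^esub> (i - 1)), (j + k) mod int U.q)"
  if "f \<in> carrier A" "g \<in> carrier A" "j \<in> {0..<int U.q}" "k \<in> {0..<int U.q}" for f g j k
  using A_act_eq[OF that(3,2)] that(1,2) by (simp add: A_bullet_def U.q_def c[simplified])
qed simp

end

section \<open>Separable towers and roots of unity\<close>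

lemma (in cring) nat_mult_power_prime:
 assumes p: "Factorial_Ring.prime p" and char: "nat_mult p \<one> = \<zero>"
 shows "(nat_mult k \<one>) [^] p = nat_mult k \<one>"
proof (induction k)
 case 0 thus ?case using p by (simp add: nat_pow_zero prime_gt_0_nat)
next
 case (Suc k)
 thus ?case using frobenius_add[OF p char, of "nat_mult k \<one>" \<one> 1] by (simp add: nat_mult_Suc)
qed

lemma (in cring) nat_mult_char_inject:
 assumes p: "Factorial_Ring.prime p" and char: "nat_mult p \<one> = \<zero>" and one: "\<one> \<noteq> \<zero>"
  and kl: "k < p" "l < p" "nat_mult k \<one> = nat_mult l \<one>"
 shows "k = l"
proof -
 have *: False if kl: "k < l" "l < p" "nat_mult k \<one> = nat_mult l \<one>" for k l
 proof -
  have "nat_mult l \<one> = nat_mult k \<one> \<oplus> nat_mult (l - k) \<one>"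
   using nat_mult_add[OF one_closed, of k "l - k"] kl(1) by simp
  hence z: "nat_mult (l - k) \<one> = \<zero>" using kl(3) by (metis add.l_cancel_one' nat_mult_closed one_closed)
  have "\<not> p dvd (l - k)" using kl by (auto dest: dvd_imp_le)
  hence "coprime (l - k) p" using p by (metis coprime_commute prime_imp_coprime)
  then obtain d where d: "[(l - k) * d = 1] (mod p)" using cong_solve_coprime_nat[of "l - k" p] by auto
  have "\<one> = nat_mult (1 mod p) \<one>" using nat_mult_mod[OF char one_closed, of 1] by simp
  also have "\<dots> = nat_mult ((l - k) * d) \<one>" using d nat_mult_mod[OF char one_closed] unfolding cong_def by metis
  also have "\<dots> = \<zero>" using z by (simp add: nat_mult_mult)
  finally show False using one by simp
 qed
 show ?thesis using *[of k l] *[of l k] kl by (cases k l rule: linorder_cases) auto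
qed

text \<open>
 Polynomials \<open>X^p + a X + b\<close> cover both Kummer equations (\<open>a = 0\<close>) and
 Artin-Schreier equations (\<open>a = -1\<close>).
\<close>

lemma (in domain) trinomial:
 assumes "p \<ge> 2" and E: "subring E R" and ab: "a \<in> E" "b \<in> E"
 obtains f where "f \<in> carrier (E[X])" "degree f = p" "f \<noteq> []"
  "\<And>x. x \<in> carrier R ==> eval f x = x [^] p \<oplus> (a \<otimes> x \<oplus> b)"
proof -
 define f where "f = \<one> # (replicate (p - 2) \<zero> @ [a, b])"
 have abc: "a \<in> carrier R" "b \<in> carrier R" using ab subringE(1)[OF E] by auto
 show ?thesis
 proof (rule that)
  show "f \<in> carrier (E[X])"
   unfolding univ_poly_carrier[symmetric] polynomial_def f_def using ab subringE(2,3)[OF E] by auto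
  show "degree f = p" "f \<noteq> []" using assms(1) by (auto simp: f_def)
  fix x assume x: "x \<in> carrier R"
  have "eval (replicate (p - 2) \<zero> @ [a, b]) x = eval [a, b] x"
   by (rule eval_replicate) (use abc x in auto)
  moreover have "length (replicate (p - 2) \<zero> @ [a, b]) = p" using assms(1) by simp
  ultimately show "eval f x = x [^] p \<oplus> (a \<otimes> x \<oplus> b)" using abc x by (simp add: f_def)
 qed
qed

context galois_setting
begin

interpretation \<G>: group \<G> by (rule \<G>_group)

lemma trinomial_root:
 assumes "p \<ge> 2" "a \<in> carrier \<Omega>" "b \<in> carrier \<Omega>"
 obtains x where "x \<in> carrier \<Omega>" "x [^] (p::nat) \<oplus> (a \<otimes> x \<oplus> b) = \<zero>"
proof -
 obtain f where f: "f \<in> carrier (poly_ring \<Omega>)" "degree f = p"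
  "\<And>x. x \<in> carrier \<Omega> ==> eval f x = x [^] p \<oplus> (a \<otimes> x \<oplus> b)"
  using trinomial[OF assms(1) carrier_is_subring assms(2,3)] by blast
 have "roots f \<noteq> {#}" using roots_over_carrier[OF f(1)] f(2) assms(1) by (auto simp: splitted_def)
 then obtain x where "x \<in># roots f" by blast
 hence "is_root f x" using roots_mem_iff_is_root[OF f(1)] by simp
 thus ?thesis using that f(3) by (auto simp: is_root_def)
qed

lemma trinomial_roots_card:
 assumes "p \<ge> 2" "a \<in> carrier \<Omega>" "b \<in> carrier \<Omega>"
  and Y: "finite Y" "\<And>y. y \<in> Y ==> y \<in> carrier \<Omega> \<and> y [^] (p::nat) \<oplus> (a \<otimes> y \<oplus> b) = \<zero>"
 shows "card Y \<le> p"
proof -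
 obtain f where f: "f \<in> carrier (poly_ring \<Omega>)" "degree f = p" "f \<noteq> []"
  "\<And>x. x \<in> carrier \<Omega> ==> eval f x = x [^] p \<oplus> (a \<otimes> x \<oplus> b)"
  using trinomial[OF assms(1) carrier_is_subring assms(2,3)] by blast
 have "Y \<subseteq> set_mset (roots f)" using Y f roots_mem_iff_is_root[OF f(1)] by (auto simp: is_root_def)
 hence "card Y \<le> card (set_mset (roots f))" by (intro card_mono) auto
 also have "\<dots> \<le> size (roots f)"
  by (metis card_eq_sum order_refl size_multiset_overloaded_eq count_greater_eq_one_iff sum_mono)
 also have "\<dots> \<le> p" using size_roots_le_degree[OF f(1)] f(2) by simp
 finally show ?thesis .
qed

lemma trinomial_separable:
 assumes "p \<ge> 2" and E: "subfield E \<Omega>" and ab: "a \<in> E" "b \<in> E" and t: "t \<in> Y"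
  and Y: "finite Y" "\<And>y. y \<in> Y ==> y \<in> carrier \<Omega> \<and> y [^] (p::nat) \<oplus> (a \<otimes> y \<oplus> b) = \<zero>" "card Y = p"
 shows "separable_root E t"
proof -
 note sub = subfieldE(1)[OF E]
 obtain f where f: "f \<in> carrier (E[X])" "degree f = p" "f \<noteq> []"
  "\<And>x. x \<in> carrier \<Omega> ==> eval f x = x [^] p \<oplus> (a \<otimes> x \<oplus> b)"
  using trinomial[OF assms(1) sub ab] by blast
 have "finite {z. is_root f z}" using finite_number_of_roots[OF carrier_polynomial_shell[OF sub f(1)]] .
 moreover have "Y \<subseteq> {z. is_root f z}" using Y f by (auto simp: is_root_def)
 ultimately have "p \<le> card {z. is_root f z}" using Y(3) card_mono by metis
 thus ?thesis using f t Y unfolding separable_root_def by auto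
qed

text \<open>
 The list is adjoined to \<open>E\<close> from its end: each entry is separable over the field generated by
 \<open>E\<close> and the entries after it.
\<close>

fun separable_tower :: "'a set => 'a list => bool" where
 "separable_tower E [] = True"
| "separable_tower E (x # xs) = (separable_tower E xs \<and> separable_root (finite_extension E xs) x)"

lemma separable_tower_subfield:
 assumes E: "subfield E \<Omega>" "F \<subseteq> E" and xs: "set xs \<subseteq> carrier \<Omega>"
 shows "subfield (finite_extension E xs) \<Omega>" "E \<subseteq> finite_extension E xs" "set xs \<subseteq> finite_extension E xs"
proof -
 show "subfield (finite_extension E xs) \<Omega>"
  by (rule finite_extension_is_subfield[OF E(1)]) (use xs algebraic_over[OF E] in auto)
 show "E \<subseteq> finite_extension E xs" by (rule finite_extension_incl[OF subfieldE(3)[OF E(1)] xs])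
 show "set xs \<subseteq> finite_extension E xs" by (rule finite_extension_mem[OF subfieldE(1)[OF E(1)] xs])
qed

lemma fixed_in_tower:
 assumes E: "subfield E \<Omega>" "F \<subseteq> E" and tow: "separable_tower E xs" and xs: "set xs \<subseteq> carrier \<Omega>"
  and z: "z \<in> finite_extension E xs" and fixed: "\<And>\<g>. \<g> \<in> fixgrp E ==> \<g> z = z"
 shows "z \<in> E"
 using tow xs z
proof (induction xs)
 case Nil thus ?case by simp
next
 case (Cons x xs)
 define E' where "E' = finite_extension E xs"
 have E': "subfield E' \<Omega>" "E \<subseteq> E'"
  unfolding E'_def using separable_tower_subfield[OF E, of xs] Cons.prems(2) by auto
 have "z \<in> E'"
 proof (rule fixed_in_simple_extension[OF E'(1)])
  show "F \<subseteq> E'" using E(2) E'(2) by blast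
  show "separable_root E' x" using Cons.prems(1) by (simp add: E'_def)
  show "z \<in> simple_extension E' x" using Cons.prems(3) by (simp add: E'_def)
  show "\<g> z = z" if "\<g> \<in> fixgrp E'" for \<g> using that fixed E'(2) by (auto simp: fixgrp_def)
 qed
 thus ?case using Cons.IH Cons.prems by (simp add: E'_def)
qed

lemma stable_finite_extension:
 assumes E: "subfield E \<Omega>" "F \<subseteq> E" "stable E" and xs: "stable (set xs)"
 shows "stable (finite_extension E xs)"
proof -
 have xsc: "set xs \<subseteq> carrier \<Omega>" using xs by (simp add: stable_def)
 note M = separable_tower_subfield[OF E(1,2) xsc]
 define M' where "M' = finite_extension E xs"
 have M': "subfield M' \<Omega>" "E \<subseteq> M'" "set xs \<subseteq> M'" using M by (simp_all add: M'_def)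
 have Mc: "M' \<subseteq> carrier \<Omega>" using subfieldE(3)[OF M'(1)] .
 have "\<g> x \<in> M'" if g: "\<g> \<in> carrier \<G>" and x: "x \<in> M'" for \<g> x
 proof -
  define Q where "Q = {y \<in> carrier \<Omega>. \<g> y \<in> M'}"
  have sub: "subring M' \<Omega>" using subfieldE(1)[OF M'(1)] .
  have "subring Q \<Omega>"
  proof (rule subringI)
   show "Q \<subseteq> carrier \<Omega>" by (auto simp: Q_def)
   show "\<one> \<in> Q" using g subringE(3)[OF sub] by (simp add: Q_def)
   show "\<ominus> a \<in> Q" if "a \<in> Q" for a using that g subringE(5)[OF sub] by (simp add: Q_def)
   show "a \<otimes> b \<in> Q" "a \<oplus> b \<in> Q" if "a \<in> Q" "b \<in> Q" for a b
    using that g subringE(6,7)[OF sub] by (simp_all add: Q_def)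
  qed
  moreover have "E \<subseteq> Q" using E(3) M'(2) g by (auto simp: Q_def stable_def)
  moreover have "set xs \<subseteq> Q" using xs M'(3) g by (auto simp: Q_def stable_def)
  ultimately have "M' \<subseteq> Q"
   unfolding M'_def finite_extension_minimal[OF subfieldE(1)[OF E(1)] xsc] by blast
  thus ?thesis using x by (auto simp: Q_def)
 qed
 thus ?thesis using Mc by (simp add: stable_def M'_def)
qed

text \<open>
 Stability of the list makes the generated field stable, and separability at each step makes an element
 fixed by everything descend through the tower.
\<close>

lemma galois_tower:
 assumes L: "galois_extension \<Omega> F L" and xs: "stable (set xs)" "separable_tower L xs"
 shows "galois_extension \<Omega> F (finite_extension L xs)"
proof -
 note Ls = galois_extension_subfield[OF L]
 have xsc: "set xs \<subseteq> carrier \<Omega>" using xs by (simp add: stable_def)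
 note M = separable_tower_subfield[OF Ls(1,2) xsc]
 show ?thesis
 proof (rule galois_extensionI)
  show "subfield (finite_extension L xs) \<Omega>" by (rule M)
  show "F \<subseteq> finite_extension L xs" using M(2) Ls(2) by blast
  show "stable (finite_extension L xs)"
   by (rule stable_finite_extension[OF Ls(1,2) galois_extension_stable[OF L] xs(1)])
  fix x assume x: "x \<in> finite_extension L xs" and fixed: "\<And>\<g>. \<g> \<in> carrier \<G> ==> \<g> x = x"
  have fx: "\<g> x = x" if "\<g> \<in> fixgrp E" for \<g> E using that fixed[of \<g>] unfolding fixgrp_def by blast
  have "x \<in> L" by (rule fixed_in_tower[OF Ls(1,2) xs(2) xsc x]) (rule fx)
  thus "x \<in> F" by (rule fixed_in_galois_extension[OF L F_subfield subset_refl]) (rule fx)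
 qed
qed

lemma automorphisms_eq_on_tower:
 assumes E: "subfield E \<Omega>" "F \<subseteq> E" and xs: "set xs \<subseteq> carrier \<Omega>"
  and g: "\<g> \<in> carrier \<G>" "\<d> \<in> carrier \<G>" and eq: "\<And>x. x \<in> E \<union> set xs ==> \<g> x = \<d> x"
  and x: "x \<in> finite_extension E xs"
 shows "\<g> x = \<d> x"
proof -
 define Q where "Q = {y \<in> carrier \<Omega>. \<g> y = \<d> y}"
 have "subring Q \<Omega>" by (rule subringI) (use g in \<open>auto simp: Q_def\<close>)
 moreover have "E \<subseteq> Q" using eq subfieldE(3)[OF E(1)] by (auto simp: Q_def)
 moreover have "set xs \<subseteq> Q" using eq xs by (auto simp: Q_def)
 ultimately have "finite_extension E xs \<subseteq> Q"
  unfolding finite_extension_minimal[OF subfieldE(1)[OF E(1)] xs] by blast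
 thus ?thesis using x by (auto simp: Q_def)
qed

definition primitive_root :: "nat => 'a => bool" where
 "primitive_root p \<zeta> \<longleftrightarrow> \<zeta> \<in> carrier \<Omega> \<and> \<zeta> [^] p = \<one> \<and> \<zeta> \<noteq> \<one>"

lemma eval_replicate_one: "x \<in> carrier \<Omega> ==> eval (replicate m \<one>) x = geometric x m"
 by (induction m) (simp_all add: geometric_Suc a_comm)

lemma primitive_root_exists:
 assumes p: "p \<ge> 2" and char: "nat_mult p \<one> \<noteq> \<zero>"
 obtains \<zeta> where "primitive_root p \<zeta>"
proof -
 define f where "f = replicate p \<one>"
 have f: "f \<in> carrier (poly_ring \<Omega>)" "degree f = p - 1"
  unfolding univ_poly_carrier[symmetric] polynomial_def f_def using p by auto
 have "roots f \<noteq> {#}" using roots_over_carrier[OF f(1)] f(2) p by (auto simp: splitted_def)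
 then obtain z where "z \<in># roots f" by blast
 hence "is_root f z" using roots_mem_iff_is_root[OF f(1)] by simp
 hence z: "z \<in> carrier \<Omega>" "geometric z p = \<zero>" by (auto simp: is_root_def f_def eval_replicate_one)
 have "z = \<one> \<oplus> (z \<ominus> \<one>)" using z by algebra
 hence "z [^] p = \<one> \<oplus> (z \<ominus> \<one>) \<otimes> geometric z p"
  using geometric_telescope[of "z \<ominus> \<one>" p] z by simp
 hence "z [^] p = \<one>" using z by simp
 moreover have "z \<noteq> \<one>"
 proof
  assume "z = \<one>"
  moreover have "geometric \<one> m = nat_mult m \<one>" for m
   by (induction m) (simp_all add: geometric_Suc nat_mult_Suc)
  ultimately show False using z char by simp
 qed
 ultimately show ?thesis using that z by (simp add: primitive_root_def)
qed

lemma primitive_root_power_mod: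
 assumes "primitive_root p \<zeta>" shows "\<zeta> [^] (k mod p) = \<zeta> [^] (k::nat)"
proof -
 have "\<zeta> [^] k = \<zeta> [^] (p * (k div p) + k mod p)" by simp
 also have "\<dots> = (\<zeta> [^] p) [^] (k div p) \<otimes> \<zeta> [^] (k mod p)"
  using assms unfolding primitive_root_def by (metis nat_pow_mult nat_pow_pow)
 finally show ?thesis using assms by (simp add: primitive_root_def)
qed

lemma primitive_root_power_eq:
 assumes p: "Factorial_Ring.prime p" and z: "primitive_root p \<zeta>" and eq: "\<zeta> [^] (k::nat) = \<zeta> [^] (l::nat)"
 shows "k mod p = l mod p"
proof -
 have zc: "\<zeta> \<in> carrier \<Omega>" and z1: "\<zeta> [^] p = \<one>" "\<zeta> \<noteq> \<one>" using z by (simp_all add: primitive_root_def)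
 have z0: "\<zeta> [^] (m::nat) \<noteq> \<zero>" for m
 proof
  assume "\<zeta> [^] m = \<zero>"
  hence "\<zeta> [^] (m * p) = \<zero>" using zc p nat_pow_pow[OF zc, of m p] by (simp add: nat_pow_zero prime_gt_0_nat)
  moreover have "\<zeta> [^] (m * p) = \<one>" using primitive_root_power_mod[OF z, of "m * p"] by simp
  ultimately show False by simp
 qed
 have *: False if kl: "k < l" "l < p" "\<zeta> [^] k = \<zeta> [^] l" for k l :: nat
 proof -
  have "\<zeta> [^] k \<otimes> \<zeta> [^] (l - k) = \<zeta> [^] k \<otimes> \<one>"
   using kl zc nat_pow_mult[OF zc, of k "l - k"] by simp
  hence d1: "\<zeta> [^] (l - k) = \<one>" using m_lcancel[OF z0 _ _ _, of k "\<zeta> [^] (l - k)" \<one>] zc by simp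
  have "\<not> p dvd (l - k)" using kl by (auto dest: dvd_imp_le)
  hence "coprime (l - k) p" using p by (metis coprime_commute prime_imp_coprime)
  then obtain d where d: "[(l - k) * d = 1] (mod p)" using cong_solve_coprime_nat[of "l - k" p] by auto
  have "\<zeta> = \<zeta> [^] (1 mod p)" using primitive_root_power_mod[OF z, of 1] zc by simp
  also have "\<dots> = \<zeta> [^] ((l - k) * d)" using d primitive_root_power_mod[OF z] unfolding cong_def by metis
  also have "\<dots> = \<one>" using d1 zc nat_pow_pow[OF zc, of "l - k" d] by simp
  finally show False using z1 by simp
 qed
 have "k mod p < p" "l mod p < p" using p by (simp_all add: prime_gt_0_nat)
 thus ?thesis using *[of "k mod p" "l mod p"] *[of "l mod p" "k mod p"] eq
  by (cases "k mod p" "l mod p" rule: linorder_cases) (auto simp: primitive_root_power_mod[OF z])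
qed

lemma primitive_root_orbit:
 assumes p: "Factorial_Ring.prime p" and z: "primitive_root p \<zeta>" and x: "x \<in> carrier \<Omega>" "x \<noteq> \<zero>"
 shows "card ((\<lambda>k. \<zeta> [^] k \<otimes> x) ` {..<p}) = p"
  "\<And>y. y \<in> (\<lambda>k. \<zeta> [^] k \<otimes> x) ` {..<p} ==> y \<in> carrier \<Omega> \<and> y [^] p \<oplus> (\<zero> \<otimes> y \<oplus> (\<ominus> (x [^] p))) = \<zero>"
proof -
 have zc: "\<zeta> \<in> carrier \<Omega>" and z1: "\<zeta> [^] p = \<one>" using z by (simp_all add: primitive_root_def)
 have "inj_on (\<lambda>k. \<zeta> [^] k \<otimes> x) {..<p}"
 proof (rule inj_onI)
  fix k l assume kl: "k \<in> {..<p}" "l \<in> {..<p}" "\<zeta> [^] k \<otimes> x = \<zeta> [^] l \<otimes> x"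
  have "\<zeta> [^] k = \<zeta> [^] l" using kl(3) m_rcancel[OF x(2) x(1), of "\<zeta> [^] k" "\<zeta> [^] l"] zc by simp
  thus "k = l" using primitive_root_power_eq[OF p z] kl by fastforce
 qed
 thus "card ((\<lambda>k. \<zeta> [^] k \<otimes> x) ` {..<p}) = p" by (simp add: card_image)
 fix y assume "y \<in> (\<lambda>k. \<zeta> [^] k \<otimes> x) ` {..<p}"
 then obtain k :: nat where y: "y = \<zeta> [^] k \<otimes> x" by blast
 have "(\<zeta> [^] k) [^] p = (\<zeta> [^] p) [^] k" using nat_pow_pow[OF zc] by (simp add: mult.commute)
 hence "y [^] p = x [^] p" using y zc x z1 by (simp add: nat_pow_distrib)
 thus "y \<in> carrier \<Omega> \<and> y [^] p \<oplus> (\<zero> \<otimes> y \<oplus> (\<ominus> (x [^] p))) = \<zero>"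
  using y zc x by (simp add: r_neg)
qed

lemma primitive_root_separable:
 assumes p: "Factorial_Ring.prime p" and z: "primitive_root p \<zeta>" and x: "x \<in> carrier \<Omega>" "x \<noteq> \<zero>"
  and E: "subfield E \<Omega>" "x [^] p \<in> E"
 shows "separable_root E x"
proof (rule trinomial_separable[where a=\<zero> and b="\<ominus> (x [^] p)" and Y="(\<lambda>k. \<zeta> [^] k \<otimes> x) ` {..<p}"])
 show "p \<ge> 2" using p by (rule prime_ge_2_nat)
 show "\<zero> \<in> E" "\<ominus> (x [^] p) \<in> E" using E(2) subringE(2,5)[OF subfieldE(1)[OF E(1)]] by auto
 show "x \<in> (\<lambda>k. \<zeta> [^] k \<otimes> x) ` {..<p}"
  using x p by (intro image_eqI[of _ _ 0]) (auto simp: prime_gt_0_nat)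
 show "w \<in> carrier \<Omega> \<and> w [^] p \<oplus> (\<zero> \<otimes> w \<oplus> (\<ominus> (x [^] p))) = \<zero>"
  if "w \<in> (\<lambda>k. \<zeta> [^] k \<otimes> x) ` {..<p}" for w by (rule primitive_root_orbit(2)[OF p z x that])
 show "card ((\<lambda>k. \<zeta> [^] k \<otimes> x) ` {..<p}) = p" by (rule primitive_root_orbit(1)[OF p z x])
qed (use E in simp_all)

lemma primitive_root_quotient:
 assumes p: "Factorial_Ring.prime p" and z: "primitive_root p \<zeta>" and x: "x \<in> carrier \<Omega>" "x \<noteq> \<zero>"
  and y: "y \<in> carrier \<Omega>" "y [^] p = x [^] p"
 shows "\<exists>k<p. y = \<zeta> [^] k \<otimes> x"
proof (rule ccontr)
 define Y where "Y = (\<lambda>k. \<zeta> [^] k \<otimes> x) ` {..<p}"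
 assume "\<not> (\<exists>k<p. y = \<zeta> [^] k \<otimes> x)"
 hence "y \<notin> Y" by (auto simp: Y_def)
 note orb = primitive_root_orbit[OF p z x, folded Y_def]
 have "card (insert y Y) \<le> p"
 proof (rule trinomial_roots_card)
  show "p \<ge> 2" using p by (rule prime_ge_2_nat)
  show "finite (insert y Y)" by (simp add: Y_def)
  show "w \<in> carrier \<Omega> \<and> w [^] p \<oplus> (\<zero> \<otimes> w \<oplus> (\<ominus> (x [^] p))) = \<zero>" if "w \<in> insert y Y" for w
   using that orb(2) y x by (auto simp: r_neg)
 qed (use x in auto)
 thus False using orb(1) \<open>y \<notin> Y\<close> by (simp add: Y_def)
qed

lemma primitive_root_automorphism:
 assumes p: "Factorial_Ring.prime p" and z: "primitive_root p \<zeta>" and g: "\<g> \<in> carrier \<G>"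
 shows "primitive_root p (\<g> \<zeta>)" "\<exists>a. \<not> p dvd a \<and> \<g> \<zeta> = \<zeta> [^] a"
proof -
 have zc: "\<zeta> \<in> carrier \<Omega>" and z1: "\<zeta> [^] p = \<one>" "\<zeta> \<noteq> \<one>" using z by (simp_all add: primitive_root_def)
 have "\<g> \<zeta> [^] p = \<one>" using \<G>_simps(5)[OF g zc, of p] z1(1) g by simp
 moreover have ne: "\<g> \<zeta> \<noteq> \<one>" using inj_onD[OF \<G>_inj[OF g], of \<zeta> \<one>] g zc z1(2) by auto
 ultimately show pr: "primitive_root p (\<g> \<zeta>)" using g zc by (simp add: primitive_root_def)
 obtain a :: nat where a: "\<g> \<zeta> = \<zeta> [^] a"
  using primitive_root_quotient[OF p z, of \<one> "\<g> \<zeta>"] pr zc by (auto simp: primitive_root_def)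
 have "\<not> p dvd a"
 proof
  assume "p dvd a"
  hence "\<zeta> [^] a = \<one>" using primitive_root_power_mod[OF z, of a] by simp
  thus False using a ne by simp
 qed
 thus "\<exists>a. \<not> p dvd a \<and> \<g> \<zeta> = \<zeta> [^] a" using a by blast
qed

end

section \<open>Fields with a cyclic Galois group\<close>

lemma (in abelian_group) finsum_periodic_shift:
 assumes f: "\<And>k. f k \<in> carrier G" "\<And>k. f (k + q) = f k" and q: "q > (0::nat)"
 shows "(\<Oplus>k\<in>{..<q}. f (k + m)) = (\<Oplus>k\<in>{..<q}. f k)"
proof (induction m)
 case 0 show ?case by simp
next
 case (Suc m)
 obtain l where l: "q = Suc l" using q by (cases q) auto
 define g where "g = (\<lambda>k. f (k + m))"
 have g: "g k \<in> carrier G" for k using f by (simp add: g_def)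
 have "g q = g 0" using f(2)[of m] by (simp add: g_def add.commute)
 moreover have "(\<Oplus>k\<in>{..Suc l}. g k) = g (Suc l) \<oplus> (\<Oplus>k\<in>{..l}. g k)"
  by (rule finsum_Suc) (use g in auto)
 moreover have "(\<Oplus>k\<in>{..Suc l}. g k) = (\<Oplus>k\<in>{..l}. g (Suc k)) \<oplus> g 0"
  by (rule finsum_Suc2) (use g in auto)
 ultimately have "g 0 \<oplus> (\<Oplus>k\<in>{..l}. g k) = g 0 \<oplus> (\<Oplus>k\<in>{..l}. g (Suc k))"
  using g l by (simp add: a_comm)
 hence "(\<Oplus>k\<in>{..l}. g (Suc k)) = (\<Oplus>k\<in>{..l}. g k)"
  using g by (simp add: add.l_cancel)
 thus ?case using Suc by (simp add: g_def l lessThan_Suc_atMost)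
qed

text \<open>
 A Galois extension \<open>K\<close> of \<open>F\<close> with group \<open>\<int>/q\<close>, given by the
 induced epimorphism \<open>\<pi>\<close> from the absolute Galois group.
\<close>

locale cyclic_quotient = galois_setting \<Omega> F + U: uniserial_ring A p n i t
 for \<Omega> (structure) and F and A and p n i :: nat and t +
 fixes \<pi> :: "('a => 'a) => int" and K
 assumes K: "galois_extension \<Omega> F K"
  and \<pi>_mult: "\<g> \<in> carrier \<G> ==> \<d> \<in> carrier \<G> ==> \<pi> (\<g> \<otimes>\<^bsub>\<G>\<^esub> \<d>) = (\<pi> \<g> + \<pi> \<d>) mod int U.q"
  and \<pi>_range: "\<pi> ` carrier \<G> = {0..<int U.q}"
  and \<pi>_ker: "{\<g> \<in> carrier \<G>. \<pi> \<g> = 0} = fixgrp K"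
begin

interpretation \<G>: group \<G> by (rule \<G>_group)

definition r :: "('a => 'a) => nat" where "r \<g> = nat (\<pi> \<g>)"

lemma \<pi>_in: "\<g> \<in> carrier \<G> ==> 0 \<le> \<pi> \<g>" "\<g> \<in> carrier \<G> ==> \<pi> \<g> < int U.q"
proof -
 assume "\<g> \<in> carrier \<G>"
 hence "\<pi> \<g> \<in> \<pi> ` carrier \<G>" by (rule imageI)
 thus "0 \<le> \<pi> \<g>" "\<pi> \<g> < int U.q" unfolding \<pi>_range by simp_all
qed

lemma \<pi>_r: "\<g> \<in> carrier \<G> ==> \<pi> \<g> = int (r \<g>)" "\<g> \<in> carrier \<G> ==> r \<g> < U.q"
 using \<pi>_in[of \<g>] by (simp_all add: r_def nat_less_iff)

lemma r_mult:
 assumes "\<g> \<in> carrier \<G>" "\<d> \<in> carrier \<G>"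
 shows "r (\<g> \<otimes>\<^bsub>\<G>\<^esub> \<d>) = (r \<g> + r \<d>) mod U.q"
proof -
 have "\<pi> (\<g> \<otimes>\<^bsub>\<G>\<^esub> \<d>) = int ((r \<g> + r \<d>) mod U.q)"
  unfolding \<pi>_mult[OF assms] \<pi>_r(1)[OF assms(1)] \<pi>_r(1)[OF assms(2)] by (simp add: zmod_int)
 thus ?thesis unfolding r_def by simp
qed

lemma r_ker: "\<g> \<in> carrier \<G> ==> r \<g> = 0 \<longleftrightarrow> \<g> \<in> fixgrp K"
 unfolding \<pi>_ker[symmetric] using \<pi>_r(1)[of \<g>] by simp

lemma r_surj: "m < U.q ==> \<exists>\<g>\<in>carrier \<G>. r \<g> = m"
proof -
 assume "m < U.q"
 hence "int m \<in> \<pi> ` carrier \<G>" unfolding \<pi>_range by simp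
 then obtain \<g> where "\<g> \<in> carrier \<G>" "int m = \<pi> \<g>" by (rule imageE)
 thus ?thesis by (intro bexI[of _ \<g>]) (simp_all add: r_def)
qed

lemma r_one: "r \<one>\<^bsub>\<G>\<^esub> = 0"
proof -
 have "\<one>\<^bsub>\<G>\<^esub> \<in> fixgrp K"
  using \<G>.one_closed galois_extension_subfield(3)[OF K] by (auto simp: fixgrp_def gal_one)
 thus ?thesis using r_ker by simp
qed

lemma r_pow: "\<g> \<in> carrier \<G> ==> r (\<g> [^]\<^bsub>\<G>\<^esub> (m::nat)) = (m * r \<g>) mod U.q"
 by (induction m) (simp_all add: r_one r_mult mod_add_left_eq mod_add_right_eq add.commute)

lemma K_props: "subfield K \<Omega>" "F \<subseteq> K" "K \<subseteq> carrier \<Omega>" "stable K"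
 using galois_extension_subfield[OF K] galois_extension_stable[OF K] by auto

lemma K_closed: "x \<in> K ==> x \<in> carrier \<Omega>" using K_props by blast

text \<open>
 The stabilizer of \<open>K\<close> is the kernel of \<open>\<pi>\<close>; apply this to the quotient of
 the two automorphisms.
\<close>

lemma agree_on_K_iff:
 assumes g: "\<g> \<in> carrier \<G>" "\<d> \<in> carrier \<G>"
 shows "(\<forall>x\<in>K. \<g> x = \<d> x) \<longleftrightarrow> r \<g> = r \<d>"
proof -
 have d: "inv\<^bsub>\<G>\<^esub> \<d> \<in> carrier \<G>" using g by simp
 have "(\<forall>x\<in>K. \<g> x = \<d> x) \<longleftrightarrow> inv\<^bsub>\<G>\<^esub> \<d> \<otimes>\<^bsub>\<G>\<^esub> \<g> \<in> fixgrp K"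
 proof -
  have "(inv\<^bsub>\<G>\<^esub> \<d> \<otimes>\<^bsub>\<G>\<^esub> \<g>) x = x \<longleftrightarrow> \<g> x = \<d> x" if x: "x \<in> K" for x
  proof -
   have xc: "x \<in> carrier \<Omega>" using K_closed[OF x] .
   have "(inv\<^bsub>\<G>\<^esub> \<d> \<otimes>\<^bsub>\<G>\<^esub> \<g>) x = (inv\<^bsub>\<G>\<^esub> \<d>) (\<g> x)" using \<G>_mult[OF d g(1) xc] .
   thus ?thesis using \<G>_inv[OF g(2), of "\<g> x"] \<G>_inv[OF g(2) xc] g xc by auto
  qed
  thus ?thesis using g d by (auto simp: fixgrp_def)
 qed
 also have "\<dots> \<longleftrightarrow> r (inv\<^bsub>\<G>\<^esub> \<d> \<otimes>\<^bsub>\<G>\<^esub> \<g>) = 0" using r_ker g d by simp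
 also have "\<dots> \<longleftrightarrow> r \<g> = r \<d>"
 proof -
  have eq: "\<d> \<otimes>\<^bsub>\<G>\<^esub> (inv\<^bsub>\<G>\<^esub> \<d> \<otimes>\<^bsub>\<G>\<^esub> \<g>) = \<g>" using g d by (simp add: \<G>.m_assoc[symmetric])
  define e where "e = inv\<^bsub>\<G>\<^esub> \<d> \<otimes>\<^bsub>\<G>\<^esub> \<g>"
  have e: "e \<in> carrier \<G>" using g d by (simp add: e_def)
  have re: "r \<g> = (r \<d> + r e) mod U.q" using r_mult[OF g(2) e] eq by (simp add: e_def)
  have "r e = 0" if "r \<g> = r \<d>"
  proof -
   have "[r \<d> + r e = r \<d> + 0] (mod U.q)" using re that \<pi>_r(2)[OF g(2)] by (simp add: cong_def)
   hence "[r e = 0] (mod U.q)" by (simp only: cong_add_lcancel_nat)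
   thus ?thesis using \<pi>_r(2)[OF e] by (simp add: cong_def)
  qed
  thus ?thesis using re \<pi>_r(2)[OF g(2)] by (auto simp: e_def[symmetric])
 qed
 finally show ?thesis .
qed

definition T where "T = t [^]\<^bsub>A\<^esub> (i - 1)"

lemma T_closed [simp]: "T \<in> carrier A" by (simp add: T_def)

lemma t_T: "t \<otimes>\<^bsub>A\<^esub> T = \<zero>\<^bsub>A\<^esub>"
proof -
 have "t \<otimes>\<^bsub>A\<^esub> T = t [^]\<^bsub>A\<^esub> Suc (i - 1)" by (simp add: T_def U.m_comm)
 thus ?thesis using U.t_i U.i_ge_3 by simp
qed

lemma s_pow_T [simp]: "U.s [^]\<^bsub>A\<^esub> (m::nat) \<otimes>\<^bsub>A\<^esub> T = T"
proof (induction m)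
 case (Suc m)
 have "U.s [^]\<^bsub>A\<^esub> Suc m \<otimes>\<^bsub>A\<^esub> T = U.s [^]\<^bsub>A\<^esub> m \<otimes>\<^bsub>A\<^esub> (T \<oplus>\<^bsub>A\<^esub> t \<otimes>\<^bsub>A\<^esub> T)" by (simp add: U.m_assoc U.l_distr)
 thus ?case using Suc t_T by simp
qed simp

text \<open>
 A function with values in \<open>tA\<close> whose coboundary is the carry cocycle of the bullet product,
 inflated to the absolute Galois group. Adding it to the module component converts homomorphisms into the
 semidirect product to homomorphisms into the bullet product.
\<close>

definition bullet_cochain :: "('a => 'a) set => (('a => 'a) => 'c) => bool" where
 "bullet_cochain G C \<longleftrightarrow> (\<forall>\<g>\<in>G. \<exists>b\<in>carrier A. C \<g> = t \<otimes>\<^bsub>A\<^esub> b) \<and>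
  (\<forall>\<g>\<in>G. \<forall>\<d>\<in>G. C (\<g> \<otimes>\<^bsub>\<G>\<^esub> \<d>) =
   C \<g> \<oplus>\<^bsub>A\<^esub> U.s [^]\<^bsub>A\<^esub> r \<g> \<otimes>\<^bsub>A\<^esub> C \<d> \<oplus>\<^bsub>A\<^esub> U.nat_mult ((r \<g> + r \<d>) div U.q) T)"

lemma socle_in_radical: "\<exists>b\<in>carrier A. U.nat_mult k T = t \<otimes>\<^bsub>A\<^esub> b"
proof (intro bexI)
 have "T = t [^]\<^bsub>A\<^esub> Suc (i - 2)" using U.i_ge_3 by (simp add: T_def Suc_diff_Suc numeral_2_eq_2)
 hence "T = t \<otimes>\<^bsub>A\<^esub> t [^]\<^bsub>A\<^esub> (i - 2)" by (simp add: U.m_comm)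
 thus "U.nat_mult k T = t \<otimes>\<^bsub>A\<^esub> U.nat_mult k (t [^]\<^bsub>A\<^esub> (i - 2))" by (simp add: U.nat_mult_right)
qed simp

lemma separable_tower_append:
 assumes E: "subfield E \<Omega>" "F \<subseteq> E" and xz: "set xs \<subseteq> carrier \<Omega>" "set zs \<subseteq> carrier \<Omega>" and zs: "separable_tower E zs"
  and xs: "\<And>x E'. x \<in> set xs ==> subfield E' \<Omega> ==> finite_extension E zs \<subseteq> E' ==> separable_root E' x"
 shows "separable_tower E (xs @ zs) \<and> finite_extension E zs \<subseteq> finite_extension E (xs @ zs)"
 using xz(1) xs
proof (induction xs)
 case Nil thus ?case using zs by simp
next
 case (Cons x xs)
 define E' where "E' = finite_extension E (xs @ zs)"
 have IH: "separable_tower E (xs @ zs)" "finite_extension E zs \<subseteq> E'"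
  using Cons.IH Cons.prems unfolding E'_def by auto
 have E': "subfield E' \<Omega>" unfolding E'_def
  by (rule separable_tower_subfield(1)[OF E]) (use Cons.prems(1) xz(2) in auto)
 have "separable_root E' x" by (rule Cons.prems(2)) (use E' IH in auto)
 moreover have "E' \<subseteq> simple_extension E' x"
  by (rule simple_extension_incl[OF subfieldE(3)[OF E']]) (use Cons.prems(1) in auto)
 ultimately show ?case using IH by (auto simp: E'_def)
qed

text \<open>
 An automorphism that induces the generator of the Galois group of \<open>K\<close>. Its powers \<open>S
 k\<close> represent the elements of that group.
\<close>

definition gen where "gen = (SOME \<g>. \<g> \<in> carrier \<G> \<and> r \<g> = 1)"

lemma gen: "gen \<in> carrier \<G>" "r gen = 1"
proof -
 have "\<exists>\<g>. \<g> \<in> carrier \<G> \<and> r \<g> = 1" using r_surj[of 1] U.q_gt_1 by blast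
 from someI_ex[OF this] show "gen \<in> carrier \<G>" "r gen = 1" by (simp_all add: gen_def)
qed

definition S :: "nat => 'a => 'a" where "S k = gen [^]\<^bsub>\<G>\<^esub> k"

lemma S_closed [simp]: "S k \<in> carrier \<G>" using gen by (simp add: S_def)

lemma r_S: "r (S k) = k mod U.q" using r_pow[OF gen(1)] gen(2) by (simp add: S_def)

lemma S_K: "x \<in> K ==> S k x \<in> K" using K_props(4) by (simp add: stable_def)

lemma S_periodic: "x \<in> K ==> S (k + U.q) x = S k x"
 using agree_on_K_iff[of "S (k + U.q)" "S k"] by (simp add: r_S)

lemma S_act:
 assumes "\<g> \<in> carrier \<G>" "x \<in> K" shows "\<g> (S k x) = S (k + r \<g>) x"
proof -
 have "r (\<g> \<otimes>\<^bsub>\<G>\<^esub> S k) = r (S (k + r \<g>))"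
  using assms(1) by (simp add: r_S r_mult mod_add_right_eq add.commute)
 moreover have "\<g> \<otimes>\<^bsub>\<G>\<^esub> S k \<in> carrier \<G>" using assms(1) by simp
 ultimately have "(\<g> \<otimes>\<^bsub>\<G>\<^esub> S k) x = S (k + r \<g>) x"
  using agree_on_K_iff[of "\<g> \<otimes>\<^bsub>\<G>\<^esub> S k" "S (k + r \<g>)"] assms(2) S_closed by blast
 thus ?thesis using \<G>_mult[OF assms(1) S_closed K_closed[OF assms(2)]] by simp
qed

lemma S_distinct: "k < U.q ==> l < U.q ==> k \<noteq> l ==> \<exists>x\<in>K. S k x \<noteq> S l x"
 using agree_on_K_iff[of "S k" "S l"] by (auto simp: r_S)

lemma K_mult: "x \<in> K ==> y \<in> K ==> x \<otimes> y \<in> K" "x \<in> K ==> y \<in> K ==> x \<oplus> y \<in> K" "\<one> \<in> K" "\<zero> \<in> K"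
 "x \<in> K ==> \<ominus> x \<in> K"
 using subringE(2,3,5-7)[OF subfieldE(1)[OF K_props(1)]] by simp_all

lemma K_pow: "x \<in> K ==> x [^] (m::nat) \<in> K"
 by (induction m) (simp_all add: K_mult)

lemma S_independent:
 assumes I: "I \<subseteq> {..<U.q}" and c: "\<And>k. k \<in> I ==> c k \<in> carrier \<Omega>" "l \<in> I" "c l \<noteq> \<zero>"
 shows "\<exists>x\<in>K. (\<Oplus>k\<in>I. c k \<otimes> S k x) \<noteq> \<zero>"
proof (rule ccontr)
 assume no: "\<not> ?thesis"
 have "c l = \<zero>"
 proof (rule independence_of_characters[where I=I and M=K and f=S and c=c])
  show "finite I" using I finite_subset by blast
  show "S k x \<in> carrier \<Omega>" if "x \<in> K" for k x using K_closed[OF S_K[OF that]] .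
  show "S k (x \<otimes> y) = S k x \<otimes> S k y" if "x \<in> K" "y \<in> K" for k x y
   using that K_closed by simp
  show "\<exists>x\<in>K. S k x \<noteq> S l x" if "k \<in> I" "l \<in> I" "k \<noteq> l" for k l using S_distinct that I by blast
  show "(\<Oplus>k\<in>I. c k \<otimes> S k x) = \<zero>" if "x \<in> K" for x using no that by blast
 qed (use c K_mult in auto)
 thus False using c by simp
qed

text \<open>
 Partial traces. They are the additive cocycle \<open>x + \<sigma>x + \<dots> + \<sigma>^(m-1)x\<close>,
 which fails to be periodic in \<open>m\<close> exactly by the trace of \<open>x\<close>.
\<close>

definition V :: "'a => nat => 'a" where "V x m = (\<Oplus>k\<in>{..<m}. S k x)"

lemma V_0 [simp]: "V x 0 = \<zero>" by (simp add: V_def)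

lemma V_Suc: "x \<in> K ==> V x (Suc m) = V x m \<oplus> S m x"
 using K_closed[OF S_K] by (simp add: V_def lessThan_Suc finsum_insert Pi_def a_comm)

lemma V_K: "x \<in> K ==> V x m \<in> K"
 by (induction m) (simp_all add: V_Suc K_mult S_K)

lemma V_closed: "x \<in> K ==> V x m \<in> carrier \<Omega>" using K_closed[OF V_K] .

lemma V_add: "\<g> \<in> carrier \<G> ==> x \<in> K ==> V x (r \<g> + m) = V x (r \<g>) \<oplus> \<g> (V x m)"
proof (induction m)
 case 0 thus ?case using V_closed by simp
next
 case (Suc m)
 have "\<g> (V x (Suc m)) = \<g> (V x m) \<oplus> S (m + r \<g>) x"
  using Suc.prems V_closed K_closed[OF S_K] S_act[of \<g> x m] by (simp add: V_Suc)
 thus ?case using Suc V_closed K_closed[OF S_K] by (simp add: V_Suc a_assoc add.commute)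
qed

lemma V_q: "x \<in> K ==> \<g> \<in> carrier \<G> ==> \<g> (V x U.q) = V x U.q"
proof -
 assume x: "x \<in> K" and g: "\<g> \<in> carrier \<G>"
 have Sc: "S k x \<in> carrier \<Omega>" for k using K_closed[OF S_K[OF x]] .
 have "\<g> (V x U.q) = (\<Oplus>k\<in>{..<U.q}. \<g> (S k x))"
  unfolding V_def by (rule finsum_automorphism[OF g]) (use Sc in auto)
 also have "\<dots> = (\<Oplus>k\<in>{..<U.q}. S (k + r \<g>) x)" using S_act[OF g x] by simp
 also have "\<dots> = V x U.q" unfolding V_def
  by (rule finsum_periodic_shift) (use Sc S_periodic[OF x] U.q_gt_1 in auto)
 finally show ?thesis .
qed

lemma V_period: "x \<in> K ==> V x (m + U.q) = V x U.q \<oplus> V x m"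
proof (induction m)
 case 0 thus ?case using V_closed by simp
next
 case (Suc m)
 thus ?case using V_closed K_closed[OF S_K] S_periodic[of x m] by (simp add: V_Suc a_assoc)
qed

text \<open>
 The trace is not identically zero by independence of characters, and it takes values in \<open>F\<close>.
\<close>

lemma trace_one_exists: "\<exists>y\<in>K. V y U.q = \<one>"
proof -
 have "\<exists>x\<in>K. (\<Oplus>k\<in>{..<U.q}. \<one> \<otimes> S k x) \<noteq> \<zero>"
  by (rule S_independent[of _ _ 0]) (use U.q_gt_1 in auto)
 then obtain x where x: "x \<in> K" "(\<Oplus>k\<in>{..<U.q}. \<one> \<otimes> S k x) \<noteq> \<zero>" by blast
 have Sc: "S k x \<in> carrier \<Omega>" for k using K_closed[OF S_K[OF x(1)]] .
 have nz: "V x U.q \<noteq> \<zero>" using x(2) Sc by (simp add: V_def)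
 have "V x U.q \<in> F"
  by (rule fixed_in_galois_extension[OF K F_subfield subset_refl V_K[OF x(1)]])
    (use V_q[OF x(1)] in \<open>simp add: fixgrp_def\<close>)
 hence "inv (V x U.q) \<in> F" using subfield_m_inv(1)[OF F_subfield] nz by blast
 define e where "e = inv (V x U.q)"
 have e: "e \<in> F" "e \<in> K" "e \<in> carrier \<Omega>" using \<open>inv (V x U.q) \<in> F\<close> K_props F_sub by (auto simp: e_def)
 have eV: "e \<otimes> V x U.q = \<one>" using nz V_closed[OF x(1)] field_Units by (simp add: e_def)
 have "V (e \<otimes> x) m = e \<otimes> V x m" for m
 proof (induction m)
  case (Suc m)
  have "S m (e \<otimes> x) = e \<otimes> S m x" using e K_closed[OF x(1)] by simp
  thus ?case using Suc e x(1) V_closed[OF x(1)] Sc by (simp add: V_Suc K_mult r_distr)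
 qed (use e in simp)
 hence "V (e \<otimes> x) U.q = \<one>" using eV by simp
 thus ?thesis using e x K_mult by blast
qed

end

section \<open>The cochain in characteristic p\<close>

context cyclic_quotient
begin

interpretation \<G>: group \<G> by (rule \<G>_group)

lemma orbit_stable:
 assumes "Y \<subseteq> carrier \<Omega>" shows "stable ((\<lambda>(\<g>, y). \<g> y) ` (carrier \<G> \<times> Y))"
 unfolding stable_def
proof (intro conjI ballI)
 show "(\<lambda>(\<g>, y). \<g> y) ` (carrier \<G> \<times> Y) \<subseteq> carrier \<Omega>" using assms by auto
 fix \<g> x assume g: "\<g> \<in> carrier \<G>" and "x \<in> (\<lambda>(\<g>, y). \<g> y) ` (carrier \<G> \<times> Y)"
 then obtain \<d> y where d: "\<d> \<in> carrier \<G>" "y \<in> Y" "x = \<d> y" by auto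
 have "\<g> x = (\<g> \<otimes>\<^bsub>\<G>\<^esub> \<d>) y" using \<G>_mult[OF g d(1), of y] d assms by auto
 thus "\<g> x \<in> (\<lambda>(\<g>, y). \<g> y) ` (carrier \<G> \<times> Y)" using g d by (intro image_eqI[of _ _ "(\<g> \<otimes>\<^bsub>\<G>\<^esub> \<d>, y)"]) auto
qed

lemma finite_orbits:
 assumes "Y \<subseteq> carrier \<Omega>" "finite Y" shows "finite ((\<lambda>(\<g>, y). \<g> y) ` (carrier \<G> \<times> Y))"
proof -
 have "(\<lambda>(\<g>, y). \<g> y) ` (carrier \<G> \<times> Y) = (\<Union>y\<in>Y. (\<lambda>\<g>. \<g> y) ` carrier \<G>)" by auto
 thus ?thesis using finite_orbit assms by (auto simp: subset_iff)
qed

lemma orbit_refl: "Y \<subseteq> carrier \<Omega> ==> Y \<subseteq> (\<lambda>(\<g>, y). \<g> y) ` (carrier \<G> \<times> Y)"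
proof
 fix y assume "Y \<subseteq> carrier \<Omega>" "y \<in> Y"
 hence "y = \<one>\<^bsub>\<G>\<^esub> y" by (auto simp: gal_one)
 thus "y \<in> (\<lambda>(\<g>, y). \<g> y) ` (carrier \<G> \<times> Y)" using \<open>y \<in> Y\<close> by (intro image_eqI[of _ _ "(\<one>\<^bsub>\<G>\<^esub>, y)"]) auto
qed

text \<open>
 A list that generates a Galois extension over every Galois extension containing \<open>K\<close>. The
 cochain factors through the field that it generates over \<open>K\<close>.
\<close>

definition tower_over_K :: "'a list => bool" where
 "tower_over_K ts \<longleftrightarrow> stable (set ts) \<and> (\<forall>E. subfield E \<Omega> \<longrightarrow> K \<subseteq> E \<longrightarrow> separable_tower E ts)"

context
 assumes char_p: "nat_mult p \<one> = \<zero>"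
begin

text \<open>
 The Artin-Schreier map \<open>x^p - x\<close>.
\<close>

definition wp :: "'a => 'a" where "wp x = x [^] p \<ominus> x"

lemma wp_closed [simp]: "x \<in> carrier \<Omega> ==> wp x \<in> carrier \<Omega>" by (simp add: wp_def)

lemma wp_add: "x \<in> carrier \<Omega> ==> y \<in> carrier \<Omega> ==> wp (x \<oplus> y) = wp x \<oplus> wp y"
proof -
 assume xy: "x \<in> carrier \<Omega>" "y \<in> carrier \<Omega>"
 have "(x \<oplus> y) [^] p = x [^] p \<oplus> y [^] p" using frobenius_add[OF U.p char_p xy, of 1] by simp
 moreover have "(a \<oplus> b) \<ominus> (x \<oplus> y) = (a \<ominus> x) \<oplus> (b \<ominus> y)" if "a \<in> carrier \<Omega>" "b \<in> carrier \<Omega>" for a b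
  using that xy by algebra
 ultimately show ?thesis using xy by (simp add: wp_def)
qed

lemma wp_nat_mult: "wp (nat_mult k \<one>) = \<zero>"
 unfolding wp_def using nat_mult_power_prime[OF U.p char_p] by (simp add: minus_eq r_neg)

lemma wp_automorphism: "\<g> \<in> carrier \<G> ==> x \<in> carrier \<Omega> ==> \<g> (wp x) = wp (\<g> x)"
 by (simp add: wp_def)

lemma automorphism_nat_mult: "\<g> \<in> carrier \<G> ==> \<g> (nat_mult k \<one>) = nat_mult k \<one>"
 by (induction k) (simp_all add: nat_mult_Suc)

lemma wp_trinomial: "x \<in> carrier \<Omega> ==> b \<in> carrier \<Omega> ==>
  x [^] p \<oplus> ((\<ominus> \<one>) \<otimes> x \<oplus> (\<ominus> b)) = \<zero> \<longleftrightarrow> wp x = b"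
proof -
 assume xb: "x \<in> carrier \<Omega>" "b \<in> carrier \<Omega>"
 have "a \<oplus> ((\<ominus> \<one>) \<otimes> x \<oplus> (\<ominus> b)) = (a \<ominus> x) \<ominus> b" if "a \<in> carrier \<Omega>" for a using that xb by algebra
 thus ?thesis using xb by (simp add: wp_def)
qed

lemma wp_fiber:
 assumes x: "x \<in> carrier \<Omega>"
 shows "card ((\<lambda>k. x \<oplus> nat_mult k \<one>) ` {..<p}) = p"
  "\<And>y. y \<in> (\<lambda>k. x \<oplus> nat_mult k \<one>) ` {..<p} ==> y \<in> carrier \<Omega> \<and> y [^] p \<oplus> ((\<ominus> \<one>) \<otimes> y \<oplus> (\<ominus> wp x)) = \<zero>"
proof -
 have "inj_on (\<lambda>k. x \<oplus> nat_mult k \<one>) {..<p}"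
 proof (rule inj_onI)
  fix k l assume kl: "k \<in> {..<p}" "l \<in> {..<p}" "x \<oplus> nat_mult k \<one> = x \<oplus> nat_mult l \<one>"
  have "nat_mult k \<one> = nat_mult l \<one>" using kl(3) x by simp
  thus "k = l" using nat_mult_char_inject[OF U.p char_p one_not_zero] kl by simp
 qed
 thus "card ((\<lambda>k. x \<oplus> nat_mult k \<one>) ` {..<p}) = p" by (simp add: card_image)
 fix y assume "y \<in> (\<lambda>k. x \<oplus> nat_mult k \<one>) ` {..<p}"
 then obtain k where y: "y = x \<oplus> nat_mult k \<one>" by blast
 have "wp y = wp x" unfolding y using x by (simp add: wp_add wp_nat_mult)
 thus "y \<in> carrier \<Omega> \<and> y [^] p \<oplus> ((\<ominus> \<one>) \<otimes> y \<oplus> (\<ominus> wp x)) = \<zero>"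
  using wp_trinomial[of y "wp x"] x y by simp
qed

lemma wp_separable:
 assumes x: "x \<in> carrier \<Omega>" and E: "subfield E \<Omega>" "wp x \<in> E"
 shows "separable_root E x"
proof (rule trinomial_separable[where a="\<ominus> \<one>" and b="\<ominus> wp x" and Y="(\<lambda>k. x \<oplus> nat_mult k \<one>) ` {..<p}"])
 show "p \<ge> 2" by (rule U.p_ge_2)
 show "\<ominus> \<one> \<in> E" "\<ominus> wp x \<in> E" using E(2) subringE(3,5)[OF subfieldE(1)[OF E(1)]] by auto
 show "x \<in> (\<lambda>k. x \<oplus> nat_mult k \<one>) ` {..<p}"
  using x U.p_ge_2 by (intro image_eqI[of _ _ 0]) auto
 show "y \<in> carrier \<Omega> \<and> y [^] p \<oplus> ((\<ominus> \<one>) \<otimes> y \<oplus> (\<ominus> wp x)) = \<zero>"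
  if "y \<in> (\<lambda>k. x \<oplus> nat_mult k \<one>) ` {..<p}" for y by (rule wp_fiber(2)[OF x that])
 show "card ((\<lambda>k. x \<oplus> nat_mult k \<one>) ` {..<p}) = p" by (rule wp_fiber(1)[OF x])
qed (use E in simp_all)

lemma wp_kernel:
 assumes e: "e \<in> carrier \<Omega>" "wp e = \<zero>" shows "\<exists>k<p. e = nat_mult k \<one>"
proof (rule ccontr)
 define Y where "Y = (\<lambda>k. \<zero> \<oplus> nat_mult k \<one>) ` {..<p}"
 assume "\<not> (\<exists>k<p. e = nat_mult k \<one>)"
 hence "e \<notin> Y" by (auto simp: Y_def)
 have wz: "wp \<zero> = \<zero>" using wp_nat_mult[of 0] by simp
 have "card (insert e Y) \<le> p"
 proof (rule trinomial_roots_card)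
  show "p \<ge> 2" by (rule U.p_ge_2)
  show "finite (insert e Y)" by (simp add: Y_def)
  show "w \<in> carrier \<Omega> \<and> w [^] p \<oplus> ((\<ominus> \<one>) \<otimes> w \<oplus> (\<ominus> \<zero>)) = \<zero>" if "w \<in> insert e Y" for w
   using that wp_fiber(2)[OF zero_closed, of w] wp_trinomial[OF e(1) zero_closed] e wz
   unfolding Y_def by auto
 qed simp_all
 thus False using wp_fiber(1)[OF zero_closed] \<open>e \<notin> Y\<close> by (simp add: Y_def)
qed

text \<open>
 Let \<open>y\<close> have trace one and let \<open>V y\<close> be its partial traces. Then \<open>V y (r
 \<g>)\<close> has coboundary equal to the negative of the carry. Applying the Artin-Schreier map to
 \<open>V y\<close> gives the partial traces \<open>V w\<close> of \<open>w = y^p - y\<close>, and these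
 form a true cocycle with values in \<open>K\<close>, since \<open>w\<close> has trace zero. By the
 additive form of Hilbert's theorem 90 it is the coboundary of some \<open>\<chi>\<close>. With
 \<open>\<theta>^p - \<theta> = \<chi>\<close> the difference \<open>\<g>\<theta> - \<theta> - V y (r
 \<g>)\<close> lies in the prime field, and its coboundary is the carry.
\<close>

lemma bullet_cochain_char_p:
 obtains C ts where "bullet_cochain (carrier \<G>) C" "tower_over_K ts"
  "\<And>\<g>. \<g> \<in> fixgrp (K \<union> set ts) ==> C \<g> = \<zero>\<^bsub>A\<^esub>"
proof -
 obtain y where y: "y \<in> K" "V y U.q = \<one>" using trace_one_exists by blast
 have yc: "y \<in> carrier \<Omega>" using K_closed[OF y(1)] .
 define w where "w = wp y"
 have wK: "w \<in> K" unfolding w_def wp_def minus_eq using y(1) by (intro K_mult K_pow)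
 note Vy = V_closed[OF y(1)] and Vw = V_closed[OF wK]
 have Sy: "S k y \<in> carrier \<Omega>" for k using K_closed[OF S_K[OF y(1)]] .
 have W: "V w m = wp (V y m)" for m
 proof (induction m)
  case 0 thus ?case using wp_nat_mult[of 0] by simp
 next
  case (Suc m)
  have "S m w = wp (S m y)" unfolding w_def using wp_automorphism[of "S m" y] yc by simp
  thus ?case using Suc wK y(1) Vy Sy by (simp add: V_Suc wp_add)
 qed
 have Wq: "V w U.q = \<zero>" using W[of U.q] y(2) wp_nat_mult[of 1] by simp
 define f where "f = (\<lambda>j. V w j \<otimes> S j y)"
 have fc: "f j \<in> carrier \<Omega>" for j using Vw Sy by (simp add: f_def)
 have fper: "f (j + U.q) = f j" for j
  using V_period[OF wK, of j] Wq Vw S_periodic[OF y(1), of j] by (simp add: f_def)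
 \<comment> \<open>Hilbert 90: \<open>-\<Sum>\<^sub>j (V w j) (\<sigma>^j y)\<close> has the coboundary \<open>V w\<close> because \<open>y\<close> has trace one.\<close>
 define \<chi> where "\<chi> = \<ominus> (\<Oplus>j\<in>{..<U.q}. f j)"
 have fK: "f j \<in> K" for j unfolding f_def using V_K[OF wK] S_K[OF y(1)] by (intro K_mult)
 have sumK: "(\<Oplus>j\<in>{..<m}. f j) \<in> K" for m :: nat
  by (induction m) (use fc fK K_mult in \<open>auto simp: lessThan_Suc finsum_insert Pi_def\<close>)
 have \<chi>K: "\<chi> \<in> K" unfolding \<chi>_def using sumK by (intro K_mult)
 have \<chi>c: "\<chi> \<in> carrier \<Omega>" using K_closed[OF \<chi>K] .
 have act_\<chi>: "\<g> \<chi> = \<chi> \<oplus> V w (r \<g>)" if g: "\<g> \<in> carrier \<G>" for \<g>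
 proof -
  let ?W = "V w (r \<g>)"
  have gf: "\<g> (f j) = f (j + r \<g>) \<oplus> (\<ominus> ?W) \<otimes> S (j + r \<g>) y" for j
  proof -
   have "V w (r \<g> + j) = ?W \<oplus> \<g> (V w j)" by (rule V_add[OF g wK])
   hence "\<g> (V w j) = V w (r \<g> + j) \<oplus> (\<ominus> ?W)"
    using Vw g by (metis a_comm add.inv_closed add.inv_solve_left' \<G>_closed)
   moreover have "\<g> (f j) = \<g> (V w j) \<otimes> S (j + r \<g>) y"
    unfolding f_def using S_act[OF g y(1)] Vw Sy g by simp
   ultimately show ?thesis using Vw Sy by (simp add: f_def l_distr add.commute)
  qed
  have "\<g> (\<Oplus>j\<in>{..<U.q}. f j) = (\<Oplus>j\<in>{..<U.q}. \<g> (f j))"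
   by (rule finsum_automorphism[OF g]) (use fc in auto)
  also have "\<dots> = (\<Oplus>j\<in>{..<U.q}. f (j + r \<g>)) \<oplus> (\<Oplus>j\<in>{..<U.q}. (\<ominus> ?W) \<otimes> S (j + r \<g>) y)"
   unfolding gf by (rule finsum_addf) (use fc Vw Sy in auto)
  also have "(\<Oplus>j\<in>{..<U.q}. f (j + r \<g>)) = (\<Oplus>j\<in>{..<U.q}. f j)"
   by (rule finsum_periodic_shift) (use fc fper U.q_gt_1 in auto)
  also have "(\<Oplus>j\<in>{..<U.q}. (\<ominus> ?W) \<otimes> S (j + r \<g>) y) = (\<ominus> ?W) \<otimes> (\<Oplus>j\<in>{..<U.q}. S (j + r \<g>) y)"
   by (rule finsum_rdistr[symmetric]) (use Vw Sy in auto)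
  also have "(\<Oplus>j\<in>{..<U.q}. S (j + r \<g>) y) = (\<Oplus>j\<in>{..<U.q}. S j y)"
   by (rule finsum_periodic_shift) (use Sy S_periodic[OF y(1)] U.q_gt_1 in auto)
  also have "\<dots> = \<one>" using y(2) by (simp add: V_def)
  finally have "\<g> (\<Oplus>j\<in>{..<U.q}. f j) = (\<Oplus>j\<in>{..<U.q}. f j) \<oplus> (\<ominus> ?W)" using Vw by simp
  moreover have fsc: "(\<Oplus>j\<in>{..<U.q}. f j) \<in> carrier \<Omega>" using fc by (intro finsum_closed) auto
  ultimately show ?thesis unfolding \<chi>_def using g Vw by (simp add: minus_add)
 qed
 obtain \<theta> where \<theta>: "\<theta> \<in> carrier \<Omega>" "wp \<theta> = \<chi>"
  using trinomial_root[OF U.p_ge_2, of "\<ominus> \<one>" "\<ominus> \<chi>"] wp_trinomial[OF _ \<chi>c] \<chi>c by auto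
 define \<kappa> where "\<kappa> = (\<lambda>\<g>. SOME k. k < p \<and> \<g> \<theta> = \<theta> \<oplus> V y (r \<g>) \<oplus> nat_mult k \<one>)"
 have \<kappa>: "\<kappa> \<g> < p \<and> \<g> \<theta> = \<theta> \<oplus> V y (r \<g>) \<oplus> nat_mult (\<kappa> \<g>) \<one>" if g: "\<g> \<in> carrier \<G>" for \<g>
 proof -
  define b where "b = \<theta> \<oplus> V y (r \<g>)"
  have b: "b \<in> carrier \<Omega>" "\<g> \<theta> \<in> carrier \<Omega>" using \<theta> Vy g by (simp_all add: b_def)
  define e where "e = \<g> \<theta> \<ominus> b"
  have ec: "e \<in> carrier \<Omega>" "\<g> \<theta> = b \<oplus> e" using b by (simp_all add: e_def) algebra
  have "wp (\<g> \<theta>) = wp b \<oplus> wp e" unfolding ec(2) using b(1) ec(1) by (rule wp_add)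
  moreover have "wp (\<g> \<theta>) = \<chi> \<oplus> V w (r \<g>)" using wp_automorphism[OF g \<theta>(1)] \<theta>(2) act_\<chi>[OF g] by simp
  moreover have "wp b = \<chi> \<oplus> V w (r \<g>)" unfolding b_def using wp_add[OF \<theta>(1) Vy] \<theta>(2) W by simp
  ultimately have "wp e = \<zero>" using \<chi>c Vw ec(1) by (metis a_closed add.l_cancel_one' wp_closed)
  then obtain k where "k < p" "e = nat_mult k \<one>" using wp_kernel[OF ec(1)] by blast
  hence "k < p \<and> \<g> \<theta> = \<theta> \<oplus> V y (r \<g>) \<oplus> nat_mult k \<one>" using ec(2) by (simp add: b_def)
  thus ?thesis unfolding \<kappa>_def by (rule someI)
 qed
 define C where "C = (\<lambda>\<g>. U.nat_mult (\<kappa> \<g>) T)"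
 obtain ts where ts: "set ts = (\<lambda>(\<g>, y). \<g> y) ` (carrier \<G> \<times> {\<theta>})"
  using finite_list[OF finite_orbits[of "{\<theta>}"]] \<theta> by auto
 show ?thesis
 proof (rule that)
  show "bullet_cochain (carrier \<G>) C"
   unfolding bullet_cochain_def
  proof (intro conjI ballI)
   show "\<exists>b\<in>carrier A. C \<g> = t \<otimes>\<^bsub>A\<^esub> b" for \<g> unfolding C_def by (rule socle_in_radical)
   fix \<g> \<d> assume g: "\<g> \<in> carrier \<G>" "\<d> \<in> carrier \<G>"
   have gd: "\<g> \<otimes>\<^bsub>\<G>\<^esub> \<d> \<in> carrier \<G>" using g by simp
   define c where "c = (r \<g> + r \<d>) div U.q"
   have Vc: "V y (m + k * U.q) = V y m \<oplus> nat_mult k \<one>" for m k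
   proof (induction k)
    case (Suc k)
    have "V y (m + Suc k * U.q) = V y (m + k * U.q + U.q)" by (simp add: ac_simps)
    also have "\<dots> = \<one> \<oplus> V y (m + k * U.q)" using V_period[OF y(1)] y(2) by simp
    finally show ?case using Suc Vy by (simp add: nat_mult_Suc a_ac)
   qed (use Vy in simp)
   have "(\<g> \<otimes>\<^bsub>\<G>\<^esub> \<d>) \<theta> = \<g> (\<d> \<theta>)" using \<G>_mult[OF g \<theta>(1)] .
   also have "\<dots> = \<g> \<theta> \<oplus> \<g> (V y (r \<d>)) \<oplus> nat_mult (\<kappa> \<d>) \<one>"
    using \<kappa>[OF g(2)] \<theta>(1) Vy g(1) automorphism_nat_mult[OF g(1)] by simp
   also have "\<dots> = \<theta> \<oplus> (V y (r \<g>) \<oplus> \<g> (V y (r \<d>))) \<oplus> (nat_mult (\<kappa> \<g>) \<one> \<oplus> nat_mult (\<kappa> \<d>) \<one>)"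
    using \<kappa>[OF g(1)] \<theta>(1) Vy g by (simp add: a_ac)
   also have "V y (r \<g>) \<oplus> \<g> (V y (r \<d>)) = V y (r \<g> + r \<d>)" using V_add[OF g(1) y(1)] by simp
   also have "\<dots> = V y (r (\<g> \<otimes>\<^bsub>\<G>\<^esub> \<d>)) \<oplus> nat_mult c \<one>"
    using Vc[of "(r \<g> + r \<d>) mod U.q" c] by (simp only: r_mult[OF g] c_def mod_div_mult_eq)
   finally have 1: "(\<g> \<otimes>\<^bsub>\<G>\<^esub> \<d>) \<theta> = \<theta> \<oplus> V y (r (\<g> \<otimes>\<^bsub>\<G>\<^esub> \<d>)) \<oplus> nat_mult (\<kappa> \<g> + \<kappa> \<d> + c) \<one>"
    using \<theta>(1) Vy by (simp add: nat_mult_add a_ac)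
   have "nat_mult (\<kappa> (\<g> \<otimes>\<^bsub>\<G>\<^esub> \<d>)) \<one> = nat_mult (\<kappa> \<g> + \<kappa> \<d> + c) \<one>"
    using 1 \<kappa>[OF gd] \<theta>(1) Vy by simp
   hence "nat_mult (\<kappa> (\<g> \<otimes>\<^bsub>\<G>\<^esub> \<d>)) \<one> = nat_mult ((\<kappa> \<g> + \<kappa> \<d> + c) mod p) \<one>"
    using nat_mult_mod[OF char_p, of \<one>] by simp
   hence "\<kappa> (\<g> \<otimes>\<^bsub>\<G>\<^esub> \<d>) = (\<kappa> \<g> + \<kappa> \<d> + c) mod p"
    using nat_mult_char_inject[OF U.p char_p one_not_zero] \<kappa>[OF gd] U.p_ge_2 by simp
   hence "C (\<g> \<otimes>\<^bsub>\<G>\<^esub> \<d>) = U.nat_mult (\<kappa> \<g> + \<kappa> \<d> + c) T"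
    using U.nat_mult_mod[OF U.char T_closed] by (simp add: C_def)
   thus "C (\<g> \<otimes>\<^bsub>\<G>\<^esub> \<d>) = C \<g> \<oplus>\<^bsub>A\<^esub> U.s [^]\<^bsub>A\<^esub> r \<g> \<otimes>\<^bsub>A\<^esub> C \<d> \<oplus>\<^bsub>A\<^esub> U.nat_mult ((r \<g> + r \<d>) div U.q) T"
    by (simp add: C_def c_def U.nat_mult_add U.nat_mult_right)
  qed
  show "tower_over_K ts"
   unfolding tower_over_K_def
  proof (intro conjI allI impI)
   show "stable (set ts)" unfolding ts using \<theta> by (intro orbit_stable) auto
   fix E assume E: "subfield E \<Omega>" "K \<subseteq> E"
   have tsc: "set ts \<subseteq> carrier \<Omega>" unfolding ts using \<theta> by auto
   have "separable_tower E (ts @ []) \<and> finite_extension E [] \<subseteq> finite_extension E (ts @ [])"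
   proof (rule separable_tower_append)
    show "subfield E \<Omega>" by (rule E)
    show "F \<subseteq> E" using E K_props by blast
    fix x E' assume x: "x \<in> set ts" and E': "subfield E' \<Omega>" "finite_extension E [] \<subseteq> E'"
    obtain \<g> where g: "\<g> \<in> carrier \<G>" "x = \<g> \<theta>" using x unfolding ts by auto
    have "wp x = \<g> \<chi>" using wp_automorphism[OF g(1) \<theta>(1)] \<theta>(2) g(2) by simp
    moreover have "\<g> \<chi> \<in> K" using \<chi>K g(1) K_props(4) by (simp add: stable_def)
    ultimately have "wp x \<in> E'" using E E' by auto
    thus "separable_root E' x" using wp_separable[OF _ E'(1)] x tsc by auto
   qed (use tsc in auto)
   thus "separable_tower E ts" by simp
  qed
  fix \<g> assume g: "\<g> \<in> fixgrp (K \<union> set ts)"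
  have gc: "\<g> \<in> carrier \<G>" and "\<g> \<in> fixgrp K" using g by (auto simp: fixgrp_def)
  hence r0: "r \<g> = 0" using r_ker by blast
  have "\<theta> \<in> set ts" unfolding ts using orbit_refl[of "{\<theta>}"] \<theta> by auto
  hence "\<g> \<theta> = \<theta>" using g by (auto simp: fixgrp_def)
  hence "\<theta> = \<theta> \<oplus> nat_mult (\<kappa> \<g>) \<one>" using \<kappa>[OF gc] r0 \<theta>(1) by simp
  hence "nat_mult (\<kappa> \<g>) \<one> = nat_mult 0 \<one>"
   using add.l_cancel_one'[OF \<theta>(1), of "nat_mult (\<kappa> \<g>) \<one>"] by simp
  hence "\<kappa> \<g> = 0" using nat_mult_char_inject[OF U.p char_p one_not_zero] \<kappa>[OF gc] U.p_ge_2 by simp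
  thus "C \<g> = \<zero>\<^bsub>A\<^esub>" by (simp add: C_def)
 qed
qed

end
end

section \<open>Sums over a window of exponents\<close>

context uniserial_ring
begin

text \<open>
 The element \<open>w' = t^(i-1-P)\<close>, where \<open>P = p^(n-1)\<close>. Since \<open>s^P = 1 +
 t^P\<close>, it satisfies \<open>s^P w' = w' + t^(i-1)\<close> and \<open>s^P t w' = t w'\<close>. The
 lower bound on \<open>i\<close> gives \<open>w' \<in> tA\<close>.
\<close>

definition top_shift where "top_shift = t [^] (i - 1 - P)"

lemma top_shift_closed [simp]: "top_shift \<in> carrier A" by (simp add: top_shift_def)

lemma top_shift_P: "t [^] P \<otimes> top_shift = t [^] (i - 1)"
proof -
 have "P + (i - 1 - P) = i - 1" using i_lower by linarith
 thus ?thesis using nat_pow_mult[OF t, of P "i - 1 - P"] by (simp only: top_shift_def)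
qed

lemma top_shift_radical: "\<exists>b\<in>carrier A. top_shift = t \<otimes> b"
proof
 have "i - 1 - P = Suc (i - 2 - P)" using i_lower by linarith
 thus "top_shift = t \<otimes> t [^] (i - 2 - P)" by (simp add: top_shift_def m_comm)
qed simp

lemma s_pow_P_top_shift:
 "s [^] P \<otimes> top_shift = top_shift \<oplus> t [^] (i - 1)"
 "s [^] P \<otimes> (t \<otimes> top_shift) = t \<otimes> top_shift"
proof -
 have sP: "s [^] P = \<one> \<oplus> t [^] P" by (rule s_pow_prime_power)
 show "s [^] P \<otimes> top_shift = top_shift \<oplus> t [^] (i - 1)"
  unfolding sP using top_shift_P by (simp add: l_distr)
 have "t [^] P \<otimes> (t \<otimes> top_shift) = t \<otimes> (t [^] P \<otimes> top_shift)" by (simp add: m_lcomm)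
 also have "\<dots> = t [^] Suc (i - 1)" unfolding top_shift_P by (simp add: m_comm)
 also have "\<dots> = \<zero>" using t_i i_ge_3 by simp
 finally show "s [^] P \<otimes> (t \<otimes> top_shift) = t \<otimes> top_shift" unfolding sP by (simp add: l_distr)
qed

lemma geometric_top_shift: "(\<Oplus>h\<in>{..<m::nat}. s [^] h \<otimes> (t \<otimes> top_shift)) \<oplus> top_shift = s [^] m \<otimes> top_shift"
proof (induction m)
 case (Suc m)
 have "s [^] Suc m \<otimes> top_shift = s [^] m \<otimes> top_shift \<oplus> s [^] m \<otimes> (t \<otimes> top_shift)"
  by (simp add: m_assoc l_distr r_distr)
 thus ?case using Suc[symmetric] by (simp add: lessThan_Suc finsum_insert Pi_def a_ac)
qed simp

text \<open>
 The element \<open>\<Sum>\<^sub>h\<^sub><\<^sub>P x(h + m) s^h t w' - u w'\<close>. It encodes a function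
 \<open>x\<close> with \<open>x(h + P) = x(h) + u\<close> by its values on a window of length
 \<open>P\<close> beginning at \<open>m\<close>.
\<close>

definition window :: "(nat => nat) => nat => nat => 'a" where
 "window x u m = (\<Oplus>h\<in>{..<P}. nat_mult (x (h + m)) (s [^] h \<otimes> (t \<otimes> top_shift))) \<ominus> nat_mult u top_shift"

lemma window_sum_closed [simp]: "(\<Oplus>h\<in>{..<P}. nat_mult (x (h + m)) (s [^] h \<otimes> (t \<otimes> top_shift))) \<in> carrier A"
 by (intro finsum_closed) auto

lemma window_closed [simp]: "window x u m \<in> carrier A" by (simp add: window_def)

text \<open>
 Moving the window by one replaces \<open>x(m)\<close> by \<open>x(m + P) = x(m) + u\<close>, and the
 surplus \<open>u t w'\<close> is absorbed by \<open>s (u w') = u w' + u t w'\<close>.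
\<close>

lemma window_step:
 assumes x: "\<And>h. x (h + P) mod p = (x h + u) mod p"
 shows "s \<otimes> window x u (Suc m) = window x u m"
proof -
 define w where "w = t \<otimes> top_shift"
 have w: "w \<in> carrier A" by (simp add: w_def)
 define f where "f = (\<lambda>h. nat_mult (x (h + m)) (s [^] h \<otimes> w))"
 have f: "f h \<in> carrier A" for h using w by (simp add: f_def)
 obtain l where l: "P = Suc l" using p_ge_2 by (cases P) auto
 let ?S = "\<Oplus>h\<in>{..<P}. f h" and ?S' = "\<Oplus>h\<in>{..<P}. f (Suc h)"
 have Sc: "?S \<in> carrier A" "?S' \<in> carrier A" using f by (auto intro!: finsum_closed)
 have "s \<otimes> nat_mult (x (h + Suc m)) (s [^] h \<otimes> w) = f (Suc h)" for h
  using w by (simp add: f_def nat_mult_right m_assoc[symmetric] m_comm[of s])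
 moreover have "s \<otimes> (\<Oplus>h\<in>{..<P}. nat_mult (x (h + Suc m)) (s [^] h \<otimes> w))
   = (\<Oplus>h\<in>{..<P}. s \<otimes> nat_mult (x (h + Suc m)) (s [^] h \<otimes> w))"
  by (rule finsum_rdistr) (use w in auto)
 ultimately have 1: "s \<otimes> (\<Oplus>h\<in>{..<P}. nat_mult (x (h + Suc m)) (s [^] h \<otimes> w)) = ?S'" by simp
 have fP: "f P = f 0 \<oplus> nat_mult u w"
 proof -
  have "f P = nat_mult (x (m + P)) w"
   using s_pow_P_top_shift(2) by (simp add: f_def w_def add.commute)
  also have "\<dots> = nat_mult (x (m + P) mod p) w" by (rule nat_mult_mod[OF char w, symmetric])
  also have "\<dots> = nat_mult (x m + u) w" unfolding x by (rule nat_mult_mod[OF char w])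
  finally show ?thesis using w by (simp add: f_def nat_mult_add)
 qed
 have "(\<Oplus>h\<in>{..Suc l}. f h) = f (Suc l) \<oplus> (\<Oplus>h\<in>{..l}. f h)" by (rule finsum_Suc) (use f in auto)
 moreover have "(\<Oplus>h\<in>{..Suc l}. f h) = (\<Oplus>h\<in>{..l}. f (Suc h)) \<oplus> f 0" by (rule finsum_Suc2) (use f in auto)
 ultimately have cyc: "?S' \<oplus> f 0 = f P \<oplus> ?S" by (simp only: l lessThan_Suc_atMost)
 have 2: "?S' = nat_mult u w \<oplus> ?S"
 proof -
  have "a = b \<oplus> c" if "a \<oplus> d = (d \<oplus> b) \<oplus> c" "a \<in> carrier A" "b \<in> carrier A" "c \<in> carrier A" "d \<in> carrier A"
   for a b c d
  proof -
   have "d \<oplus> a = d \<oplus> (b \<oplus> c)" using that by (simp only: a_comm[of d a] a_assoc)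
   thus ?thesis using that by (simp only: add.l_cancel add.m_closed)
  qed
  from this[OF cyc[unfolded fP]] show ?thesis using f Sc w by (simp only: nat_mult_closed)
 qed
 have "s \<otimes> nat_mult u top_shift = nat_mult u top_shift \<oplus> nat_mult u w"
  using w nat_mult_distrib[of top_shift w u] by (simp add: nat_mult_right l_distr w_def)
 moreover have "s \<otimes> window x u (Suc m) = s \<otimes> (\<Oplus>h\<in>{..<P}. nat_mult (x (h + Suc m)) (s [^] h \<otimes> w)) \<ominus> s \<otimes> nat_mult u top_shift"
  unfolding window_def w_def by (simp only: minus_eq r_distr r_minus s_closed window_sum_closed nat_mult_closed top_shift_closed a_inv_closed)
 ultimately have "s \<otimes> window x u (Suc m) = (nat_mult u w \<oplus> ?S) \<ominus> (nat_mult u top_shift \<oplus> nat_mult u w)"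
  using 1 2 by simp
 also have "\<dots> = ?S \<ominus> nat_mult u top_shift"
 proof -
  have "(a \<oplus> b) \<ominus> (c \<oplus> a) = b \<ominus> c" if "a \<in> carrier A" "b \<in> carrier A" "c \<in> carrier A" for a b c
   using that by algebra
  thus ?thesis using w Sc by simp
 qed
 finally show ?thesis by (simp add: window_def f_def w_def)
qed

lemma window_shift:
 assumes x: "\<And>h. x (h + P) mod p = (x h + u) mod p"
 shows "s [^] m \<otimes> window x u m = window x u 0"
proof (induction m)
 case (Suc m)
 have "s [^] Suc m \<otimes> window x u (Suc m) = s [^] m \<otimes> (s \<otimes> window x u (Suc m))" by (simp add: m_assoc)
 thus ?case using Suc window_step[of x u m, OF x] by simp
qed simp

text \<open>
 The coefficient \<open>c\<close> contributes \<open>c \<Sum>\<^sub>h\<^sub><\<^sub>P s^h t w' = c (s^P -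
 1) w' = c t^(i-1)\<close>. This is how a carry in the exponents of roots of unity becomes the carry of the
 bullet product.
\<close>

lemma window_add:
 assumes x: "\<And>h. x h mod p = (y h + z (h + m) + c) mod p" and u: "u mod p = (v + w) mod p"
 shows "window x u 0 = window y v 0 \<oplus> window z w m \<oplus> nat_mult c (t [^] (i - 1))"
proof -
 define g where "g = (\<lambda>h::nat. s [^] h \<otimes> (t \<otimes> top_shift))"
 have g: "g h \<in> carrier A" for h :: nat by (simp add: g_def)
 have split: "nat_mult (x h) (g h) = nat_mult (y h) (g h) \<oplus> nat_mult (z (h + m)) (g h) \<oplus> nat_mult c (g h)" for h
 proof -
  have "nat_mult (x h) (g h) = nat_mult ((y h + z (h + m) + c) mod p) (g h)"
   using nat_mult_mod[OF char g, of "x h"] x by simp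
  also have "\<dots> = nat_mult (y h + z (h + m) + c) (g h)" by (rule nat_mult_mod[OF char g])
  finally show ?thesis using g by (simp add: nat_mult_add)
 qed
 have "nat_mult u top_shift = nat_mult ((v + w) mod p) top_shift"
  using nat_mult_mod[OF char top_shift_closed, of u] u by simp
 also have "\<dots> = nat_mult (v + w) top_shift" by (rule nat_mult_mod[OF char top_shift_closed])
 finally have us: "nat_mult u top_shift = nat_mult v top_shift \<oplus> nat_mult w top_shift" by (simp add: nat_mult_add)
 have G: "(\<Oplus>h\<in>{..<P}. nat_mult c (g h)) = nat_mult c (t [^] (i - 1))"
 proof -
  have "(\<Oplus>h\<in>{..<P}. g h) \<oplus> top_shift = t [^] (i - 1) \<oplus> top_shift"
   using geometric_top_shift[of P] s_pow_P_top_shift(1) by (simp add: g_def a_comm)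
  moreover have Gc: "(\<Oplus>h\<in>{..<P}. g h) \<in> carrier A" using g by (intro finsum_closed) auto
  ultimately have "(\<Oplus>h\<in>{..<P}. g h) = t [^] (i - 1)" by simp
  moreover have "nat_mult c \<one> \<otimes> (\<Oplus>h\<in>{..<P}. g h) = (\<Oplus>h\<in>{..<P}. nat_mult c \<one> \<otimes> g h)"
   by (rule finsum_rdistr) (use g in auto)
  ultimately show ?thesis using g by (simp add: nat_mult_left)
 qed
 have "(\<Oplus>h\<in>{..<P}. nat_mult (x h) (g h)) = (\<Oplus>h\<in>{..<P}. nat_mult (y h) (g h))
   \<oplus> (\<Oplus>h\<in>{..<P}. nat_mult (z (h + m)) (g h)) \<oplus> (\<Oplus>h\<in>{..<P}. nat_mult c (g h))"
  unfolding split using g by (simp add: finsum_addf Pi_def)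
 moreover have "(a \<oplus> b \<oplus> d) \<ominus> (e \<oplus> f) = (a \<ominus> e) \<oplus> (b \<ominus> f) \<oplus> d"
  if "a \<in> carrier A" "b \<in> carrier A" "d \<in> carrier A" "e \<in> carrier A" "f \<in> carrier A" for a b d e f
  using that by algebra
 moreover have "(\<Oplus>h\<in>{..<P}. nat_mult (y h) (g h)) \<in> carrier A" "(\<Oplus>h\<in>{..<P}. nat_mult (z (h + m)) (g h)) \<in> carrier A"
  using g by (auto intro!: finsum_closed)
 moreover have "s [^] h \<otimes> (t \<otimes> top_shift) = g h" for h :: nat by (simp add: g_def)
 ultimately show ?thesis unfolding window_def us G by simp
qed

lemma window_radical: "\<exists>b\<in>carrier A. window x u m = t \<otimes> b"
proof -
 obtain b where b: "b \<in> carrier A" "top_shift = t \<otimes> b" using top_shift_radical by blast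
 define g where "g = (\<lambda>h. nat_mult (x (h + m)) (s [^] h \<otimes> top_shift))"
 have g: "g h \<in> carrier A" for h by (simp add: g_def)
 have "nat_mult (x (h + m)) (s [^] h \<otimes> (t \<otimes> top_shift)) = t \<otimes> g h" for h
  by (simp add: g_def nat_mult_right m_lcomm)
 moreover have "t \<otimes> (\<Oplus>h\<in>{..<P}. g h) = (\<Oplus>h\<in>{..<P}. t \<otimes> g h)" by (rule finsum_rdistr) (use g in auto)
 moreover have "nat_mult u top_shift = t \<otimes> nat_mult u b" using b by (simp add: nat_mult_right)
 moreover have "(\<Oplus>h\<in>{..<P}. g h) \<in> carrier A" using g by (intro finsum_closed) auto
 ultimately have "window x u m = t \<otimes> ((\<Oplus>h\<in>{..<P}. g h) \<ominus> nat_mult u b)"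
  using b(1) by (simp add: window_def minus_eq r_distr r_minus)
 thus ?thesis using b(1) \<open>(\<Oplus>h\<in>{..<P}. g h) \<in> carrier A\<close> by (intro bexI[of _ "(\<Oplus>h\<in>{..<P}. g h) \<ominus> nat_mult u b"]) auto
qed

lemma window_zero: "window (\<lambda>h. 0) 0 m = \<zero>"
 by (simp add: window_def minus_eq)

lemma window_cong: "(\<And>h. h < P ==> x (h + m) = y (h + m)) ==> window x u m = window y u m"
 unfolding window_def by (simp cong: finsum_cong)

end

section \<open>The cochain over the stabilizer of a root of unity\<close>

context cyclic_quotient
begin

interpretation \<G>: group \<G> by (rule \<G>_group)

lemma finsum_in_subfield:
 assumes M: "subfield M \<Omega>" and f: "\<And>k. f k \<in> M"
 shows "(\<Oplus>k\<in>{..<m::nat}. f k) \<in> M"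
proof -
 note M' = subringE(1,2,7)[OF subfieldE(1)[OF M]]
 have fc: "f k \<in> carrier \<Omega>" for k using f subsetD[OF M'(1)] by blast
 show ?thesis
  by (induction m) (use fc f M'(2,3) in \<open>simp_all add: lessThan_Suc finsum_insert Pi_def\<close>)
qed

lemma pow_in_subfield: "subfield M \<Omega> ==> x \<in> M ==> x [^] (m::nat) \<in> M"
 by (induction m) (simp_all add: subringE(3,6)[OF subfieldE(1)])

context
 fixes \<zeta> assumes zeta: "primitive_root p \<zeta>"
begin

lemma zeta_closed [simp]: "\<zeta> \<in> carrier \<Omega>" using zeta by (simp add: primitive_root_def)

lemma zeta_p: "\<zeta> [^] p = \<one>" using zeta by (simp add: primitive_root_def)

lemma zeta_nonzero: "\<zeta> \<noteq> \<zero>"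
proof
 assume "\<zeta> = \<zero>"
 hence "\<zeta> [^] p = \<zero>" using U.p_ge_2 nat_pow_zero[of p] by simp
 thus False using zeta_p by simp
qed

definition stab where "stab = {\<g> \<in> carrier \<G>. \<g> \<zeta> = \<zeta>}"

lemma stab_closed: "\<g> \<in> stab ==> \<g> \<in> carrier \<G>" by (simp add: stab_def)

lemma stab_mult: "\<g> \<in> stab ==> \<d> \<in> stab ==> \<g> \<otimes>\<^bsub>\<G>\<^esub> \<d> \<in> stab"
 using \<G>_mult[of \<g> \<d> \<zeta>] by (simp add: stab_def)

lemma power_on_root:
 assumes g: "\<g> \<in> carrier \<G>" "\<g> \<zeta> = \<zeta> [^] (a::nat)"
 shows "(\<g> [^]\<^bsub>\<G>\<^esub> (k::nat)) \<zeta> = \<zeta> [^] (a ^ k)"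
proof (induction k)
 case 0 show ?case by (simp add: gal_one)
next
 case (Suc k)
 have gk: "\<g> [^]\<^bsub>\<G>\<^esub> k \<in> carrier \<G>" using g by simp
 have "(\<g> [^]\<^bsub>\<G>\<^esub> Suc k) \<zeta> = (\<g> [^]\<^bsub>\<G>\<^esub> k) (\<zeta> [^] a)" using \<G>_mult[OF gk g(1), of \<zeta>] g(2) by simp
 also have "\<dots> = (\<zeta> [^] (a ^ k)) [^] a" using \<G>_simps(5)[OF gk zeta_closed, of a] Suc by simp
 finally show ?case by (simp add: nat_pow_pow mult.commute)
qed

lemma power_root_cong: "[k = l] (mod p) ==> \<zeta> [^] k = \<zeta> [^] l"
 using primitive_root_power_mod[OF zeta, of k] primitive_root_power_mod[OF zeta, of l] by (simp add: cong_def)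

text \<open>
 The power \<open>p - 1\<close> of any automorphism fixes \<open>\<zeta>\<close> by Fermat's theorem, and
 \<open>p - 1\<close> is invertible modulo \<open>q\<close>.
\<close>

lemma stab_generator: "\<exists>\<sigma>\<in>stab. r \<sigma> = 1"
proof -
 obtain a :: nat where a: "\<not> p dvd a" "gen \<zeta> = \<zeta> [^] a"
  using primitive_root_automorphism(2)[OF U.p zeta gen(1)] by blast
 have "coprime (p - 1) p" using U.p_ge_2 by (intro coprime_diff_one_left_nat) auto
 hence "coprime (p - 1) U.q" unfolding U.q_def by simp
 then obtain m where m: "[(p - 1) * m = 1] (mod U.q)" using cong_solve_coprime_nat by auto
 \<comment> \<open>The factor \<open>m\<close> undoes the multiplication by \<open>p - 1\<close> on the cyclic group.\<close>
 define \<sigma> where "\<sigma> = gen [^]\<^bsub>\<G>\<^esub> ((p - 1) * m)"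
 have sc: "\<sigma> \<in> carrier \<G>" using gen(1) by (simp add: \<sigma>_def)
 have "[a ^ (p - 1) = 1] (mod p)" using fermat_theorem[OF U.p a(1)] .
 hence "[(a ^ (p - 1)) ^ m = 1 ^ m] (mod p)" by (rule cong_pow)
 hence "[a ^ ((p - 1) * m) = 1] (mod p)" by (simp add: power_mult)
 hence "\<sigma> \<zeta> = \<zeta> [^] (1::nat)"
  unfolding \<sigma>_def power_on_root[OF gen(1) a(2)] by (rule power_root_cong)
 hence "\<sigma> \<in> stab" using sc by (simp add: stab_def)
 moreover have "r \<sigma> = ((p - 1) * m) mod U.q" unfolding \<sigma>_def r_pow[OF gen(1)] gen(2) by simp
 hence "r \<sigma> = 1" using m U.q_gt_1 by (simp add: cong_def)
 ultimately show ?thesis by blast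
qed

text \<open>
 The power \<open>q\<close> of an automorphism acts trivially on \<open>K\<close> and in the same way as
 the automorphism itself on \<open>\<zeta>\<close>, because \<open>a^p = a\<close> modulo \<open>p\<close>.
 So every conjugate of \<open>\<zeta>\<close> is reached without moving \<open>K\<close>.
\<close>

lemma conjugate_root_kernel:
 assumes g: "\<g> \<in> carrier \<G>" shows "\<exists>\<rho>\<in>carrier \<G>. \<rho> \<zeta> = \<g> \<zeta> \<and> r \<rho> = 0"
proof -
 obtain a :: nat where a: "\<not> p dvd a" "\<g> \<zeta> = \<zeta> [^] a"
  using primitive_root_automorphism(2)[OF U.p zeta g] by blast
 have ap: "[b ^ p = b] (mod p)" if "\<not> p dvd b" for b
 proof -
  have "[b ^ (p - 1) * b = 1 * b] (mod p)" using fermat_theorem[OF U.p that] by (rule cong_scalar_right)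
  moreover have "b ^ p = b ^ (p - 1) * b" using U.p_ge_2 by (cases p) auto
  ultimately show ?thesis by simp
 qed
 have "[a ^ (p ^ m) = a] (mod p)" for m
 proof (induction m)
  case (Suc m)
  have "[(a ^ (p ^ m)) ^ p = a ^ p] (mod p)" using Suc by (rule cong_pow)
  moreover have "a ^ (p ^ Suc m) = (a ^ (p ^ m)) ^ p" by (simp add: power_mult[symmetric] mult.commute)
  ultimately show ?case using ap[OF a(1)] cong_trans by metis
 qed simp
 hence "[a ^ U.q = a] (mod p)" by (simp add: U.q_def)
 hence "(\<g> [^]\<^bsub>\<G>\<^esub> U.q) \<zeta> = \<g> \<zeta>" unfolding power_on_root[OF g a(2)] a(2) by (rule power_root_cong)
 moreover have "r (\<g> [^]\<^bsub>\<G>\<^esub> U.q) = 0" unfolding r_pow[OF g] by simp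
 moreover have "\<g> [^]\<^bsub>\<G>\<^esub> U.q \<in> carrier \<G>" using g by simp
 ultimately show ?thesis by blast
qed

text \<open>
 Lagrange resolvents for the subgroup of order \<open>p\<close> of the Galois group of \<open>K\<close>. A
 nonzero one exists by independence of characters. The factor \<open>\<zeta>\<close> acquired under a shift
 by \<open>P\<close> comes from the coefficients \<open>\<zeta>^(-k)\<close>, written with exponent
 \<open>(p - 1) k\<close>.
\<close>

lemma resolvent_exists:
 obtains \<alpha> x where "x \<in> K" "\<And>h. \<alpha> h \<in> carrier \<Omega>" "\<And>h. \<alpha> h \<noteq> \<zero>" "\<And>h. \<alpha> (h + U.P) = \<zeta> \<otimes> \<alpha> h"
  "\<And>\<g> h. \<g> \<in> carrier \<G> ==> \<g> (\<alpha> h) = (\<Oplus>k\<in>{..<p}. (\<g> \<zeta>) [^] ((p - 1) * k) \<otimes> S (h + r \<g> + k * U.P) x)"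
  "\<And>\<g> h. \<g> \<in> stab ==> \<g> (\<alpha> h) = \<alpha> (h + r \<g>)"
proof -
 have P0: "U.P > 0" using U.p_ge_2 by simp
 define I where "I = (\<lambda>k. k * U.P) ` {..<p}"
 have I: "I \<subseteq> {..<U.q}" using P0 by (auto simp: I_def U.q_eq)
 have "\<exists>x\<in>K. (\<Oplus>j\<in>I. \<zeta> [^] ((p - 1) * (j div U.P)) \<otimes> S j x) \<noteq> \<zero>"
 proof (rule S_independent[OF I, of _ 0])
  show "0 \<in> I" using U.p_ge_2 by (auto simp: I_def intro!: image_eqI[of _ _ 0])
 qed simp_all
 then obtain x where x: "x \<in> K" "(\<Oplus>j\<in>I. \<zeta> [^] ((p - 1) * (j div U.P)) \<otimes> S j x) \<noteq> \<zero>" by blast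
 have Sc: "S k x \<in> carrier \<Omega>" for k using K_closed[OF S_K[OF x(1)]] .
 define \<alpha> where "\<alpha> = (\<lambda>h. \<Oplus>k\<in>{..<p}. \<zeta> [^] ((p - 1) * k) \<otimes> S (h + k * U.P) x)"
 have \<alpha>c: "\<alpha> h \<in> carrier \<Omega>" for h unfolding \<alpha>_def using Sc by (intro finsum_closed) auto
 have inj: "inj_on (\<lambda>k. k * U.P) {..<p}" using P0 by (auto intro: inj_onI)
 have "(\<Oplus>j\<in>I. \<zeta> [^] ((p - 1) * (j div U.P)) \<otimes> S j x)
   = (\<Oplus>k\<in>{..<p}. \<zeta> [^] ((p - 1) * (k * U.P div U.P)) \<otimes> S (k * U.P) x)"
  unfolding I_def by (rule finsum_reindex[OF _ inj]) (use Sc in auto)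
 also have "\<dots> = \<alpha> 0" using P0 by (simp add: \<alpha>_def)
 finally have \<alpha>0: "\<alpha> 0 \<noteq> \<zero>" using x(2) by simp
 have shift: "\<alpha> (h + U.P) = \<zeta> \<otimes> \<alpha> h" for h
 proof -
  define g where "g = (\<lambda>k. \<zeta> [^] ((p - 1) * k) \<otimes> S (h + k * U.P) x)"
  have g: "g k \<in> carrier \<Omega>" for k using Sc by (simp add: g_def)
  have gp: "g (k + p) = g k" for k
  proof -
   have "S (h + (k + p) * U.P) x = S (h + k * U.P + U.q) x" by (simp add: U.q_eq algebra_simps)
   moreover have "\<zeta> [^] ((p - 1) * (k + p)) = \<zeta> [^] ((p - 1) * k)"
    by (rule power_root_cong) (simp add: cong_def add_mult_distrib2)
   ultimately show ?thesis using S_periodic[OF x(1)] by (simp add: g_def)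
  qed
  have gs: "\<zeta> [^] ((p - 1) * k) \<otimes> S (h + U.P + k * U.P) x = \<zeta> \<otimes> g (k + 1)" for k
  proof -
   have "\<zeta> \<otimes> \<zeta> [^] ((p - 1) * (k + 1)) = \<zeta> [^] Suc ((p - 1) * (k + 1))"
    by (simp add: m_comm)
   also have "\<dots> = \<zeta> [^] ((p - 1) * k)"
   proof (rule power_root_cong)
    have "(p - 1) * (k + 1) = (p - 1) * k + (p - 1)" by (simp only: add_mult_distrib2 mult_1_right)
    hence "Suc ((p - 1) * (k + 1)) = (p - 1) * k + p" using U.p_ge_2 by linarith
    thus "[Suc ((p - 1) * (k + 1)) = (p - 1) * k] (mod p)" by (simp add: cong_def)
   qed
   finally have e: "\<zeta> \<otimes> \<zeta> [^] ((p - 1) * (k + 1)) = \<zeta> [^] ((p - 1) * k)" .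
   have "\<zeta> \<otimes> g (k + 1) = (\<zeta> \<otimes> \<zeta> [^] ((p - 1) * (k + 1))) \<otimes> S (h + (k + 1) * U.P) x"
    unfolding g_def by (rule m_assoc[symmetric]) (use Sc in auto)
   thus ?thesis unfolding e by (simp add: algebra_simps)
  qed
  have "\<alpha> (h + U.P) = (\<Oplus>k\<in>{..<p}. \<zeta> \<otimes> g (k + 1))" unfolding \<alpha>_def gs ..
  also have "\<dots> = \<zeta> \<otimes> (\<Oplus>k\<in>{..<p}. g (k + 1))" by (rule finsum_rdistr[symmetric]) (use g in auto)
  also have "(\<Oplus>k\<in>{..<p}. g (k + 1)) = (\<Oplus>k\<in>{..<p}. g k)"
   by (rule finsum_periodic_shift) (use g gp U.p_ge_2 in auto)
  finally show ?thesis by (simp add: \<alpha>_def g_def)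
 qed
 have act: "\<g> (\<alpha> h) = (\<Oplus>k\<in>{..<p}. (\<g> \<zeta>) [^] ((p - 1) * k) \<otimes> S (h + r \<g> + k * U.P) x)"
  if g: "\<g> \<in> carrier \<G>" for \<g> h
 proof -
  have "\<g> (\<alpha> h) = (\<Oplus>k\<in>{..<p}. \<g> (\<zeta> [^] ((p - 1) * k) \<otimes> S (h + k * U.P) x))"
   unfolding \<alpha>_def by (rule finsum_automorphism[OF g]) (use Sc in auto)
  moreover have "\<g> (\<zeta> [^] ((p - 1) * k) \<otimes> S (h + k * U.P) x) = (\<g> \<zeta>) [^] ((p - 1) * k) \<otimes> S (h + r \<g> + k * U.P) x" for k
   using S_act[OF g x(1), of "h + k * U.P"] g Sc by (simp add: ac_simps)
  ultimately show ?thesis by (simp only:)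
 qed
 have act': "\<g> (\<alpha> h) = \<alpha> (h + r \<g>)" if "\<g> \<in> stab" for \<g> h
  using act[OF stab_closed[OF that]] that by (simp add: \<alpha>_def stab_def)
 obtain \<sigma> where s: "\<sigma> \<in> stab" "r \<sigma> = 1" using stab_generator by blast
 have "\<alpha> h \<noteq> \<zero>" for h
 proof (induction h)
  case (Suc h)
  have "\<sigma> (\<alpha> h) = \<alpha> (Suc h)" using act'[OF s(1)] s(2) by simp
  moreover have "\<sigma> \<zero> = \<zero>" using stab_closed[OF s(1)] by simp
  ultimately show ?case
   using inj_onD[OF \<G>_inj[OF stab_closed[OF s(1)]], of "\<alpha> h" \<zero>] Suc \<alpha>c by auto
 qed (rule \<alpha>0)
 thus ?thesis using that[OF x(1) \<alpha>c _ shift act act'] by blast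
qed

text \<open>
 Kummer theory. Let \<open>\<theta>\<^sub>h\<close> be \<open>p\<close>-th roots of the resolvents
 \<open>\<alpha>\<^sub>h\<close>, chosen such that \<open>\<theta>\<^sub>h\<^sub>+\<^sub>P = \<xi>
 \<theta>\<^sub>h\<close> with \<open>\<xi>^p = \<zeta>\<close>; then
 \<open>\<theta>\<^sub>h\<^sub>+\<^sub>q = \<zeta> \<theta>\<^sub>h\<close>. An automorphism
 \<open>\<g>\<close> that fixes \<open>\<zeta>\<close> sends \<open>\<theta>\<^sub>h\<close> to
 \<open>\<zeta>^(x(h)) \<theta>\<^sub>h\<^sub>+\<^sub>r\<close> with \<open>r = r \<g>\<close>, and
 \<open>\<xi>\<close> to \<open>\<zeta>^u \<xi>\<close>. The exponents satisfy \<open>x(h + P) = x(h) +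
 u\<close>, and composing automorphisms adds them up to a shift by \<open>r\<close> and the carry caused by
 \<open>\<theta>\<^sub>h\<^sub>+\<^sub>q = \<zeta> \<theta>\<^sub>h\<close>. So \<open>s^r\<close> times
 the window element of \<open>x\<close> is the required cochain.
\<close>

lemma bullet_cochain_stabilizer:
 obtains C xs where "bullet_cochain stab C" "set xs \<subseteq> carrier \<Omega>" "stable (set xs)"
  "\<And>\<g>. \<g> \<in> stab ==> \<g> \<in> fixgrp (K \<union> set xs) ==> C \<g> = \<zero>\<^bsub>A\<^esub>"
  "\<And>x E. x \<in> set xs ==> subfield E \<Omega> ==> K \<subseteq> E ==> (\<lambda>\<g>. \<g> \<zeta>) ` carrier \<G> \<subseteq> E ==> separable_root E x"
proof -
 obtain \<alpha> y where y: "y \<in> K" and \<alpha>: "\<And>h. \<alpha> h \<in> carrier \<Omega>" "\<And>h. \<alpha> h \<noteq> \<zero>"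
  and \<alpha>P: "\<And>h. \<alpha> (h + U.P) = \<zeta> \<otimes> \<alpha> h"
  and act: "\<And>\<g> h. \<g> \<in> carrier \<G> ==> \<g> (\<alpha> h) = (\<Oplus>k\<in>{..<p}. (\<g> \<zeta>) [^] ((p - 1) * k) \<otimes> S (h + r \<g> + k * U.P) y)"
  and act': "\<And>\<g> h. \<g> \<in> stab ==> \<g> (\<alpha> h) = \<alpha> (h + r \<g>)"
  by (rule resolvent_exists, rule that)
 have P0: "U.P > 0" using U.p_ge_2 by simp
 have root: "\<exists>b\<in>carrier \<Omega>. b [^] p = a" if "a \<in> carrier \<Omega>" for a
 proof -
  have na: "\<ominus> a \<in> carrier \<Omega>" using that by simp
  obtain b where b: "b \<in> carrier \<Omega>" "b [^] p \<oplus> (\<zero> \<otimes> b \<oplus> (\<ominus> a)) = \<zero>"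
   by (rule trinomial_root[OF U.p_ge_2 zero_closed na])
  have "c = (c \<oplus> (\<zero> \<otimes> b \<oplus> (\<ominus> a))) \<oplus> a" if "c \<in> carrier \<Omega>" for c
   using that b(1) \<open>a \<in> carrier \<Omega>\<close> by algebra
  from this[of "b [^] p"] have "b [^] p = a" using b that by simp
  thus ?thesis using b(1) by blast
 qed
 obtain \<xi> where \<xi>: "\<xi> \<in> carrier \<Omega>" "\<xi> [^] p = \<zeta>" using root[OF zeta_closed] by blast
 have "\<forall>h. \<exists>b. b \<in> carrier \<Omega> \<and> b [^] p = \<alpha> h" using root \<alpha>(1) by blast
 then obtain \<theta>0 where \<theta>0: "\<And>h. \<theta>0 h \<in> carrier \<Omega>" "\<And>h. \<theta>0 h [^] p = \<alpha> h" by metis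
 \<comment> \<open>Only \<open>P\<close> roots are chosen; the others are forced by the rule for shifting by \<open>P\<close>.\<close>
 define \<theta> where "\<theta> = (\<lambda>h. \<xi> [^] (h div U.P) \<otimes> \<theta>0 (h mod U.P))"
 have \<theta>c: "\<theta> h \<in> carrier \<Omega>" for h using \<xi> \<theta>0 by (simp add: \<theta>_def)
 have pow_Suc: "a [^] Suc m \<otimes> b = a \<otimes> (a [^] m \<otimes> b)" if "a \<in> carrier \<Omega>" "b \<in> carrier \<Omega>" for a b m
  unfolding nat_pow_Suc2[OF that(1)] using that by (intro m_assoc) auto
 have \<theta>P: "\<theta> (h + U.P) = \<xi> \<otimes> \<theta> h" for h
 proof -
  have "(h + U.P) div U.P = Suc (h div U.P)" "(h + U.P) mod U.P = h mod U.P"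
   using div_add_self2[of U.P h] P0 by (simp_all only: neq0_conv Suc_eq_plus1 mod_add_self2)
  thus ?thesis using pow_Suc[OF \<xi>(1) \<theta>0(1)] unfolding \<theta>_def by (simp only:)
 qed
 have \<theta>p: "\<theta> h [^] p = \<alpha> h" for h
 proof -
  have "\<alpha> (m + k * U.P) = \<zeta> [^] k \<otimes> \<alpha> m" for m k
  proof (induction k)
   case (Suc k)
   have "\<alpha> (m + Suc k * U.P) = \<zeta> \<otimes> \<alpha> (m + k * U.P)" using \<alpha>P[of "m + k * U.P"] by (simp add: ac_simps)
   thus ?case using Suc pow_Suc[OF zeta_closed \<alpha>(1)] by (simp only:)
  qed (use \<alpha> in simp)
  from this[of "h mod U.P" "h div U.P"] have "\<alpha> h = \<zeta> [^] (h div U.P) \<otimes> \<alpha> (h mod U.P)"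
   by (simp only: mod_div_mult_eq)
  moreover have "(\<xi> [^] (h div U.P)) [^] p = \<zeta> [^] (h div U.P)"
   using \<xi> by (simp only: nat_pow_pow mult.commute[of _ p]) (simp add: nat_pow_pow[symmetric])
  ultimately show ?thesis unfolding \<theta>_def using \<xi>(1) \<theta>0 by (simp add: nat_pow_distrib)
 qed
 have nz: "x \<noteq> \<zero>" if "x [^] p \<noteq> \<zero>" for x using that U.p_ge_2 nat_pow_zero[of p] by auto
 have \<theta>nz: "\<theta> h \<noteq> \<zero>" for h using nz \<theta>p \<alpha>(2) by simp
 have \<xi>nz: "\<xi> \<noteq> \<zero>" using nz \<xi>(2) zeta_nonzero by simp
 have \<theta>q: "\<theta> (h + k * U.q) = \<zeta> [^] k \<otimes> \<theta> h" for h k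
 proof -
  have "\<theta> (h + m * U.P) = \<xi> [^] m \<otimes> \<theta> h" for m
  proof (induction m)
   case (Suc m)
   have "\<theta> (h + Suc m * U.P) = \<xi> \<otimes> \<theta> (h + m * U.P)" using \<theta>P[of "h + m * U.P"] by (simp add: ac_simps)
   thus ?case using Suc pow_Suc[OF \<xi>(1) \<theta>c] by (simp only:)
  qed (use \<theta>c in simp)
  from this[of "k * p"] have "\<theta> (h + k * U.q) = \<xi> [^] (p * k) \<otimes> \<theta> h" by (simp add: U.q_eq ac_simps)
  thus ?thesis using \<xi> by (simp add: nat_pow_pow[symmetric])
 qed
 define x where "x = (\<lambda>\<g> h. SOME k. k < p \<and> \<g> (\<theta> h) = \<zeta> [^] k \<otimes> \<theta> (h + r \<g>))"
 have x: "x \<g> h < p \<and> \<g> (\<theta> h) = \<zeta> [^] (x \<g> h) \<otimes> \<theta> (h + r \<g>)" if g: "\<g> \<in> stab" for \<g> h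
 proof -
  have gc: "\<g> \<in> carrier \<G>" using stab_closed[OF g] .
  have "\<g> (\<theta> h) [^] p = \<theta> (h + r \<g>) [^] p"
   using \<G>_simps(5)[OF gc \<theta>c[of h], of p] act'[OF g, of h] \<theta>p by simp
  hence "\<exists>k<p. \<g> (\<theta> h) = \<zeta> [^] k \<otimes> \<theta> (h + r \<g>)"
   using primitive_root_quotient[OF U.p zeta \<theta>c \<theta>nz, of "\<g> (\<theta> h)" "h + r \<g>"] \<theta>c gc by simp
  then obtain k where "k < p \<and> \<g> (\<theta> h) = \<zeta> [^] k \<otimes> \<theta> (h + r \<g>)" by blast
  thus ?thesis unfolding x_def by (rule someI)
 qed
 define u where "u = (\<lambda>\<g>. SOME k. k < p \<and> \<g> \<xi> = \<zeta> [^] k \<otimes> \<xi>)"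
 have u: "u \<g> < p \<and> \<g> \<xi> = \<zeta> [^] (u \<g>) \<otimes> \<xi>" if g: "\<g> \<in> stab" for \<g>
 proof -
  have gc: "\<g> \<in> carrier \<G>" using stab_closed[OF g] .
  have "\<g> \<xi> [^] p = \<xi> [^] p" using \<G>_simps(5)[OF gc \<xi>(1), of p] g \<xi> by (simp add: stab_def)
  hence "\<exists>k<p. \<g> \<xi> = \<zeta> [^] k \<otimes> \<xi>"
   using primitive_root_quotient[OF U.p zeta \<xi>(1) \<xi>nz, of "\<g> \<xi>"] \<xi> gc by simp
  then obtain k where "k < p \<and> \<g> \<xi> = \<zeta> [^] k \<otimes> \<xi>" by blast
  thus ?thesis unfolding u_def by (rule someI)
 qed
 have cancel: "k mod p = l mod p" if "\<zeta> [^] k \<otimes> a = \<zeta> [^] l \<otimes> a" "a \<in> carrier \<Omega>" "a \<noteq> \<zero>" for k l :: nat and a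
 proof (rule primitive_root_power_eq[OF U.p zeta])
  show "\<zeta> [^] k = \<zeta> [^] l" using that m_rcancel[OF that(3,2), of "\<zeta> [^] k" "\<zeta> [^] l"] by simp
 qed
 have gz: "\<g> (\<zeta> [^] (k::nat)) = \<zeta> [^] k" if "\<g> \<in> stab" for \<g> k
  using that by (simp add: stab_def)
 have x_shift: "x \<g> (h + U.P) mod p = (x \<g> h + u \<g>) mod p" if g: "\<g> \<in> stab" for \<g> h
 proof (rule cancel[OF _ \<theta>c \<theta>nz])
  have gc: "\<g> \<in> carrier \<G>" using stab_closed[OF g] .
  have "\<zeta> [^] x \<g> (h + U.P) \<otimes> \<theta> (h + r \<g> + U.P) = \<g> (\<theta> (h + U.P))" using x[OF g, of "h + U.P"] by (simp add: ac_simps)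
  also have "\<dots> = \<g> \<xi> \<otimes> \<g> (\<theta> h)" unfolding \<theta>P using gc \<xi> \<theta>c by simp
  also have "\<dots> = (\<zeta> [^] u \<g> \<otimes> \<xi>) \<otimes> (\<zeta> [^] x \<g> h \<otimes> \<theta> (h + r \<g>))" using x[OF g] u[OF g] by simp
  also have "\<dots> = (\<zeta> [^] x \<g> h \<otimes> \<zeta> [^] u \<g>) \<otimes> (\<xi> \<otimes> \<theta> (h + r \<g>))"
  proof -
   have "(a \<otimes> b) \<otimes> (c \<otimes> d) = (c \<otimes> a) \<otimes> (b \<otimes> d)"
    if "a \<in> carrier \<Omega>" "b \<in> carrier \<Omega>" "c \<in> carrier \<Omega>" "d \<in> carrier \<Omega>" for a b c d using that by algebra
   thus ?thesis using \<xi>(1) \<theta>c by simp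
  qed
  finally show "\<zeta> [^] x \<g> (h + U.P) \<otimes> \<theta> (h + r \<g> + U.P) = \<zeta> [^] (x \<g> h + u \<g>) \<otimes> \<theta> (h + r \<g> + U.P)"
   unfolding \<theta>P nat_pow_mult[OF zeta_closed] .
 qed
 define carry where "carry = (\<lambda>\<g> \<d>. (r \<g> + r \<d>) div U.q)"
 have x_mult: "x (\<g> \<otimes>\<^bsub>\<G>\<^esub> \<d>) h mod p = (x \<d> h + x \<g> (h + r \<d>) + carry \<g> \<d>) mod p"
  if g: "\<g> \<in> stab" "\<d> \<in> stab" for \<g> \<d> h
 proof (rule cancel[OF _ \<theta>c \<theta>nz])
  have gc: "\<g> \<in> carrier \<G>" "\<d> \<in> carrier \<G>" using stab_closed g by auto
  have e: "h + r \<d> + r \<g> = h + r (\<g> \<otimes>\<^bsub>\<G>\<^esub> \<d>) + carry \<g> \<d> * U.q"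
  proof -
   have "r \<g> + r \<d> = r (\<g> \<otimes>\<^bsub>\<G>\<^esub> \<d>) + carry \<g> \<d> * U.q"
    unfolding r_mult[OF gc] carry_def by (simp only: mod_div_mult_eq)
   thus ?thesis by linarith
  qed
  have "\<zeta> [^] x (\<g> \<otimes>\<^bsub>\<G>\<^esub> \<d>) h \<otimes> \<theta> (h + r (\<g> \<otimes>\<^bsub>\<G>\<^esub> \<d>)) = (\<g> \<otimes>\<^bsub>\<G>\<^esub> \<d>) (\<theta> h)"
   using x[OF stab_mult[OF g], of h] by simp
  also have "\<dots> = \<g> (\<zeta> [^] x \<d> h \<otimes> \<theta> (h + r \<d>))" using \<G>_mult[OF gc \<theta>c] x[OF g(2)] by simp
  also have "\<dots> = \<zeta> [^] x \<d> h \<otimes> (\<zeta> [^] x \<g> (h + r \<d>) \<otimes> \<theta> (h + r \<d> + r \<g>))"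
   using x[OF g(1), of "h + r \<d>"] gz[OF g(1)] \<G>_simps(2)[OF gc(1) _ \<theta>c, of "\<zeta> [^] x \<d> h" "h + r \<d>"] by simp
  also have "\<dots> = \<zeta> [^] (x \<d> h + x \<g> (h + r \<d>) + carry \<g> \<d>) \<otimes> \<theta> (h + r (\<g> \<otimes>\<^bsub>\<G>\<^esub> \<d>))"
   unfolding e \<theta>q by (simp add: nat_pow_mult[symmetric] \<theta>c m_assoc)
  finally show "\<zeta> [^] x (\<g> \<otimes>\<^bsub>\<G>\<^esub> \<d>) h \<otimes> \<theta> (h + r (\<g> \<otimes>\<^bsub>\<G>\<^esub> \<d>)) =
   \<zeta> [^] (x \<d> h + x \<g> (h + r \<d>) + carry \<g> \<d>) \<otimes> \<theta> (h + r (\<g> \<otimes>\<^bsub>\<G>\<^esub> \<d>))" .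
 qed
 have u_mult: "u (\<g> \<otimes>\<^bsub>\<G>\<^esub> \<d>) mod p = (u \<d> + u \<g>) mod p" if g: "\<g> \<in> stab" "\<d> \<in> stab" for \<g> \<d>
 proof (rule cancel[OF _ \<xi>(1) \<xi>nz])
  have gc: "\<g> \<in> carrier \<G>" "\<d> \<in> carrier \<G>" using stab_closed g by auto
  have "\<zeta> [^] u (\<g> \<otimes>\<^bsub>\<G>\<^esub> \<d>) \<otimes> \<xi> = (\<g> \<otimes>\<^bsub>\<G>\<^esub> \<d>) \<xi>" using u[OF stab_mult[OF g]] by simp
  also have "\<dots> = \<g> (\<zeta> [^] u \<d> \<otimes> \<xi>)" using \<G>_mult[OF gc \<xi>(1)] u[OF g(2)] by simp
  also have "\<dots> = \<zeta> [^] u \<d> \<otimes> (\<zeta> [^] u \<g> \<otimes> \<xi>)"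
   using u[OF g(1)] gz[OF g(1)] \<G>_simps(2)[OF gc(1) _ \<xi>(1), of "\<zeta> [^] u \<d>"] by simp
  finally show "\<zeta> [^] u (\<g> \<otimes>\<^bsub>\<G>\<^esub> \<d>) \<otimes> \<xi> = \<zeta> [^] (u \<d> + u \<g>) \<otimes> \<xi>"
   using \<xi>(1) by (simp add: nat_pow_mult[symmetric] m_assoc)
 qed
 define C where "C = (\<lambda>\<g>. U.s [^]\<^bsub>A\<^esub> r \<g> \<otimes>\<^bsub>A\<^esub> U.window (x \<g>) (u \<g>) 0)"
 define Y where "Y = insert \<xi> (\<theta> ` {..<U.P})"
 have Y: "Y \<subseteq> carrier \<Omega>" "finite Y" using \<xi> \<theta>c by (auto simp: Y_def)
 obtain xs where xs: "set xs = (\<lambda>(\<g>, y). \<g> y) ` (carrier \<G> \<times> Y)"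
  using finite_list[OF finite_orbits[OF Y]] by blast
 have xsc: "set xs \<subseteq> carrier \<Omega>" unfolding xs using Y(1) by auto
 show ?thesis
 proof (rule that)
  show "bullet_cochain stab C"
   unfolding bullet_cochain_def
  proof (intro conjI ballI)
   fix \<g> assume "\<g> \<in> stab"
   obtain b where b: "b \<in> carrier A" "U.window (x \<g>) (u \<g>) 0 = t \<otimes>\<^bsub>A\<^esub> b" using U.window_radical by blast
   have "C \<g> = t \<otimes>\<^bsub>A\<^esub> (U.s [^]\<^bsub>A\<^esub> r \<g> \<otimes>\<^bsub>A\<^esub> b)" unfolding C_def b(2) using b(1) by (simp add: U.m_lcomm)
   thus "\<exists>b\<in>carrier A. C \<g> = t \<otimes>\<^bsub>A\<^esub> b" using b(1) by (intro bexI[of _ "U.s [^]\<^bsub>A\<^esub> r \<g> \<otimes>\<^bsub>A\<^esub> b"]) auto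
  next
   fix \<g> \<d> assume g: "\<g> \<in> stab" "\<d> \<in> stab"
   have gc: "\<g> \<in> carrier \<G>" "\<d> \<in> carrier \<G>" using stab_closed g by auto
   let ?w = "U.window (x \<g>) (u \<g>)" and ?v = "U.window (x \<d>) (u \<d>) 0" and ?a = "U.s [^]\<^bsub>A\<^esub> r \<g>" and ?b = "U.s [^]\<^bsub>A\<^esub> r \<d>"
   have "U.window (x (\<g> \<otimes>\<^bsub>\<G>\<^esub> \<d>)) (u (\<g> \<otimes>\<^bsub>\<G>\<^esub> \<d>)) 0 = ?v \<oplus>\<^bsub>A\<^esub> ?w (r \<d>) \<oplus>\<^bsub>A\<^esub> U.nat_mult (carry \<g> \<d>) T"
    unfolding T_def by (rule U.window_add) (use x_mult[OF g] u_mult[OF g] in auto)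
   moreover have "U.s [^]\<^bsub>A\<^esub> r (\<g> \<otimes>\<^bsub>\<G>\<^esub> \<d>) = ?a \<otimes>\<^bsub>A\<^esub> ?b"
    unfolding r_mult[OF gc] U.s_pow_mod by (simp add: U.nat_pow_mult)
   ultimately have "C (\<g> \<otimes>\<^bsub>\<G>\<^esub> \<d>) = (?a \<otimes>\<^bsub>A\<^esub> ?b) \<otimes>\<^bsub>A\<^esub> (?v \<oplus>\<^bsub>A\<^esub> ?w (r \<d>) \<oplus>\<^bsub>A\<^esub> U.nat_mult (carry \<g> \<d>) T)"
    by (simp add: C_def)
   also have "\<dots> = ?a \<otimes>\<^bsub>A\<^esub> (?b \<otimes>\<^bsub>A\<^esub> ?v) \<oplus>\<^bsub>A\<^esub> ?a \<otimes>\<^bsub>A\<^esub> (?b \<otimes>\<^bsub>A\<^esub> ?w (r \<d>)) \<oplus>\<^bsub>A\<^esub> ?a \<otimes>\<^bsub>A\<^esub> (?b \<otimes>\<^bsub>A\<^esub> U.nat_mult (carry \<g> \<d>) T)"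
    by (simp only: U.m_assoc U.r_distr U.nat_pow_closed U.s_closed U.window_closed U.nat_mult_closed T_closed U.m_closed U.a_closed)
   also have "?b \<otimes>\<^bsub>A\<^esub> ?w (r \<d>) = ?w 0" by (rule U.window_shift) (rule x_shift[OF g(1)])
   also have "?a \<otimes>\<^bsub>A\<^esub> (?b \<otimes>\<^bsub>A\<^esub> U.nat_mult (carry \<g> \<d>) T) = U.nat_mult (carry \<g> \<d>) T"
    by (simp add: U.nat_mult_right)
   finally show "C (\<g> \<otimes>\<^bsub>\<G>\<^esub> \<d>) = C \<g> \<oplus>\<^bsub>A\<^esub> ?a \<otimes>\<^bsub>A\<^esub> C \<d> \<oplus>\<^bsub>A\<^esub> U.nat_mult ((r \<g> + r \<d>) div U.q) T"
    unfolding C_def carry_def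
    by (simp only: U.a_comm[of "?a \<otimes>\<^bsub>A\<^esub> (?b \<otimes>\<^bsub>A\<^esub> ?v)"] U.nat_pow_closed U.s_closed U.window_closed U.m_closed)
  qed
  show "set xs \<subseteq> carrier \<Omega>" by (rule xsc)
  show "stable (set xs)" unfolding xs by (rule orbit_stable[OF Y(1)])
  show "C \<g> = \<zero>\<^bsub>A\<^esub>" if g: "\<g> \<in> stab" "\<g> \<in> fixgrp (K \<union> set xs)" for \<g>
  proof -
   have "\<g> \<in> fixgrp K" using g(2) by (auto simp: fixgrp_def)
   hence r0: "r \<g> = 0" using r_ker[OF stab_closed[OF g(1)]] by blast
   have fix_Y: "\<g> a = a" if "a \<in> Y" for a
    using g(2) subsetD[OF orbit_refl[OF Y(1)] that] unfolding fixgrp_def xs by blast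
   have one: "\<zeta> [^] (0::nat) \<otimes> a = a" if "a \<in> carrier \<Omega>" for a using that by simp
   have "x \<g> h = 0" if "h < U.P" for h
   proof -
    have "\<g> (\<theta> h) = \<theta> h" by (rule fix_Y) (use that in \<open>auto simp: Y_def\<close>)
    hence "\<zeta> [^] x \<g> h \<otimes> \<theta> h = \<zeta> [^] (0::nat) \<otimes> \<theta> h" using x[OF g(1), of h] r0 one[OF \<theta>c, of h] by simp
    from cancel[OF this \<theta>c \<theta>nz] show ?thesis using x[OF g(1), of h] by simp
   qed
   hence "U.window (x \<g>) (u \<g>) 0 = U.window (\<lambda>h. 0) (u \<g>) 0" by (intro U.window_cong) simp
   moreover have "u \<g> = 0"
   proof -
    have "\<g> \<xi> = \<xi>" by (rule fix_Y) (simp add: Y_def)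
    hence "\<zeta> [^] u \<g> \<otimes> \<xi> = \<zeta> [^] (0::nat) \<otimes> \<xi>" using u[OF g(1)] one[OF \<xi>(1)] by simp
    from cancel[OF this \<xi>(1) \<xi>nz] show ?thesis using u[OF g(1)] by simp
   qed
   ultimately show ?thesis by (simp add: C_def U.window_zero)
  qed
  show "separable_root E a" if a: "a \<in> set xs" and E: "subfield E \<Omega>" "K \<subseteq> E" "(\<lambda>\<g>. \<g> \<zeta>) ` carrier \<G> \<subseteq> E" for a E
  proof -
   obtain \<g> b where g: "\<g> \<in> carrier \<G>" and b: "b \<in> Y" and ab: "a = \<g> b" using a unfolding xs by auto
   have bc: "b \<in> carrier \<Omega>" using b Y(1) by blast
   have zE: "\<g> \<zeta> \<in> E" using E(3) g by blast
   have "\<g> (b [^] p) \<in> E"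
   proof (cases "b = \<xi>")
    case True thus ?thesis using zE \<xi>(2) by simp
   next
    case False
    then obtain h where h: "b = \<theta> h" using b by (auto simp: Y_def)
    have "(\<g> \<zeta>) [^] ((p - 1) * k) \<otimes> S (h + r \<g> + k * U.P) y \<in> E" for k
     using subringE(6)[OF subfieldE(1)[OF E(1)]] pow_in_subfield[OF E(1) zE] subsetD[OF E(2) S_K[OF y]] by blast
    hence "\<g> (\<alpha> h) \<in> E" unfolding act[OF g] by (rule finsum_in_subfield[OF E(1)])
    thus ?thesis using \<theta>p h by simp
   qed
   hence "a [^] p \<in> E" using \<G>_simps(5)[OF g bc, of p] ab by simp
   moreover have "b \<noteq> \<zero>" using b \<xi>nz \<theta>nz unfolding Y_def by (metis imageE insertE)
   hence "a \<noteq> \<zero>" using inj_onD[OF \<G>_inj[OF g], of b \<zero>] bc g ab by auto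
   moreover have "a \<in> carrier \<Omega>" using ab g bc by simp
   ultimately show ?thesis using primitive_root_separable[OF U.p zeta] E(1) by blast
  qed
 qed
qed

end
end

section \<open>Averaging over the conjugates of the root of unity\<close>

context cyclic_quotient
begin

interpretation \<G>: group \<G> by (rule \<G>_group)

lemma r_inv: "\<rho> \<in> carrier \<G> ==> r \<rho> = 0 ==> r (inv\<^bsub>\<G>\<^esub> \<rho>) = 0"
proof -
 assume r: "\<rho> \<in> carrier \<G>" "r \<rho> = 0"
 have "r (\<rho> \<otimes>\<^bsub>\<G>\<^esub> inv\<^bsub>\<G>\<^esub> \<rho>) = 0" using r r_one by simp
 moreover have "r (\<rho> \<otimes>\<^bsub>\<G>\<^esub> inv\<^bsub>\<G>\<^esub> \<rho>) = (r \<rho> + r (inv\<^bsub>\<G>\<^esub> \<rho>)) mod U.q" by (rule r_mult) (use r in auto)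
 ultimately show ?thesis using r \<pi>_r(2)[of "inv\<^bsub>\<G>\<^esub> \<rho>"] by simp
qed

text \<open>
 Transfer from the stabilizer of \<open>\<zeta>\<close> to the whole group. Choose \<open>\<rho> z\<close>
 trivial on \<open>K\<close> with \<open>\<rho> z \<zeta> = z\<close> and average the cochain of the
 stabilizer over the elements \<open>\<rho>(\<g>z)^(-1) \<g> \<rho> z\<close>, where \<open>z\<close> runs
 through the conjugates of \<open>\<zeta>\<close>. There are at most \<open>p - 1\<close> of them, so their
 number is invertible in \<open>A\<close>.
\<close>

lemma bullet_cochain_not_char_p:
 assumes not_char_p: "nat_mult p \<one> \<noteq> \<zero>"
 obtains C ts where "bullet_cochain (carrier \<G>) C" "tower_over_K ts"
  "\<And>\<g>. \<g> \<in> fixgrp (K \<union> set ts) ==> C \<g> = \<zero>\<^bsub>A\<^esub>"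
proof -
 obtain \<zeta> where zeta: "primitive_root p \<zeta>" using primitive_root_exists[OF U.p_ge_2 not_char_p] by blast
 have zc: "\<zeta> \<in> carrier \<Omega>" using zeta by (simp add: primitive_root_def)
 obtain C0 xs where C0: "bullet_cochain (stab \<zeta>) C0" and xs: "set xs \<subseteq> carrier \<Omega>" "stable (set xs)"
  and C0_0: "\<And>\<g>. \<g> \<in> stab \<zeta> ==> \<g> \<in> fixgrp (K \<union> set xs) ==> C0 \<g> = \<zero>\<^bsub>A\<^esub>"
  and sep: "\<And>x E. x \<in> set xs ==> subfield E \<Omega> ==> K \<subseteq> E ==> (\<lambda>\<g>. \<g> \<zeta>) ` carrier \<G> \<subseteq> E ==> separable_root E x"
  by (rule bullet_cochain_stabilizer[OF zeta], rule that)
 define Z where "Z = (\<lambda>\<g>. \<g> \<zeta>) ` carrier \<G>"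
 have Zf: "finite Z" unfolding Z_def by (rule finite_orbit[OF zc])
 have Zc: "Z \<subseteq> carrier \<Omega>" unfolding Z_def using zc by auto
 have Z_act: "\<g> z \<in> Z" if gz: "\<g> \<in> carrier \<G>" "z \<in> Z" for \<g> z
 proof -
  obtain \<d> where d: "\<d> \<in> carrier \<G>" "z = \<d> \<zeta>" using gz(2) unfolding Z_def by blast
  have "\<g> z = (\<g> \<otimes>\<^bsub>\<G>\<^esub> \<d>) \<zeta>" using \<G>_mult[OF gz(1) d(1) zc] d(2) by simp
  moreover have "\<g> \<otimes>\<^bsub>\<G>\<^esub> \<d> \<in> carrier \<G>" using gz(1) d(1) by simp
  ultimately show ?thesis unfolding Z_def by blast
 qed
 have Z_root: "primitive_root p z" if "z \<in> Z" for z
  using that primitive_root_automorphism(1)[OF U.p zeta] unfolding Z_def by blast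
 have Z_card: "\<not> p dvd card Z"
 proof -
  have "Z \<subseteq> (\<lambda>a. \<zeta> [^] a) ` {1..<p}"
  proof
   fix z assume "z \<in> Z"
   then obtain \<g> where g: "\<g> \<in> carrier \<G>" "z = \<g> \<zeta>" unfolding Z_def by blast
   obtain a :: nat where a: "\<not> p dvd a" "\<g> \<zeta> = \<zeta> [^] a"
    using primitive_root_automorphism(2)[OF U.p zeta g(1)] by blast
   have "z = \<zeta> [^] (a mod p)" using g(2) a(2) primitive_root_power_mod[OF zeta, of a] by simp
   moreover have "a mod p \<noteq> 0" "a mod p < p" using a(1) U.p_ge_2 by (simp_all add: dvd_eq_mod_eq_0)
   ultimately show "z \<in> (\<lambda>a. \<zeta> [^] a) ` {1..<p}" by (intro image_eqI[of _ _ "a mod p"]) auto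
  qed
  hence "card Z \<le> p - 1" using surj_card_le[of "{1..<p}" Z] by simp
  moreover have "Z \<noteq> {}" unfolding Z_def using \<G>.one_closed by blast
  hence "0 < card Z" using Zf by (simp add: card_gt_0_iff)
  ultimately show ?thesis using U.p_ge_2 nat_dvd_not_less[of "card Z" p] by linarith
 qed
 have "coprime (card Z) p" using Z_card U.p by (metis coprime_commute prime_imp_coprime)
 then obtain e where e: "[card Z * e = 1] (mod p)" using cong_solve_coprime_nat by auto

 define \<rho> where "\<rho> = (\<lambda>z. SOME \<rho>. \<rho> \<in> carrier \<G> \<and> \<rho> \<zeta> = z \<and> r \<rho> = 0)"
 have \<rho>: "\<rho> z \<in> carrier \<G> \<and> \<rho> z \<zeta> = z \<and> r (\<rho> z) = 0" if "z \<in> Z" for z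
 proof -
  obtain \<g> where g: "\<g> \<in> carrier \<G>" "z = \<g> \<zeta>" using \<open>z \<in> Z\<close> unfolding Z_def by blast
  have "\<exists>\<rho>. \<rho> \<in> carrier \<G> \<and> \<rho> \<zeta> = z \<and> r \<rho> = 0" using conjugate_root_kernel[OF zeta g(1)] g(2) by blast
  thus ?thesis unfolding \<rho>_def by (rule someI_ex)
 qed
 \<comment> \<open>The transfer elements: they fix \<open>\<zeta>\<close> and induce the same element as \<open>\<g>\<close> on \<open>K\<close>.\<close>
 define \<tau> where "\<tau> = (\<lambda>\<g> z. inv\<^bsub>\<G>\<^esub> (\<rho> (\<g> z)) \<otimes>\<^bsub>\<G>\<^esub> (\<g> \<otimes>\<^bsub>\<G>\<^esub> \<rho> z))"
 have \<tau>_app: "\<tau> \<g> z y = (inv\<^bsub>\<G>\<^esub> (\<rho> (\<g> z))) (\<g> (\<rho> z y))" if "\<g> \<in> carrier \<G>" "z \<in> Z" "y \<in> carrier \<Omega>" for \<g> z y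
  using that \<rho>[OF that(2)] \<rho>[OF Z_act[OF that(1,2)]] by (simp add: \<tau>_def \<G>_mult)
 have \<tau>_stab: "\<tau> \<g> z \<in> stab \<zeta>" if g: "\<g> \<in> carrier \<G>" "z \<in> Z" for \<g> z
 proof -
  have "\<tau> \<g> z \<zeta> = (inv\<^bsub>\<G>\<^esub> (\<rho> (\<g> z))) (\<rho> (\<g> z) \<zeta>)" using \<tau>_app[OF g zc] \<rho>[OF g(2)] \<rho>[OF Z_act[OF g]] by simp
  also have "\<dots> = \<zeta>" using \<G>_inv(1) \<rho>[OF Z_act[OF g]] zc by blast
  finally have "\<tau> \<g> z \<zeta> = \<zeta>" .
  moreover have "\<tau> \<g> z \<in> carrier \<G>" using g \<rho>[OF g(2)] \<rho>[OF Z_act[OF g]] by (simp add: \<tau>_def)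
  ultimately show ?thesis by (simp add: stab_def[OF zeta])
 qed
 have r_\<tau>: "r (\<tau> \<g> z) = r \<g>" if g: "\<g> \<in> carrier \<G>" "z \<in> Z" for \<g> z
  using g \<rho>[OF g(2)] \<rho>[OF Z_act[OF g]] r_inv[of "\<rho> (\<g> z)"] \<pi>_r(2)[OF g(1)] by (simp add: \<tau>_def r_mult)
 have \<tau>_mult: "\<tau> (\<g> \<otimes>\<^bsub>\<G>\<^esub> \<d>) z = \<tau> \<g> (\<d> z) \<otimes>\<^bsub>\<G>\<^esub> \<tau> \<d> z"
  if g: "\<g> \<in> carrier \<G>" "\<d> \<in> carrier \<G>" "z \<in> Z" for \<g> \<d> z
 proof -
  have dz: "\<d> z \<in> Z" and gdz: "\<g> (\<d> z) \<in> Z" using Z_act g by auto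
  have "(\<g> \<otimes>\<^bsub>\<G>\<^esub> \<d>) z = \<g> (\<d> z)" using \<G>_mult[OF g(1,2)] g(3) Zc by blast
  moreover have "a \<otimes>\<^bsub>\<G>\<^esub> (\<g> \<otimes>\<^bsub>\<G>\<^esub> b) \<otimes>\<^bsub>\<G>\<^esub> (inv\<^bsub>\<G>\<^esub> b \<otimes>\<^bsub>\<G>\<^esub> (\<d> \<otimes>\<^bsub>\<G>\<^esub> c)) = a \<otimes>\<^bsub>\<G>\<^esub> (\<g> \<otimes>\<^bsub>\<G>\<^esub> \<d> \<otimes>\<^bsub>\<G>\<^esub> c)"
   if "a \<in> carrier \<G>" "b \<in> carrier \<G>" "c \<in> carrier \<G>" for a b c
  proof -
   have "b \<otimes>\<^bsub>\<G>\<^esub> (inv\<^bsub>\<G>\<^esub> b \<otimes>\<^bsub>\<G>\<^esub> d) = d" if "d \<in> carrier \<G>" for d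
    using that \<open>b \<in> carrier \<G>\<close> by (simp add: \<G>.m_assoc[symmetric])
   thus ?thesis using that g by (simp add: \<G>.m_assoc)
  qed
  ultimately show ?thesis using \<rho>[OF g(3)] \<rho>[OF dz] \<rho>[OF gdz] by (simp add: \<tau>_def)
 qed
 have C0_rad: "\<exists>b\<in>carrier A. C0 \<g> = t \<otimes>\<^bsub>A\<^esub> b" if "\<g> \<in> stab \<zeta>" for \<g>
  using C0 that unfolding bullet_cochain_def by blast
 have C0c: "C0 \<g> \<in> carrier A" if "\<g> \<in> stab \<zeta>" for \<g> using C0_rad[OF that] U.t by auto
 define Sum where "Sum = (\<lambda>\<g>. \<Oplus>\<^bsub>A\<^esub>z\<in>Z. C0 (\<tau> \<g> z))"
 have Sum_c: "Sum \<g> \<in> carrier A" if "\<g> \<in> carrier \<G>" for \<g>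
  unfolding Sum_def by (rule U.finsum_closed) (use C0c \<tau>_stab that in auto)
 define C where "C = (\<lambda>\<g>. U.nat_mult e (Sum \<g>))"
 obtain zs where zs: "set zs = Z" using finite_list[OF Zf] by blast
 have ts: "set (xs @ zs) = set xs \<union> Z" by (simp add: zs)
 show ?thesis
 proof (rule that)
  show "bullet_cochain (carrier \<G>) C"
   unfolding bullet_cochain_def
  proof (intro conjI ballI)
   fix \<g> assume g: "\<g> \<in> carrier \<G>"
   have "\<forall>z\<in>Z. \<exists>b. b \<in> carrier A \<and> C0 (\<tau> \<g> z) = t \<otimes>\<^bsub>A\<^esub> b" using C0_rad \<tau>_stab[OF g] by blast
   then obtain b where b: "\<And>z. z \<in> Z ==> b z \<in> carrier A" "\<And>z. z \<in> Z ==> C0 (\<tau> \<g> z) = t \<otimes>\<^bsub>A\<^esub> b z"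
    by metis
   have "Sum \<g> = (\<Oplus>\<^bsub>A\<^esub>z\<in>Z. t \<otimes>\<^bsub>A\<^esub> b z)"
    unfolding Sum_def by (rule U.finsum_cong') (use b in auto)
   also have "\<dots> = t \<otimes>\<^bsub>A\<^esub> (\<Oplus>\<^bsub>A\<^esub>z\<in>Z. b z)" by (rule U.finsum_rdistr[symmetric]) (use b Zf in auto)
   finally have "C \<g> = t \<otimes>\<^bsub>A\<^esub> U.nat_mult e (\<Oplus>\<^bsub>A\<^esub>z\<in>Z. b z)"
    using b(1) by (simp add: C_def U.nat_mult_right Pi_def)
   moreover have "U.nat_mult e (\<Oplus>\<^bsub>A\<^esub>z\<in>Z. b z) \<in> carrier A" using b(1) by (simp add: Pi_def)
   ultimately show "\<exists>b\<in>carrier A. C \<g> = t \<otimes>\<^bsub>A\<^esub> b" by blast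
  next
   fix \<g> \<d> assume g: "\<g> \<in> carrier \<G>" "\<d> \<in> carrier \<G>"
   define c where "c = (r \<g> + r \<d>) div U.q"
   define a where "a = U.s [^]\<^bsub>A\<^esub> r \<g>"
   have ac: "a \<in> carrier A" by (simp add: a_def)
   have cT: "U.nat_mult c T \<in> carrier A" by simp
   have C0\<tau>: "C0 (\<tau> \<g> z) \<in> carrier A" "C0 (\<tau> \<d> z) \<in> carrier A" "C0 (\<tau> \<g> (\<d> z)) \<in> carrier A" if "z \<in> Z" for z
    using C0c \<tau>_stab g Z_act[OF g(2) that] that by auto
   have step: "C0 (\<tau> (\<g> \<otimes>\<^bsub>\<G>\<^esub> \<d>) z) = (C0 (\<tau> \<g> (\<d> z)) \<oplus>\<^bsub>A\<^esub> a \<otimes>\<^bsub>A\<^esub> C0 (\<tau> \<d> z)) \<oplus>\<^bsub>A\<^esub> U.nat_mult c T" if z: "z \<in> Z" for z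
   proof -
    have "C0 (\<tau> \<g> (\<d> z) \<otimes>\<^bsub>\<G>\<^esub> \<tau> \<d> z) = C0 (\<tau> \<g> (\<d> z)) \<oplus>\<^bsub>A\<^esub> U.s [^]\<^bsub>A\<^esub> r (\<tau> \<g> (\<d> z)) \<otimes>\<^bsub>A\<^esub> C0 (\<tau> \<d> z)
      \<oplus>\<^bsub>A\<^esub> U.nat_mult ((r (\<tau> \<g> (\<d> z)) + r (\<tau> \<d> z)) div U.q) T"
     using C0 \<tau>_stab[OF g(1) Z_act[OF g(2) z]] \<tau>_stab[OF g(2) z] unfolding bullet_cochain_def by blast
    thus ?thesis
     unfolding \<tau>_mult[OF g z] r_\<tau>[OF g(1) Z_act[OF g(2) z]] r_\<tau>[OF g(2) z] c_def a_def .
   qed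
   have "Sum (\<g> \<otimes>\<^bsub>\<G>\<^esub> \<d>) = (\<Oplus>\<^bsub>A\<^esub>z\<in>Z. (C0 (\<tau> \<g> (\<d> z)) \<oplus>\<^bsub>A\<^esub> a \<otimes>\<^bsub>A\<^esub> C0 (\<tau> \<d> z)) \<oplus>\<^bsub>A\<^esub> U.nat_mult c T)"
    unfolding Sum_def by (rule U.finsum_cong') (use step C0\<tau> ac cT in auto)
   also have "\<dots> = (\<Oplus>\<^bsub>A\<^esub>z\<in>Z. C0 (\<tau> \<g> (\<d> z)) \<oplus>\<^bsub>A\<^esub> a \<otimes>\<^bsub>A\<^esub> C0 (\<tau> \<d> z)) \<oplus>\<^bsub>A\<^esub> (\<Oplus>\<^bsub>A\<^esub>z\<in>Z. U.nat_mult c T)"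
    by (rule U.finsum_addf) (use C0\<tau> ac in auto)
   also have "(\<Oplus>\<^bsub>A\<^esub>z\<in>Z. C0 (\<tau> \<g> (\<d> z)) \<oplus>\<^bsub>A\<^esub> a \<otimes>\<^bsub>A\<^esub> C0 (\<tau> \<d> z))
     = (\<Oplus>\<^bsub>A\<^esub>z\<in>Z. C0 (\<tau> \<g> (\<d> z))) \<oplus>\<^bsub>A\<^esub> (\<Oplus>\<^bsub>A\<^esub>z\<in>Z. a \<otimes>\<^bsub>A\<^esub> C0 (\<tau> \<d> z))"
    by (rule U.finsum_addf) (use C0\<tau> ac in auto)
   also have "(\<Oplus>\<^bsub>A\<^esub>z\<in>Z. C0 (\<tau> \<g> (\<d> z))) = Sum \<g>"
   proof -
    have inj: "inj_on \<d> Z" using \<G>_inj[OF g(2)] Zc inj_on_subset by blast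
    have dZ: "\<d> ` Z = Z" by (rule endo_inj_surj[OF Zf _ inj]) (use Z_act[OF g(2)] in blast)
    have "(\<Oplus>\<^bsub>A\<^esub>z\<in>\<d> ` Z. C0 (\<tau> \<g> z)) = (\<Oplus>\<^bsub>A\<^esub>z\<in>Z. C0 (\<tau> \<g> (\<d> z)))"
     by (rule U.finsum_reindex[OF _ inj]) (use C0\<tau>(3) in auto)
    thus ?thesis unfolding dZ Sum_def by simp
   qed
   also have "(\<Oplus>\<^bsub>A\<^esub>z\<in>Z. a \<otimes>\<^bsub>A\<^esub> C0 (\<tau> \<d> z)) = a \<otimes>\<^bsub>A\<^esub> Sum \<d>"
    unfolding Sum_def by (rule U.finsum_rdistr[symmetric]) (use C0\<tau> ac Zf in auto)
   also have "(\<Oplus>\<^bsub>A\<^esub>z\<in>Z. U.nat_mult c T) = U.nat_mult (card Z) (U.nat_mult c T)"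
    unfolding U.nat_mult_def[of "card Z"] by (rule U.add.finprod_const[OF cT])
   finally have "C (\<g> \<otimes>\<^bsub>\<G>\<^esub> \<d>) = C \<g> \<oplus>\<^bsub>A\<^esub> a \<otimes>\<^bsub>A\<^esub> C \<d> \<oplus>\<^bsub>A\<^esub> U.nat_mult e (U.nat_mult (card Z) (U.nat_mult c T))"
    using ac Sum_c[OF g(1)] Sum_c[OF g(2)] cT by (simp add: C_def U.nat_mult_distrib U.nat_mult_right)
   moreover have "U.nat_mult e (U.nat_mult (card Z) (U.nat_mult c T)) = U.nat_mult c T"
   proof -
    have "U.nat_mult e (U.nat_mult (card Z) (U.nat_mult c T)) = U.nat_mult (card Z * e) (U.nat_mult c T)"
     by (rule U.nat_mult_mult[OF cT, symmetric])
    also have "\<dots> = U.nat_mult (card Z * e mod p) (U.nat_mult c T)" by (rule U.nat_mult_mod[OF U.char cT, symmetric])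
    also have "card Z * e mod p = Suc 0" using e U.p_ge_2 by (simp add: cong_def)
    finally show ?thesis by simp
   qed
   ultimately show "C (\<g> \<otimes>\<^bsub>\<G>\<^esub> \<d>) = C \<g> \<oplus>\<^bsub>A\<^esub> U.s [^]\<^bsub>A\<^esub> r \<g> \<otimes>\<^bsub>A\<^esub> C \<d> \<oplus>\<^bsub>A\<^esub> U.nat_mult ((r \<g> + r \<d>) div U.q) T"
    unfolding a_def c_def by (rule trans[OF _ arg_cong])
  qed
  show "tower_over_K (xs @ zs)"
   unfolding tower_over_K_def
  proof (intro conjI allI impI)
   show "stable (set (xs @ zs))" unfolding ts stable_def
    using xs(2) Z_act Zc unfolding stable_def by blast
   fix E assume E: "subfield E \<Omega>" "K \<subseteq> E"
   have FE: "F \<subseteq> E" using E K_props by blast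
   have zsc: "set zs \<subseteq> carrier \<Omega>" using zs Zc by simp
   have "separable_tower E (zs @ []) \<and> finite_extension E [] \<subseteq> finite_extension E (zs @ [])"
   proof (rule separable_tower_append[OF E(1) FE zsc])
    fix z E' assume z: "z \<in> set zs" and E': "subfield E' \<Omega>"
    have pr: "primitive_root p z" using Z_root z zs by blast
    hence "z [^] p = \<one>" "z \<in> carrier \<Omega>" by (simp_all add: primitive_root_def)
    moreover have "z \<noteq> \<zero>" using zeta_nonzero[OF pr] .
    moreover have "\<one> \<in> E'" using subringE(3)[OF subfieldE(1)[OF E']] .
    ultimately show "separable_root E' z" using primitive_root_separable[OF U.p zeta, of z E'] E' by simp
   qed simp_all
   hence zt: "separable_tower E zs" by simp
   have KE: "E \<subseteq> finite_extension E zs"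
    by (rule finite_extension_incl[OF subringE(1)[OF subfieldE(1)[OF E(1)]] zsc])
   have ZE: "Z \<subseteq> finite_extension E zs"
    using finite_extension_mem[OF subfieldE(1)[OF E(1)] zsc] zs by simp
   have "separable_tower E (xs @ zs) \<and> finite_extension E zs \<subseteq> finite_extension E (xs @ zs)"
   proof (rule separable_tower_append[OF E(1) FE xs(1) zsc zt])
    fix x E' assume x: "x \<in> set xs" and E': "subfield E' \<Omega>" "finite_extension E zs \<subseteq> E'"
    show "separable_root E' x"
     by (rule sep[OF x E'(1)]) (use E(2) KE ZE E'(2) in \<open>auto simp: Z_def[symmetric]\<close>)
   qed
   thus "separable_tower E (xs @ zs)" by simp
  qed
  fix \<g> assume g: "\<g> \<in> fixgrp (K \<union> set (xs @ zs))"
  have gc: "\<g> \<in> carrier \<G>" using g by (simp add: fixgrp_def)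
  have gz: "\<g> z = z" if "z \<in> Z" for z using g that zs by (simp add: fixgrp_def)
  have "C0 (\<tau> \<g> z) = \<zero>\<^bsub>A\<^esub>" if z: "z \<in> Z" for z
  proof (rule C0_0[OF \<tau>_stab[OF gc z]])
   have "\<tau> \<g> z y = y" if y: "y \<in> K \<union> set xs" for y
   proof -
    have yc: "y \<in> carrier \<Omega>" using y xs K_closed by blast
    have "\<rho> z y \<in> K \<union> set xs" using y \<rho>[OF z] K_props(4) xs(2) unfolding stable_def by blast
    hence "\<g> (\<rho> z y) = \<rho> z y" using g by (auto simp: fixgrp_def)
    thus ?thesis using \<tau>_app[OF gc z yc] gz[OF z] \<G>_inv(1)[OF _ yc] \<rho>[OF z] by simp
   qed
   thus "\<tau> \<g> z \<in> fixgrp (K \<union> set xs)" using \<tau>_stab[OF gc z] unfolding stab_def[OF zeta] fixgrp_def by simp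
  qed
  hence "Sum \<g> = \<zero>\<^bsub>A\<^esub>" unfolding Sum_def by (intro U.add.finprod_one_eqI) auto
  thus "C \<g> = \<zero>\<^bsub>A\<^esub>" by (simp add: C_def)
 qed
qed

lemma bullet_cochain_exists:
 obtains C ts where "bullet_cochain (carrier \<G>) C" "tower_over_K ts"
  "\<And>\<g>. \<g> \<in> fixgrp (K \<union> set ts) ==> C \<g> = \<zero>\<^bsub>A\<^esub>"
proof (cases "nat_mult p \<one> = \<zero>")
 case True thus ?thesis using that by (rule bullet_cochain_char_p)
next
 case False thus ?thesis using that by (rule bullet_cochain_not_char_p)
qed

end

section \<open>Galois extensions as kernels of epimorphisms\<close>

lemma hom_eq_iff_kernel:
 assumes "group G" "group H" and f: "f \<in> hom G H" and xy: "x \<in> carrier G" "y \<in> carrier G"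
 shows "f x = f y \<longleftrightarrow> f (inv\<^bsub>G\<^esub> y \<otimes>\<^bsub>G\<^esub> x) = \<one>\<^bsub>H\<^esub>"
proof -
 interpret h: group_hom G H f using assms by (simp add: group_hom_def group_hom_axioms_def)
 have "f (inv\<^bsub>G\<^esub> y \<otimes>\<^bsub>G\<^esub> x) = inv\<^bsub>H\<^esub> f y \<otimes>\<^bsub>H\<^esub> f x" using xy by simp
 thus ?thesis using xy h.H.inv_equality[of "inv\<^bsub>H\<^esub> f y" "f x"] by (auto simp: h.H.l_inv)
qed

text \<open>
 Both epimorphisms factor through the quotient by their common kernel.
\<close>

lemma epi_factor:
 assumes G: "group G" and H: "group H" "group H'"
  and f: "f \<in> hom G H" "f ` carrier G = carrier H" and g: "g \<in> hom G H'" "g ` carrier G = carrier H'"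
  and ker: "{x \<in> carrier G. f x = \<one>\<^bsub>H\<^esub>} = {x \<in> carrier G. g x = \<one>\<^bsub>H'\<^esub>}"
 obtains a where "a \<in> iso H H'" "a \<in> extensional (carrier H)" "\<And>x. x \<in> carrier G ==> a (f x) = g x"
proof -
 interpret G: group G by fact
 have eq: "f x = f y \<longleftrightarrow> g x = g y" if xy: "x \<in> carrier G" "y \<in> carrier G" for x y
 proof -
  have c: "inv\<^bsub>G\<^esub> y \<otimes>\<^bsub>G\<^esub> x \<in> carrier G" using xy by simp
  have "(f (inv\<^bsub>G\<^esub> y \<otimes>\<^bsub>G\<^esub> x) = \<one>\<^bsub>H\<^esub>) = (g (inv\<^bsub>G\<^esub> y \<otimes>\<^bsub>G\<^esub> x) = \<one>\<^bsub>H'\<^esub>)" using ker c by blast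
  thus ?thesis using hom_eq_iff_kernel[OF G H(1) f(1) xy] hom_eq_iff_kernel[OF G H(2) g(1) xy] by simp
 qed
 define a where "a = (\<lambda>y\<in>carrier H. g (SOME x. x \<in> carrier G \<and> f x = y))"
 have af: "a (f x) = g x" if x: "x \<in> carrier G" for x
 proof -
  have "\<exists>z. z \<in> carrier G \<and> f z = f x" using x by blast
  from someI_ex[OF this] have "g (SOME z. z \<in> carrier G \<and> f z = f x) = g x" using eq x by blast
  moreover have "f x \<in> carrier H" using f(1) x by (auto simp: hom_def)
  ultimately show ?thesis by (simp add: a_def)
 qed
 show ?thesis
 proof (rule that)
  show "a \<in> iso H H'"
  proof (rule isoI)
   show "a \<in> hom H H'"
   proof (rule homI)
    fix y assume "y \<in> carrier H"
    then obtain x where x: "x \<in> carrier G" "y = f x" using f(2) by blast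
    show "a y \<in> carrier H'" using af[OF x(1)] x(2) g(1) x(1) by (auto simp: hom_def)
    fix y' assume "y' \<in> carrier H"
    then obtain x' where x': "x' \<in> carrier G" "y' = f x'" using f(2) by blast
    have "y \<otimes>\<^bsub>H\<^esub> y' = f (x \<otimes>\<^bsub>G\<^esub> x')" using hom_mult[OF f(1) x(1) x'(1)] x(2) x'(2) by simp
    thus "a (y \<otimes>\<^bsub>H\<^esub> y') = a y \<otimes>\<^bsub>H'\<^esub> a y'"
     using af[of "x \<otimes>\<^bsub>G\<^esub> x'"] af[OF x(1)] af[OF x'(1)] x x' hom_mult[OF g(1) x(1) x'(1)] by simp
   qed
   have "inj_on a (carrier H)"
   proof (rule inj_onI)
    fix y y' assume y: "y \<in> carrier H" "y' \<in> carrier H" "a y = a y'"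
    obtain x x' where x: "x \<in> carrier G" "y = f x" "x' \<in> carrier G" "y' = f x'" using y f(2) by blast
    show "y = y'" using y(3) eq[OF x(1,3)] af[OF x(1)] af[OF x(3)] x(2,4) by simp
   qed
   moreover have "a ` carrier H = carrier H'"
   proof -
    have "a ` carrier H = (\<lambda>x. a (f x)) ` carrier G" unfolding f(2)[symmetric] by (simp add: image_image)
    also have "\<dots> = g ` carrier G" using af by (rule image_cong[OF refl])
    finally show ?thesis using g(2) by simp
   qed
   ultimately show "bij_betw a (carrier H) (carrier H')" by (simp add: bij_betw_def)
  qed
  show "a \<in> extensional (carrier H)" by (simp add: a_def)
 qed (rule af)
qed

lemma times_finite_eqpoll:
 assumes "infinite S" "finite B" "B \<noteq> {}" shows "S \<approx> S \<times> B"
proof -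
 have "ordLeq3 (card_of B) (card_of S)"
  using finite_lepoll_infinite[OF assms(1,2)] unfolding lepoll_def card_of_ordLeq .
 from card_of_Times_infinite[OF assms(1,3) this] have "ordIso2 (card_of (S \<times> B)) (card_of S)" by blast
 hence "S \<times> B \<approx> S" by (simp only: eqpoll_iff_card_of_ordIso)
 thus ?thesis by (rule eqpoll_sym)
qed

text \<open>
 The sets of fields may be infinite, so the cancellation of the finite set of automorphisms needs cardinal
 arithmetic when \<open>S\<close> is infinite.
\<close>

lemma times_finite_cancel_eqpoll:
 assumes eq: "S \<times> B \<approx> S' \<times> B" and B: "finite B" "B \<noteq> {}"
 shows "S \<approx> S'"
proof (cases "finite S")
 case True
 hence f: "finite (S' \<times> B)" using eqpoll_finite_iff[OF eq] B(1) by (simp only: finite_cartesian_product)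
 hence S': "finite S'" using B(2) by (rule finite_cartesian_productD1)
 have "card (S \<times> B) = card (S' \<times> B)" using eqpoll_iff_card[of "S \<times> B" "S' \<times> B"] eq f True B(1) by simp
 hence "card S = card S'" using B by (simp add: card_cartesian_product)
 thus ?thesis using eqpoll_iff_card[OF True S'] by simp
next
 case False
 have "infinite S'"
 proof
  assume "finite S'"
  hence "finite (S \<times> B)" using eqpoll_finite_iff[OF eq] B(1) by (simp only: finite_cartesian_product)
  thus False using finite_cartesian_productD1[OF _ B(2)] False by blast
 qed
 hence "S' \<times> B \<approx> S'" by (rule eqpoll_sym[OF times_finite_eqpoll[OF _ B]])
 from eqpoll_trans[OF times_finite_eqpoll[OF False B] eqpoll_trans[OF eq this]] show ?thesis .
qed

context galois_setting
begin

interpretation \<G>: group \<G> by (rule \<G>_group)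

text \<open>
 The field \<open>L\<close> is the fixed field of the kernel of \<open>\<phi>\<close>.
\<close>

definition cuts_out :: "(('a => 'a) => 'g) => ('g, 'm) monoid_scheme => 'a set => bool" where
 "cuts_out \<phi> E L \<longleftrightarrow> galois_extension \<Omega> F L \<and> {\<g> \<in> carrier \<G>. \<phi> \<g> = \<one>\<^bsub>E\<^esub>} = fixgrp L"

text \<open>
 Continuous epimorphisms from the absolute Galois group, continuity meaning that the kernel is the
 stabilizer of a Galois extension. They are extensional so that each is counted once.
\<close>

definition epis :: "('g, 'm) monoid_scheme => (('a => 'a) => 'g) set" where
 "epis E = {\<phi> \<in> hom \<G> E. \<phi> ` carrier \<G> = carrier E \<and> \<phi> \<in> extensional (carrier \<G>) \<and> (\<exists>L. cuts_out \<phi> E L)}"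

lemma cuts_out_unique: "cuts_out \<phi> E L ==> cuts_out \<phi> E L' ==> L = L'"
 by (rule galois_extension_unique[of L L']) (auto simp: cuts_out_def)

lemma cuts_out_fixgrp: "cuts_out \<phi> E L ==> \<g> \<in> carrier \<G> ==> \<phi> \<g> = \<one>\<^bsub>E\<^esub> \<longleftrightarrow> \<g> \<in> fixgrp L"
 unfolding cuts_out_def by blast

lemma galois_group_group: "galois_extension \<Omega> F L ==> group (galois_group \<Omega> F L)"
 by (rule gal_group) (auto dest: galois_extension_subfield)

lemma restrict_one:
 assumes L: "galois_extension \<Omega> F L" and g: "\<g> \<in> carrier \<G>"
 shows "restrict \<g> L = \<one>\<^bsub>galois_group \<Omega> F L\<^esub> \<longleftrightarrow> \<g> \<in> fixgrp L"
 using g by (auto simp: gal_one fixgrp_def fun_eq_iff restrict_def)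

lemma restriction_epi:
 assumes L: "galois_extension \<Omega> F L"
 shows "(\<lambda>\<g>. restrict \<g> L) \<in> hom \<G> (galois_group \<Omega> F L)"
  "(\<lambda>\<g>. restrict \<g> L) ` carrier \<G> = carrier (galois_group \<Omega> F L)"
proof -
 note Ls = galois_extension_subfield[OF L] and st = galois_extension_stable[OF L]
 show "(\<lambda>\<g>. restrict \<g> L) \<in> hom \<G> (galois_group \<Omega> F L)"
  using restrict_gal[OF st Ls(1,2)] restrict_gal_mult[OF st Ls(1,2)] by (intro homI)
 show "(\<lambda>\<g>. restrict \<g> L) ` carrier \<G> = carrier (galois_group \<Omega> F L)"
 proof (intro equalityI subsetI)
  fix d assume "d \<in> carrier (galois_group \<Omega> F L)"
  then obtain \<g> where "\<g> \<in> carrier \<G>" "restrict \<g> L = d" by (rule restrict_gal_surj[OF Ls(1,2)])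
  thus "d \<in> (\<lambda>\<g>. restrict \<g> L) ` carrier \<G>" by blast
 qed (use restrict_gal[OF st Ls(1,2)] in blast)
qed

lemma epi_of_iso:
 assumes L: "galois_extension \<Omega> F L" and E: "group E" and \<psi>: "\<psi> \<in> iso (galois_group \<Omega> F L) E"
 shows "(\<lambda>\<g>\<in>carrier \<G>. \<psi> (restrict \<g> L)) \<in> epis E" "cuts_out (\<lambda>\<g>\<in>carrier \<G>. \<psi> (restrict \<g> L)) E L"
proof -
 interpret G: group "galois_group \<Omega> F L" by (rule galois_group_group[OF L])
 interpret E: group E by fact
 note R = restriction_epi[OF L]
 have hom: "\<psi> \<in> hom (galois_group \<Omega> F L) E" and bij: "bij_betw \<psi> (carrier (galois_group \<Omega> F L)) (carrier E)"
  using \<psi> by (auto simp: iso_def)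
 have Rc: "restrict \<g> L \<in> carrier (galois_group \<Omega> F L)" if "\<g> \<in> carrier \<G>" for \<g>
  using hom_in_carrier[OF R(1) that] .
 have one: "\<psi> \<one>\<^bsub>galois_group \<Omega> F L\<^esub> = \<one>\<^bsub>E\<^esub>" by (rule hom_one[OF hom G.group_axioms E.group_axioms])
 have inj: "\<psi> d = \<one>\<^bsub>E\<^esub> \<longleftrightarrow> d = \<one>\<^bsub>galois_group \<Omega> F L\<^esub>" if "d \<in> carrier (galois_group \<Omega> F L)" for d
  using one bij that inj_onD[of \<psi> _ d "\<one>\<^bsub>galois_group \<Omega> F L\<^esub>"] by (auto simp: bij_betw_def)
 let ?\<phi> = "\<lambda>\<g>\<in>carrier \<G>. \<psi> (restrict \<g> L)"
 have "?\<phi> \<g> = \<one>\<^bsub>E\<^esub> \<longleftrightarrow> \<g> \<in> fixgrp L" if "\<g> \<in> carrier \<G>" for \<g>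
  using inj[OF Rc[OF that]] restrict_one[OF L that] that by simp
 thus cut: "cuts_out ?\<phi> E L" using L by (auto simp: cuts_out_def fixgrp_def)
 have "?\<phi> \<in> hom \<G> E"
 proof (rule homI)
  fix x y assume xy: "x \<in> carrier \<G>" "y \<in> carrier \<G>"
  show "?\<phi> x \<in> carrier E" using hom_in_carrier[OF hom Rc[OF xy(1)]] xy by simp
  show "?\<phi> (x \<otimes>\<^bsub>\<G>\<^esub> y) = ?\<phi> x \<otimes>\<^bsub>E\<^esub> ?\<phi> y"
   using hom_mult[OF R(1) xy] hom_mult[OF hom Rc[OF xy(1)] Rc[OF xy(2)]] xy by simp
 qed
 moreover have "?\<phi> ` carrier \<G> = carrier E"
 proof -
  have "?\<phi> ` carrier \<G> = \<psi> ` ((\<lambda>\<g>. restrict \<g> L) ` carrier \<G>)" unfolding image_image by (rule image_cong) simp_all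
  also have "\<dots> = carrier E" unfolding R(2) using bij by (simp add: bij_betw_def)
  finally show ?thesis .
 qed
 ultimately show "?\<phi> \<in> epis E" using cut unfolding epis_def by blast
qed

lemma iso_of_epi:
 assumes E: "group E" and \<phi>: "\<phi> \<in> hom \<G> E" "\<phi> ` carrier \<G> = carrier E" and cut: "cuts_out \<phi> E L"
 obtains \<psi> where "\<psi> \<in> iso (galois_group \<Omega> F L) E" "\<And>\<g>. \<g> \<in> carrier \<G> ==> \<psi> (restrict \<g> L) = \<phi> \<g>"
proof -
 have L: "galois_extension \<Omega> F L" using cut by (simp add: cuts_out_def)
 have ker: "{\<g> \<in> carrier \<G>. restrict \<g> L = \<one>\<^bsub>galois_group \<Omega> F L\<^esub>} = {\<g> \<in> carrier \<G>. \<phi> \<g> = \<one>\<^bsub>E\<^esub>}"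
  using restrict_one[OF L] cuts_out_fixgrp[OF cut] by blast
 obtain \<psi> where "\<psi> \<in> iso (galois_group \<Omega> F L) E" "\<And>\<g>. \<g> \<in> carrier \<G> ==> \<psi> (restrict \<g> L) = \<phi> \<g>"
  by (rule epi_factor[OF \<G>_group galois_group_group[OF L] E restriction_epi[OF L] \<phi> ker], rule that)
 thus ?thesis by (rule that)
qed

text \<open>
 A homomorphism that is trivial on the stabilizer of a Galois extension \<open>M\<close> has a kernel that
 corresponds to a subextension of \<open>M\<close>.
\<close>

lemma field_of_epi:
 assumes E: "group E" and \<phi>: "\<phi> \<in> hom \<G> E" and M: "galois_extension \<Omega> F M"
  and ker: "\<And>\<g>. \<g> \<in> fixgrp M ==> \<phi> \<g> = \<one>\<^bsub>E\<^esub>" and fin: "finite ((\<lambda>\<g>. restrict \<g> M) ` carrier \<G>)"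
 obtains L where "cuts_out \<phi> E L"
proof -
 interpret h: group_hom \<G> E \<phi> using \<G>_group E \<phi> by (simp add: group_hom_def group_hom_axioms_def)
 define N where "N = {\<g> \<in> carrier \<G>. \<phi> \<g> = \<one>\<^bsub>E\<^esub>}"
 have "N \<lhd> \<G>" using h.normal_kernel by (simp add: N_def kernel_def)
 moreover have "fixgrp M \<subseteq> N" using ker by (auto simp: N_def fixgrp_def)
 moreover have "finite ((\<lambda>\<g>. restrict \<g> M) ` N)" by (rule finite_subset[OF _ fin]) (auto simp: N_def)
 ultimately obtain L where "galois_extension \<Omega> F L" "fixgrp L = N" by (rule galois_correspondence[OF _ M])
 thus ?thesis by (intro that[of L]) (simp add: cuts_out_def N_def)
qed

text \<open>
 A solution field together with its isomorphism is an epimorphism from the absolute Galois group that lifts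
 the given one. The inclusion \<open>K \<subseteq> L\<close> is automatic, since the kernel of the lift is
 contained in the stabilizer of \<open>K\<close>.
\<close>

lemma embedding_solutions_iff:
 assumes E: "group E" and K: "galois_extension \<Omega> F K" and one: "pr \<one>\<^bsub>E\<^esub> = \<one>\<^bsub>Q\<^esub>" and Q: "group Q"
  and \<iota>: "\<iota> \<in> iso (galois_group \<Omega> F K) Q"
 shows "L \<in> embedding_solutions \<Omega> F K \<iota> E pr \<longleftrightarrow>
  (\<exists>\<phi>\<in>epis E. cuts_out \<phi> E L \<and> (\<forall>\<g>\<in>carrier \<G>. pr (\<phi> \<g>) = \<iota> (restrict \<g> K)))"
proof
 assume "L \<in> embedding_solutions \<Omega> F K \<iota> E pr"
 then obtain \<psi> where L: "galois_extension \<Omega> F L" "K \<subseteq> L" and \<psi>: "\<psi> \<in> iso (galois_group \<Omega> F L) E"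
  "\<And>\<phi>. \<phi> \<in> carrier (galois_group \<Omega> F L) ==> pr (\<psi> \<phi>) = \<iota> (restrict \<phi> K)"
  unfolding embedding_solutions_def by blast
 have "pr ((\<lambda>\<g>\<in>carrier \<G>. \<psi> (restrict \<g> L)) \<g>) = \<iota> (restrict \<g> K)" if g: "\<g> \<in> carrier \<G>" for \<g>
 proof -
  have "restrict (restrict \<g> L) K = restrict \<g> K" using L(2) by (simp add: restrict_restrict Int_absorb1)
  thus ?thesis using \<psi>(2)[OF hom_in_carrier[OF restriction_epi(1)[OF L(1)] g]] g by simp
 qed
 thus "\<exists>\<phi>\<in>epis E. cuts_out \<phi> E L \<and> (\<forall>\<g>\<in>carrier \<G>. pr (\<phi> \<g>) = \<iota> (restrict \<g> K))"
  using epi_of_iso[OF L(1) E \<psi>(1)] by blast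
next
 assume "\<exists>\<phi>\<in>epis E. cuts_out \<phi> E L \<and> (\<forall>\<g>\<in>carrier \<G>. pr (\<phi> \<g>) = \<iota> (restrict \<g> K))"
 then obtain \<phi> where \<phi>: "\<phi> \<in> hom \<G> E" "\<phi> ` carrier \<G> = carrier E" and cut: "cuts_out \<phi> E L"
  and s\<phi>: "\<And>\<g>. \<g> \<in> carrier \<G> ==> pr (\<phi> \<g>) = \<iota> (restrict \<g> K)" unfolding epis_def by blast
 have L: "galois_extension \<Omega> F L" using cut by (simp add: cuts_out_def)
 obtain \<psi> where \<psi>: "\<psi> \<in> iso (galois_group \<Omega> F L) E" "\<And>\<g>. \<g> \<in> carrier \<G> ==> \<psi> (restrict \<g> L) = \<phi> \<g>"
  by (rule iso_of_epi[OF E \<phi> cut], rule that)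
 have cutK: "cuts_out (\<lambda>\<g>\<in>carrier \<G>. \<iota> (restrict \<g> K)) Q K" by (rule epi_of_iso(2)[OF K Q \<iota>])
 have "K \<subseteq> L"
 proof (rule galois_extension_le[OF K L], rule subsetI)
  fix \<g> assume g: "\<g> \<in> fixgrp L"
  hence gc: "\<g> \<in> carrier \<G>" by (simp add: fixgrp_def)
  have "\<phi> \<g> = \<one>\<^bsub>E\<^esub>" using cuts_out_fixgrp[OF cut gc] g by simp
  hence "\<iota> (restrict \<g> K) = \<one>\<^bsub>Q\<^esub>" using s\<phi>[OF gc] one by simp
  thus "\<g> \<in> fixgrp K" using cuts_out_fixgrp[OF cutK gc] gc by simp
 qed
 moreover have "pr (\<psi> d) = \<iota> (restrict d K)" if "d \<in> carrier (galois_group \<Omega> F L)" for d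
 proof -
  obtain \<g> where g: "\<g> \<in> carrier \<G>" "d = restrict \<g> L" using \<open>d \<in> _\<close> restriction_epi(2)[OF L] by blast
  have "restrict d K = restrict \<g> K" unfolding g(2) using \<open>K \<subseteq> L\<close> by (simp add: restrict_restrict Int_absorb1)
  thus ?thesis using \<psi>(2)[OF g(1)] s\<phi>[OF g(1)] g(2) by simp
 qed
 ultimately show "L \<in> embedding_solutions \<Omega> F K \<iota> E pr" using L \<psi>(1) unfolding embedding_solutions_def by blast
qed

end

section \<open>Twisting lifts by the cochain\<close>

lemma finite_image_factor:
 assumes fin: "finite (g ` S)" and fac: "\<And>x y. x \<in> S ==> y \<in> S ==> g x = g y ==> f x = f y"
 shows "finite (f ` S)"
proof -
 have "f ` S \<subseteq> (\<lambda>z. f (SOME x. x \<in> S \<and> g x = z)) ` g ` S"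
 proof
  fix w assume "w \<in> f ` S"
  then obtain x where x: "x \<in> S" "w = f x" by blast
  have "\<exists>y. y \<in> S \<and> g y = g x" using x by blast
  from someI_ex[OF this] have "f (SOME y. y \<in> S \<and> g y = g x) = f x" using fac x(1) by blast
  thus "w \<in> (\<lambda>z. f (SOME x. x \<in> S \<and> g x = z)) ` g ` S" using x by force
 qed
 thus ?thesis using fin finite_surj by blast
qed

lemma (in cring) affine_cocycle_add:
 assumes "a \<in> carrier R" "x \<in> carrier R" "y \<in> carrier R" "e \<in> carrier R" "u \<in> carrier R" "v \<in> carrier R" "w \<in> carrier R"
 shows "(x \<oplus> a \<otimes> y \<oplus> e) \<oplus> (u \<oplus> a \<otimes> v \<oplus> w) = (x \<oplus> u) \<oplus> a \<otimes> (y \<oplus> v) \<oplus> (e \<oplus> w)"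
 using assms by algebra

context cyclic_quotient
begin

interpretation \<G>: group \<G> by (rule \<G>_group)

text \<open>
 The solutions of the embedding problem as homomorphisms: epimorphisms onto the extension whose second
 component is the given \<open>\<pi>\<close>.
\<close>

definition lifts :: "('c \<times> int) monoid => (('a => 'a) => 'c \<times> int) set" where
 "lifts E = {\<phi> \<in> epis E. \<forall>\<g>\<in>carrier \<G>. snd (\<phi> \<g>) = \<pi> \<g>}"

definition twist :: "(('a => 'a) => 'c) => (('a => 'a) => 'c \<times> int) => ('a => 'a) => 'c \<times> int" where
 "twist D \<phi> = (\<lambda>\<g>\<in>carrier \<G>. (fst (\<phi> \<g>) \<oplus>\<^bsub>A\<^esub> D \<g>, \<pi> \<g>))"

lemma twist_hom:
 assumes E: "ext_group A p n i t E c" and E': "ext_group A p n i t E' c'" and d: "d \<in> carrier A" "c' = c \<oplus>\<^bsub>A\<^esub> d"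
  and Dc: "\<And>\<g>. \<g> \<in> carrier \<G> ==> D \<g> \<in> carrier A"
  and D_mult: "\<And>\<g> \<d>. \<g> \<in> carrier \<G> ==> \<d> \<in> carrier \<G> ==> D (\<g> \<otimes>\<^bsub>\<G>\<^esub> \<d>) =
   D \<g> \<oplus>\<^bsub>A\<^esub> U.s [^]\<^bsub>A\<^esub> r \<g> \<otimes>\<^bsub>A\<^esub> D \<d> \<oplus>\<^bsub>A\<^esub> (if r \<g> + r \<d> < U.q then \<zero>\<^bsub>A\<^esub> else d)"
  and \<phi>: "\<phi> \<in> hom \<G> E" "\<And>\<g>. \<g> \<in> carrier \<G> ==> snd (\<phi> \<g>) = \<pi> \<g>"
 shows "twist D \<phi> \<in> hom \<G> E'"
proof (rule homI)
 interpret E: ext_group A p n i t E c by (rule E)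
 interpret E': ext_group A p n i t E' c' by (rule E')
 have fc: "fst (\<phi> \<g>) \<in> carrier A" if "\<g> \<in> carrier \<G>" for \<g>
  using hom_in_carrier[OF \<phi>(1) that] unfolding E.carrier_E by (rule SigmaE) simp
 have \<pi>c: "\<pi> \<g> \<in> {0..<int U.q}" if "\<g> \<in> carrier \<G>" for \<g> using \<pi>_in[OF that] by simp
 fix \<g> \<d> assume g: "\<g> \<in> carrier \<G>" "\<d> \<in> carrier \<G>"
 have gd: "\<g> \<otimes>\<^bsub>\<G>\<^esub> \<d> \<in> carrier \<G>" using g by simp
 show "twist D \<phi> \<g> \<in> carrier E'"
  unfolding E'.carrier_E using g fc[OF g(1)] Dc[OF g(1)] \<pi>c[OF g(1)] by (simp add: twist_def)
 define a where "a = U.s [^]\<^bsub>A\<^esub> r \<g>"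
 have ac: "a \<in> carrier A" by (simp add: a_def)
 have \<phi>e: "\<phi> \<epsilon> = (fst (\<phi> \<epsilon>), \<pi> \<epsilon>)" if "\<epsilon> \<in> carrier \<G>" for \<epsilon> using \<phi>(2)[OF that] by (simp add: prod_eq_iff)
 have "\<phi> (\<g> \<otimes>\<^bsub>\<G>\<^esub> \<d>) = (fst (\<phi> \<g>), \<pi> \<g>) \<otimes>\<^bsub>E\<^esub> (fst (\<phi> \<d>), \<pi> \<d>)"
  using hom_mult[OF \<phi>(1) g] \<phi>e[OF g(1)] \<phi>e[OF g(2)] by simp
 also have "\<dots> = (fst (\<phi> \<g>) \<oplus>\<^bsub>A\<^esub> a \<otimes>\<^bsub>A\<^esub> fst (\<phi> \<d>) \<oplus>\<^bsub>A\<^esub> E.carry (\<pi> \<g>) (\<pi> \<d>), (\<pi> \<g> + \<pi> \<d>) mod int U.q)"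
  using E.E_mult[OF fc[OF g(1)] fc[OF g(2)] \<pi>c[OF g(1)] \<pi>c[OF g(2)]] by (simp add: a_def r_def)
 finally have f_mult: "fst (\<phi> (\<g> \<otimes>\<^bsub>\<G>\<^esub> \<d>)) = fst (\<phi> \<g>) \<oplus>\<^bsub>A\<^esub> a \<otimes>\<^bsub>A\<^esub> fst (\<phi> \<d>) \<oplus>\<^bsub>A\<^esub> E.carry (\<pi> \<g>) (\<pi> \<d>)" by simp
 define w where "w = (if r \<g> + r \<d> < U.q then \<zero>\<^bsub>A\<^esub> else d)"
 have wc: "w \<in> carrier A" using d by (simp add: w_def)
 have w: "E.carry (\<pi> \<g>) (\<pi> \<d>) \<oplus>\<^bsub>A\<^esub> w = E'.carry (\<pi> \<g>) (\<pi> \<d>)"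
 proof -
  have "\<pi> \<g> + \<pi> \<d> < int U.q \<longleftrightarrow> r \<g> + r \<d> < U.q" using \<pi>_r(1)[OF g(1)] \<pi>_r(1)[OF g(2)] by linarith
  thus ?thesis using d(1) by (simp add: w_def E.carry_def E'.carry_def d(2)[symmetric])
 qed
 have "fst (\<phi> (\<g> \<otimes>\<^bsub>\<G>\<^esub> \<d>)) \<oplus>\<^bsub>A\<^esub> D (\<g> \<otimes>\<^bsub>\<G>\<^esub> \<d>) =
   (fst (\<phi> \<g>) \<oplus>\<^bsub>A\<^esub> D \<g>) \<oplus>\<^bsub>A\<^esub> a \<otimes>\<^bsub>A\<^esub> (fst (\<phi> \<d>) \<oplus>\<^bsub>A\<^esub> D \<d>) \<oplus>\<^bsub>A\<^esub> E'.carry (\<pi> \<g>) (\<pi> \<d>)"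
  unfolding f_mult D_mult[OF g] w[symmetric] a_def[symmetric] w_def[symmetric]
  by (rule U.affine_cocycle_add) (use ac fc g Dc wc in auto)
 moreover have "(fst (\<phi> \<g>) \<oplus>\<^bsub>A\<^esub> D \<g>, \<pi> \<g>) \<otimes>\<^bsub>E'\<^esub> (fst (\<phi> \<d>) \<oplus>\<^bsub>A\<^esub> D \<d>, \<pi> \<d>) =
   ((fst (\<phi> \<g>) \<oplus>\<^bsub>A\<^esub> D \<g>) \<oplus>\<^bsub>A\<^esub> a \<otimes>\<^bsub>A\<^esub> (fst (\<phi> \<d>) \<oplus>\<^bsub>A\<^esub> D \<d>) \<oplus>\<^bsub>A\<^esub> E'.carry (\<pi> \<g>) (\<pi> \<d>), (\<pi> \<g> + \<pi> \<d>) mod int U.q)"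
  using E'.E_mult[of "fst (\<phi> \<g>) \<oplus>\<^bsub>A\<^esub> D \<g>" "fst (\<phi> \<d>) \<oplus>\<^bsub>A\<^esub> D \<d>" "\<pi> \<g>" "\<pi> \<d>"] fc g Dc \<pi>c by (simp add: a_def r_def)
 ultimately show "twist D \<phi> (\<g> \<otimes>\<^bsub>\<G>\<^esub> \<d>) = twist D \<phi> \<g> \<otimes>\<^bsub>E'\<^esub> twist D \<phi> \<d>"
  using g gd \<pi>_mult[OF g] by (simp add: twist_def)
qed

text \<open>
 The first components of the images of the automorphisms trivial on \<open>K\<close> form a submodule of
 \<open>A\<close>, where stability under \<open>s\<close> comes from conjugation by a lift of the
 generator. If it contains a unit it is all of \<open>A\<close>.
\<close>

lemma surjective_of_unit:
 assumes E: "ext_group A p n i t E c" and \<phi>: "\<phi> \<in> hom \<G> E" "\<And>\<g>. \<g> \<in> carrier \<G> ==> snd (\<phi> \<g>) = \<pi> \<g>"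
  and u: "\<epsilon> \<in> carrier \<G>" "\<pi> \<epsilon> = 0" "fst (\<phi> \<epsilon>) \<in> Units A"
 shows "\<phi> ` carrier \<G> = carrier E"
proof -
 interpret E: ext_group A p n i t E c by (rule E)
 define f where "f = (\<lambda>\<g>. fst (\<phi> \<g>))"
 have fc: "f \<g> \<in> carrier A" if "\<g> \<in> carrier \<G>" for \<g>
  using hom_in_carrier[OF \<phi>(1) that] unfolding f_def E.carrier_E by (rule SigmaE) simp
 have \<pi>c: "\<pi> \<g> \<in> {0..<int U.q}" if "\<g> \<in> carrier \<G>" for \<g> using \<pi>_in[OF that] by simp
 have \<phi>e: "\<phi> \<epsilon> = (f \<epsilon>, \<pi> \<epsilon>)" if "\<epsilon> \<in> carrier \<G>" for \<epsilon> using \<phi>(2)[OF that] by (simp add: prod_eq_iff f_def)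
 have f_mult: "f (\<g> \<otimes>\<^bsub>\<G>\<^esub> \<d>) = f \<g> \<oplus>\<^bsub>A\<^esub> U.s [^]\<^bsub>A\<^esub> r \<g> \<otimes>\<^bsub>A\<^esub> f \<d> \<oplus>\<^bsub>A\<^esub> E.carry (\<pi> \<g>) (\<pi> \<d>)"
  if g: "\<g> \<in> carrier \<G>" "\<d> \<in> carrier \<G>" for \<g> \<d>
 proof -
  have "\<phi> (\<g> \<otimes>\<^bsub>\<G>\<^esub> \<d>) = (f \<g>, \<pi> \<g>) \<otimes>\<^bsub>E\<^esub> (f \<d>, \<pi> \<d>)"
   unfolding \<phi>e[OF g(1), symmetric] \<phi>e[OF g(2), symmetric] by (rule hom_mult[OF \<phi>(1) g])
  hence "fst (\<phi> (\<g> \<otimes>\<^bsub>\<G>\<^esub> \<d>)) = f \<g> \<oplus>\<^bsub>A\<^esub> U.s [^]\<^bsub>A\<^esub> r \<g> \<otimes>\<^bsub>A\<^esub> f \<d> \<oplus>\<^bsub>A\<^esub> E.carry (\<pi> \<g>) (\<pi> \<d>)"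
   using E.E_mult[OF fc[OF g(1)] fc[OF g(2)] \<pi>c[OF g(1)] \<pi>c[OF g(2)]] by (simp add: r_def)
  thus ?thesis by (simp only: f_def)
 qed
 have carry0: "E.carry 0 j = \<zero>\<^bsub>A\<^esub>" "E.carry j 0 = \<zero>\<^bsub>A\<^esub>" if "j < int U.q" for j
  using that by (simp_all add: E.carry_def)
 define N where "N = {\<g> \<in> carrier \<G>. \<pi> \<g> = 0}"
 have N: "\<g> \<in> carrier \<G>" "\<pi> \<g> = 0" "r \<g> = 0" if "\<g> \<in> N" for \<g> using that by (auto simp: N_def r_def)
 have fN: "f (\<g> \<otimes>\<^bsub>\<G>\<^esub> \<d>) = f \<g> \<oplus>\<^bsub>A\<^esub> f \<d>" if g: "\<g> \<in> N" "\<d> \<in> carrier \<G>" for \<g> \<d>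
  using f_mult[OF N(1)[OF g(1)] g(2)] N[OF g(1)] carry0 \<pi>_in[OF g(2)] fc[OF N(1)[OF g(1)]] fc[OF g(2)] by simp
 have N_mult: "\<g> \<otimes>\<^bsub>\<G>\<^esub> \<d> \<in> N" if "\<g> \<in> N" "\<d> \<in> N" for \<g> \<d>
  using N[OF that(1)] N[OF that(2)] \<pi>_mult[of \<g> \<d>] by (simp add: N_def)
 have one: "\<one>\<^bsub>\<G>\<^esub> \<in> N" using r_one \<pi>_r(1)[of "\<one>\<^bsub>\<G>\<^esub>"] by (simp add: N_def)
 have f_one: "f \<one>\<^bsub>\<G>\<^esub> = \<zero>\<^bsub>A\<^esub>"
  using hom_one[OF \<phi>(1) \<G>_group E.group_E] by (simp add: f_def E.one_E)
 have "f ` N = carrier A"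
 proof (rule U.stable_eq_carrier)
  show "f ` N \<subseteq> carrier A" using fc N by auto
  show "\<zero>\<^bsub>A\<^esub> \<in> f ` N" using one f_one by (intro image_eqI[of _ _ "\<one>\<^bsub>\<G>\<^esub>"]) auto
  show "x \<oplus>\<^bsub>A\<^esub> y \<in> f ` N" if xy: "x \<in> f ` N" "y \<in> f ` N" for x y
  proof -
   obtain \<g> \<d> where g: "\<g> \<in> N" "\<d> \<in> N" "x = f \<g>" "y = f \<d>" using xy by blast
   show ?thesis using N_mult[OF g(1,2)] fN[OF g(1) N(1)[OF g(2)]] g(3,4) by (intro image_eqI[of _ _ "\<g> \<otimes>\<^bsub>\<G>\<^esub> \<d>"]) auto
  qed
  show "U.s \<otimes>\<^bsub>A\<^esub> x \<in> f ` N" if x: "x \<in> f ` N" for x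
  proof -
   obtain \<g> where g: "\<g> \<in> N" "x = f \<g>" using x by blast
   have gc: "\<g> \<in> carrier \<G>" using N[OF g(1)] by simp
   define \<kappa> where "\<kappa> = gen \<otimes>\<^bsub>\<G>\<^esub> \<g> \<otimes>\<^bsub>\<G>\<^esub> inv\<^bsub>\<G>\<^esub> gen"
   have \<kappa>c: "\<kappa> \<in> carrier \<G>" using gen gc by (simp add: \<kappa>_def)
   have \<kappa>gen: "\<kappa> \<otimes>\<^bsub>\<G>\<^esub> gen = gen \<otimes>\<^bsub>\<G>\<^esub> \<g>" using gen gc by (simp add: \<kappa>_def \<G>.m_assoc)
   have "(r \<kappa> + 1) mod U.q = (1 + 0) mod U.q"
    using r_mult[OF \<kappa>c gen(1)] r_mult[OF gen(1) gc] \<kappa>gen gen(2) N(3)[OF g(1)] by simp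
   hence "[r \<kappa> + 1 = 0 + 1] (mod U.q)" by (simp add: cong_def)
   hence "[r \<kappa> = 0] (mod U.q)" by (simp only: cong_add_rcancel_nat)
   hence "r \<kappa> = 0" using \<pi>_r(2)[OF \<kappa>c] by (simp add: cong_def)
   hence \<kappa>N: "\<kappa> \<in> N" using \<kappa>c \<pi>_r(1)[OF \<kappa>c] by (simp add: N_def)
   have "f (gen \<otimes>\<^bsub>\<G>\<^esub> \<g>) = f gen \<oplus>\<^bsub>A\<^esub> U.s \<otimes>\<^bsub>A\<^esub> f \<g>"
    using f_mult[OF gen(1) gc] gen(2) N(2)[OF g(1)] carry0 \<pi>_in[OF gen(1)] fc[OF gen(1)] fc[OF gc] by simp
   moreover have "f (\<kappa> \<otimes>\<^bsub>\<G>\<^esub> gen) = f \<kappa> \<oplus>\<^bsub>A\<^esub> f gen" using fN[OF \<kappa>N gen(1)] .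
   ultimately have "f gen \<oplus>\<^bsub>A\<^esub> U.s \<otimes>\<^bsub>A\<^esub> f \<g> = f gen \<oplus>\<^bsub>A\<^esub> f \<kappa>"
    using \<kappa>gen U.a_comm[OF fc[OF \<kappa>c] fc[OF gen(1)]] by simp
   hence "U.s \<otimes>\<^bsub>A\<^esub> f \<g> = f \<kappa>"
    by (rule U.add.l_cancel) (use fc gen(1) gc \<kappa>c in auto)
   thus ?thesis using \<kappa>N g(2) by (intro image_eqI[of _ _ \<kappa>]) auto
  qed
  show "f \<epsilon> \<in> f ` N" using u by (simp add: N_def)
  show "f \<epsilon> \<in> Units A" using u(3) by (simp add: f_def)
 qed
 show ?thesis
 proof (intro equalityI subsetI)
  fix x assume "x \<in> carrier E"
  then obtain b j where x: "x = (b, j)" "b \<in> carrier A" "j \<in> {0..<int U.q}" unfolding E.carrier_E by blast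
  obtain \<d> where d: "\<d> \<in> carrier \<G>" "\<pi> \<d> = j" using x(3) unfolding \<pi>_range[symmetric] by blast
  have "b \<ominus>\<^bsub>A\<^esub> f \<d> \<in> f ` N" unfolding \<open>f ` N = carrier A\<close> using x(2) fc[OF d(1)] by simp
  then obtain \<g> where g: "\<g> \<in> N" "f \<g> = b \<ominus>\<^bsub>A\<^esub> f \<d>" by auto
  have gd: "\<g> \<otimes>\<^bsub>\<G>\<^esub> \<d> \<in> carrier \<G>" using N(1)[OF g(1)] d(1) by simp
  have "f (\<g> \<otimes>\<^bsub>\<G>\<^esub> \<d>) = b"
   using fN[OF g(1) d(1)] g(2) x(2) fc[OF d(1)] by (simp add: U.minus_eq U.a_assoc U.l_neg)
  moreover have "\<pi> (\<g> \<otimes>\<^bsub>\<G>\<^esub> \<d>) = j"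
   using \<pi>_mult[OF N(1)[OF g(1)] d(1)] N(2)[OF g(1)] d(2) x(3) by simp
  ultimately have "\<phi> (\<g> \<otimes>\<^bsub>\<G>\<^esub> \<d>) = x" using \<phi>e[OF gd] x(1) by simp
  thus "x \<in> \<phi> ` carrier \<G>" using gd by blast
 qed (use hom_in_carrier[OF \<phi>(1)] in blast)
qed

lemma finite_tower_restrictions:
 assumes E: "group E" "finite (carrier E)" and \<phi>: "\<phi> \<in> hom \<G> E" and L: "cuts_out \<phi> E L" and ts: "stable (set ts)"
 shows "finite ((\<lambda>\<g>. restrict \<g> (finite_extension L ts)) ` carrier \<G>)"
proof (rule finite_image_factor[of "\<lambda>\<g>. (\<phi> \<g>, restrict \<g> (set ts))"])
 have Lg: "galois_extension \<Omega> F L" using L by (simp add: cuts_out_def)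
 note Ls = galois_extension_subfield[OF Lg]
 have tsc: "set ts \<subseteq> carrier \<Omega>" using ts by (simp add: stable_def)
 have "(\<lambda>\<g>. (\<phi> \<g>, restrict \<g> (set ts))) ` carrier \<G> \<subseteq> carrier E \<times> (set ts \<rightarrow>\<^sub>E set ts)"
  using hom_in_carrier[OF \<phi>] ts by (auto simp: stable_def)
 moreover have "finite (carrier E \<times> (set ts \<rightarrow>\<^sub>E set ts))" using E(2) by (intro finite_cartesian_product finite_PiE) auto
 ultimately show "finite ((\<lambda>\<g>. (\<phi> \<g>, restrict \<g> (set ts))) ` carrier \<G>)" by (rule finite_subset)
 fix \<g> \<d> assume g: "\<g> \<in> carrier \<G>" "\<d> \<in> carrier \<G>" and eq: "(\<phi> \<g>, restrict \<g> (set ts)) = (\<phi> \<d>, restrict \<d> (set ts))"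
 have d: "inv\<^bsub>\<G>\<^esub> \<d> \<in> carrier \<G>" using g by simp
 have dg: "inv\<^bsub>\<G>\<^esub> \<d> \<otimes>\<^bsub>\<G>\<^esub> \<g> \<in> carrier \<G>" using g by simp
 have "\<phi> (inv\<^bsub>\<G>\<^esub> \<d> \<otimes>\<^bsub>\<G>\<^esub> \<g>) = \<one>\<^bsub>E\<^esub>" using hom_eq_iff_kernel[OF \<G>_group E(1) \<phi> g] eq by simp
 hence fx: "inv\<^bsub>\<G>\<^esub> \<d> \<otimes>\<^bsub>\<G>\<^esub> \<g> \<in> fixgrp L" using cuts_out_fixgrp[OF L dg] by simp
 have "\<g> x = \<d> x" if x: "x \<in> L \<union> set ts" for x
 proof (cases "x \<in> L")
  case True
  have xc: "x \<in> carrier \<Omega>" using Ls(3) True by blast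
  have "(inv\<^bsub>\<G>\<^esub> \<d>) (\<g> x) = x" using fx True \<G>_mult[OF d g(1) xc] by (simp add: fixgrp_def)
  thus ?thesis using \<G>_inv(2)[OF g(2), of "\<g> x"] g(1) xc by simp
 next
  case False
  hence "x \<in> set ts" using x by blast
  thus ?thesis using eq restrict_apply'[of x "set ts" \<g>] restrict_apply'[of x "set ts" \<d>] by simp
 qed
 hence "\<g> x = \<d> x" if "x \<in> finite_extension L ts" for x
  using automorphisms_eq_on_tower[OF Ls(1,2) tsc g _ that] by blast
 thus "restrict \<g> (finite_extension L ts) = restrict \<d> (finite_extension L ts)" by (rule restrict_ext)
qed

text \<open>
 The twisted homomorphism is onto because the first components change only by elements of
 \<open>tA\<close>, so a preimage of \<open>(1, 0)\<close> still has a unit as first component. It is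
 continuous because it is trivial on the stabilizer of the Galois extension generated by \<open>ts\<close>
 over the field of the original lift.
\<close>

lemma twist_lifts:
 assumes E: "ext_group A p n i t E c" and E': "ext_group A p n i t E' c'" and d: "d \<in> carrier A" "c' = c \<oplus>\<^bsub>A\<^esub> d"
  and D_rad: "\<And>\<g>. \<g> \<in> carrier \<G> ==> \<exists>b\<in>carrier A. D \<g> = t \<otimes>\<^bsub>A\<^esub> b"
  and D_mult: "\<And>\<g> \<d>. \<g> \<in> carrier \<G> ==> \<d> \<in> carrier \<G> ==> D (\<g> \<otimes>\<^bsub>\<G>\<^esub> \<d>) =
   D \<g> \<oplus>\<^bsub>A\<^esub> U.s [^]\<^bsub>A\<^esub> r \<g> \<otimes>\<^bsub>A\<^esub> D \<d> \<oplus>\<^bsub>A\<^esub> (if r \<g> + r \<d> < U.q then \<zero>\<^bsub>A\<^esub> else d)"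
  and ts: "tower_over_K ts" and D_fix: "\<And>\<g>. \<g> \<in> fixgrp (K \<union> set ts) ==> D \<g> = \<zero>\<^bsub>A\<^esub>"
  and \<phi>: "\<phi> \<in> lifts E"
 shows "twist D \<phi> \<in> lifts E'"
proof -
 interpret E: ext_group A p n i t E c by (rule E)
 interpret E': ext_group A p n i t E' c' by (rule E')
 have Dc: "D \<g> \<in> carrier A" if "\<g> \<in> carrier \<G>" for \<g> using D_rad[OF that] by auto
 have hom: "\<phi> \<in> hom \<G> E" and img: "\<phi> ` carrier \<G> = carrier E" and snd: "\<And>\<g>. \<g> \<in> carrier \<G> ==> snd (\<phi> \<g>) = \<pi> \<g>"
  using \<phi> by (auto simp: lifts_def epis_def)
 obtain L where L: "cuts_out \<phi> E L" using \<phi> by (auto simp: lifts_def epis_def)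
 have Lg: "galois_extension \<Omega> F L" using L by (simp add: cuts_out_def)
 note Ls = galois_extension_subfield[OF Lg]
 have hom': "twist D \<phi> \<in> hom \<G> E'" by (rule twist_hom[OF E E' d Dc D_mult hom snd])
 have snd': "snd (twist D \<phi> \<g>) = \<pi> \<g>" if "\<g> \<in> carrier \<G>" for \<g> using that by (simp add: twist_def)
 have img': "twist D \<phi> ` carrier \<G> = carrier E'"
 proof -
  have "(\<one>\<^bsub>A\<^esub>, 0) \<in> \<phi> ` carrier \<G>" unfolding img E.carrier_E using U.q_gt_1 by simp
  then obtain \<epsilon> where e: "\<epsilon> \<in> carrier \<G>" "\<phi> \<epsilon> = (\<one>\<^bsub>A\<^esub>, 0)" by auto
  obtain b where b: "b \<in> carrier A" "D \<epsilon> = t \<otimes>\<^bsub>A\<^esub> b" using D_rad[OF e(1)] by blast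
  show ?thesis
  proof (rule surjective_of_unit[OF E' hom' snd' e(1)])
   show "\<pi> \<epsilon> = 0" using snd[OF e(1)] e(2) by simp
   show "fst (twist D \<phi> \<epsilon>) \<in> Units A" using e b U.one_plus_t_unit[OF b(1)] by (simp add: twist_def)
  qed
 qed
 have sub: "\<pi> \<g> = 0" if g: "\<g> \<in> fixgrp L" for \<g>
 proof -
  have gc: "\<g> \<in> carrier \<G>" using g by (simp add: fixgrp_def)
  have "\<phi> \<g> = \<one>\<^bsub>E\<^esub>" using cuts_out_fixgrp[OF L gc] g by simp
  thus ?thesis using snd[OF gc] by (simp add: E.one_E)
 qed
 have KL: "K \<subseteq> L"
 proof (rule galois_extension_le[OF K Lg], rule subsetI)
  fix \<g> assume g: "\<g> \<in> fixgrp L"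
  thus "\<g> \<in> fixgrp K" unfolding \<pi>_ker[symmetric] using sub[OF g] by (simp add: fixgrp_def)
 qed
 have st: "stable (set ts)" and sep: "separable_tower L ts" using ts Ls(1) KL by (auto simp: tower_over_K_def)
 have tsc: "set ts \<subseteq> carrier \<Omega>" using st by (simp add: stable_def)
 define M where "M = finite_extension L ts"
 have M: "galois_extension \<Omega> F M" unfolding M_def by (rule galois_tower[OF Lg st sep])
 have LM: "L \<subseteq> M" unfolding M_def by (rule finite_extension_incl[OF Ls(3) tsc])
 have tM: "set ts \<subseteq> M" unfolding M_def by (rule finite_extension_mem[OF subfieldE(1)[OF Ls(1)] tsc])
 have finE: "finite (carrier E)" unfolding E.carrier_E using U.finite_carrier by simp
 have ker: "twist D \<phi> \<g> = \<one>\<^bsub>E'\<^esub>" if g: "\<g> \<in> fixgrp M" for \<g>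
 proof -
  have gc: "\<g> \<in> carrier \<G>" using g by (simp add: fixgrp_def)
  have gL: "\<g> \<in> fixgrp L" and gK: "\<g> \<in> fixgrp (K \<union> set ts)" using g LM tM KL by (auto simp: fixgrp_def)
  have "\<phi> \<g> = \<one>\<^bsub>E\<^esub>" using cuts_out_fixgrp[OF L gc] gL by simp
  thus ?thesis using D_fix[OF gK] sub[OF gL] gc by (simp add: twist_def E.one_E E'.one_E)
 qed
 obtain L' where "cuts_out (twist D \<phi>) E' L'"
  by (rule field_of_epi[OF E'.group_E hom' M ker finite_tower_restrictions[OF E.group_E finE hom L st, folded M_def]])
 moreover have "twist D \<phi> \<in> extensional (carrier \<G>)" by (simp add: twist_def)
 ultimately show ?thesis using hom' img' snd' unfolding lifts_def epis_def by blast
qed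

text \<open>
 Twisting by the negative of the cochain is inverse to twisting by the cochain.
\<close>

lemma lifts_twist_eqpoll:
 assumes E: "ext_group A p n i t E \<zero>\<^bsub>A\<^esub>" and E': "ext_group A p n i t E' T"
 shows "lifts E \<approx> lifts E'"
proof -
 interpret E: ext_group A p n i t E "\<zero>\<^bsub>A\<^esub>" by (rule E)
 interpret E': ext_group A p n i t E' T by (rule E')
 obtain C ts where C: "bullet_cochain (carrier \<G>) C" and ts: "tower_over_K ts"
  and C_fix: "\<And>\<g>. \<g> \<in> fixgrp (K \<union> set ts) ==> C \<g> = \<zero>\<^bsub>A\<^esub>" by (rule bullet_cochain_exists, rule that)
 have C_rad: "\<exists>b\<in>carrier A. C \<g> = t \<otimes>\<^bsub>A\<^esub> b" if "\<g> \<in> carrier \<G>" for \<g> using C that unfolding bullet_cochain_def by blast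
 have Cc: "C \<g> \<in> carrier A" if "\<g> \<in> carrier \<G>" for \<g> using C_rad[OF that] by auto
 have C_mult: "C (\<g> \<otimes>\<^bsub>\<G>\<^esub> \<d>) = C \<g> \<oplus>\<^bsub>A\<^esub> U.s [^]\<^bsub>A\<^esub> r \<g> \<otimes>\<^bsub>A\<^esub> C \<d> \<oplus>\<^bsub>A\<^esub> (if r \<g> + r \<d> < U.q then \<zero>\<^bsub>A\<^esub> else T)"
  if g: "\<g> \<in> carrier \<G>" "\<d> \<in> carrier \<G>" for \<g> \<d>
 proof -
  have "U.nat_mult ((r \<g> + r \<d>) div U.q) T = (if r \<g> + r \<d> < U.q then \<zero>\<^bsub>A\<^esub> else T)"
  proof (cases "r \<g> + r \<d> < U.q")
   case False
   have "(r \<g> + r \<d>) div U.q = Suc 0"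
    by (rule div_nat_eqI) (use False \<pi>_r(2)[OF g(1)] \<pi>_r(2)[OF g(2)] in simp_all)
   thus ?thesis using False by simp
  qed simp
  thus ?thesis using C g unfolding bullet_cochain_def by simp
 qed
 define D where "D = (\<lambda>\<g>. \<ominus>\<^bsub>A\<^esub> C \<g>)"
 have D_rad: "\<exists>b\<in>carrier A. D \<g> = t \<otimes>\<^bsub>A\<^esub> b" if g: "\<g> \<in> carrier \<G>" for \<g>
 proof -
  obtain b where b: "b \<in> carrier A" "C \<g> = t \<otimes>\<^bsub>A\<^esub> b" using C_rad[OF g] by blast
  have "D \<g> = t \<otimes>\<^bsub>A\<^esub> (\<ominus>\<^bsub>A\<^esub> b)" unfolding D_def b(2) using b(1) by (simp add: U.r_minus)
  thus ?thesis using b(1) by (intro bexI[of _ "\<ominus>\<^bsub>A\<^esub> b"]) auto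
 qed
 have D_mult: "D (\<g> \<otimes>\<^bsub>\<G>\<^esub> \<d>) = D \<g> \<oplus>\<^bsub>A\<^esub> U.s [^]\<^bsub>A\<^esub> r \<g> \<otimes>\<^bsub>A\<^esub> D \<d> \<oplus>\<^bsub>A\<^esub> (if r \<g> + r \<d> < U.q then \<zero>\<^bsub>A\<^esub> else \<ominus>\<^bsub>A\<^esub> T)"
  if g: "\<g> \<in> carrier \<G>" "\<d> \<in> carrier \<G>" for \<g> \<d>
  unfolding D_def C_mult[OF g] using Cc[OF g(1)] Cc[OF g(2)] by (simp add: U.minus_add U.r_minus)
 have there: "twist C \<phi> \<in> lifts E'" if "\<phi> \<in> lifts E" for \<phi>
  by (rule twist_lifts[OF E E' T_closed _ C_rad C_mult ts C_fix that]) simp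
 have backward: "twist D \<phi> \<in> lifts E" if "\<phi> \<in> lifts E'" for \<phi>
  by (rule twist_lifts[OF E' E _ _ D_rad D_mult ts _ that]) (simp_all add: U.r_neg D_def C_fix)
 have inverse: "twist G' (twist G \<phi>) = \<phi>"
  if \<phi>: "\<phi> \<in> lifts H" and H: "carrier H = carrier A \<times> {0..<int U.q}"
   and G: "\<And>\<g> f. \<g> \<in> carrier \<G> ==> f \<in> carrier A ==> (f \<oplus>\<^bsub>A\<^esub> G \<g>) \<oplus>\<^bsub>A\<^esub> G' \<g> = f" for G G' :: "('a => 'a) => 'c" and H \<phi>
 proof (rule extensionalityI)
  show "twist G' (twist G \<phi>) \<in> extensional (carrier \<G>)" by (simp add: twist_def)
  show "\<phi> \<in> extensional (carrier \<G>)" using \<phi> by (simp add: lifts_def epis_def)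
  fix \<g> assume g: "\<g> \<in> carrier \<G>"
  have "\<phi> \<in> hom \<G> H" using \<phi> by (simp add: lifts_def epis_def)
  hence "fst (\<phi> \<g>) \<in> carrier A" using hom_in_carrier[OF _ g, of \<phi> H] H by (auto simp: mem_Times_iff)
  moreover have "snd (\<phi> \<g>) = \<pi> \<g>" using \<phi> g by (simp add: lifts_def)
  ultimately show "twist G' (twist G \<phi>) \<g> = \<phi> \<g>" using g G[OF g] by (simp add: twist_def prod_eq_iff)
 qed
 have "bij_betw (twist C) (lifts E) (lifts E')"
 proof (rule bij_betw_byWitness[where f' = "twist D"])
  show "\<forall>\<phi>\<in>lifts E. twist D (twist C \<phi>) = \<phi>"
   using inverse[OF _ E.carrier_E] Cc by (simp add: D_def U.a_assoc U.r_neg)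
  show "\<forall>\<phi>\<in>lifts E'. twist C (twist D \<phi>) = \<phi>"
   using inverse[OF _ E'.carrier_E] Cc by (simp add: D_def U.a_assoc U.l_neg)
 qed (use there backward in blast)+
 thus ?thesis unfolding eqpoll_def by blast
qed

end

section \<open>Counting\<close>

context galois_setting
begin

interpretation \<G>: group \<G> by (rule \<G>_group)

lemma epi_compose:
 assumes \<phi>: "\<phi> \<in> epis E" and E: "group E" "group E'" and a: "a \<in> iso E E'"
 shows "(\<lambda>\<g>\<in>carrier \<G>. a (\<phi> \<g>)) \<in> epis E'"
  "cuts_out \<phi> E L ==> cuts_out (\<lambda>\<g>\<in>carrier \<G>. a (\<phi> \<g>)) E' L"
proof -
 have hom: "\<phi> \<in> hom \<G> E" and img: "\<phi> ` carrier \<G> = carrier E" using \<phi> by (auto simp: epis_def)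
 have ahom: "a \<in> hom E E'" and bij: "bij_betw a (carrier E) (carrier E')" using a by (auto simp: iso_def)
 have c: "\<phi> \<g> \<in> carrier E" if "\<g> \<in> carrier \<G>" for \<g> using hom_in_carrier[OF hom that] .
 have one: "a \<one>\<^bsub>E\<^esub> = \<one>\<^bsub>E'\<^esub>" by (rule hom_one[OF ahom E])
 have one_in: "\<one>\<^bsub>E\<^esub> \<in> carrier E" using E(1) by (simp add: group.is_monoid monoid.one_closed)
 have "a (\<phi> \<g>) = \<one>\<^bsub>E'\<^esub> \<longleftrightarrow> \<phi> \<g> = \<one>\<^bsub>E\<^esub>" if "\<g> \<in> carrier \<G>" for \<g>
  using inj_onD[of a "carrier E" "\<phi> \<g>" "\<one>\<^bsub>E\<^esub>"] bij one one_in c[OF that] by (auto simp: bij_betw_def)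
 hence ker: "{\<g> \<in> carrier \<G>. (\<lambda>\<g>\<in>carrier \<G>. a (\<phi> \<g>)) \<g> = \<one>\<^bsub>E'\<^esub>} = {\<g> \<in> carrier \<G>. \<phi> \<g> = \<one>\<^bsub>E\<^esub>}" by auto
 show cut: "cuts_out (\<lambda>\<g>\<in>carrier \<G>. a (\<phi> \<g>)) E' L" if "cuts_out \<phi> E L" for L
  using that unfolding cuts_out_def ker .
 have "(\<lambda>\<g>\<in>carrier \<G>. a (\<phi> \<g>)) \<in> hom \<G> E'"
 proof (rule homI)
  fix x y assume xy: "x \<in> carrier \<G>" "y \<in> carrier \<G>"
  show "(\<lambda>\<g>\<in>carrier \<G>. a (\<phi> \<g>)) x \<in> carrier E'" using hom_in_carrier[OF ahom c[OF xy(1)]] xy by simp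
  show "(\<lambda>\<g>\<in>carrier \<G>. a (\<phi> \<g>)) (x \<otimes>\<^bsub>\<G>\<^esub> y) = (\<lambda>\<g>\<in>carrier \<G>. a (\<phi> \<g>)) x \<otimes>\<^bsub>E'\<^esub> (\<lambda>\<g>\<in>carrier \<G>. a (\<phi> \<g>)) y"
   using hom_mult[OF hom xy] hom_mult[OF ahom c[OF xy(1)] c[OF xy(2)]] xy by simp
 qed
 moreover have "(\<lambda>\<g>\<in>carrier \<G>. a (\<phi> \<g>)) ` carrier \<G> = carrier E'"
 proof -
  have "(\<lambda>\<g>\<in>carrier \<G>. a (\<phi> \<g>)) ` carrier \<G> = a ` (\<phi> ` carrier \<G>)" unfolding image_image by (rule image_cong) simp_all
  also have "\<dots> = carrier E'" unfolding img using bij by (simp add: bij_betw_def)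
  finally show ?thesis .
 qed
 moreover obtain L where "cuts_out \<phi> E L" using \<phi> by (auto simp: epis_def)
 ultimately show "(\<lambda>\<g>\<in>carrier \<G>. a (\<phi> \<g>)) \<in> epis E'" using cut unfolding epis_def by blast
qed

end

context cyclic_quotient
begin

interpretation \<G>: group \<G> by (rule \<G>_group)

definition solutions :: "('c \<times> int) monoid => 'a set set" where
 "solutions E = {L. \<exists>\<phi>\<in>lifts E. cuts_out \<phi> E L}"

text \<open>
 The lifts that cut out a fixed field form a single free orbit under the automorphisms of the extension
 over the cyclic quotient.
\<close>

lemma lifts_eqpoll_times:
 assumes E: "ext_group A p n i t E c"
 shows "solutions E \<times> ext_group.auts E \<approx> lifts E"
proof -
 interpret E: ext_group A p n i t E c by (rule E)
 define \<Phi> where "\<Phi> = (\<lambda>L. SOME \<phi>. \<phi> \<in> lifts E \<and> cuts_out \<phi> E L)"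
 have \<Phi>: "\<Phi> L \<in> lifts E" "cuts_out (\<Phi> L) E L" if "L \<in> solutions E" for L
 proof -
  have "\<exists>\<phi>. \<phi> \<in> lifts E \<and> cuts_out \<phi> E L" using that by (auto simp: solutions_def)
  from someI_ex[OF this] show "\<Phi> L \<in> lifts E" "cuts_out (\<Phi> L) E L" by (simp_all add: \<Phi>_def)
 qed
 have \<Phi>e: "\<Phi> L \<in> epis E" and \<Phi>s: "\<And>\<g>. \<g> \<in> carrier \<G> ==> snd (\<Phi> L \<g>) = \<pi> \<g>" if "L \<in> solutions E" for L
  using \<Phi>(1)[OF that] by (auto simp: lifts_def)
 have \<Phi>h: "\<Phi> L \<in> hom \<G> E" "\<Phi> L ` carrier \<G> = carrier E" if "L \<in> solutions E" for L
  using \<Phi>e[OF that] by (auto simp: epis_def)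
 define h where "h = (\<lambda>(L, a). \<lambda>\<g>\<in>carrier \<G>. (a (\<Phi> L \<g>) :: 'c \<times> int))"
 have auts: "a \<in> iso E E" "a \<in> extensional (carrier E)" "\<And>x. x \<in> carrier E ==> snd (a x) = snd x"
  if "a \<in> E.auts" for a using that by (auto simp: E.auts_def)
 have into: "h (L, a) \<in> lifts E" "cuts_out (h (L, a)) E L" if La: "L \<in> solutions E" "a \<in> E.auts" for L a
 proof -
  show "cuts_out (h (L, a)) E L" unfolding h_def prod.case
   by (rule epi_compose(2)[OF \<Phi>e[OF La(1)] E.group_E E.group_E auts(1)[OF La(2)] \<Phi>(2)[OF La(1)]])
  have "h (L, a) \<in> epis E" unfolding h_def prod.case
   by (rule epi_compose(1)[OF \<Phi>e[OF La(1)] E.group_E E.group_E auts(1)[OF La(2)]])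
  moreover have "snd (h (L, a) \<g>) = \<pi> \<g>" if g: "\<g> \<in> carrier \<G>" for \<g>
   using auts(3)[OF La(2) hom_in_carrier[OF \<Phi>h(1)[OF La(1)] g]] \<Phi>s[OF La(1) g] g by (simp add: h_def)
  ultimately show "h (L, a) \<in> lifts E" by (simp add: lifts_def)
 qed
 have "bij_betw h (solutions E \<times> E.auts) (lifts E)"
  unfolding bij_betw_def
 proof (intro conjI inj_onI equalityI subsetI)
  fix x y assume xy: "x \<in> solutions E \<times> E.auts" "y \<in> solutions E \<times> E.auts" "h x = h y"
  obtain L a L' a' where e: "x = (L, a)" "y = (L', a')" by (cases x, cases y)
  have La: "L \<in> solutions E" "a \<in> E.auts" and La': "L' \<in> solutions E" "a' \<in> E.auts" using xy e by auto
  have "L = L'" using cuts_out_unique[OF into(2)[OF La]] into(2)[OF La'] xy(3) unfolding e by simp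
  moreover have "a = a'"
  proof (rule extensionalityI[OF auts(2)[OF La(2)] auts(2)[OF La'(2)]])
   fix z assume "z \<in> carrier E"
   then obtain \<g> where g: "\<g> \<in> carrier \<G>" "z = \<Phi> L \<g>" using \<Phi>h(2)[OF La(1)] by blast
   have "h (L, a) \<g> = h (L, a') \<g>" using xy(3) \<open>L = L'\<close> unfolding e by simp
   thus "a z = a' z" using g by (simp add: h_def)
  qed
  ultimately show "x = y" unfolding e by simp
 next
  fix \<phi> assume "\<phi> \<in> h ` (solutions E \<times> E.auts)"
  thus "\<phi> \<in> lifts E" using into(1) by auto
 next
  fix \<phi> assume \<phi>: "\<phi> \<in> lifts E"
  then obtain L where L: "cuts_out \<phi> E L" by (auto simp: lifts_def epis_def)
  have Ls: "L \<in> solutions E" using \<phi> L by (auto simp: solutions_def)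
  have \<phi>h: "\<phi> \<in> hom \<G> E" "\<phi> ` carrier \<G> = carrier E" and ext: "\<phi> \<in> extensional (carrier \<G>)"
   and s\<phi>: "\<And>\<g>. \<g> \<in> carrier \<G> ==> snd (\<phi> \<g>) = \<pi> \<g>" using \<phi> by (auto simp: lifts_def epis_def)
  have ker: "{\<g> \<in> carrier \<G>. \<Phi> L \<g> = \<one>\<^bsub>E\<^esub>} = {\<g> \<in> carrier \<G>. \<phi> \<g> = \<one>\<^bsub>E\<^esub>}"
   using L \<Phi>(2)[OF Ls] by (simp add: cuts_out_def)
  obtain a where a: "a \<in> iso E E" "a \<in> extensional (carrier E)" "\<And>\<g>. \<g> \<in> carrier \<G> ==> a (\<Phi> L \<g>) = \<phi> \<g>"
   by (rule epi_factor[OF \<G>_group E.group_E E.group_E \<Phi>h[OF Ls] \<phi>h ker], rule that)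
  have "snd (a z) = snd z" if z: "z \<in> carrier E" for z
  proof -
   obtain \<g> where g: "\<g> \<in> carrier \<G>" "z = \<Phi> L \<g>" using z \<Phi>h(2)[OF Ls] by blast
   show ?thesis using a(3)[OF g(1)] s\<phi>[OF g(1)] \<Phi>s[OF Ls g(1)] g(2) by simp
  qed
  hence "a \<in> E.auts" using a by (simp add: E.auts_def)
  moreover have "\<phi> = h (L, a)"
   by (rule extensionalityI[OF ext]) (use a(3) in \<open>simp_all add: h_def\<close>)
  ultimately show "\<phi> \<in> h ` (solutions E \<times> E.auts)" using Ls by blast
 qed
 thus ?thesis unfolding eqpoll_def by blast
qed

text \<open>
 The two extensions have equally many lifts, and \<open>p - 1\<close> times as many automorphisms belong to
 the semidirect product.
\<close>

lemma solutions_eqpoll: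
 assumes E: "ext_group A p n i t E \<zero>\<^bsub>A\<^esub>" and E': "ext_group A p n i t E' T"
 shows "solutions E' \<approx> {..<p - 1} \<times> solutions E"
proof -
 interpret E: ext_group A p n i t E "\<zero>\<^bsub>A\<^esub>" by (rule E)
 interpret E': ext_group A p n i t E' T by (rule E')
 have "card E.auts = (p - 1) * card E'.auts"
  unfolding E.card_auts(2) E'.card_auts(2) U.card_units T_def by simp
 hence "E.auts \<approx> {..<p - 1} \<times> E'.auts"
  using eqpoll_iff_card[of E.auts "{..<p - 1} \<times> E'.auts"] E.card_auts(1) E'.card_auts(1)
  by (simp add: card_cartesian_product)
 hence "solutions E \<times> E.auts \<approx> solutions E \<times> ({..<p - 1} \<times> E'.auts)"
  by (rule times_eqpoll_cong[OF eqpoll_refl])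
 also have "solutions E \<times> ({..<p - 1} \<times> E'.auts) \<approx> (solutions E \<times> {..<p - 1}) \<times> E'.auts"
  by (rule eqpoll_sym[OF times_assoc_eqpoll])
 also have "(solutions E \<times> {..<p - 1}) \<times> E'.auts \<approx> ({..<p - 1} \<times> solutions E) \<times> E'.auts"
  by (rule times_eqpoll_cong[OF times_commute_eqpoll eqpoll_refl])
 finally have 1: "solutions E \<times> E.auts \<approx> ({..<p - 1} \<times> solutions E) \<times> E'.auts" .
 have "solutions E' \<times> E'.auts \<approx> lifts E'" by (rule lifts_eqpoll_times[OF E'])
 also have "lifts E' \<approx> lifts E" by (rule eqpoll_sym[OF lifts_twist_eqpoll[OF E E']])
 also have "lifts E \<approx> solutions E \<times> E.auts" by (rule eqpoll_sym[OF lifts_eqpoll_times[OF E]])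
 finally have 2: "solutions E' \<times> E'.auts \<approx> solutions E \<times> E.auts" .
 show ?thesis
  by (rule times_finite_cancel_eqpoll[OF eqpoll_trans[OF 2 1] E'.card_auts(1,3)])
qed

end

locale extension_pair = galois_setting \<Omega> F + U: uniserial_ring A p n i t
 for \<Omega> (structure) and F and A and p n i :: nat and t +
 fixes E E'
 assumes E: "ext_group A p n i t E \<zero>\<^bsub>A\<^esub>" and E': "ext_group A p n i t E' (t [^]\<^bsub>A\<^esub> (i - 1))"
begin

interpretation \<G>: group \<G> by (rule \<G>_group)

abbreviation "Q \<equiv> integer_mod_group U.q"

lemma Q_simps: "carrier Q = {0..<int U.q}" "\<one>\<^bsub>Q\<^esub> = 0" "x \<otimes>\<^bsub>Q\<^esub> y = (x + y) mod int U.q"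
 using U.q_gt_1 by (simp_all add: carrier_integer_mod_group)

lemma Q_group: "group Q" by simp

lemma cyclic_quotient_restriction:
 assumes K: "galois_extension \<Omega> F K" and \<iota>: "\<iota> \<in> iso (galois_group \<Omega> F K) Q"
 shows "cyclic_quotient \<Omega> F A p n i t (\<lambda>\<g>. \<iota> (restrict \<g> K)) K"
proof -
 note epi = epi_of_iso[OF K Q_group \<iota>]
 let ?\<phi> = "\<lambda>\<g>\<in>carrier \<G>. \<iota> (restrict \<g> K)"
 have hom: "?\<phi> \<in> hom \<G> Q" and img: "?\<phi> ` carrier \<G> = carrier Q" using epi(1) by (auto simp: epis_def)
 show ?thesis
 proof (intro cyclic_quotient.intro cyclic_quotient_axioms.intro)
  show "galois_setting \<Omega> F" by (rule galois_setting_axioms)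
  show "uniserial_ring A p n i t" by (rule U.uniserial_ring_axioms)
  show "galois_extension \<Omega> F K" by (rule K)
  show "\<iota> (restrict (\<g> \<otimes>\<^bsub>\<G>\<^esub> \<d>) K) = (\<iota> (restrict \<g> K) + \<iota> (restrict \<d> K)) mod int U.q"
   if g: "\<g> \<in> carrier \<G>" "\<d> \<in> carrier \<G>" for \<g> \<d>
  proof -
   have "\<g> \<otimes>\<^bsub>\<G>\<^esub> \<d> \<in> carrier \<G>" using g by simp
   thus ?thesis using hom_mult[OF hom g] g by (simp add: Q_simps)
  qed
  have "(\<lambda>\<g>. \<iota> (restrict \<g> K)) ` carrier \<G> = ?\<phi> ` carrier \<G>" by (rule image_cong) simp_all
  thus "(\<lambda>\<g>. \<iota> (restrict \<g> K)) ` carrier \<G> = {0..<int U.q}" unfolding img Q_simps .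
  have "{\<g> \<in> carrier \<G>. ?\<phi> \<g> = \<one>\<^bsub>Q\<^esub>} = fixgrp K" using epi(2) by (simp only: cuts_out_def)
  moreover have "{\<g> \<in> carrier \<G>. ?\<phi> \<g> = \<one>\<^bsub>Q\<^esub>} = {\<g> \<in> carrier \<G>. \<iota> (restrict \<g> K) = 0}"
   by (intro Collect_cong conj_cong refl) (simp add: Q_simps(2))
  ultimately show "{\<g> \<in> carrier \<G>. \<iota> (restrict \<g> K) = 0} = fixgrp K" by (simp only:)
 qed
qed

abbreviation "sols K \<iota> H \<equiv> embedding_solutions \<Omega> F K \<iota> H snd"

lemma sols_iff:
 assumes K: "galois_extension \<Omega> F K" "\<iota> \<in> iso (galois_group \<Omega> F K) Q" and H: "ext_group A p n i t H c"
 shows "L \<in> sols K \<iota> H \<longleftrightarrow> (\<exists>\<phi>\<in>epis H. cuts_out \<phi> H L \<and> (\<forall>\<g>\<in>carrier \<G>. snd (\<phi> \<g>) = \<iota> (restrict \<g> K)))"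
proof -
 interpret H: ext_group A p n i t H c by (rule H)
 show ?thesis
  by (rule embedding_solutions_iff[OF H.group_E K(1) _ Q_group K(2)]) (simp add: H.one_E Q_simps)
qed

theorem embedding_solutions_eqpoll:
 assumes K: "galois_extension \<Omega> F K" and \<iota>: "\<iota> \<in> iso (galois_group \<Omega> F K) Q"
 shows "sols K \<iota> E' \<approx> {..<p - 1} \<times> sols K \<iota> E"
proof -
 interpret C: cyclic_quotient \<Omega> F A p n i t "\<lambda>\<g>. \<iota> (restrict \<g> K)" K
  by (rule cyclic_quotient_restriction[OF K \<iota>])
 have "C.solutions H = sols K \<iota> H" if H: "ext_group A p n i t H c" for H c
  using sols_iff[OF K \<iota> H] by (auto simp: C.solutions_def C.lifts_def)
 thus ?thesis using C.solutions_eqpoll[OF E E'[folded C.T_def]] E E' by metis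
qed

definition cyclic_fields where
 "cyclic_fields = {K. galois_extension \<Omega> F K \<and> galois_group \<Omega> F K \<cong> Q}"

text \<open>
 Some identification of the Galois group of \<open>K\<close> with the cyclic group; the counts over
 \<open>K\<close> do not depend on it.
\<close>

definition identification where
 "identification K = (SOME \<iota>. \<iota> \<in> iso (galois_group \<Omega> F K) Q)"

lemma cyclic_fieldsD:
 assumes "K \<in> cyclic_fields"
 shows "galois_extension \<Omega> F K" "identification K \<in> iso (galois_group \<Omega> F K) Q"
proof -
 show "galois_extension \<Omega> F K" using assms by (simp add: cyclic_fields_def)
 have "\<exists>\<iota>. \<iota> \<in> iso (galois_group \<Omega> F K) Q" using assms by (auto simp: cyclic_fields_def is_iso_def)
 from someI_ex[OF this] show "identification K \<in> iso (galois_group \<Omega> F K) Q" by (simp add: identification_def)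
qed

text \<open>
 The stabilizer of \<open>K\<close> is the preimage of the module under any epimorphism cutting out
 \<open>L\<close>, and the module is characterized inside the group. Two epimorphisms that cut out
 \<open>L\<close> identify the same pairs of automorphisms, so they give the same preimage.
\<close>

lemma sols_K_unique:
 assumes H: "ext_group A p n i t H c" and K: "K \<in> cyclic_fields" "K' \<in> cyclic_fields"
  and L: "L \<in> sols K (identification K) H" "L \<in> sols K' (identification K') H"
 shows "K = K'"
proof -
 interpret H: ext_group A p n i t H c by (rule H)
 note K1 = cyclic_fieldsD[OF K(1)] and K2 = cyclic_fieldsD[OF K(2)]
 have fixgrp_kernel: "\<g> \<in> fixgrp M \<longleftrightarrow> (\<forall>\<alpha>\<in>carrier \<G>. \<forall>\<beta>\<in>carrier \<G>. \<forall>\<upsilon>\<in>carrier \<G>.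
   \<phi> (\<alpha> \<otimes>\<^bsub>\<G>\<^esub> \<beta>) = \<phi> (\<upsilon> \<otimes>\<^bsub>\<G>\<^esub> (\<beta> \<otimes>\<^bsub>\<G>\<^esub> \<alpha>)) \<longrightarrow> \<phi> (\<g> \<otimes>\<^bsub>\<G>\<^esub> \<upsilon>) = \<phi> (\<upsilon> \<otimes>\<^bsub>\<G>\<^esub> \<g>))"
  if M: "galois_extension \<Omega> F M" "\<iota> \<in> iso (galois_group \<Omega> F M) Q" and \<phi>: "\<phi> \<in> epis H"
   and s: "\<forall>\<g>\<in>carrier \<G>. snd (\<phi> \<g>) = \<iota> (restrict \<g> M)" and g: "\<g> \<in> carrier \<G>" for M \<iota> \<phi> \<g>
 proof -
  have hom: "\<phi> \<in> hom \<G> H" and img: "carrier H = \<phi> ` carrier \<G>" using \<phi> by (auto simp: epis_def)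
  have "\<g> \<in> fixgrp M \<longleftrightarrow> snd (\<phi> \<g>) = 0"
   using cuts_out_fixgrp[OF epi_of_iso(2)[OF M(1) Q_group M(2)] g] s g by (simp add: Q_simps)
  also have "\<dots> \<longleftrightarrow> (\<forall>a\<in>carrier H. \<forall>b\<in>carrier H. \<forall>y\<in>carrier H.
    a \<otimes>\<^bsub>H\<^esub> b = y \<otimes>\<^bsub>H\<^esub> (b \<otimes>\<^bsub>H\<^esub> a) \<longrightarrow> \<phi> \<g> \<otimes>\<^bsub>H\<^esub> y = y \<otimes>\<^bsub>H\<^esub> \<phi> \<g>)"
   by (rule H.kernel_characteristic[OF hom_in_carrier[OF hom g]])
  also have "\<dots> \<longleftrightarrow> (\<forall>\<alpha>\<in>carrier \<G>. \<forall>\<beta>\<in>carrier \<G>. \<forall>\<upsilon>\<in>carrier \<G>.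
    \<phi> (\<alpha> \<otimes>\<^bsub>\<G>\<^esub> \<beta>) = \<phi> (\<upsilon> \<otimes>\<^bsub>\<G>\<^esub> (\<beta> \<otimes>\<^bsub>\<G>\<^esub> \<alpha>)) \<longrightarrow> \<phi> (\<g> \<otimes>\<^bsub>\<G>\<^esub> \<upsilon>) = \<phi> (\<upsilon> \<otimes>\<^bsub>\<G>\<^esub> \<g>))"
   unfolding img ball_simps(9) using g by (simp add: hom_mult[OF hom])
  finally show ?thesis .
 qed
 obtain \<phi> where \<phi>: "\<phi> \<in> epis H" "cuts_out \<phi> H L" "\<forall>\<g>\<in>carrier \<G>. snd (\<phi> \<g>) = identification K (restrict \<g> K)"
  using L(1) unfolding sols_iff[OF K1 H] by blast
 obtain \<phi>' where \<phi>': "\<phi>' \<in> epis H" "cuts_out \<phi>' H L" "\<forall>\<g>\<in>carrier \<G>. snd (\<phi>' \<g>) = identification K' (restrict \<g> K')"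
  using L(2) unfolding sols_iff[OF K2 H] by blast
 have eq: "\<phi> x = \<phi> y \<longleftrightarrow> \<phi>' x = \<phi>' y" if xy: "x \<in> carrier \<G>" "y \<in> carrier \<G>" for x y
 proof -
  have c: "inv\<^bsub>\<G>\<^esub> y \<otimes>\<^bsub>\<G>\<^esub> x \<in> carrier \<G>" using xy by simp
  have hom: "\<phi> \<in> hom \<G> H" "\<phi>' \<in> hom \<G> H" using \<phi>(1) \<phi>'(1) by (auto simp: epis_def)
  show ?thesis
   unfolding hom_eq_iff_kernel[OF \<G>_group H.group_E hom(1) xy] hom_eq_iff_kernel[OF \<G>_group H.group_E hom(2) xy]
    cuts_out_fixgrp[OF \<phi>(2) c] cuts_out_fixgrp[OF \<phi>'(2) c] ..
 qed
 have "\<g> \<in> fixgrp K \<longleftrightarrow> \<g> \<in> fixgrp K'" if g: "\<g> \<in> carrier \<G>" for \<g>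
  unfolding fixgrp_kernel[OF K1 \<phi>(1,3) g] fixgrp_kernel[OF K2 \<phi>'(1,3) g] using eq g by simp
 hence "fixgrp K = fixgrp K'" by (auto simp: fixgrp_def)
 thus ?thesis by (rule galois_extension_unique[OF K1(1) K2(1)])
qed

text \<open>
 Every realization is a solution over exactly one cyclic field \<open>K\<close>, the one cut out by the
 composition with the projection. The identification that this composition induces on the Galois group of
 \<open>K\<close> is adjusted to the chosen one by lifting an automorphism of the cyclic group.
\<close>

lemma realizations_union:
 assumes H: "ext_group A p n i t H c"
 shows "galois_realizations \<Omega> F H = (\<Union>K\<in>cyclic_fields. sols K (identification K) H)"
proof (intro equalityI subsetI)
 interpret H: ext_group A p n i t H c by (rule H)
 fix L assume "L \<in> galois_realizations \<Omega> F H"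
 then obtain \<psi> where L: "galois_extension \<Omega> F L" and \<psi>: "\<psi> \<in> iso (galois_group \<Omega> F L) H"
  by (auto simp: galois_realizations_def is_iso_def)
 define \<phi> where "\<phi> = (\<lambda>\<g>\<in>carrier \<G>. \<psi> (restrict \<g> L))"
 have \<phi>: "\<phi> \<in> epis H" "cuts_out \<phi> H L" unfolding \<phi>_def by (rule epi_of_iso[OF L H.group_E \<psi>])+
 have hom: "\<phi> \<in> hom \<G> H" and img: "\<phi> ` carrier \<G> = carrier H" using \<phi>(1) by (auto simp: epis_def)
 define \<kappa> where "\<kappa> = (\<lambda>\<g>. snd (\<phi> \<g>))"
 have snd_hom: "snd (x \<otimes>\<^bsub>H\<^esub> y) = snd x \<otimes>\<^bsub>Q\<^esub> snd y" if "x \<in> carrier H" "y \<in> carrier H" for x y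
  using that by (auto simp: H.carrier_E H.E_mult Q_simps)
 have \<kappa>: "\<kappa> \<in> hom \<G> Q" "\<kappa> ` carrier \<G> = carrier Q"
 proof -
  show "\<kappa> \<in> hom \<G> Q"
  proof (rule homI)
   fix x y assume xy: "x \<in> carrier \<G>" "y \<in> carrier \<G>"
   show "\<kappa> x \<in> carrier Q" using hom_in_carrier[OF hom xy(1)] by (auto simp: \<kappa>_def Q_simps H.carrier_E mem_Times_iff)
   show "\<kappa> (x \<otimes>\<^bsub>\<G>\<^esub> y) = \<kappa> x \<otimes>\<^bsub>Q\<^esub> \<kappa> y"
    using hom_mult[OF hom xy] snd_hom[OF hom_in_carrier[OF hom xy(1)] hom_in_carrier[OF hom xy(2)]] by (simp only: \<kappa>_def)
  qed
  have "\<kappa> ` carrier \<G> = snd ` (\<phi> ` carrier \<G>)" unfolding image_image \<kappa>_def ..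
  also have "\<dots> = snd ` (carrier A \<times> {0..<int U.q})" unfolding img H.carrier_E ..
  also have "\<dots> = {0..<int U.q}" using U.zero_closed by force
  finally show "\<kappa> ` carrier \<G> = carrier Q" unfolding Q_simps .
 qed
 have fin: "finite ((\<lambda>\<g>. restrict \<g> L) ` carrier \<G>)"
 proof -
  have "finite (carrier H)" unfolding H.carrier_E using U.finite_carrier by simp
  moreover have "bij_betw \<psi> (carrier (galois_group \<Omega> F L)) (carrier H)" using \<psi> by (simp add: iso_def)
  ultimately show ?thesis unfolding restriction_epi(2)[OF L] using bij_betw_finite by blast
 qed
 obtain K where K: "cuts_out \<kappa> Q K"
 proof (rule field_of_epi[OF Q_group \<kappa>(1) L _ fin])
  fix \<g> assume g: "\<g> \<in> fixgrp L"
  hence "\<g> \<in> carrier \<G>" by (simp add: fixgrp_def)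
  hence "\<phi> \<g> = \<one>\<^bsub>H\<^esub>" using cuts_out_fixgrp[OF \<phi>(2)] g by simp
  thus "\<kappa> \<g> = \<one>\<^bsub>Q\<^esub>" by (simp add: \<kappa>_def H.one_E Q_simps)
 qed
 have Kg: "galois_extension \<Omega> F K" using K by (simp add: cuts_out_def)
 obtain \<psi>K where "\<psi>K \<in> iso (galois_group \<Omega> F K) Q" by (rule iso_of_epi[OF Q_group \<kappa> K])
 hence KC: "K \<in> cyclic_fields" using Kg by (auto simp: cyclic_fields_def is_iso_def)
 define \<mu> where "\<mu> = (\<lambda>\<g>\<in>carrier \<G>. identification K (restrict \<g> K))"
 have \<mu>: "\<mu> \<in> epis Q" "cuts_out \<mu> Q K"
  unfolding \<mu>_def by (rule epi_of_iso[OF Kg Q_group cyclic_fieldsD(2)[OF KC]])+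
 have \<mu>h: "\<mu> \<in> hom \<G> Q" "\<mu> ` carrier \<G> = carrier Q" using \<mu>(1) by (auto simp: epis_def)
 have ker: "{\<g> \<in> carrier \<G>. \<kappa> \<g> = \<one>\<^bsub>Q\<^esub>} = {\<g> \<in> carrier \<G>. \<mu> \<g> = \<one>\<^bsub>Q\<^esub>}"
  using K \<mu>(2) by (simp only: cuts_out_def)
 obtain w where w: "w \<in> iso Q Q" "\<And>\<g>. \<g> \<in> carrier \<G> ==> w (\<kappa> \<g>) = \<mu> \<g>"
  by (rule epi_factor[OF \<G>_group Q_group Q_group \<kappa> \<mu>h ker], rule that)
 obtain a where a: "a \<in> iso H H" "\<And>x. x \<in> carrier H ==> snd (a x) = w (snd x)"
  by (rule H.lift_automorphism[OF w(1)], rule that)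
 have "snd ((\<lambda>\<g>\<in>carrier \<G>. a (\<phi> \<g>)) \<g>) = identification K (restrict \<g> K)" if g: "\<g> \<in> carrier \<G>" for \<g>
  using a(2)[OF hom_in_carrier[OF hom g]] w(2)[OF g] g by (simp add: \<kappa>_def \<mu>_def)
 hence "L \<in> sols K (identification K) H"
  unfolding sols_iff[OF cyclic_fieldsD[OF KC] H]
  using epi_compose[OF \<phi>(1) H.group_E H.group_E a(1)] \<phi>(2) by blast
 thus "L \<in> (\<Union>K\<in>cyclic_fields. sols K (identification K) H)" using KC by blast
next
 fix L assume "L \<in> (\<Union>K\<in>cyclic_fields. sols K (identification K) H)"
 then obtain K where "L \<in> sols K (identification K) H" by blast
 thus "L \<in> galois_realizations \<Omega> F H"
  unfolding embedding_solutions_def galois_realizations_def is_iso_def by blast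
qed

text \<open>
 Realizations are partitioned by their cyclic subfields, and over each of these the count of embedding
 solutions applies.
\<close>

theorem galois_realizations_eqpoll:
 "galois_realizations \<Omega> F E' \<approx> {..<p - 1} \<times> galois_realizations \<Omega> F E"
proof -
 let ?S = "\<lambda>H K. sols K (identification K) H"
 have disj: "pairwise (\<lambda>K K'. disjnt (?S H K) (?S H K')) cyclic_fields" if H: "ext_group A p n i t H c" for H c
  unfolding pairwise_def disjnt_iff using sols_K_unique[OF H] by blast
 have "(\<Union>K\<in>cyclic_fields. ?S E' K) \<approx> (\<Union>K\<in>cyclic_fields. {..<p - 1} \<times> ?S E K)"
 proof (rule UN_eqpoll_UN)
  show "?S E' K \<approx> {..<p - 1} \<times> ?S E K" if "K \<in> cyclic_fields" for K
   by (rule embedding_solutions_eqpoll[OF cyclic_fieldsD[OF that]])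
  show "pairwise (\<lambda>K K'. disjnt (?S E' K) (?S E' K')) cyclic_fields" by (rule disj[OF E'])
  show "pairwise (\<lambda>K K'. disjnt ({..<p - 1} \<times> ?S E K) ({..<p - 1} \<times> ?S E K')) cyclic_fields"
   using disj[OF E] unfolding pairwise_def disjnt_iff by blast
 qed
 moreover have "(\<Union>K\<in>cyclic_fields. {..<p - 1} \<times> ?S E K) = {..<p - 1} \<times> (\<Union>K\<in>cyclic_fields. ?S E K)" by blast
 ultimately show ?thesis unfolding realizations_union[OF E] realizations_union[OF E'] by simp
qed

end

theorem theorem5p4:
  fixes p n i :: nat
    and \<Omega> :: "('a, 'b) ring_scheme"
    and F :: "'a set"
  assumes "Factorial_Ring.prime p" and "odd p"
    and "n \<ge> 1"
    and "p ^ (n - 1) + 2 \<le> i" and "i < p ^ n"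
    and "algebraic_closure \<Omega> F"
  shows "(\<forall>K \<iota>. galois_extension \<Omega> F K \<and> \<iota> \<in> iso (galois_group \<Omega> F K) (cyc p n) \<longrightarrow>
            eqpoll (embedding_solutions \<Omega> F K \<iota> (A_bullet p n i) snd)
                   ({..<p - 1} \<times> embedding_solutions \<Omega> F K \<iota> (A_semidirect p n i) snd))
       \<and> eqpoll (galois_realizations \<Omega> F (A_bullet p n i))
                ({..<p - 1} \<times> galois_realizations \<Omega> F (A_semidirect p n i))"
proof -
 interpret T: truncated_group_algebra p n i
  using assms(1,3-5) by unfold_locales
 interpret G: galois_setting \<Omega> F using assms(6) by (simp add: galois_setting_def)
 interpret extension_pair \<Omega> F T.A p n i T.T "A_semidirect p n i" "A_bullet p n i"
 proof (intro extension_pair.intro extension_pair_axioms.intro)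
  show "galois_setting \<Omega> F" by (rule G.galois_setting_axioms)
  show "uniserial_ring T.A p n i T.T" by (rule T.U.uniserial_ring_axioms)
 qed (rule T.A_semidirect_ext T.A_bullet_ext)+
 show ?thesis
  using embedding_solutions_eqpoll galois_realizations_eqpoll by (simp only: T.U.q_def) blast
qed

end
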